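(* There exist positive constants $C_1,C_2,C_3$ such that, if $a$ is uniformly bounded (i.e. $\sup_{x\in\overline\Omega,\kappa\ge\kappa_0}|a(x,\kappa)|<\infty$), $\kappa>0$, $H>0$ and $(\psi,\mathbf A)$ is a solution of the Ginzburg–Landau equations, then $$\|(\nabla-i\kappa H\mathbf A)\psi\|_{L^2(\Omega)}\le C_1\kappa\|\psi\|_{L^2(\Omega)},\qquad \|\operatorname{curl}(\mathbf A-\mathbf F)\|_{L^2(\Omega)}\le\frac{C_2}{H}\|\psi\|_{L^2(\Omega)}\|\psi\|_{L^4(\Omega)},$$ $$\|(\nabla-i\kappa H\mathbf F)\psi\|_{L^2(\Omega)}\le C_3\kappa\|\psi\|_{L^2(\Omega)}.$$
   Context: $\Omega\subset\mathbb R^2$ bounded, open, simply connected, smooth boundary, $\nu$ the unit interior normal; $B_0\in C^\infty(\overline\Omega)$ real; $a(\cdot,\kappa)\in C^1(\overline\Omega)$ real. $H^1_{\rm div}(\Omega)=\{\mathbf A\in H^1(\Omega;\mathbb R^2):\operatorname{div}\mathbf A=0,\ \mathbf A\cdot\nu|_{\partial\Omega}=0\}$, $\operatorname{curl}\mathbf A=\partial_{x_1}A_2-\partial_{x_2}A_1$, $\mathbf F\in H^1_{\rm div}(\Omega)$ with $\operatorname{curl}\mathbf F=B_0$. The Ginzburg–Landau equations for $(\psi,\mathbf A)\in H^1(\Omega;\mathbb C)\times H^1_{\rm div}(\Omega)$ (weak sense): $-(\nabla-i\kappa H\mathbf A)^2\psi=\kappa^2(a(x,\kappa)-|\psi|^2)\psi$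 in $\Omega$; $-\nabla^\perp\operatorname{curl}(\mathbf A-\mathbf F)=\frac1{\kappa H}\operatorname{Im}(\bar\psi(\nabla-i\kappa H\mathbf A)\psi)$ in $\Omega$; $\nu\cdot(\nabla-i\kappa H\mathbf A)\psi=0$ and $\operatorname{curl}\mathbf A=\operatorname{curl}\mathbf F$ on $\partial\Omega$; $\nabla^\perp f=(\partial_{x_2}f,-\partial_{x_1}f)$.
   Formalization: The estimates are stated for κ ≥ κ₀ with κ₀ > 0, the range on which a is assumed uniformly bounded, instead of all κ > 0 (for κ < κ₀ a is uncontrolled and the first bound can fail); the constants are chosen after Ω, F and a. *)

theory Defs
  imports "HOL-Analysis.Analysis"
begin

type_synonym pt = "real^2"

fun Ck :: "nat \<Rightarrow> pt set \<Rightarrow> (pt \<Rightarrow> real) \<Rightarrow> bool" where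
  "Ck 0 U f = continuous_on U f"
| "Ck (Suc k) U f = ((\<forall>x\<in>U. f differentiable (at x)) \<and>
      (\<forall>v. Ck k U (\<lambda>x. frechet_derivative f (at x) v)))"

definition smooth :: "(pt \<Rightarrow> real) \<Rightarrow> bool" where
  "smooth f \<longleftrightarrow> (\<forall>k. Ck k UNIV f)"

definition Ck_closure :: "nat \<Rightarrow> pt set \<Rightarrow> (pt \<Rightarrow> real) \<Rightarrow> bool" where
  "Ck_closure k \<Omega> f \<longleftrightarrow> (\<exists>g. Ck k UNIV g \<and> (\<forall>x\<in>closure \<Omega>. g x = f x))"

definition smooth_closure :: "pt set \<Rightarrow> (pt \<Rightarrow> real) \<Rightarrow> bool" where
  "smooth_closure \<Omega> f \<longleftrightarrow> (\<exists>g. smooth g \<and> (\<forall>x\<in>closure \<Omega>. g x = f x))"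

definition smooth_boundary :: "pt set \<Rightarrow> bool" where
  "smooth_boundary \<Omega> \<longleftrightarrow> (\<exists>\<rho>. smooth \<rho> \<and> \<Omega> = {x. \<rho> x < 0} \<and>
      (\<forall>x. \<rho> x = 0 \<longrightarrow> frechet_derivative \<rho> (at x) \<noteq> (\<lambda>v. 0)))"

definition pd :: "(pt \<Rightarrow> real) \<Rightarrow> 2 \<Rightarrow> pt \<Rightarrow> real" where
  "pd \<phi> j x = frechet_derivative \<phi> (at x) (axis j 1)"

definition grad :: "(pt \<Rightarrow> real) \<Rightarrow> pt \<Rightarrow> real^2" where
  "grad \<phi> x = (\<chi> j. pd \<phi> j x)"

definition test_fn :: "pt set \<Rightarrow> (pt \<Rightarrow> real) \<Rightarrow> bool" where
  "test_fn \<Omega> \<phi> \<longleftrightarrow> smooth \<phi> \<and> compact (closure {x. \<phi> x \<noteq> 0}) \<and> closure {x. \<phi> x \<noteq> 0} \<subseteq> \<Omega>"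

definition L2 :: "pt set \<Rightarrow> (pt \<Rightarrow> 'a::{banach,second_countable_topology}) \<Rightarrow> bool" where
  "L2 \<Omega> u \<longleftrightarrow> set_borel_measurable lebesgue \<Omega> u \<and>
      set_integrable lebesgue \<Omega> (\<lambda>x. (norm (u x))^2)"

definition L2norm :: "pt set \<Rightarrow> (pt \<Rightarrow> 'a::{banach,second_countable_topology}) \<Rightarrow> real" where
  "L2norm \<Omega> u = sqrt (LINT x:\<Omega>|lebesgue. (norm (u x))^2)"

definition L4norm :: "pt set \<Rightarrow> (pt \<Rightarrow> 'a::{banach,second_countable_topology}) \<Rightarrow> real" where
  "L4norm \<Omega> u = (LINT x:\<Omega>|lebesgue. (norm (u x))^4) powr (1/4)"

definition weak_partial :: "pt set \<Rightarrow> (pt \<Rightarrow> 'a::{banach,second_countable_topology}) \<Rightarrow> 2 \<Rightarrow> (pt \<Rightarrow> 'a) \<Rightarrow> bool" where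
  "weak_partial \<Omega> u j g \<longleftrightarrow> (\<forall>\<phi>. test_fn \<Omega> \<phi> \<longrightarrow>
      (LINT x:\<Omega>|lebesgue. pd \<phi> j x *\<^sub>R u x) = - (LINT x:\<Omega>|lebesgue. \<phi> x *\<^sub>R g x))"

definition H1 :: "pt set \<Rightarrow> (pt \<Rightarrow> 'a::{banach,second_countable_topology}) \<Rightarrow> (pt \<Rightarrow> 'a^2) \<Rightarrow> bool" where
  "H1 \<Omega> u Du \<longleftrightarrow> L2 \<Omega> u \<and> (\<forall>j. L2 \<Omega> (\<lambda>x. Du x $ j) \<and> weak_partial \<Omega> u j (\<lambda>x. Du x $ j))"

text \<open>Vector field A in H^1(Omega;R^2), DA x $ i $ j = weak d_j A_i.\<close>
definition H1_vec :: "pt set \<Rightarrow> (pt \<Rightarrow> real^2) \<Rightarrow> (pt \<Rightarrow> real^2^2) \<Rightarrow> bool" where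
  "H1_vec \<Omega> A DA \<longleftrightarrow> (\<forall>i. H1 \<Omega> (\<lambda>x. A x $ i) (\<lambda>x. DA x $ i))"

definition wcurl :: "(pt \<Rightarrow> real^2^2) \<Rightarrow> pt \<Rightarrow> real" where
  "wcurl DA x = DA x $ 2 $ 1 - DA x $ 1 $ 2"

definition wdiv :: "(pt \<Rightarrow> real^2^2) \<Rightarrow> pt \<Rightarrow> real" where
  "wdiv DA x = DA x $ 1 $ 1 + DA x $ 2 $ 2"

text \<open>H^1_div: div A = 0 in Omega and A.nu = 0 on the boundary, the latter in the weak
  (Green formula) sense: the integral of A . grad phi vanishes for every smooth phi.\<close>
definition H1div :: "pt set \<Rightarrow> (pt \<Rightarrow> real^2) \<Rightarrow> (pt \<Rightarrow> real^2^2) \<Rightarrow> bool" where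
  "H1div \<Omega> A DA \<longleftrightarrow> H1_vec \<Omega> A DA \<and> (AE x in lebesgue. x \<in> \<Omega> \<longrightarrow> wdiv DA x = 0) \<and>
     (\<forall>\<phi>. smooth \<phi> \<longrightarrow> (LINT x:\<Omega>|lebesgue. A x \<bullet> grad \<phi> x) = 0)"

definition mgrad :: "real \<Rightarrow> real \<Rightarrow> (pt \<Rightarrow> real^2) \<Rightarrow> (pt \<Rightarrow> complex) \<Rightarrow> (pt \<Rightarrow> complex^2) \<Rightarrow> pt \<Rightarrow> complex^2" where
  "mgrad \<kappa> H A \<psi> D\<psi> x = (\<chi> j. D\<psi> x $ j - \<i> * complex_of_real (\<kappa> * H * A x $ j) * \<psi> x)"

definition supercurrent :: "real \<Rightarrow> real \<Rightarrow> (pt \<Rightarrow> real^2) \<Rightarrow> (pt \<Rightarrow> complex) \<Rightarrow> (pt \<Rightarrow> complex^2) \<Rightarrow> pt \<Rightarrow> real^2" where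
  "supercurrent \<kappa> H A \<psi> D\<psi> x = (\<chi> j. Im (cnj (\<psi> x) * mgrad \<kappa> H A \<psi> D\<psi> x $ j))"

text \<open>Weak solution of the Ginzburg-Landau equations (natural boundary conditions are
  encoded by testing against the full spaces H^1(Omega;C) and H^1_div(Omega)).\<close>
definition GL_solution :: "pt set \<Rightarrow> (pt \<Rightarrow> real \<Rightarrow> real) \<Rightarrow> (pt \<Rightarrow> real^2) \<Rightarrow> (pt \<Rightarrow> real^2^2)
    \<Rightarrow> real \<Rightarrow> real \<Rightarrow> (pt \<Rightarrow> complex) \<Rightarrow> (pt \<Rightarrow> complex^2) \<Rightarrow> (pt \<Rightarrow> real^2) \<Rightarrow> (pt \<Rightarrow> real^2^2) \<Rightarrow> bool" where
  "GL_solution \<Omega> a F DF \<kappa> H \<psi> D\<psi> A DA \<longleftrightarrow>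
     H1 \<Omega> \<psi> D\<psi> \<and> H1div \<Omega> A DA \<and>
     (\<forall>\<phi> D\<phi>. H1 \<Omega> \<phi> D\<phi> \<longrightarrow>
        (LINT x:\<Omega>|lebesgue. (\<Sum>j\<in>UNIV. mgrad \<kappa> H A \<psi> D\<psi> x $ j * cnj (mgrad \<kappa> H A \<phi> D\<phi> x $ j)))
        = complex_of_real (\<kappa>^2) * (LINT x:\<Omega>|lebesgue.
            complex_of_real (a x \<kappa> - (cmod (\<psi> x))^2) * \<psi> x * cnj (\<phi> x))) \<and>
     (\<forall>B DB. H1div \<Omega> B DB \<longrightarrow>
        - (LINT x:\<Omega>|lebesgue. (wcurl DA x - wcurl DF x) * wcurl DB x)
        = (1 / (\<kappa> * H)) * (LINT x:\<Omega>|lebesgue. supercurrent \<kappa> H A \<psi> D\<psi> x \<bullet> B x))"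

end

theory Submission
  imports Defs "HOL-Complex_Analysis.Riemann_Mapping"
begin

text \<open>The energy identity (the first equation tested with \<open>\<psi>\<close>) gives the first inequality and a bound on
  \<open>\<parallel>\<psi>\<parallel>\<^sub>4\<close>.  Testing the second equation with \<open>B = A - F\<close> bounds \<open>\<parallel>curl B\<parallel>\<^sup>2\<close> by
  \<open>\<parallel>\<nabla>\<^sub>A\<psi>\<parallel> \<parallel>\<psi>\<parallel>\<^sub>4 \<parallel>B\<parallel>\<^sub>4 / (\<kappa> H)\<close>, so everything rests on the div-curl estimate
  \<open>\<parallel>B\<parallel>\<^sub>4 \<le> C \<parallel>curl B\<parallel>\<close> for divergence-free tangential fields.

  No charts, traces or extension operators are used: boundary terms are read off from the cutoffs
  \<open>\<Theta>(\<rho>/\<epsilon>)\<close> built from a defining function \<open>\<rho>\<close> of \<open>\<Omega>\<close>, as \<open>\<epsilon> \<rightarrow> 0\<close>.  Integrating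
  \<open>div (f\<^sup>2 \<Theta>(\<rho>/\<epsilon>) \<nabla>\<rho>)\<close> controls the boundary mass of \<open>f\<^sup>2\<close>; with the inequality
  \<open>\<parallel>h\<parallel>\<^sub>2\<^sup>2 \<le> \<parallel>\<partial>\<^sub>1h\<parallel>\<^sub>1 \<parallel>\<partial>\<^sub>2h\<parallel>\<^sub>1\<close> for \<open>h = \<Theta>(\<rho>/\<epsilon>) f\<^sup>2\<close> this is the embedding of \<open>H\<^sup>1\<close> into \<open>L\<^sup>4\<close>.
  A tangential divergence-free \<open>B\<close>, extended by zero, is divergence-free on the plane; its stream function
  vanishes outside \<open>\<Omega>\<close> because the complement is connected, and testing with it gives
  \<open>\<parallel>B\<parallel> \<le> C \<parallel>curl B\<parallel>\<close>.  Finally \<open>|DB|\<^sup>2 = (curl B)\<^sup>2 - 2 det DB\<close>, where the null Lagrangian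
  \<open>det DB\<close> only contributes a curvature term on the boundary, since \<open>B \<bullet> \<nabla>\<rho>\<close> has zero trace.\<close>

subsection \<open>Smooth functions\<close>

text \<open>A first derivative of a cutoff costs 1/e and a second one 1/e^2, so boundary terms
  survive the limit e -> 0 unless the other factors are small near the boundary.
  \<open>strip_inequality\<close> supplies this smallness: if v vanishes where
  \<open>\<rho> x \<ge> e\<close>, its norm over the strip \<open>- 2 * e \<le> \<rho> x\<close> is
  at most a constant times e times the norm of its gradient over \<open>- 3 * e < \<rho> x\<close>,
  and the latter norm tends to 0 for a gradient that vanishes off the domain. Vanishing is asked
  only beyond e because a mollified zero extension leaks slightly across the boundary. Hence two
  limits in a fixed order: first the mollification index at fixed strip width, then the width.

  The third inequality follows from the other two. The two magnetic gradients differ by i kappa H (A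
  - F) psi, of norm at most a constant times kappa H |psi|_4 |A - F|_4; the curl bound contributes
  1/H, which cancels H, and the remaining |psi|_4^2 is bounded by the energy identity, with no
  pointwise bound on psi. The constants depend only on the domain and on the bound for a.\<close>

fun Rk :: "nat \<Rightarrow> (real \<Rightarrow> real) \<Rightarrow> bool" where
  "Rk 0 f = continuous_on UNIV f"
| "Rk (Suc k) f = (\<exists>f'. (\<forall>t. (f has_real_derivative f' t) (at t)) \<and> Rk k f')"

lemma Rk_SucD: "Rk (Suc k) f \<Longrightarrow> Rk k f"
proof (induction k arbitrary: f)
  case 0
  then show ?case by (auto simp: continuous_on_eq_continuous_within intro: DERIV_isCont)
next
  case (Suc k)
  from Suc.prems obtain f' where f': "\<forall>t. (f has_real_derivative f' t) (at t)" "Rk (Suc k) f'"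
    by (metis Rk.simps(2))
  with Suc.IH[of f'] show ?case by auto
qed

lemma Rk_SucI: "(\<And>t. (f has_real_derivative f' t) (at t)) \<Longrightarrow> Rk k f' \<Longrightarrow> Rk (Suc k) f"
  by auto

lemma Rk_const: "Rk k (\<lambda>t. c)"
  by (induction k arbitrary: c) (auto intro!: exI[of _ "\<lambda>_. 0"])

lemma Rk_add: "Rk k f \<Longrightarrow> Rk k g \<Longrightarrow> Rk k (\<lambda>t. f t + g t)"
proof (induction k arbitrary: f g)
  case 0 then show ?case by (simp add: continuous_on_add)
next
  case (Suc k)
  from Suc.prems obtain f' g' where "\<forall>t. (f has_real_derivative f' t) (at t)" "Rk k f'"
    "\<forall>t. (g has_real_derivative g' t) (at t)" "Rk k g'" by auto
  then show ?case
    by (intro Rk_SucI[where f'="\<lambda>t. f' t + g' t"] DERIV_add Suc.IH) auto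
qed

lemma Rk_mult: "Rk k f \<Longrightarrow> Rk k g \<Longrightarrow> Rk k (\<lambda>t. f t * g t)"
proof (induction k arbitrary: f g)
  case 0 then show ?case by (simp add: continuous_on_mult)
next
  case (Suc k)
  from Suc.prems obtain f' g' where *: "\<forall>t. (f has_real_derivative f' t) (at t)" "Rk k f'"
    "\<forall>t. (g has_real_derivative g' t) (at t)" "Rk k g'" by auto
  have "Rk k f" "Rk k g" using Suc.prems Rk_SucD by blast+
  with Suc.IH[of f' g] Suc.IH[of f g'] * have "Rk k (\<lambda>t. f' t * g t + f t * g' t)"
    by (intro Rk_add) auto
  moreover have "((\<lambda>t. f t * g t) has_real_derivative f' t * g t + f t * g' t) (at t)" for t
    using DERIV_mult[of f "f' t" t UNIV g "g' t"] * by (simp add: algebra_simps)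
  ultimately show ?case by (rule Rk_SucI[rotated])
qed

lemma Rk_inverse:
  assumes "Rk k h" "\<And>t. h t \<noteq> 0" shows "Rk k (\<lambda>t. inverse (h t))"
  using assms
proof (induction k arbitrary: h)
  case 0 then show ?case by (simp add: continuous_on_inverse)
next
  case (Suc k)
  from Suc.prems obtain h' where *: "\<forall>t. (h has_real_derivative h' t) (at t)" "Rk k h'" by auto
  have "Rk k (\<lambda>t. inverse (h t))" using Suc Rk_SucD by blast
  then have "Rk k (\<lambda>t. (-1) * (h' t * (inverse (h t) * inverse (h t))))"
    using * by (intro Rk_mult Rk_const)
  moreover have "((\<lambda>t. inverse (h t)) has_real_derivative (-1) * (h' t * (inverse (h t) * inverse (h t)))) (at t)" for t
    using DERIV_inverse'[of h "h' t" t UNIV] * Suc.prems(2) by (simp add: mult_ac)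
  ultimately show ?case by (rule Rk_SucI[rotated])
qed

lemma Rk_affine: "Rk k f \<Longrightarrow> Rk k (\<lambda>t. f (c * t + d))"
proof (induction k arbitrary: f)
  case 0 then show ?case
    by (auto intro!: continuous_intros continuous_on_compose2[of UNIV f])
next
  case (Suc k)
  from Suc.prems obtain f' where *: "\<forall>t. (f has_real_derivative f' t) (at t)" "Rk k f'" by auto
  have "Rk k (\<lambda>t. c * f' (c * t + d))" using Suc.IH[OF *(2)] Rk_mult[OF Rk_const] by blast
  moreover have "((\<lambda>t. f (c * t + d)) has_real_derivative c * f' (c * t + d)) (at t)" for t
    by (rule DERIV_cong[OF DERIV_chain'[of "\<lambda>t. c * t + d" c]]) (use * in \<open>auto intro!: derivative_eq_intros\<close>)
  ultimately show ?case by (rule Rk_SucI[rotated])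
qed

definition smooth1 :: "(real \<Rightarrow> real) \<Rightarrow> bool" where "smooth1 f \<longleftrightarrow> (\<forall>k. Rk k f)"

text \<open>Each order k yields its own derivative witness; uniqueness of derivatives makes all of
  them the same function, which therefore has every order.\<close>

lemma smooth1_derivE:
  assumes "smooth1 f"
  obtains f' where "\<And>t. (f has_real_derivative f' t) (at t)" "smooth1 f'"
proof -
  from assms have "Rk (Suc k) f" for k by (auto simp: smooth1_def)
  then have ex: "\<exists>f'. (\<forall>t. (f has_real_derivative f' t) (at t)) \<and> Rk k f'" for k by auto
  from ex[of 0] obtain f' where f': "\<forall>t. (f has_real_derivative f' t) (at t)" by auto
  have "Rk k f'" for k
  proof -
    from ex[of k] obtain g where g: "\<forall>t. (f has_real_derivative g t) (at t)" "Rk k g" by auto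
    then have "g = f'" using f' DERIV_unique by (intro ext) blast
    with g show ?thesis by simp
  qed
  with f' that show ?thesis by (auto simp: smooth1_def)
qed

text \<open>The family \<open>t\<^sup>-\<^sup>n e\<^sup>-\<^sup>1\<^sup>/\<^sup>t\<close> is closed under differentiation up to linear combinations.\<close>
definition expinv :: "nat \<Rightarrow> real \<Rightarrow> real" where
  "expinv n t = (if t > 0 then (1/t)^n * exp (-(1/t)) else 0)"

lemma expinv_nonneg: "expinv n t \<ge> 0" by (simp add: expinv_def)
lemma expinv_eq_0: "t \<le> 0 \<Longrightarrow> expinv n t = 0" by (simp add: expinv_def)
lemma expinv_pos: "t > 0 \<Longrightarrow> expinv n t > 0" by (simp add: expinv_def)

lemma expinv_tendsto_0: "(expinv n \<longlongrightarrow> 0) (at 0)"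
proof -
  have "((\<lambda>s::real. s^n / exp s) \<longlongrightarrow> 0) at_top" by (rule tendsto_power_div_exp_0)
  from filterlim_compose[OF this filterlim_inverse_at_top_right]
  have "((\<lambda>t::real. (inverse t)^n / exp (inverse t)) \<longlongrightarrow> 0) (at_right 0)" .
  then have r: "(expinv n \<longlongrightarrow> 0) (at_right 0)"
    by (rule Lim_transform_eventually)
      (auto simp: eventually_at_right_field expinv_def exp_minus divide_simps intro!: exI[of _ 1])
  have l: "(expinv n \<longlongrightarrow> 0) (at_left 0)"
    by (rule Lim_transform_eventually[OF tendsto_const])
      (auto simp: eventually_at_left_field expinv_def intro!: exI[of _ "-1"])
  from filterlim_split_at[OF l r] show ?thesis .
qed

lemma expinv_deriv:
  "(expinv n has_real_derivative (- real n * expinv (n+1) t + expinv (n+2) t)) (at t)"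
proof -
  consider "t > 0" | "t < 0" | "t = 0" by linarith
  then show ?thesis
  proof cases
    case 1
    have "((\<lambda>t. (1/t)^n * exp (-(1/t))) has_real_derivative (- real n * expinv (n+1) t + expinv (n+2) t)) (at t)"
    proof -
      have "((\<lambda>t. (1/t)^n * exp (-(1/t))) has_real_derivative
          (real n * (1/t)^(n-1) * (-1/t^2)) * exp (-(1/t)) + (1/t)^n * (exp (-(1/t)) * (1/t^2))) (at t)"
        by (rule DERIV_mult' DERIV_power derivative_eq_intros refl | use 1 in \<open>simp add: field_simps power2_eq_square\<close>)+
      also have "(real n * (1/t)^(n-1) * (-1/t^2)) = - real n * (1/t)^(n+1)"
        by (cases n) (auto simp: power2_eq_square algebra_simps add_divide_distrib diff_divide_distrib)
      finally show ?thesis using 1 by (simp add: expinv_def power2_eq_square algebra_simps)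
    qed
    then show ?thesis
      by (rule has_field_derivative_transform_within_open[of _ _ _ "{0<..}"])
        (use 1 in \<open>auto simp: expinv_def\<close>)
  next
    case 2
    have "((\<lambda>t::real. 0) has_real_derivative (- real n * expinv (n+1) t + expinv (n+2) t)) (at t)"
      using 2 by (auto simp: expinv_def)
    then show ?thesis
      by (rule has_field_derivative_transform_within_open[of _ _ _ "{..<0}"])
        (use 2 in \<open>auto simp: expinv_def\<close>)
  next
    case 3
    \<comment> \<open>At 0 the difference quotient of \<open>expinv n\<close> is
      \<open>expinv (Suc n)\<close> itself, which tends to 0.\<close>
    have "((\<lambda>h. (expinv n (0+h) - expinv n 0) / h) \<longlongrightarrow> 0) (at 0)"
      by (rule Lim_transform_eventually[OF expinv_tendsto_0[of "Suc n"]])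
        (auto simp: expinv_def eventually_at intro!: exI[of _ 1])
    then show ?thesis using 3 by (simp add: DERIV_def expinv_def)
  qed
qed

lemma smooth1_expinv: "smooth1 (expinv n)"
proof -
  have "Rk k (expinv n)" for k
  proof (induction k arbitrary: n)
    case 0
    then show ?case
      using DERIV_isCont[OF expinv_deriv] by (auto simp: continuous_on_eq_continuous_within)
  next
    case (Suc k)
    have "Rk k (\<lambda>t. - real n * expinv (n+1) t + expinv (n+2) t)"
      using Suc by (intro Rk_add Rk_mult[OF Rk_const]) auto
    with expinv_deriv show ?case by (rule Rk_SucI)
  qed
  then show ?thesis by (simp add: smooth1_def)
qed

text \<open>T is a / (a + b), where a is flat zero from -1 on and b is flat zero up to -2, so the
  denominator never vanishes. The transition is placed in [-2, -1], left of 0, so that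
  T(\<open>\<rho>\<close>/e) is supported where \<open>\<rho> x \<le> - e\<close>, hence in a
  compact subset of the domain.\<close>

lemma cutoff_exists:
  obtains T T1 T2 :: "real \<Rightarrow> real" and C where
    "smooth1 T" "smooth1 T1" "smooth1 T2"
    "\<And>t. (T has_real_derivative T1 t) (at t)" "\<And>t. (T1 has_real_derivative T2 t) (at t)"
    "\<And>t. 0 \<le> T t" "\<And>t. T t \<le> 1" "\<And>t. t \<le> -2 \<Longrightarrow> T t = 1" "\<And>t. t \<ge> -1 \<Longrightarrow> T t = 0"
    "\<And>t. T1 t \<le> 0" "\<And>t. t < -2 \<Longrightarrow> T1 t = 0" "\<And>t. t > -1 \<Longrightarrow> T1 t = 0"
    "\<And>t. t < -2 \<Longrightarrow> T2 t = 0" "\<And>t. t > -1 \<Longrightarrow> T2 t = 0"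
    "\<And>t. \<bar>T1 t\<bar> \<le> C" "\<And>t. \<bar>T2 t\<bar> \<le> C"
proof -
  define a where "a t = expinv 0 ((-1) * t + (-1))" for t
  define b where "b t = expinv 0 (1 * t + 2)" for t
  define a' where "a' t = - expinv 2 ((-1) * t + (-1))" for t
  define b' where "b' t = expinv 2 (1 * t + 2)" for t
  have sa: "smooth1 a" "smooth1 b"
    using smooth1_expinv[of 0] unfolding smooth1_def a_def b_def by (blast intro: Rk_affine)+
  have d0: "(expinv 0 has_real_derivative expinv 2 t) (at t)" for t
    using expinv_deriv[of 0 t] by (simp add: numeral_2_eq_2)
  have da: "(a has_real_derivative a' t) (at t)" "(b has_real_derivative b' t) (at t)" for t
    unfolding a_def b_def a'_def b'_def
    by (rule DERIV_cong[OF DERIV_chain'[OF _ d0]], auto intro!: derivative_eq_intros)+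
  have pos: "a t + b t > 0" for t
    using expinv_nonneg[of 0 "-t-1"] expinv_nonneg[of 0 "t+2"] expinv_pos[of "-t-1" 0] expinv_pos[of "t+2" 0]
    by (cases "t < -1") (auto simp: a_def b_def)
  define T where "T t = a t * inverse (a t + b t)" for t
  have sT: "smooth1 T"
    unfolding smooth1_def T_def
  proof
    fix k
    have "Rk k a" "Rk k b" using sa by (auto simp: smooth1_def)
    moreover from this have "Rk k (\<lambda>t. inverse (a t + b t))"
      by (rule Rk_inverse[OF Rk_add]) (use pos in \<open>metis less_irrefl\<close>)
    ultimately show "Rk k (\<lambda>t. a t * inverse (a t + b t))" by (intro Rk_mult)
  qed
  have dT: "(T has_real_derivative (a' t * b t - a t * b' t) / (a t + b t)^2) (at t)" for t
    unfolding T_def divide_inverse[symmetric]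
    by (rule derivative_eq_intros da refl | use pos[of t] in \<open>simp add: field_simps power2_eq_square\<close>)+
  from sT obtain T1 where T1: "\<And>t. (T has_real_derivative T1 t) (at t)" "smooth1 T1"
    by (rule smooth1_derivE) blast
  from T1(2) obtain T2 where T2: "\<And>t. (T1 has_real_derivative T2 t) (at t)" "smooth1 T2"
    by (rule smooth1_derivE) blast
  \<comment> \<open>Smoothness of \<open>T1\<close> comes from \<open>smooth1_derivE\<close>; the
    explicit quotient is what shows its sign and its support.\<close>
  have T1eq: "T1 t = (a' t * b t - a t * b' t) / (a t + b t)^2" for t
    using T1(1) dT DERIV_unique by blast
  have 0: "T1 t \<le> 0" for t
    unfolding T1eq by (intro divide_nonpos_nonneg)
      (auto simp: a_def b_def a'_def b'_def expinv_nonneg intro!: add_nonneg_nonneg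
         intro: order_trans[of _ 0])
  have T1z: "T1 t = 0" if "t < -2 \<or> t > -1" for t
    using that by (auto simp: T1eq a_def b_def a'_def b'_def expinv_eq_0)
  have T2z: "T2 t = 0" if "t < -2 \<or> t > -1" for t
  proof -
    have "((\<lambda>t. 0) has_real_derivative 0) (at t)" by simp
    then have "(T1 has_real_derivative 0) (at t)"
      by (rule has_field_derivative_transform_within_open[of _ _ _ "{..< -2} \<union> {-1<..}"])
        (use that T1z in auto)
    then show ?thesis using T2(1) DERIV_unique by blast
  qed
  have bd: "\<exists>C. \<forall>t. \<bar>g t\<bar> \<le> C" if "smooth1 g" "\<And>t. t < -2 \<or> t > -1 \<Longrightarrow> g t = 0" for g :: "real \<Rightarrow> real"
  proof -
    have "continuous_on UNIV g" using that(1) unfolding smooth1_def by (metis Rk.simps(1))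
    then have "compact (g ` {-2..-1})" by (intro compact_continuous_image) (auto intro: continuous_on_subset)
    then obtain C where C: "\<forall>x\<in>{-2..-1}. \<bar>g x\<bar> \<le> C"
      using compact_imp_bounded bounded_iff[of "g ` {-2..-1}"] by auto
    have "\<bar>g t\<bar> \<le> \<bar>C\<bar>" for t
    proof (cases "t \<in> {-2..-1}")
      case True with C have "\<bar>g t\<bar> \<le> C" by blast then show ?thesis by linarith
    next
      case False then show ?thesis using that(2)[of t] by auto
    qed
    then show ?thesis by blast
  qed
  obtain C1 where C1: "\<forall>t. \<bar>T1 t\<bar> \<le> C1" using bd[OF T1(2)] T1z by blast
  obtain C2 where C2: "\<forall>t. \<bar>T2 t\<bar> \<le> C2" using bd[OF T2(2)] T2z by blast
  show ?thesis
  proof (rule that[of T T1 T2 "\<bar>C1\<bar> + \<bar>C2\<bar>"])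
    fix t
    show "\<bar>T1 t\<bar> \<le> \<bar>C1\<bar> + \<bar>C2\<bar>" "\<bar>T2 t\<bar> \<le> \<bar>C1\<bar> + \<bar>C2\<bar>"
      using C1[rule_format, of t] C2[rule_format, of t] by linarith+
    have ab: "a t \<ge> 0" "b t \<ge> 0" by (simp_all add: a_def b_def expinv_nonneg)
    show "0 \<le> T t" using ab pos[of t] by (simp add: T_def)
    show "T t \<le> 1" using ab pos[of t] by (simp add: T_def divide_inverse[symmetric])
    show "t \<le> -2 \<Longrightarrow> T t = 1" using pos[of t] by (auto simp: T_def b_def expinv_eq_0)
    show "t \<ge> -1 \<Longrightarrow> T t = 0" by (auto simp: T_def a_def expinv_eq_0)
  qed (use sT T1 T2 0 T1z T2z in auto)
qed

section \<open>Closure properties of \<open>Ck\<close> and \<open>smooth\<close>\<close>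

lemma Ck_SucD: "Ck (Suc k) UNIV f \<Longrightarrow> Ck k UNIV f"
proof (induction k arbitrary: f)
  case 0
  then show ?case
    by (auto simp: continuous_on_eq_continuous_within intro: differentiable_imp_continuous_within)
next
  case (Suc k)
  have "\<forall>v. Ck (Suc k) UNIV (\<lambda>x. frechet_derivative f (at x) v)"
    using Suc.prems by (subst (asm) Ck.simps(2)) blast
  moreover have "\<forall>x. f differentiable at x" using Suc.prems by (subst (asm) Ck.simps(2)) blast
  ultimately show ?case using Suc.IH by simp
qed

lemma Ck_Suc_of_has_derivative:
  assumes "\<And>x. (f has_derivative (\<lambda>v. D x v)) (at x)" "\<And>v. Ck k UNIV (\<lambda>x. D x v)"
  shows "Ck (Suc k) UNIV f"
proof -
  have "frechet_derivative f (at x) = D x" for x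
    using frechet_derivative_at[OF assms(1)[of x]] by simp
  then show ?thesis using assms by (auto simp: differentiable_def)
qed

lemma Ck_Suc_E:
  assumes "Ck (Suc k) UNIV f"
  shows "\<And>x. (f has_derivative frechet_derivative f (at x)) (at x)"
    "\<And>v. Ck k UNIV (\<lambda>x. frechet_derivative f (at x) v)"
  using assms by (auto simp: frechet_derivative_works)

lemma Ck_const: "Ck k UNIV (\<lambda>x. c)"
proof (induction k arbitrary: c)
  case (Suc k)
  show ?case by (rule Ck_Suc_of_has_derivative[where D="\<lambda>x v. 0"]) (auto simp: Suc)
qed auto

lemma Ck_add: "Ck k UNIV f \<Longrightarrow> Ck k UNIV g \<Longrightarrow> Ck k UNIV (\<lambda>x. f x + g x)"
proof (induction k arbitrary: f g)
  case (Suc k)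
  note f = Ck_Suc_E[OF Suc.prems(1)] and g = Ck_Suc_E[OF Suc.prems(2)]
  show ?case
    by (rule Ck_Suc_of_has_derivative[OF has_derivative_add[OF f(1) g(1)]]) (intro Suc.IH f g)
qed (simp add: continuous_on_add)

lemma Ck_mult: "Ck k UNIV f \<Longrightarrow> Ck k UNIV g \<Longrightarrow> Ck k UNIV (\<lambda>x. f x * g x)"
proof (induction k arbitrary: f g)
  case (Suc k)
  note f = Ck_Suc_E[OF Suc.prems(1)] and g = Ck_Suc_E[OF Suc.prems(2)]
  show ?case
    by (rule Ck_Suc_of_has_derivative[OF has_derivative_mult[OF f(1) g(1)]])
      (intro Ck_add Suc.IH f(2) g(2) Ck_SucD[OF Suc.prems(1)] Ck_SucD[OF Suc.prems(2)])
qed (simp add: continuous_on_mult)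

lemma Ck_comp: "Rk k G \<Longrightarrow> Ck k UNIV f \<Longrightarrow> Ck k UNIV (\<lambda>x. G (f x))"
proof (induction k arbitrary: f G)
  case 0 then show ?case by (auto intro: continuous_on_compose2[of UNIV G])
next
  case (Suc k)
  note f = Ck_Suc_E[OF Suc.prems(2)]
  from Suc.prems(1) obtain G' where G: "\<forall>t. (G has_real_derivative G' t) (at t)" "Rk k G'" by auto
  have d: "((\<lambda>x. G (f x)) has_derivative (\<lambda>v. G' (f x) * frechet_derivative f (at x) v)) (at x)" for x
    using has_derivative_compose[OF f(1), of G "(*) (G' (f x))"] G(1) by (simp add: has_field_derivative_def)
  show ?case
    by (rule Ck_Suc_of_has_derivative[OF d]) (rule Ck_mult[OF Suc.IH[OF G(2) Ck_SucD[OF Suc.prems(2)]] f(2)])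
qed

lemma Ck_affine: "Ck k UNIV f \<Longrightarrow> Ck k UNIV (\<lambda>x. f (c *\<^sub>R x + d))"
proof (induction k arbitrary: f)
  case 0 then show ?case by (auto intro!: continuous_intros continuous_on_compose2[of UNIV f])
next
  case (Suc k)
  note f = Ck_Suc_E[OF Suc.prems]
  have d: "((\<lambda>x. f (c *\<^sub>R x + d)) has_derivative (\<lambda>v. frechet_derivative f (at (c *\<^sub>R x + d)) (c *\<^sub>R v))) (at x)" for x
    by (rule has_derivative_compose[OF _ f(1), of "\<lambda>x. c *\<^sub>R x + d"]) (auto intro!: derivative_eq_intros)
  show ?case
    by (rule Ck_Suc_of_has_derivative[OF d]) (rule Suc.IH[OF f(2)])
qed

lemma Ck_component: "Ck k UNIV (\<lambda>x::pt. x $ j)"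
proof (cases k)
  case 0 then show ?thesis by (auto intro: continuous_intros)
next
  case (Suc k)
  show ?thesis unfolding Suc
    by (rule Ck_Suc_of_has_derivative[where D="\<lambda>x v. v $ j"])
      (auto intro!: bounded_linear_imp_has_derivative bounded_linear_vec_nth Ck_const)
qed

lemma smooth_const [simp]: "smooth (\<lambda>x. c)" by (simp add: smooth_def Ck_const)
lemma smooth_add: "smooth f \<Longrightarrow> smooth g \<Longrightarrow> smooth (\<lambda>x. f x + g x)" by (simp add: smooth_def Ck_add)
lemma smooth_mult: "smooth f \<Longrightarrow> smooth g \<Longrightarrow> smooth (\<lambda>x. f x * g x)" by (simp add: smooth_def Ck_mult)
lemma smooth_comp: "smooth1 G \<Longrightarrow> smooth f \<Longrightarrow> smooth (\<lambda>x. G (f x))"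
  by (simp add: smooth_def smooth1_def Ck_comp)
lemma smooth_affine: "smooth f \<Longrightarrow> smooth (\<lambda>x. f (c *\<^sub>R x + d))" by (simp add: smooth_def Ck_affine)
lemma smooth_component [simp]: "smooth (\<lambda>x. x $ j)" by (simp add: smooth_def Ck_component)
lemma smooth_uminus: "smooth f \<Longrightarrow> smooth (\<lambda>x. - f x)" using smooth_mult[of "\<lambda>x. -1" f] by simp
lemma smooth_diff: "smooth f \<Longrightarrow> smooth g \<Longrightarrow> smooth (\<lambda>x. f x - g x)"
  using smooth_add[OF _ smooth_uminus, of f g] by simp

lemma smooth_frechet: "smooth f \<Longrightarrow> smooth (\<lambda>x. frechet_derivative f (at x) v)"
  unfolding smooth_def by (metis Ck_Suc_E(2))

lemma smooth_pd: "smooth f \<Longrightarrow> smooth (pd f j)"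
  unfolding pd_def by (rule smooth_frechet)

lemma smooth_continuous: "smooth f \<Longrightarrow> continuous_on S f"
  unfolding smooth_def by (metis Ck.simps(1) continuous_on_subset subset_UNIV)

section \<open>Rules for partial derivatives\<close>

lemma pd_of_has_derivative: "(f has_derivative D) (at x) \<Longrightarrow> pd f j x = D (axis j 1)"
  unfolding pd_def by (metis frechet_derivative_at)

lemma pt_expand: "(v::pt) = v $ 1 *\<^sub>R axis 1 1 + v $ 2 *\<^sub>R axis 2 1"
  by (simp add: vec_eq_iff forall_2 axis_def)

lemma has_derivative_pd:
  assumes "f differentiable at x"
  shows "(f has_derivative (\<lambda>v. v $ 1 * pd f 1 x + v $ 2 * pd f 2 x)) (at x)"
proof -
  let ?D = "frechet_derivative f (at x)"
  have D: "(f has_derivative ?D) (at x)" using assms frechet_derivative_works by blast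
  interpret bounded_linear ?D using D by (rule has_derivative_bounded_linear)
  have "?D = (\<lambda>v. v $ 1 * pd f 1 x + v $ 2 * pd f 2 x)"
    by (rule ext, subst pt_expand, simp only: add scale pd_def real_scaleR_def)
  with D show ?thesis by simp
qed

lemma smooth_has_derivative:
  "smooth f \<Longrightarrow> (f has_derivative (\<lambda>v. v $ 1 * pd f 1 x + v $ 2 * pd f 2 x)) (at x)"
  by (rule has_derivative_pd) (metis Ck_Suc_E(1) differentiableI smooth_def)

lemma smoothI:
  assumes "\<And>x. (f has_derivative (\<lambda>v. v $ 1 * g1 x + v $ 2 * g2 x)) (at x)" "smooth g1" "smooth g2"
  shows "smooth f"
  unfolding smooth_def
proof
  fix k
  have "Ck (Suc k) UNIV f"
    by (rule Ck_Suc_of_has_derivative[OF assms(1)])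
      (use assms(2,3) in \<open>auto simp: smooth_def intro!: Ck_add Ck_mult[OF Ck_const]\<close>)
  then show "Ck k UNIV f" by (rule Ck_SucD)
qed

lemma axis_pd: "axis j 1 $ (1::2) * pd f 1 x + axis j 1 $ (2::2) * pd f 2 x = pd f j x"
  using exhaust_2[of j] by (auto simp: axis_def)

lemma pd_const [simp]: "pd (\<lambda>x. c) j x = 0"
  using pd_of_has_derivative[OF has_derivative_const] .

lemma pd_add:
  assumes "smooth f" "smooth g"
  shows "pd (\<lambda>x. f x + g x) j x = pd f j x + pd g j x"
  using pd_of_has_derivative[OF has_derivative_add[OF assms[THEN smooth_has_derivative]]]
  by (simp only: axis_pd)

lemma pd_mult:
  assumes "smooth f" "smooth g"
  shows "pd (\<lambda>x. f x * g x) j x = pd f j x * g x + f x * pd g j x"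
  using pd_of_has_derivative[OF has_derivative_mult[OF assms[THEN smooth_has_derivative]]]
  by (simp only: axis_pd add.commute)

lemma pd_comp:
  assumes "smooth f" "\<And>t. (G has_real_derivative G' t) (at t)"
  shows "pd (\<lambda>x. G (f x)) j x = G' (f x) * pd f j x"
proof -
  have "((\<lambda>x. G (f x)) has_derivative (\<lambda>v. G' (f x) * (v $ 1 * pd f 1 x + v $ 2 * pd f 2 x))) (at x)"
    using has_derivative_compose[OF smooth_has_derivative[OF assms(1)], of G "(*) (G' (f x))"] assms(2)
    by (simp add: has_field_derivative_def)
  from pd_of_has_derivative[OF this] show ?thesis by (simp only: axis_pd)
qed

lemma pd_affine:
  assumes "smooth f"
  shows "pd (\<lambda>x. f (c *\<^sub>R x + d)) j x = c * pd f j (c *\<^sub>R x + d)"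
proof -
  have "((\<lambda>x. f (c *\<^sub>R x + d)) has_derivative (\<lambda>v. (c *\<^sub>R v) $ 1 * pd f 1 (c *\<^sub>R x + d) + (c *\<^sub>R v) $ 2 * pd f 2 (c *\<^sub>R x + d))) (at x)"
    by (rule has_derivative_compose[OF _ smooth_has_derivative[OF assms], of "\<lambda>x. c *\<^sub>R x + d"]) (auto intro!: derivative_eq_intros)
  from pd_of_has_derivative[OF this, of j] show ?thesis
    by (simp only: vector_scaleR_component real_scaleR_def mult.assoc distrib_left[symmetric] axis_pd)
qed

lemma pd_component: "pd (\<lambda>x. x $ i) j x = (if i = j then 1 else 0)"
  using pd_of_has_derivative[OF bounded_linear_imp_has_derivative[OF bounded_linear_vec_nth], of i j x]
  by (auto simp: axis_def)

lemma pd_cmult: "smooth f \<Longrightarrow> pd (\<lambda>x. c * f x) j x = c * pd f j x"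
  using pd_mult[of "\<lambda>x. c" f] by simp
lemma pd_uminus: "smooth f \<Longrightarrow> pd (\<lambda>x. - f x) j x = - pd f j x"
  using pd_cmult[of f "-1"] by simp
lemma pd_diff: "smooth f \<Longrightarrow> smooth g \<Longrightarrow> pd (\<lambda>x. f x - g x) j x = pd f j x - pd g j x"
  using pd_add[OF _ smooth_uminus, of f g] by (simp add: pd_uminus)

lemma pd_eq_0_outside:
  assumes "smooth f" "open S" "x \<in> S" "\<And>y. y \<in> S \<Longrightarrow> f y = 0"
  shows "pd f j x = 0"
proof -
  have "(f has_derivative (\<lambda>v. 0)) (at x)"
    by (rule has_derivative_transform_within_open[OF has_derivative_const assms(2,3)]) (simp add: assms(4))
  from pd_of_has_derivative[OF this] show ?thesis .
qed

subsection \<open>Square-integrable functions\<close>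

text \<open>The analysis takes place on the whole plane, with functions that are extended by zero
  off the domain; the set integrals of the statement are translated only at the end.\<close>

definition sqi :: "(pt \<Rightarrow> real) \<Rightarrow> bool" where
  "sqi f \<longleftrightarrow> f \<in> borel_measurable lebesgue \<and> integrable lebesgue (\<lambda>x. (f x)^2)"

definition nrm :: "(pt \<Rightarrow> real) \<Rightarrow> real" where
  "nrm f = sqrt (\<integral>x. (f x)^2 \<partial>lebesgue)"

lemma sqi_meas [measurable_dest]: "sqi f \<Longrightarrow> f \<in> borel_measurable lebesgue" by (simp add: sqi_def)
lemma sqi_int: "sqi f \<Longrightarrow> integrable lebesgue (\<lambda>x. (f x)^2)" by (simp add: sqi_def)

lemma nrm_nonneg [simp]: "0 \<le> nrm f" by (simp add: nrm_def)
lemma nrm_power2: "(nrm f)^2 = (\<integral>x. (f x)^2 \<partial>lebesgue)" by (simp add: nrm_def)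

lemma continuous_meas: "continuous_on UNIV (f :: pt \<Rightarrow> real) \<Longrightarrow> f \<in> borel_measurable lebesgue"
  by (simp add: borel_measurable_continuous_onI measurable_completion)

lemma smooth_meas: "smooth f \<Longrightarrow> f \<in> borel_measurable lebesgue"
  by (simp add: continuous_meas smooth_continuous)

lemma mult_le_sum_squares: "\<bar>a * b\<bar> \<le> a^2 + (b::real)^2"
proof -
  have "0 \<le> (\<bar>a\<bar> - \<bar>b\<bar>)^2" by simp
  then have "2 * (\<bar>a\<bar> * \<bar>b\<bar>) \<le> a^2 + b^2" by (simp add: power2_diff)
  moreover have "0 \<le> \<bar>a\<bar> * \<bar>b\<bar>" by simp
  ultimately show ?thesis by (simp only: abs_mult)
qed

lemma sqi_mult_integrable:
  assumes "sqi f" "sqi g" shows "integrable lebesgue (\<lambda>x. f x * g x)"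
proof (rule Bochner_Integration.integrable_bound)
  show "integrable lebesgue (\<lambda>x. (f x)^2 + (g x)^2)" using assms by (simp add: sqi_int)
  show "(\<lambda>x. f x * g x) \<in> borel_measurable lebesgue"
    using assms by (simp add: sqi_meas borel_measurable_times)
qed (use mult_le_sum_squares in auto)

lemma sqi_bounded_mult:
  assumes f: "sqi f" and m: "m \<in> borel_measurable lebesgue" "\<And>x. \<bar>m x\<bar> \<le> C"
  shows "sqi (\<lambda>x. m x * f x)"
  unfolding sqi_def
proof
  show meas: "(\<lambda>x. m x * f x) \<in> borel_measurable lebesgue"
    using assms by (simp add: sqi_meas borel_measurable_times)
  show "integrable lebesgue (\<lambda>x. (m x * f x)^2)"
  proof (rule Bochner_Integration.integrable_bound)
    show "integrable lebesgue (\<lambda>x. C^2 * (f x)^2)" using sqi_int[OF f] by simp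
    show "(\<lambda>x. (m x * f x)^2) \<in> borel_measurable lebesgue" using meas by (rule borel_measurable_power)
    have "(m x * f x)^2 \<le> C^2 * (f x)^2" for x
      using m(2)[of x] unfolding power_mult_distrib
      by (intro mult_right_mono) (auto simp flip: abs_le_square_iff)
    then show "AE x in lebesgue. norm ((m x * f x)^2) \<le> norm (C^2 * (f x)^2)" by simp
  qed
qed

lemma sqi_add: assumes "sqi f" "sqi g" shows "sqi (\<lambda>x. f x + g x)"
proof -
  have "(\<lambda>x. (f x + g x)^2) = (\<lambda>x. (f x)^2 + (g x)^2 + 2 * (f x * g x))"
    by (auto simp: power2_sum algebra_simps)
  then show ?thesis using assms sqi_mult_integrable[OF assms]
    by (simp add: sqi_def borel_measurable_add)
qed

lemma sqi_cmult: "sqi f \<Longrightarrow> sqi (\<lambda>x. c * f x)"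
  by (rule sqi_bounded_mult[of f "\<lambda>x. c" "\<bar>c\<bar>"]) auto
lemma sqi_uminus: "sqi f \<Longrightarrow> sqi (\<lambda>x. - f x)" using sqi_cmult[of f "-1"] by simp
lemma sqi_diff: "sqi f \<Longrightarrow> sqi g \<Longrightarrow> sqi (\<lambda>x. f x - g x)"
  using sqi_add[OF _ sqi_uminus, of f g] by simp
lemma sqi_abs: "sqi f \<Longrightarrow> sqi (\<lambda>x. \<bar>f x\<bar>)"
  by (simp add: sqi_def borel_measurable_abs)
lemma sqi_indicator: "sqi f \<Longrightarrow> S \<in> sets lebesgue \<Longrightarrow> sqi (\<lambda>x. indicator S x * f x)"
  by (rule sqi_bounded_mult[where C=1]) (auto simp: indicator_def)

lemma nrm_mono:
  assumes "sqi g" "AE x in lebesgue. \<bar>f x\<bar> \<le> \<bar>g x\<bar>" "f \<in> borel_measurable lebesgue"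
  shows "nrm f \<le> nrm g"
proof -
  have "integrable lebesgue (\<lambda>x. (f x)^2)"
    by (rule Bochner_Integration.integrable_bound[OF sqi_int[OF assms(1)]])
      (use assms(2,3) in \<open>auto simp: abs_le_square_iff intro: borel_measurable_power\<close>)
  then show ?thesis unfolding nrm_def using assms(2)
    by (intro real_sqrt_le_mono integral_mono_AE sqi_int[OF assms(1)]) (auto simp: abs_le_square_iff)
qed

lemma nrm_cmult: "nrm (\<lambda>x. c * f x) = \<bar>c\<bar> * nrm f"
  by (simp add: nrm_def power_mult_distrib real_sqrt_mult)

lemma nrm_bounded_mult:
  assumes "sqi f" "m \<in> borel_measurable lebesgue" "\<And>x. \<bar>m x\<bar> \<le> C"
  shows "nrm (\<lambda>x. m x * f x) \<le> C * nrm f"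
proof -
  have C: "C \<ge> 0" using assms(3)[of undefined] by linarith
  have "nrm (\<lambda>x. m x * f x) \<le> nrm (\<lambda>x. C * f x)"
  proof (rule nrm_mono)
    show "AE x in lebesgue. \<bar>m x * f x\<bar> \<le> \<bar>C * f x\<bar>"
      using assms(3) C by (auto simp: abs_mult intro!: mult_right_mono)
  qed (use assms in \<open>auto simp: sqi_cmult intro: sqi_meas borel_measurable_times\<close>)
  then show ?thesis using C by (simp add: nrm_cmult)
qed

lemma nrm_uminus: "nrm (\<lambda>x. - f x) = nrm f" by (simp add: nrm_def)
lemma nrm_minus_commute: "nrm (\<lambda>x. f x - g x) = nrm (\<lambda>x. g x - f x)"
  by (simp add: nrm_def power2_commute)

text \<open>Young's inequality with a weight t, optimised at t = \<open>nrm g / nrm f\<close>. Both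
  norms are enlarged by e > 0 so that this quotient makes sense, and then e tends to 0.\<close>

lemma Cauchy_Schwarz_abs:
  assumes f: "sqi f" and g: "sqi g"
  shows "(\<integral>x. \<bar>f x * g x\<bar> \<partial>lebesgue) \<le> nrm f * nrm g"
proof -
  let ?I = "\<integral>x. \<bar>f x * g x\<bar> \<partial>lebesgue"
  have young: "2 * ?I \<le> t * (nrm f)^2 + (nrm g)^2 / t" if t: "t > 0" for t :: real
  proof -
    have "2 * \<bar>f x * g x\<bar> \<le> t * (f x)^2 + (g x)^2 / t" for x
    proof -
      have "0 \<le> (sqrt t * \<bar>f x\<bar> - \<bar>g x\<bar> / sqrt t)^2" by simp
      also have "\<dots> = t * (f x)^2 + (g x)^2 / t - 2 * (\<bar>f x\<bar> * \<bar>g x\<bar>)"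
        using t by (simp add: power2_diff power_mult_distrib power_divide)
      finally show ?thesis by (simp add: abs_mult)
    qed
    then have "(\<integral>x. 2 * \<bar>f x * g x\<bar> \<partial>lebesgue) \<le> (\<integral>x. t * (f x)^2 + (g x)^2 / t \<partial>lebesgue)"
      using sqi_mult_integrable[OF f g] f g
      by (intro integral_mono) (auto simp: sqi_int)
    then show ?thesis using f g by (simp add: sqi_int nrm_power2)
  qed
  have step: "?I \<le> (nrm f + e) * (nrm g + e)" if e: "e > 0" for e
  proof -
    let ?a = "nrm f + e" and ?b = "nrm g + e"
    have p: "?a > 0" "?b > 0" using e by (simp_all add: add_nonneg_pos)
    have "2 * ?I \<le> (?b / ?a) * (nrm f)^2 + (nrm g)^2 / (?b / ?a)"
      by (rule young) (use p in simp)
    also have "\<dots> \<le> (?b / ?a) * ?a^2 + ?b^2 / (?b / ?a)"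
      using p e by (intro add_mono mult_left_mono divide_right_mono power_mono) auto
    also have "\<dots> = 2 * (?a * ?b)" using p by (simp add: power2_eq_square)
    finally show ?thesis by simp
  qed
  have "((\<lambda>e. (nrm f + e) * (nrm g + e)) \<longlongrightarrow> (nrm f + 0) * (nrm g + 0)) (at_right 0)"
    by (intro tendsto_intros)
  moreover have "\<forall>\<^sub>F e in at_right 0. ?I \<le> (nrm f + e) * (nrm g + e)"
    using step by (auto simp: eventually_at_right_field intro!: exI[of _ 1])
  ultimately show ?thesis
    using tendsto_lowerbound[of _ _ "at_right (0::real)"] by simp
qed

lemma Cauchy_Schwarz:
  assumes "sqi f" "sqi g"
  shows "\<bar>\<integral>x. f x * g x \<partial>lebesgue\<bar> \<le> nrm f * nrm g"
  using integral_abs_bound[of lebesgue "\<lambda>x. f x * g x"] Cauchy_Schwarz_abs[OF assms] by linarith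

lemma nrm_triangle:
  assumes "sqi f" "sqi g" shows "nrm (\<lambda>x. f x + g x) \<le> nrm f + nrm g"
proof (rule power2_le_imp_le)
  have "(nrm (\<lambda>x. f x + g x))^2 = (\<integral>x. (f x)^2 + (g x)^2 + 2 * (f x * g x) \<partial>lebesgue)"
    unfolding nrm_power2 by (simp add: power2_sum mult.assoc)
  also have "\<dots> = (nrm f)^2 + (nrm g)^2 + 2 * (\<integral>x. f x * g x \<partial>lebesgue)"
    using assms sqi_mult_integrable[OF assms] by (simp add: sqi_int nrm_power2)
  also have "\<dots> \<le> (nrm f + nrm g)^2"
    using Cauchy_Schwarz[OF assms] by (simp add: power2_sum)
  finally show "(nrm (\<lambda>x. f x + g x))^2 \<le> (nrm f + nrm g)^2" .
qed simp

lemma nrm_triangle_diff: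
  assumes "sqi f" "sqi g" shows "nrm f \<le> nrm g + nrm (\<lambda>x. f x - g x)"
  using nrm_triangle[OF assms(2) sqi_diff[OF assms]] by simp

lemma nrm_tendsto:
  assumes "\<And>n. sqi (fn n)" "sqi f" "(\<lambda>n. nrm (\<lambda>x. fn n x - f x)) \<longlonglongrightarrow> 0"
  shows "(\<lambda>n. nrm (fn n)) \<longlonglongrightarrow> nrm f"
proof -
  have "\<bar>nrm (fn n) - nrm f\<bar> \<le> nrm (\<lambda>x. fn n x - f x)" for n
    using nrm_triangle_diff[OF assms(1)[of n] assms(2)] nrm_triangle_diff[OF assms(2) assms(1)[of n]]
    by (simp add: nrm_minus_commute)
  then have "(\<lambda>n. nrm (fn n) - nrm f) \<longlonglongrightarrow> 0"
    by (intro Lim_null_comparison[OF _ assms(3)]) auto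
  then show ?thesis by (simp add: LIM_zero_iff)
qed

text \<open>This is how every bilinear identity proved for mollified functions passes to the limit:
  two factors converge in mean square and the weight is bounded.\<close>

lemma triple_tendsto:
  assumes fn: "\<And>n. sqi (fn n)" "sqi f" "(\<lambda>n. nrm (\<lambda>x. fn n x - f x)) \<longlonglongrightarrow> 0"
    and gn: "\<And>n. sqi (gn n)" "sqi g" "(\<lambda>n. nrm (\<lambda>x. gn n x - g x)) \<longlonglongrightarrow> 0"
    and m: "m \<in> borel_measurable lebesgue" "\<And>x. \<bar>m x\<bar> \<le> C"
  shows "(\<lambda>n. \<integral>x. m x * fn n x * gn n x \<partial>lebesgue) \<longlonglongrightarrow> (\<integral>x. m x * f x * g x \<partial>lebesgue)"
proof -
  have bm: "sqi (\<lambda>x. m x * h x)" if "sqi h" for h using sqi_bounded_mult[OF that m] .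
  have est: "\<bar>(\<integral>x. m x * fn n x * gn n x \<partial>lebesgue) - (\<integral>x. m x * f x * g x \<partial>lebesgue)\<bar>
    \<le> C * nrm (fn n) * nrm (\<lambda>x. gn n x - g x) + C * nrm (\<lambda>x. fn n x - f x) * nrm g" for n
  proof -
    have i: "integrable lebesgue (\<lambda>x. m x * h x * k x)" if "sqi h" "sqi k" for h k
      using sqi_mult_integrable[OF bm[OF that(1)] that(2)] .
    have "(\<integral>x. m x * fn n x * (gn n x - g x) \<partial>lebesgue)
        = (\<integral>x. m x * fn n x * gn n x \<partial>lebesgue) - (\<integral>x. m x * fn n x * g x \<partial>lebesgue)"
      unfolding right_diff_distrib by (intro Bochner_Integration.integral_diff i fn gn)
    moreover have "(\<integral>x. m x * (fn n x - f x) * g x \<partial>lebesgue)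
        = (\<integral>x. m x * fn n x * g x \<partial>lebesgue) - (\<integral>x. m x * f x * g x \<partial>lebesgue)"
      unfolding right_diff_distrib left_diff_distrib by (intro Bochner_Integration.integral_diff i fn gn)
    moreover have "\<bar>\<integral>x. m x * fn n x * (gn n x - g x) \<partial>lebesgue\<bar> \<le> C * nrm (fn n) * nrm (\<lambda>x. gn n x - g x)"
      using Cauchy_Schwarz[OF bm[OF fn(1)[of n]] sqi_diff[OF gn(1)[of n] gn(2)]]
        mult_right_mono[OF nrm_bounded_mult[OF fn(1)[of n] m] nrm_nonneg] by (meson order_trans)
    moreover have "\<bar>\<integral>x. m x * (fn n x - f x) * g x \<partial>lebesgue\<bar> \<le> C * nrm (\<lambda>x. fn n x - f x) * nrm g"
      using Cauchy_Schwarz[OF bm[OF sqi_diff[OF fn(1)[of n] fn(2)]] gn(2)]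
        mult_right_mono[OF nrm_bounded_mult[OF sqi_diff[OF fn(1)[of n] fn(2)] m] nrm_nonneg] by (meson order_trans)
    ultimately show ?thesis by linarith
  qed
  have "(\<lambda>n. C * nrm (fn n) * nrm (\<lambda>x. gn n x - g x) + C * nrm (\<lambda>x. fn n x - f x) * nrm g)
    \<longlonglongrightarrow> C * nrm f * 0 + C * 0 * nrm g"
    by (intro tendsto_intros nrm_tendsto fn gn)
  then have "(\<lambda>n. C * nrm (fn n) * nrm (\<lambda>x. gn n x - g x) + C * nrm (\<lambda>x. fn n x - f x) * nrm g) \<longlonglongrightarrow> 0"
    by simp
  then have "(\<lambda>n. (\<integral>x. m x * fn n x * gn n x \<partial>lebesgue) - (\<integral>x. m x * f x * g x \<partial>lebesgue)) \<longlonglongrightarrow> 0"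
    by (rule Lim_null_comparison[OF always_eventually, rotated]) (simp only: real_norm_def est simp_thms)
  then show ?thesis by (rule LIM_zero_cancel)
qed

lemma bounded_supp_integrable:
  fixes f :: "pt \<Rightarrow> real"
  assumes "f \<in> borel_measurable lebesgue" "\<And>x. \<bar>f x\<bar> \<le> C" "\<And>x. norm x > R \<Longrightarrow> f x = 0"
  shows "integrable lebesgue f"
proof (rule Bochner_Integration.integrable_bound)
  show "integrable lebesgue (\<lambda>x. C * indicator (cball (0::pt) R) x)"
    by (intro integrable_mult_right integrable_real_indicator) (use emeasure_lborel_cball_finite[of 0 R] in auto)
  show "AE x in lebesgue. norm (f x) \<le> norm (C * indicator (cball (0::pt) R) x)"
    using assms(2,3) by (intro always_eventually) (auto simp: indicator_def intro: order_trans[OF _ abs_ge_self])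
qed (rule assms)

lemma bounded_supp_sqi:
  assumes "f \<in> borel_measurable lebesgue" "\<And>x. \<bar>f x\<bar> \<le> C" "\<And>x. norm x > R \<Longrightarrow> f x = 0"
  shows "sqi f"
  unfolding sqi_def
proof
  show "integrable lebesgue (\<lambda>x. (f x)^2)"
    by (rule bounded_supp_integrable[of _ "C^2" R])
      (use assms in \<open>auto intro: borel_measurable_power simp flip: abs_le_square_iff intro: order_trans[OF _ abs_ge_self]\<close>)
qed (rule assms)

lemma continuous_supp_bounded:
  fixes f :: "pt \<Rightarrow> real"
  assumes "continuous_on UNIV f" "\<And>x. norm x > R \<Longrightarrow> f x = 0"
  obtains C where "C \<ge> 0" "\<And>x. \<bar>f x\<bar> \<le> C"
proof -
  have "compact (f ` cball 0 R)"
    by (intro compact_continuous_image continuous_on_subset[OF assms(1)]) auto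
  then obtain C where C: "\<forall>x\<in>cball 0 R. \<bar>f x\<bar> \<le> C"
    using compact_imp_bounded bounded_iff[of "f ` cball 0 R"] by auto
  have "\<bar>f x\<bar> \<le> \<bar>C\<bar>" for x
  proof (cases "norm x \<le> R")
    case True then have "\<bar>f x\<bar> \<le> C" using C by auto
    then show ?thesis by linarith
  next
    case False then show ?thesis using assms(2)[of x] by auto
  qed
  then show ?thesis using that[of "\<bar>C\<bar>"] by auto
qed

lemma continuous_supp_sqi:
  assumes "continuous_on UNIV f" "\<And>x. norm x > R \<Longrightarrow> f x = 0"
  shows "sqi f" "integrable lebesgue f"
proof -
  obtain C where C: "\<And>x. \<bar>f x\<bar> \<le> C" using continuous_supp_bounded[OF assms] by blast
  show "sqi f" by (rule bounded_supp_sqi[OF continuous_meas[OF assms(1)] C assms(2)])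
  show "integrable lebesgue f" by (rule bounded_supp_integrable[OF continuous_meas[OF assms(1)] C assms(2)])
qed

lemma sqi_supp_integrable:
  assumes "sqi f" "\<And>x. norm x > R \<Longrightarrow> f x = 0"
  shows "integrable lebesgue f"
proof -
  have "sqi (indicator (cball 0 R) :: pt \<Rightarrow> real)"
    by (rule bounded_supp_sqi[of _ 1 R]) (auto simp: indicator_def intro!: borel_measurable_indicator)
  then have "integrable lebesgue (\<lambda>x. f x * indicator (cball 0 R) x)"
    by (rule sqi_mult_integrable[OF assms(1)])
  moreover have "f x * indicator (cball 0 R) x = f x" for x
    using assms(2)[of x] by (cases "norm x \<le> R") auto
  ultimately show ?thesis by simp
qed

lemma pd_supp: "smooth f \<Longrightarrow> (\<And>x. norm x > R \<Longrightarrow> f x = 0) \<Longrightarrow> norm x > R \<Longrightarrow> pd f j x = 0"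
  by (rule pd_eq_0_outside[of f "- cball 0 R"]) auto

section \<open>Invariance of integrals under reflection\<close>

lemma lborel_reflect: "distr lborel borel (\<lambda>y. c - y) = (lborel :: pt measure)"
  using lborel_affine[of "-1" c] by (simp add: density_1 one_ennreal_def[symmetric])

lemma integral_reflect:
  assumes "(f :: pt \<Rightarrow> real) \<in> borel_measurable borel"
  shows "(\<integral>y. f (c - y) \<partial>lebesgue) = (\<integral>y. f y \<partial>lebesgue)"
proof -
  have "(\<integral>y. f y \<partial>lborel) = (\<integral>y. f y \<partial>distr lborel borel (\<lambda>y. c - y))" by (simp add: lborel_reflect)
  also have "\<dots> = (\<integral>y. f (c - y) \<partial>lborel)" using assms by (subst integral_distr) auto
  finally show ?thesis using assms by (simp add: integral_completion)
qed

lemma nn_integral_reflect: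
  assumes "f \<in> borel_measurable borel"
  shows "(\<integral>\<^sup>+y. f (c - y) \<partial>lborel) = (\<integral>\<^sup>+y. f y \<partial>(lborel :: pt measure))"
proof -
  have "(\<integral>\<^sup>+y. f y \<partial>lborel) = (\<integral>\<^sup>+y. f y \<partial>distr lborel borel (\<lambda>y. c - y))" by (simp add: lborel_reflect)
  also have "\<dots> = (\<integral>\<^sup>+y. f (c - y) \<partial>lborel)" using assms by (subst nn_integral_distr) auto
  finally show ?thesis by simp
qed

subsection \<open>Mollification\<close>

lemma compact_supp_uniform:
  fixes g :: "pt \<Rightarrow> real"
  assumes g: "continuous_on UNIV g" "\<And>x. norm x > R \<Longrightarrow> g x = 0" and e: "e > 0"
  obtains d where "d > 0" "\<And>x h. norm h < d \<Longrightarrow> \<bar>g (x + h) - g x\<bar> < e"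
proof -
  \<comment> \<open>The margin 1 matches the bound \<open>min d 1\<close> on the shift: either both
    points lie in this ball, or both lie outside the support.\<close>
  have "uniformly_continuous_on (cball 0 (R+1)) g"
    by (rule compact_uniformly_continuous[OF continuous_on_subset[OF g(1)]]) auto
  then obtain d where d: "d > 0"
    "\<And>x x'. x \<in> cball 0 (R+1) \<Longrightarrow> x' \<in> cball 0 (R+1) \<Longrightarrow> dist x' x < d \<Longrightarrow> dist (g x') (g x) < e"
    using e unfolding uniformly_continuous_on_def by metis
  show ?thesis
  proof (rule that[of "min d 1"])
    fix x h :: pt assume h: "norm h < min d 1"
    have t: "norm x \<le> norm (x + h) + norm h" using norm_triangle_ineq4[of "x+h" h] by simp
    have t': "norm (x + h) \<le> norm x + norm h" by (rule norm_triangle_ineq)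
    show "\<bar>g (x + h) - g x\<bar> < e"
    proof (cases "norm x \<le> R + 1 \<and> norm (x + h) \<le> R + 1")
      case True
      then have "x \<in> cball 0 (R+1)" "x + h \<in> cball 0 (R+1)" by (simp_all only: mem_cball_0)
      from d(2)[OF this] h show ?thesis by (simp add: dist_norm)
    next
      case False
      then have "norm x > R" "norm (x+h) > R" using t t' h by auto
      with g(2) e show ?thesis by simp
    qed
  qed (use d in auto)
qed

lemma axis_bound: "\<bar>h $ 1 * a + h $ 2 * b\<bar> \<le> norm (h::pt) * (\<bar>a\<bar> + \<bar>b\<bar>)"
proof -
  have "\<bar>h $ 1 * a + h $ 2 * b\<bar> \<le> \<bar>h $ 1\<bar> * \<bar>a\<bar> + \<bar>h $ 2\<bar> * \<bar>b\<bar>"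
    using abs_triangle_ineq[of "h $ 1 * a" "h $ 2 * b"] by (simp add: abs_mult)
  also have "\<dots> \<le> norm h * \<bar>a\<bar> + norm h * \<bar>b\<bar>"
    by (intro add_mono mult_right_mono component_le_norm_cart) auto
  finally show ?thesis by (simp add: distrib_left)
qed

text \<open>The mean value theorem along the segment reduces the remainder to the oscillation of the
  first derivatives, which are uniformly continuous by compact support. Uniformity in z is what
  allows differentiation under an integral sign.\<close>

lemma uniform_differentiable:
  assumes k: "smooth k" "\<And>x. norm x > R \<Longrightarrow> k x = 0" and e: "e > 0"
  obtains d where "d > 0"
    "\<And>z h. norm h < d \<Longrightarrow> \<bar>k (z + h) - k z - (h $ 1 * pd k 1 z + h $ 2 * pd k 2 z)\<bar> \<le> e * norm h"
proof -
  have u: "\<exists>d>0. \<forall>x h. norm h < d \<longrightarrow> \<bar>pd k j (x + h) - pd k j x\<bar> < e/2" for j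
    using compact_supp_uniform[OF smooth_continuous[OF smooth_pd[OF k(1)]] pd_supp[where R=R, OF k], where e="e/2"] e
    by (metis half_gt_zero)
  obtain d1 where d1: "d1 > 0" "\<And>x h. norm h < d1 \<Longrightarrow> \<bar>pd k 1 (x + h) - pd k 1 x\<bar> < e/2" using u by blast
  obtain d2 where d2: "d2 > 0" "\<And>x h. norm h < d2 \<Longrightarrow> \<bar>pd k 2 (x + h) - pd k 2 x\<bar> < e/2" using u by blast
  show ?thesis
  proof (rule that[of "min d1 d2"])
    fix z h :: pt assume h: "norm h < min d1 d2"
    define f where "f t = k (z + t *\<^sub>R h)" for t
    have "(f has_real_derivative (h $ 1 * pd k 1 (z + t *\<^sub>R h) + h $ 2 * pd k 2 (z + t *\<^sub>R h))) (at t)" for t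
    proof -
      have "((\<lambda>t. z + t *\<^sub>R h) has_derivative (\<lambda>s. s *\<^sub>R h)) (at t)"
        by (auto intro!: derivative_eq_intros)
      from has_derivative_compose[OF this smooth_has_derivative[OF k(1)]]
      show ?thesis unfolding f_def has_field_derivative_def
        by (rule has_derivative_eq_rhs) (auto simp: algebra_simps)
    qed
    from MVT2[of 0 1 f, OF _ this] obtain s where s: "0 < s" "s < 1"
      "f 1 - f 0 = h $ 1 * pd k 1 (z + s *\<^sub>R h) + h $ 2 * pd k 2 (z + s *\<^sub>R h)" by auto
    have "norm (s *\<^sub>R h) \<le> norm h" using s by (simp add: mult_left_le_one_le)
    then have n: "norm (s *\<^sub>R h) < d1" "norm (s *\<^sub>R h) < d2" using h by auto
    have "k (z + h) - k z - (h $ 1 * pd k 1 z + h $ 2 * pd k 2 z)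
       = h $ 1 * (pd k 1 (z + s *\<^sub>R h) - pd k 1 z) + h $ 2 * (pd k 2 (z + s *\<^sub>R h) - pd k 2 z)"
      using s(3) by (simp add: f_def algebra_simps)
    also have "\<bar>\<dots>\<bar> \<le> norm h * (e/2 + e/2)"
      by (rule order_trans[OF axis_bound])
        (intro mult_left_mono add_mono less_imp_le[OF d1(2)] less_imp_le[OF d2(2)] n norm_ge_zero)
    finally show "\<bar>k (z + h) - k z - (h $ 1 * pd k 1 z + h $ 2 * pd k 2 z)\<bar> \<le> e * norm h"
      by (simp add: mult.commute)
  qed (use d1 d2 in auto)
qed

definition conv :: "(pt \<Rightarrow> real) \<Rightarrow> (pt \<Rightarrow> real) \<Rightarrow> pt \<Rightarrow> real" where
  "conv k f x = (\<integral>y. f y * k (x - y) \<partial>lebesgue)"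

lemma conv_integrable:
  fixes f k :: "pt \<Rightarrow> real"
  assumes f: "integrable lebesgue f" and k: "continuous_on UNIV k" "\<And>x. norm x > R \<Longrightarrow> k x = 0"
  shows "integrable lebesgue (\<lambda>y. f y * k (x - y))"
proof -
  obtain C where C: "C \<ge> 0" "\<And>x. \<bar>k x\<bar> \<le> C"
    by (rule continuous_supp_bounded[where R=R, OF k]) blast+
  show ?thesis
  proof (rule Bochner_Integration.integrable_bound)
    show "integrable lebesgue (\<lambda>y. C * f y)" using f by simp
    have "continuous_on UNIV (\<lambda>y. k (x - y))"
      by (rule continuous_on_compose2[OF k(1)]) (auto intro: continuous_intros)
    then show "(\<lambda>y. f y * k (x - y)) \<in> borel_measurable lebesgue"
      by (intro borel_measurable_times borel_measurable_integrable[OF f] continuous_meas)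
    show "AE y in lebesgue. norm (f y * k (x - y)) \<le> norm (C * f y)"
    proof (rule always_eventually, rule allI)
      fix y have "\<bar>f y\<bar> * \<bar>k (x - y)\<bar> \<le> \<bar>f y\<bar> * C" by (intro mult_left_mono C) auto
      then show "norm (f y * k (x - y)) \<le> norm (C * f y)" using C(1) by (simp add: abs_mult mult.commute)
    qed
  qed
qed

lemma conv_has_derivative:
  assumes f: "integrable lebesgue f" and k: "smooth k" "\<And>x. norm x > R \<Longrightarrow> k x = 0"
  shows "(conv k f has_derivative (\<lambda>v. v $ 1 * conv (pd k 1) f x + v $ 2 * conv (pd k 2) f x)) (at x)"
  unfolding has_derivative_at_alt
proof (intro conjI allI impI)
  show "bounded_linear (\<lambda>v. v $ 1 * conv (pd k 1) f x + v $ 2 * conv (pd k 2) f x)"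
    by (intro bounded_linear_intros bounded_linear_vec_nth)
next
  fix e :: real assume e: "e > 0"
  \<comment> \<open>The mass of f multiplies the uniform remainder of k; dividing e by N + 1 instead
    of N also covers f = 0 almost everywhere.\<close>
  define N where "N = (\<integral>y. \<bar>f y\<bar> \<partial>lebesgue)"
  have N: "N \<ge> 0" by (simp add: N_def)
  have e': "e / (N + 1) > 0" using e N by simp
  obtain d where d: "d > 0" "\<And>z h. norm h < d \<Longrightarrow>
      \<bar>k (z + h) - k z - (h $ 1 * pd k 1 z + h $ 2 * pd k 2 z)\<bar> \<le> e / (N + 1) * norm h"
    by (rule uniform_differentiable[where R=R, OF k e']) blast+
  have ik: "integrable lebesgue (\<lambda>y. f y * k (x - y))" for x
    by (rule conv_integrable[OF f smooth_continuous[OF k(1)] k(2)])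
  have ip: "integrable lebesgue (\<lambda>y. f y * pd k j (x - y))" for j
    by (rule conv_integrable[OF f smooth_continuous[OF smooth_pd[OF k(1)]] pd_supp[where R=R, OF k]])
  show "\<exists>d>0. \<forall>y. norm (y - x) < d \<longrightarrow>
     norm (conv k f y - conv k f x - ((y - x) $ 1 * conv (pd k 1) f x + (y - x) $ 2 * conv (pd k 2) f x))
       \<le> e * norm (y - x)"
  proof (intro exI[of _ d] conjI allI impI d(1))
    fix y assume y: "norm (y - x) < d"
    let ?h = "y - x"
    let ?R = "\<lambda>t. k (y - t) - k (x - t) - (?h $ 1 * pd k 1 (x - t) + ?h $ 2 * pd k 2 (x - t))"
    have eq: "conv k f y - conv k f x - (?h $ 1 * conv (pd k 1) f x + ?h $ 2 * conv (pd k 2) f x)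
       = (\<integral>t. f t * ?R t \<partial>lebesgue)"
    proof -
      have "(\<integral>t. f t * ?R t \<partial>lebesgue) = (\<integral>t. f t * k (y - t) - f t * k (x - t)
         - (?h $ 1 * (f t * pd k 1 (x - t)) + ?h $ 2 * (f t * pd k 2 (x - t))) \<partial>lebesgue)"
        by (rule Bochner_Integration.integral_cong) (auto simp: algebra_simps)
      then show ?thesis by (simp add: conv_def ik ip)
    qed
    have i: "integrable lebesgue (\<lambda>t. f t * ?R t)"
    proof -
      have "integrable lebesgue (\<lambda>t. f t * k (y - t) - f t * k (x - t)
         - (?h $ 1 * (f t * pd k 1 (x - t)) + ?h $ 2 * (f t * pd k 2 (x - t))))"
        by (intro Bochner_Integration.integrable_diff Bochner_Integration.integrable_add integrable_mult_right ik ip)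
      then show ?thesis by (simp add: algebra_simps)
    qed
    have "\<bar>\<integral>t. f t * ?R t \<partial>lebesgue\<bar> \<le> (\<integral>t. \<bar>f t * ?R t\<bar> \<partial>lebesgue)" by (rule integral_abs_bound)
    also have "\<dots> \<le> (\<integral>t. (e / (N + 1) * norm ?h) * \<bar>f t\<bar> \<partial>lebesgue)"
    proof (rule integral_mono)
      fix t
      have "\<bar>?R t\<bar> \<le> e / (N + 1) * norm ?h" using d(2)[OF y, of "x - t"] by simp
      then show "\<bar>f t * ?R t\<bar> \<le> (e / (N + 1) * norm ?h) * \<bar>f t\<bar>"
        unfolding abs_mult by (subst mult.commute) (rule mult_right_mono, auto)
    qed (use i f in auto)
    also have "\<dots> = (e * norm ?h) * (N / (N + 1))" by (simp add: N_def)
    also have "\<dots> \<le> (e * norm ?h) * 1" using e N by (intro mult_left_mono) auto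
    finally show "norm (conv k f y - conv k f x - (?h $ 1 * conv (pd k 1) f x + ?h $ 2 * conv (pd k 2) f x))
       \<le> e * norm ?h" by (simp only: eq real_norm_def mult_1_right)
  qed
qed

lemma smooth_conv:
  assumes f: "integrable lebesgue f" and k: "smooth k" "\<And>x. norm x > R \<Longrightarrow> k x = 0"
  shows "smooth (conv k f)"
  unfolding smooth_def
proof
  fix m
  have "Ck m UNIV (conv k f)" if "smooth k" "\<And>x. norm x > R \<Longrightarrow> k x = 0" for k
    using that
  proof (induction m arbitrary: k)
    case 0
    show ?case using has_derivative_continuous[OF conv_has_derivative[where R=R, OF f 0]]
      by (auto simp: continuous_on_eq_continuous_within)
  next
    case (Suc m)
    have p: "Ck m UNIV (conv (pd k j) f)" for j
      by (rule Suc.IH[OF smooth_pd[OF Suc.prems(1)] pd_supp[where R=R, OF Suc.prems]])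
    show ?case
    proof (rule Ck_Suc_of_has_derivative)
      show "(conv k f has_derivative (\<lambda>v. v $ 1 * conv (pd k 1) f x + v $ 2 * conv (pd k 2) f x)) (at x)" for x
        by (rule conv_has_derivative[OF f Suc.prems])
    qed (intro Ck_add Ck_mult[OF Ck_const] p)
  qed
  from this[OF k] show "Ck m UNIV (conv k f)" .
qed

lemma pd_conv:
  assumes "integrable lebesgue f" "smooth k" "\<And>x. norm x > R \<Longrightarrow> k x = 0"
  shows "pd (conv k f) j x = conv (pd k j) f x"
  using pd_of_has_derivative[OF conv_has_derivative[where R=R, OF assms], of j] exhaust_2[of j]
  by (auto simp: axis_def)

text \<open>Convolving k with the indicator of a ball of radius R + 1 gives a function that is
  constant near the origin, equal there to the integral of k. Its derivative at 0 is the integral of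
  \<open>pd k j\<close>, which is therefore 0.\<close>

lemma integral_pd_eq_0:
  assumes k: "smooth k" "\<And>x. norm x > R \<Longrightarrow> k x = 0"
  shows "(\<integral>x. pd k j x \<partial>lebesgue) = 0"
proof -
  let ?f = "indicator (cball (0::pt) (R + 1)) :: pt \<Rightarrow> real"
  have f: "integrable lebesgue ?f"
    by (rule bounded_supp_integrable[of _ 1 "R+1"]) (auto simp: indicator_def intro!: borel_measurable_indicator)
  have eq: "conv g ?f x = (\<integral>y. g y \<partial>lebesgue)"
    if "continuous_on UNIV g" "\<And>x. norm x > R \<Longrightarrow> g x = 0" "norm x < 1" for g x
  proof -
    have "?f y * g (x - y) = g (x - y)" for y
      using that(2)[of "x - y"] that(3) norm_triangle_ineq2[of y x]
      by (cases "norm y \<le> R + 1") (auto simp: norm_minus_commute)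
    then have "conv g ?f x = (\<integral>y. g (x - y) \<partial>lebesgue)" unfolding conv_def by (simp only:)
    also have "\<dots> = (\<integral>y. g y \<partial>lebesgue)"
      by (rule integral_reflect) (rule borel_measurable_continuous_onI[OF that(1)])
    finally show ?thesis .
  qed
  have "(conv k ?f has_derivative (\<lambda>v. 0)) (at 0)"
    by (rule has_derivative_transform_within_open[OF has_derivative_const, of "ball 0 1"])
      (use eq[OF smooth_continuous[OF k(1)] k(2)] in auto)
  then have "pd (conv k ?f) j 0 = 0" by (rule pd_of_has_derivative)
  then show ?thesis
    using eq[OF smooth_continuous[OF smooth_pd[OF k(1)]] pd_supp[where R=R, OF k], of 0 j]
    by (simp add: pd_conv[OF f k])
qed

text \<open>The standard bump exp(-1/(1 - |x|^2)). The squared norm is spelled out as a polynomial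
  so that smoothness follows from the closure rules.\<close>

definition eta0 :: "pt \<Rightarrow> real" where
  "eta0 x = expinv 0 (1 - x $ 1 * x $ 1 - x $ 2 * x $ 2)"

text \<open>Supported in the ball of radius 1/(n+1). Dividing by the integral of the rescaled bump
  gives mass 1 without computing the Jacobian of the rescaling.\<close>

definition eta :: "nat \<Rightarrow> pt \<Rightarrow> real" where
  "eta n x = eta0 (real (Suc n) *\<^sub>R x) / (\<integral>x. eta0 (real (Suc n) *\<^sub>R x) \<partial>lebesgue)"

abbreviation moll :: "nat \<Rightarrow> (pt \<Rightarrow> real) \<Rightarrow> pt \<Rightarrow> real" where "moll n \<equiv> conv (eta n)"

lemma norm_pt_sq: "(norm (x::pt))^2 = x $ 1 * x $ 1 + x $ 2 * x $ 2"
  by (simp add: norm_vec_def L2_set_def sum_2 power2_eq_square)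

lemma eta0_eq: "eta0 x = expinv 0 (1 - (norm x)^2)" by (simp add: eta0_def norm_pt_sq algebra_simps)

lemma eta0_smooth: "smooth eta0"
  unfolding eta0_def
  by (rule smooth_comp[OF smooth1_expinv]) (intro smooth_diff smooth_mult smooth_const smooth_component)

lemma eta0_scaled:
  "smooth (\<lambda>x. eta0 (real (Suc n) *\<^sub>R x))"
  "0 \<le> eta0 x"
  "norm x \<ge> 1 / real (Suc n) \<Longrightarrow> eta0 (real (Suc n) *\<^sub>R x) = 0"
  "norm x > 1 \<Longrightarrow> eta0 (real (Suc n) *\<^sub>R x) = 0"
proof -
  show "smooth (\<lambda>x. eta0 (real (Suc n) *\<^sub>R x))" using smooth_affine[OF eta0_smooth, of "real (Suc n)" 0] by simp
  show "0 \<le> eta0 x" by (simp add: eta0_def expinv_nonneg)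
  show *: "eta0 (real (Suc n) *\<^sub>R x) = 0" if "norm x \<ge> 1 / real (Suc n)" for x
  proof -
    have "norm (real (Suc n) *\<^sub>R x) \<ge> 1" using that by (simp add: field_simps del: of_nat_Suc)
    then have "(norm (real (Suc n) *\<^sub>R x))^2 \<ge> 1" by (rule one_le_power)
    then show ?thesis unfolding eta0_eq by (intro expinv_eq_0) linarith
  qed
  show "norm x > 1 \<Longrightarrow> eta0 (real (Suc n) *\<^sub>R x) = 0"
    by (rule *, rule order_trans[of _ 1]) simp_all
qed

lemma eta0_integral_pos: "0 < (\<integral>x. eta0 (real (Suc n) *\<^sub>R x) \<partial>lebesgue)"
proof -
  let ?f = "\<lambda>x. eta0 (real (Suc n) *\<^sub>R x)"
  have c: "continuous_on UNIV ?f" by (rule smooth_continuous[OF eta0_scaled(1)])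
  have i: "integrable lebesgue ?f" by (rule continuous_supp_sqi(2)[OF c eta0_scaled(4)])
  have "(\<integral>x. ?f x \<partial>lebesgue) \<noteq> 0"
  proof
    assume "(\<integral>x. ?f x \<partial>lebesgue) = 0"
    then have "AE x in lebesgue. ?f x = 0"
      using integral_nonneg_eq_0_iff_AE[OF i] eta0_scaled(2) by simp
    then have "AE x in lebesgue. x \<notin> ball (0::pt) (1 / real (Suc n))"
    proof (eventually_elim)
      fix x :: pt assume z: "?f x = 0"
      show "x \<notin> ball 0 (1 / real (Suc n))"
      proof
        assume "x \<in> ball 0 (1 / real (Suc n))"
        then have "norm (real (Suc n) *\<^sub>R x) < 1" by (simp add: field_simps del: of_nat_Suc)
        then have "(norm (real (Suc n) *\<^sub>R x))^2 < 1" by (simp add: power_less_one_iff del: norm_scaleR)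
        then have "?f x > 0" unfolding eta0_eq by (intro expinv_pos) linarith
        with z show False by simp
      qed
    qed
    then have "ball (0::pt) (1 / real (Suc n)) \<in> null_sets lebesgue"
      by (subst AE_iff_null_sets) auto
    then show False
      using open_not_negligible[of "ball (0::pt) (1 / real (Suc n))"] by (simp add: negligible_iff_null_sets)
  qed
  moreover have "(\<integral>x. ?f x \<partial>lebesgue) \<ge> 0" by (simp add: eta0_scaled(2))
  ultimately show ?thesis by simp
qed

lemma eta_smooth: "smooth (eta n)"
  unfolding eta_def divide_inverse by (intro smooth_mult smooth_const eta0_scaled)
lemma eta_nonneg: "0 \<le> eta n x"
  unfolding eta_def using eta0_integral_pos[of n] by (simp add: eta0_scaled(2))
lemma eta_supp: "norm x \<ge> 1 / real (Suc n) \<Longrightarrow> eta n x = 0"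
  unfolding eta_def by (subst eta0_scaled(3)) auto
lemma eta_supp1: "norm x > 1 \<Longrightarrow> eta n x = 0"
  unfolding eta_def by (subst eta0_scaled(4)) auto
lemma eta_integral: "(\<integral>x. eta n x \<partial>lebesgue) = 1"
  unfolding eta_def using eta0_integral_pos[of n] by simp
lemma eta_sym: "eta n (- x) = eta n x"
  by (simp add: eta_def eta0_eq)
lemma eta_cont: "continuous_on UNIV (eta n)" by (rule smooth_continuous[OF eta_smooth])
lemma eta_integrable: "integrable lebesgue (eta n)"
  by (rule continuous_supp_sqi(2)[OF eta_cont eta_supp1])
lemma eta_meas_borel [measurable]: "eta n \<in> borel_measurable borel"
  by (rule borel_measurable_continuous_onI[OF eta_cont])

lemmas smooth_moll = smooth_conv[OF _ eta_smooth eta_supp1]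
lemmas moll_integrable = conv_integrable[OF _ eta_cont eta_supp1]

lemma sqi_cball: "sqi (indicator (cball 0 R))"
  by (rule bounded_supp_sqi[of _ 1 R]) (auto simp: indicator_def intro!: borel_measurable_indicator)

text \<open>Tonelli's theorem is applied below to \<open>lborel\<close>, hence to Borel functions;
  replacing f by an almost everywhere equal Borel function changes no convolution with a Borel
  kernel.\<close>

lemma sqi_borel_rep:
  assumes "sqi f"
  obtains f' where "f' \<in> borel_measurable borel" "AE x in lebesgue. f x = f' x" "sqi f'" "\<And>k x. k \<in> borel_measurable borel \<Longrightarrow> conv k f x = conv k f' x"
proof -
  obtain f' where f': "f' \<in> borel_measurable lborel" "AE x in lborel. f x = f' x"
    using completion_ex_borel_measurable_real[OF sqi_meas[OF assms]] by blast
  have ae: "AE x in lebesgue. f x = f' x" using f'(2) by (rule AE_completion)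
  have m: "f' \<in> borel_measurable borel" "f' \<in> borel_measurable lebesgue"
    using f'(1) by (auto intro: measurable_completion)
  have "integrable lebesgue (\<lambda>x. (f' x)^2)"
    using sqi_int[OF assms] ae assms m
    by (subst integrable_cong_AE[where g="\<lambda>x. (f x)^2"]) (auto simp: sqi_def borel_measurable_power)
  then have s: "sqi f'" using m by (simp add: sqi_def)
  have "conv k f x = conv k f' x" if "k \<in> borel_measurable borel" for k x
  proof -
    have "(\<lambda>y. k (x - y)) \<in> borel_measurable borel" using that by measurable
    then have "(\<lambda>y. k (x - y)) \<in> borel_measurable lebesgue" by (simp add: measurable_completion)
    then show ?thesis unfolding conv_def using ae assms m
      by (intro integral_cong_AE borel_measurable_times) (auto simp: sqi_def)
  qed
  with that[OF m(1) ae s] show ?thesis by blast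
qed

lemma nn_integral_eta: "(\<integral>\<^sup>+x. ennreal (eta n (x - y)) \<partial>lborel) = 1"
proof -
  have "(\<integral>\<^sup>+x. ennreal (eta n (x - y)) \<partial>lborel) = (\<integral>\<^sup>+x. ennreal (eta n (y - x)) \<partial>lborel)"
    by (rule nn_integral_cong) (metis eta_sym minus_diff_eq)
  also have "\<dots> = (\<integral>\<^sup>+x. ennreal (eta n x) \<partial>lborel)"
    by (rule nn_integral_reflect[of "\<lambda>x. ennreal (eta n x)"]) simp
  also have "\<dots> = (\<integral>\<^sup>+x. ennreal (eta n x) \<partial>lebesgue)" by (simp add: nn_integral_completion)
  also have "\<dots> = 1"
    using nn_integral_eq_integral[OF eta_integrable] eta_integral by (simp add: eta_nonneg)
  finally show ?thesis .
qed

lemma eta_reflect_integral: "(\<integral>y. eta n (x - y) \<partial>lebesgue) = 1"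
  using integral_reflect[OF eta_meas_borel] eta_integral by simp

lemma eta_reflect_integrable: "integrable lebesgue (\<lambda>y. eta n (x - y))"
proof (rule continuous_supp_sqi(2))
  show "continuous_on UNIV (\<lambda>y. eta n (x - y))"
    by (rule continuous_on_compose2[OF eta_cont]) (auto intro: continuous_intros)
  show "eta n (x - y) = 0" if "norm y > norm x + 1" for y
    using that norm_triangle_ineq2[of y x] by (intro eta_supp1) (simp add: norm_minus_commute)
qed

text \<open>Expand the nonnegative integral of (f - c)^2 against the probability density
  \<open>eta n (x - y)\<close>, with c the mean \<open>moll n f x\<close>.\<close>

lemma moll_Jensen:
  assumes f: "sqi f" "integrable lebesgue f"
  shows "(moll n f x)^2 \<le> (\<integral>y. (f y)^2 * eta n (x - y) \<partial>lebesgue)"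
proof -
  let ?c = "moll n f x"
  have i: "integrable lebesgue (\<lambda>y. f y * eta n (x - y))" "integrable lebesgue (\<lambda>y. (f y)^2 * eta n (x - y))"
    using moll_integrable[OF f(2)] moll_integrable[OF sqi_int[OF f(1)]] by auto
  have "0 \<le> (\<integral>y. (f y - ?c)^2 * eta n (x - y) \<partial>lebesgue)" by (simp add: eta_nonneg)
  also have "\<dots> = (\<integral>y. (f y)^2 * eta n (x - y) - (2 * ?c) * (f y * eta n (x - y)) + ?c^2 * eta n (x - y) \<partial>lebesgue)"
    by (rule Bochner_Integration.integral_cong) (auto simp: power2_diff algebra_simps)
  also have "\<dots> = (\<integral>y. (f y)^2 * eta n (x - y) \<partial>lebesgue) - (2 * ?c) * ?c + ?c^2"
    using i eta_reflect_integrable[of n x] by (simp add: eta_reflect_integral conv_def)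
  finally show ?thesis by (simp add: power2_eq_square)
qed

text \<open>Mollification is a contraction in mean square: integrate \<open>moll_Jensen\<close> in
  x, exchange the integrals and use that the kernel has mass 1.\<close>

lemma moll_sqi:
  assumes f: "sqi f" "\<And>x. norm x > R \<Longrightarrow> f x = 0"
  shows "sqi (moll n f)" "nrm (moll n f) \<le> nrm f"
proof -
  have fi: "integrable lebesgue f" by (rule sqi_supp_integrable[OF f])
  have c: "continuous_on UNIV (moll n f)" by (rule smooth_continuous[OF smooth_moll[OF fi]])
  show s: "sqi (moll n f)"
  proof (rule continuous_supp_sqi(1)[OF c])
    fix x :: pt assume x: "norm x > R + 1"
    have "f y * eta n (x - y) = 0" for y
      using f(2)[of y] eta_supp1[of "x - y" n] x norm_triangle_ineq2[of x y]
      by (cases "norm y > R") auto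
    then show "moll n f x = 0" by (simp only: conv_def integral_zero)
  qed
  obtain f' where f': "f' \<in> borel_measurable borel" "AE x in lebesgue. f x = f' x" "sqi f'"
    "\<And>x. moll n f x = moll n f' x"
    using sqi_borel_rep[OF f(1)] eta_meas_borel by metis
  note [measurable] = f'(1)
  have f'i: "integrable lebesgue f'"
    using fi f'(2) sqi_meas[OF f'(3)] by (subst integrable_cong_AE[where g=f]) auto
  have "ennreal ((nrm (moll n f))^2) = (\<integral>\<^sup>+x. ennreal ((moll n f x)^2) \<partial>lebesgue)"
    unfolding nrm_power2 by (subst nn_integral_eq_integral) (use sqi_int[OF s] in auto)
  also have "\<dots> = (\<integral>\<^sup>+x. ennreal ((moll n f' x)^2) \<partial>lborel)"
    by (simp add: nn_integral_completion f'(4))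
  also have "\<dots> \<le> (\<integral>\<^sup>+x. (\<integral>\<^sup>+y. ennreal ((f' y)^2) * ennreal (eta n (x - y)) \<partial>lborel) \<partial>lborel)"
  proof (rule nn_integral_mono)
    fix x
    have "ennreal ((moll n f' x)^2) \<le> ennreal (\<integral>y. (f' y)^2 * eta n (x - y) \<partial>lebesgue)"
      by (rule ennreal_leI[OF moll_Jensen[OF f'(3) f'i]])
    also have "\<dots> = (\<integral>\<^sup>+y. ennreal ((f' y)^2 * eta n (x - y)) \<partial>lebesgue)"
      by (rule nn_integral_eq_integral[symmetric])
        (use moll_integrable[OF sqi_int[OF f'(3)]] eta_nonneg in auto)
    also have "\<dots> = (\<integral>\<^sup>+y. ennreal ((f' y)^2) * ennreal (eta n (x - y)) \<partial>lborel)"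
      by (simp add: nn_integral_completion ennreal_mult eta_nonneg)
    finally show "ennreal ((moll n f' x)^2) \<le> (\<integral>\<^sup>+y. ennreal ((f' y)^2) * ennreal (eta n (x - y)) \<partial>lborel)" .
  qed
  also have "\<dots> = (\<integral>\<^sup>+y. (\<integral>\<^sup>+x. ennreal ((f' y)^2) * ennreal (eta n (x - y)) \<partial>lborel) \<partial>lborel)"
    by (rule lborel_pair.Fubini') measurable
  also have "\<dots> = (\<integral>\<^sup>+y. ennreal ((f' y)^2) \<partial>lborel)"
    by (simp add: nn_integral_cmult nn_integral_eta)
  also have "\<dots> = (\<integral>\<^sup>+y. ennreal ((f' y)^2) \<partial>lebesgue)" by (simp add: nn_integral_completion)
  also have "\<dots> = (\<integral>\<^sup>+y. ennreal ((f y)^2) \<partial>lebesgue)"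
    by (rule nn_integral_cong_AE) (use f'(2) in auto)
  also have "\<dots> = ennreal ((nrm f)^2)"
    unfolding nrm_power2 by (subst nn_integral_eq_integral) (use sqi_int[OF f(1)] in auto)
  finally have "(nrm (moll n f))^2 \<le> (nrm f)^2" by simp
  then show "nrm (moll n f) \<le> nrm f" by (rule power2_le_imp_le) simp
qed

lemma nrm_tendsto_0_dominated:
  assumes meas: "\<And>n. fn n \<in> borel_measurable lebesgue" and w: "sqi w"
    and bnd: "\<And>n x. \<bar>fn n x\<bar> \<le> \<bar>w x\<bar>" and lim: "AE x in lebesgue. (\<lambda>n. fn n x) \<longlonglongrightarrow> 0"
  shows "(\<lambda>n. nrm (fn n)) \<longlonglongrightarrow> 0"
proof -
  have "(\<lambda>n. \<integral>x. (fn n x)^2 \<partial>lebesgue) \<longlonglongrightarrow> (\<integral>x. 0 \<partial>(lebesgue :: pt measure))"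
  proof (rule integral_dominated_convergence)
    show "integrable lebesgue (\<lambda>x. (w x)^2)" by (rule sqi_int[OF w])
    show "AE x in lebesgue. (\<lambda>n. (fn n x)^2) \<longlonglongrightarrow> 0"
      using lim by eventually_elim (auto intro: tendsto_eq_intros)
    show "AE x in lebesgue. norm ((fn n x)^2) \<le> (w x)^2" for n
      using bnd[of n] by (auto simp: abs_le_square_iff)
  qed (auto intro: borel_measurable_power meas)
  from tendsto_real_sqrt[OF this] show ?thesis by (simp add: nrm_def)
qed

text \<open>Truncating the values of f costs little. The truncated function is an almost everywhere
  limit of continuous functions, and truncating these at the same level and multiplying by a
  continuous cutoff in space gives a common dominating function.\<close>

lemma sqi_approx_continuous:
  assumes f: "sqi f" "\<And>x. norm x > R \<Longrightarrow> f x = 0" and e: "e > 0"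
  obtains g where "continuous_on UNIV g" "\<And>x. norm x > R + 1 \<Longrightarrow> g x = 0" "nrm (\<lambda>x. f x - g x) < e"
proof -
  define tr where "tr M t = max (- M) (min M t)" for M t :: real
  have tr_cont: "continuous_on UNIV (tr M)" for M unfolding tr_def by (intro continuous_intros)
  have tr_meas: "(\<lambda>x. tr M (h x)) \<in> borel_measurable lebesgue" if "h \<in> borel_measurable lebesgue" for M h
    unfolding tr_def using that by measurable
  have "(\<lambda>n. nrm (\<lambda>x. f x - tr (real n) (f x))) \<longlonglongrightarrow> 0"
  proof (rule nrm_tendsto_0_dominated[OF _ f(1)])
    show "(\<lambda>x. f x - tr (real n) (f x)) \<in> borel_measurable lebesgue" for n
      by (intro borel_measurable_diff tr_meas sqi_meas f)
    show "\<bar>f x - tr (real n) (f x)\<bar> \<le> \<bar>f x\<bar>" for n x unfolding tr_def by linarith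
    show "AE x in lebesgue. (\<lambda>n. f x - tr (real n) (f x)) \<longlonglongrightarrow> 0"
    proof (rule always_eventually, rule allI)
      fix x
      obtain N :: nat where N: "\<bar>f x\<bar> \<le> real N" using real_arch_simple by blast
      have "f x - tr (real n) (f x) = 0" if "n \<ge> N" for n
        using N that unfolding tr_def by (auto simp: abs_le_iff max_def min_def dest: order_trans of_nat_mono)
      then show "(\<lambda>n. f x - tr (real n) (f x)) \<longlonglongrightarrow> 0"
        by (intro tendsto_eventually) (auto simp: eventually_sequentially)
    qed
  qed
  then obtain M' where "nrm (\<lambda>x. f x - tr (real M') (f x)) < e/2"
    using e by (metis (no_types, lifting) LIMSEQ_D abs_of_nonneg diff_zero half_gt_zero le_refl nrm_nonneg real_norm_def)
  then obtain M :: real where M: "M \<ge> 0" "nrm (\<lambda>x. f x - tr M (f x)) < e/2" by (metis of_nat_0_le_iff)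
  \<comment> \<open>This notion of measurability directly provides continuous functions that
    converge to f off a negligible set.\<close>
  have "f measurable_on UNIV"
    using lebesgue_measurable_imp_measurable_on[of f UNIV] sqi_meas[OF f(1)] by simp
  then obtain N g where N: "negligible N" and g: "\<And>n. continuous_on UNIV (g n)"
    "\<And>x. x \<notin> N \<Longrightarrow> (\<lambda>n. g n x) \<longlonglongrightarrow> f x"
    unfolding measurable_on_def by auto
  define c :: "pt \<Rightarrow> real" where "c x = max 0 (min 1 (R + 1 - norm x))" for x
  have c: "continuous_on UNIV c" "\<And>x. 0 \<le> c x" "\<And>x. c x \<le> 1" "\<And>x. norm x \<le> R \<Longrightarrow> c x = 1" "\<And>x. norm x > R + 1 \<Longrightarrow> c x = 0"
    unfolding c_def by (auto intro!: continuous_intros)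
  define h where "h n x = c x * tr M (g n x)" for n x
  have h: "continuous_on UNIV (h n)" for n
    unfolding h_def by (intro continuous_on_mult c continuous_on_compose2[OF tr_cont g(1)]) auto
  have ftr: "tr M (f x) = c x * tr M (f x)" for x
    using f(2)[of x] c(4)[of x] M(1) by (cases "norm x \<le> R") (auto simp: tr_def)
  have lim: "(\<lambda>n. nrm (\<lambda>x. tr M (f x) - h n x)) \<longlonglongrightarrow> 0"
  proof (rule nrm_tendsto_0_dominated)
    show "(\<lambda>x. tr M (f x) - h n x) \<in> borel_measurable lebesgue" for n
      by (intro borel_measurable_diff tr_meas sqi_meas f continuous_meas h)
    show "sqi (\<lambda>x. 2 * M * indicator (cball (0::pt) (R+1)) x)"
      by (rule sqi_cmult[OF sqi_cball])
    show "\<bar>tr M (f x) - h n x\<bar> \<le> \<bar>2 * M * indicator (cball (0::pt) (R+1)) x\<bar>" for n x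
    proof (cases "norm x > R + 1")
      case True
      then have "tr M (f x) = 0" "h n x = 0" using f(2)[of x] c(5)[of x] ftr[of x] by (auto simp: h_def)
      then show ?thesis by simp
    next
      case False
      have t: "\<bar>tr M t\<bar> \<le> M" for t using M(1) unfolding tr_def by auto
      have "\<bar>h n x\<bar> \<le> 1 * M" unfolding h_def abs_mult using c(2,3)[of x] t by (intro mult_mono) auto
      with t[of "f x"] False M(1) show ?thesis by (simp add: not_less)
    qed
    have "AE x in lebesgue. x \<notin> N"
      using N unfolding negligible_iff_null_sets by (rule AE_not_in)
    then show "AE x in lebesgue. (\<lambda>n. tr M (f x) - h n x) \<longlonglongrightarrow> 0"
    proof eventually_elim
      fix x assume "x \<notin> N"
      then have "(\<lambda>n. g n x) \<longlonglongrightarrow> f x" by (rule g(2))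
      then have "(\<lambda>n. tr M (f x) - h n x) \<longlonglongrightarrow> tr M (f x) - c x * tr M (f x)"
        unfolding h_def tr_def by (intro tendsto_intros tendsto_max tendsto_min)
      then show "(\<lambda>n. tr M (f x) - h n x) \<longlonglongrightarrow> 0" using ftr[of x] by simp
    qed
  qed
  then obtain n where n: "nrm (\<lambda>x. tr M (f x) - h n x) < e/2"
    using e by (metis (no_types, lifting) LIMSEQ_D abs_of_nonneg diff_zero half_gt_zero le_refl nrm_nonneg real_norm_def)
  have str: "sqi (\<lambda>x. tr M (f x))"
  proof (rule bounded_supp_sqi[of _ M R])
    show "\<bar>tr M (f x)\<bar> \<le> M" for x using M(1) unfolding tr_def by auto
    show "norm x > R \<Longrightarrow> tr M (f x) = 0" for x using M(1) f(2) unfolding tr_def by auto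
  qed (intro tr_meas sqi_meas f)
  have hs: "norm x > R + 1 \<Longrightarrow> h n x = 0" for x by (simp add: h_def c(5))
  have sh: "sqi (h n)" by (rule continuous_supp_sqi(1)[OF h hs])
  have "nrm (\<lambda>x. f x - h n x) \<le> nrm (\<lambda>x. f x - tr M (f x)) + nrm (\<lambda>x. tr M (f x) - h n x)"
    using nrm_triangle[OF sqi_diff[OF f(1) str] sqi_diff[OF str sh]] by simp
  with M n have "nrm (\<lambda>x. f x - h n x) < e" by simp
  with that[OF h hs] show ?thesis by blast
qed

lemma moll_diff:
  assumes "integrable lebesgue f" "integrable lebesgue g"
  shows "moll n (\<lambda>x. f x - g x) x = moll n f x - moll n g x"
  using moll_integrable[OF assms(1)] moll_integrable[OF assms(2)]
  by (simp add: conv_def left_diff_distrib)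

text \<open>Since mollification is a contraction, it suffices to treat a continuous approximant g of
  compact support, for which uniform continuity gives uniform convergence on a fixed ball.\<close>

theorem moll_tendsto:
  assumes f: "sqi f" "\<And>x. norm x > R \<Longrightarrow> f x = 0"
  shows "(\<lambda>n. nrm (\<lambda>x. moll n f x - f x)) \<longlonglongrightarrow> 0"
proof (rule LIMSEQ_I)
  fix r :: real assume r: "r > 0"
  then have r3: "r/4 > 0" by simp
  obtain g where g: "continuous_on UNIV g" "\<And>x. norm x > R + 1 \<Longrightarrow> g x = 0" "nrm (\<lambda>x. f x - g x) < r/4"
    by (rule sqi_approx_continuous[OF f r3]) blast+
  have sg: "sqi g" "integrable lebesgue g" by (rule continuous_supp_sqi[OF g(1,2)]; assumption)+
  define B where "B = (indicator (cball (0::pt) (R+2)) :: pt \<Rightarrow> real)"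
  have sB: "sqi B" unfolding B_def by (rule sqi_cball)
  \<comment> \<open>A uniform error e on the ball of radius R + 2 has norm at most e times
    \<open>nrm B\<close>, that is, at most r/4.\<close>
  define e where "e = r / (4 * (nrm B + 1))"
  have e: "e > 0" using r by (simp add: e_def add_nonneg_pos)
  obtain d where d: "d > 0" "\<And>x h. norm h < d \<Longrightarrow> \<bar>g (x + h) - g x\<bar> < e"
    using compact_supp_uniform[OF g(1,2) e] by blast
  obtain N where N: "1 / real (Suc N) < d" using d(1) nat_approx_posE by blast
  have main: "\<bar>moll n g x - g x\<bar> \<le> e * B x" if n: "n \<ge> N" for n x
  proof (cases "norm x > R + 2")
    case True
    have "g y * eta n (x - y) = 0" for y
      using g(2)[of y] eta_supp1[of "x - y" n] True norm_triangle_ineq2[of x y]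
      by (cases "norm y > R + 1") auto
    then have "moll n g x = 0" by (simp only: conv_def integral_zero)
    then show ?thesis using True g(2)[of x] by (simp add: B_def)
  next
    case False
    have i: "integrable lebesgue (\<lambda>y. g y * eta n (x - y))" "integrable lebesgue (\<lambda>y. eta n (x - y))"
      using moll_integrable[OF sg(2)] eta_reflect_integrable by auto
    have "moll n g x - g x = (\<integral>y. g y * eta n (x - y) - g x * eta n (x - y) \<partial>lebesgue)"
      using i by (simp add: conv_def eta_reflect_integral)
    also have "\<bar>\<dots>\<bar> \<le> (\<integral>y. \<bar>g y * eta n (x - y) - g x * eta n (x - y)\<bar> \<partial>lebesgue)" by (rule integral_abs_bound)
    also have "\<dots> \<le> (\<integral>y. e * eta n (x - y) \<partial>lebesgue)"
    proof (rule integral_mono)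
      fix y
      show "\<bar>g y * eta n (x - y) - g x * eta n (x - y)\<bar> \<le> e * eta n (x - y)"
      proof (cases "norm (x - y) \<ge> 1 / real (Suc n)")
        case True then show ?thesis by (simp add: eta_supp)
      next
        case False
        have "1 / real (Suc n) \<le> 1 / real (Suc N)" using n by (simp add: field_simps)
        then have "norm (y - x) < d" using False N by (simp add: norm_minus_commute)
        from d(2)[OF this, of x] have "\<bar>g y - g x\<bar> \<le> e" by simp
        then have "\<bar>g y - g x\<bar> * eta n (x - y) \<le> e * eta n (x - y)" by (intro mult_right_mono eta_nonneg)
        then show ?thesis using eta_nonneg[of n "x - y"] by (simp add: abs_mult flip: left_diff_distrib)
      qed
    qed (use i in auto)
    also have "\<dots> = e" by (simp add: eta_reflect_integral)
    finally show ?thesis using False by (simp add: B_def not_less)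
  qed
  have fi: "integrable lebesgue f" by (rule sqi_supp_integrable[OF f])
  have "norm (nrm (\<lambda>x. moll n f x - f x) - 0) < r" if n: "n \<ge> N" for n
  proof -
    have s1: "sqi (moll n f)" by (rule moll_sqi(1)[OF f])
    have s2: "sqi (moll n g)" by (rule moll_sqi(1)[OF sg(1) g(2)])
    have fg: "sqi (\<lambda>x. f x - g x)" "\<And>x. norm x > R + 1 \<Longrightarrow> f x - g x = 0"
      using sqi_diff[OF f(1) sg(1)] f(2) g(2) by auto
    have "moll n (\<lambda>x. f x - g x) = (\<lambda>x. moll n f x - moll n g x)"
      by (rule ext) (rule moll_diff[OF fi sg(2)])
    then have a: "nrm (\<lambda>x. moll n f x - moll n g x) < r/4"
      using moll_sqi(2)[where R="R+1" and n=n, OF fg] g(3) by simp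
    have "nrm (\<lambda>x. moll n g x - g x) \<le> nrm (\<lambda>x. e * B x)"
      by (rule nrm_mono) (use main[OF n] sB s2 sg in \<open>auto intro!: sqi_cmult sqi_meas sqi_diff intro: order_trans[OF _ abs_ge_self]\<close>)
    also have "\<dots> = e * nrm B" using e by (simp add: nrm_cmult)
    also have "\<dots> \<le> r/4"
    proof -
      have "e * nrm B \<le> e * (nrm B + 1)" using e by simp
      also have "\<dots> = r/4"
        unfolding e_def using nrm_nonneg[of B] by (simp add: field_simps add_nonneg_eq_0_iff)
      finally show ?thesis .
    qed
    finally have b: "nrm (\<lambda>x. moll n g x - g x) \<le> r/4" .
    have "nrm (\<lambda>x. moll n f x - f x) \<le> nrm (\<lambda>x. moll n f x - moll n g x) + nrm (\<lambda>x. moll n g x - f x)"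
      using nrm_triangle[OF sqi_diff[OF s1 s2] sqi_diff[OF s2 f(1)]] by simp
    also have "nrm (\<lambda>x. moll n g x - f x) \<le> nrm (\<lambda>x. moll n g x - g x) + nrm (\<lambda>x. g x - f x)"
      using nrm_triangle[OF sqi_diff[OF s2 sg(1)] sqi_diff[OF sg(1) f(1)]] by simp
    finally show ?thesis using a b g(3) r by (simp add: nrm_minus_commute[of g f])
  qed
  then show "\<exists>no. \<forall>n\<ge>no. norm (nrm (\<lambda>x. moll n f x - f x) - 0) < r" by blast
qed

text \<open>Only the weak derivative identity for the single test function
  \<open>eta n (x - y)\<close> is assumed. It is available for x well inside the domain, and for
  every x in the plane when the zero extension is weakly differentiable across the boundary; both
  cases occur below.\<close>

lemma pd_moll_moll:
  assumes f: "integrable lebesgue f" and g: "integrable lebesgue g"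
    and w: "(\<integral>y. f y * pd (\<lambda>y. eta n (x - y)) j y \<partial>lebesgue) = - (\<integral>y. g y * eta n (x - y) \<partial>lebesgue)"
  shows "pd (moll n f) j x = moll n g x"
proof -
  have "pd (\<lambda>y. eta n (x - y)) j y = - pd (eta n) j (x - y)" for y
    using pd_affine[OF eta_smooth[of n], of "-1" x j y] by (simp add: algebra_simps)
  then have "pd (moll n f) j x = - (\<integral>y. f y * pd (\<lambda>y. eta n (x - y)) j y \<partial>lebesgue)"
    by (simp add: pd_conv[OF f eta_smooth eta_supp1] conv_def)
  then show ?thesis using w by (simp add: conv_def)
qed

lemma eta_shift_smooth: "smooth (\<lambda>y. eta n (x - y))"
  using smooth_affine[OF eta_smooth[of n], of "-1" x] by (simp add: algebra_simps)

text \<open>The kernel is a function of a quadratic polynomial, so its second derivatives are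
  explicit and visibly symmetric. Convolution then hands the symmetry on to every mollified
  function.\<close>

lemma eta_pd_sym: "pd (pd (eta n) i) j x = pd (pd (eta n) j) i x"
proof -
  define a where "a = (real (Suc n))^2"
  define c where "c = inverse (\<integral>x. eta0 (real (Suc n) *\<^sub>R x) \<partial>lebesgue)"
  define q where "q x = 1 - a * (x $ 1 * x $ 1) - a * (x $ 2 * x $ 2)" for x :: pt
  have eta: "eta n = (\<lambda>x. c * expinv 0 (q x))"
    by (rule ext) (simp add: eta_def eta0_def c_def q_def a_def divide_inverse power2_eq_square algebra_simps)
  have q: "smooth q" unfolding q_def by (intro smooth_diff smooth_mult smooth_const smooth_component)
  have pq: "pd q i x = - (2 * a) * x $ i" for i x
    unfolding q_def using exhaust_2[of i]
    by (auto simp: pd_diff pd_mult pd_component smooth_diff smooth_mult)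
  have d0: "(expinv 0 has_real_derivative expinv 2 t) (at t)" for t
    using expinv_deriv[of 0 t] by (simp add: numeral_2_eq_2)
  have p1: "pd (eta n) i = (\<lambda>x. c * (expinv 2 (q x) * (- (2 * a) * x $ i)))" for i
  proof
    fix x
    have "pd (\<lambda>x. expinv 0 (q x)) i x = expinv 2 (q x) * pd q i x" by (rule pd_comp[OF q d0])
    then show "pd (eta n) i x = c * (expinv 2 (q x) * (- (2 * a) * x $ i))"
      unfolding eta by (simp add: pd_cmult smooth_comp[OF smooth1_expinv q] pq)
  qed
  define E where "E t = - real 2 * expinv (2 + 1) t + expinv (2 + 2) t" for t
  have E: "(expinv 2 has_real_derivative E t) (at t)" for t unfolding E_def by (rule expinv_deriv)
  have "pd (pd (eta n) i) j x = c * (E (q x) * (- (2 * a) * x $ j) * (- (2 * a) * x $ i)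
      + expinv 2 (q x) * (- (2 * a) * (if i = j then 1 else 0)))" for i j
  proof -
    have "pd (\<lambda>x. expinv 2 (q x)) j x = E (q x) * pd q j x" by (rule pd_comp[OF q E])
    then show ?thesis unfolding p1
      by (simp add: pd_cmult pd_mult smooth_comp[OF smooth1_expinv q] pq pd_component smooth_mult smooth_uminus pd_uminus right_diff_distrib)
  qed
  from this[of i j] this[of j i] show ?thesis by (cases "i = j") (auto simp: algebra_simps)
qed

lemma moll_pd_sym:
  assumes f: "integrable lebesgue f"
  shows "pd (pd (moll n f) i) j x = pd (pd (moll n f) j) i x"
proof -
  have p: "pd (moll n f) i = conv (pd (eta n) i) f" for i
    by (rule ext) (rule pd_conv[OF f eta_smooth eta_supp1])
  have "pd (pd (moll n f) i) j x = conv (pd (pd (eta n) i) j) f x" for i j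
    unfolding p by (rule pd_conv[OF f smooth_pd[OF eta_smooth] pd_supp[OF eta_smooth eta_supp1]])
  moreover have "pd (pd (eta n) i) j = pd (pd (eta n) j) i" by (rule ext) (rule eta_pd_sym)
  ultimately show ?thesis by simp
qed

subsection \<open>Weak derivatives on a bounded open set\<close>

lemma sqi_int3:
  assumes "m \<in> borel_measurable lebesgue" "\<And>x. \<bar>m x\<bar> \<le> C" "sqi f" "sqi g"
  shows "integrable lebesgue (\<lambda>x. m x * f x * g x)"
  using sqi_mult_integrable[OF sqi_bounded_mult[OF assms(3,1,2)] assms(4)] .

lemma nrm_abs_int3:
  assumes "m \<in> borel_measurable lebesgue" "\<And>x. \<bar>m x\<bar> \<le> C" "sqi f" "sqi g"
  shows "\<bar>\<integral>x. m x * f x * g x \<partial>lebesgue\<bar> \<le> C * nrm f * nrm g"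
  using order_trans[OF Cauchy_Schwarz[OF sqi_bounded_mult[OF assms(3,1,2)] assms(4)]
      mult_right_mono[OF nrm_bounded_mult[OF assms(3,1,2)] nrm_nonneg]] .

text \<open>Real first order Sobolev functions, with both the function and its gradient extended by
  zero. Test functions are supported inside the domain, so D is the weak gradient there but in
  general not the weak gradient of the zero extension on the plane.\<close>

definition h1 :: "pt set \<Rightarrow> (pt \<Rightarrow> real) \<Rightarrow> (2 \<Rightarrow> pt \<Rightarrow> real) \<Rightarrow> bool" where
  "h1 \<Omega> f D \<longleftrightarrow> sqi f \<and> (\<forall>j. sqi (D j)) \<and> (\<forall>x. x \<notin> \<Omega> \<longrightarrow> f x = 0 \<and> (\<forall>j. D j x = 0)) \<and>
     (\<forall>\<phi> j. test_fn \<Omega> \<phi> \<longrightarrow> (\<integral>x. pd \<phi> j x * f x \<partial>lebesgue) = - (\<integral>x. \<phi> x * D j x \<partial>lebesgue))"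

lemma h1D:
  assumes "h1 \<Omega> f D"
  shows "sqi f" "sqi (D j)" "x \<notin> \<Omega> \<Longrightarrow> f x = 0" "x \<notin> \<Omega> \<Longrightarrow> D j x = 0"
    "test_fn \<Omega> \<phi> \<Longrightarrow> (\<integral>x. pd \<phi> j x * f x \<partial>lebesgue) = - (\<integral>x. \<phi> x * D j x \<partial>lebesgue)"
  using assms unfolding h1_def by auto

lemma not_in_supp: "x \<notin> closure {x. \<phi> x \<noteq> 0} \<Longrightarrow> \<phi> x = 0"
  using closure_subset[of "{x. \<phi> x \<noteq> 0}"] by auto

lemma test_fn_smooth: "test_fn \<Omega> \<phi> \<Longrightarrow> smooth \<phi>" by (simp add: test_fn_def)

lemma test_fn_mult: assumes "test_fn \<Omega> \<phi>" "smooth g" shows "test_fn \<Omega> (\<lambda>x. \<phi> x * g x)"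
proof -
  have sub: "closure {x. \<phi> x * g x \<noteq> 0} \<subseteq> closure {x. \<phi> x \<noteq> 0}" by (rule closure_mono) auto
  have "compact (closure {x. \<phi> x \<noteq> 0} \<inter> closure {x. \<phi> x * g x \<noteq> 0})"
    using assms(1) by (intro compact_Int_closed) (auto simp: test_fn_def)
  with sub have "compact (closure {x. \<phi> x * g x \<noteq> 0})" by (simp add: Int_absorb1)
  with sub assms show ?thesis by (auto simp: test_fn_def intro: smooth_mult)
qed

lemma test_fnI:
  assumes "smooth \<phi>" "compact K" "K \<subseteq> \<Omega>" "\<And>x. x \<notin> K \<Longrightarrow> \<phi> x = 0"
  shows "test_fn \<Omega> \<phi>"
proof -
  have sub: "closure {x. \<phi> x \<noteq> 0} \<subseteq> K"
    using assms(2,4) by (intro closure_minimal) (auto simp: compact_imp_closed)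
  have "compact (K \<inter> closure {x. \<phi> x \<noteq> 0})" using assms(2) by (intro compact_Int_closed) auto
  with sub have "compact (closure {x. \<phi> x \<noteq> 0})" by (simp add: Int_absorb1)
  with sub assms show ?thesis by (auto simp: test_fn_def)
qed

lemma test_fn_eta:
  assumes "cball x (1 / real (Suc n)) \<subseteq> \<Omega>"
  shows "test_fn \<Omega> (\<lambda>y. eta n (x - y))"
proof (rule test_fnI[OF eta_shift_smooth _ assms])
  show "eta n (x - y) = 0" if "y \<notin> cball x (1 / real (Suc n))" for y
    using that by (intro eta_supp) (simp add: dist_norm)
qed auto

text \<open>The unit margin in R leaves room for mollification: kernels have radius at most 1, so
  mollified functions still vanish outside the ball of radius R.\<close>

locale bdd_open =
  fixes \<Omega> :: "pt set" and R :: real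
  assumes open_dom: "open \<Omega>" and dom_sub: "\<Omega> \<subseteq> ball 0 (R - 1)"
begin

lemma dom_norm: "x \<in> \<Omega> \<Longrightarrow> norm x < R - 1" using dom_sub by auto

lemma h1_supp: "h1 \<Omega> f D \<Longrightarrow> norm x > R - 1 \<Longrightarrow> f x = 0" "h1 \<Omega> f D \<Longrightarrow> norm x > R - 1 \<Longrightarrow> D j x = 0"
  using h1D(3,4)[of \<Omega> f D x] dom_norm[of x] by force+

lemma h1_integrable: assumes "h1 \<Omega> f D" shows "integrable lebesgue f" "integrable lebesgue (D j)"
  using sqi_supp_integrable[OF h1D(1)[OF assms] h1_supp(1)[OF assms]]
    sqi_supp_integrable[OF h1D(2)[OF assms] h1_supp(2)[OF assms]] by auto

lemma test_fn_supp: "test_fn \<Omega> \<phi> \<Longrightarrow> norm x > R - 1 \<Longrightarrow> \<phi> x = 0"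
  using closure_subset[of "{x. \<phi> x \<noteq> 0}"] dom_norm[of x] by (force simp: test_fn_def)

lemma test_fn_bounded:
  assumes "test_fn \<Omega> \<phi>" obtains C where "\<And>x. \<bar>\<phi> x\<bar> \<le> C" "\<And>x j. \<bar>pd \<phi> j x\<bar> \<le> C"
proof -
  have s: "smooth \<phi>" using assms by (rule test_fn_smooth)
  obtain C0 where C0: "\<And>x. \<bar>\<phi> x\<bar> \<le> C0"
    using continuous_supp_bounded[OF smooth_continuous[OF s] test_fn_supp[OF assms]] by blast
  have "\<exists>C. \<forall>x. \<bar>pd \<phi> j x\<bar> \<le> C" for j
    using continuous_supp_bounded[OF smooth_continuous[OF smooth_pd[OF s]] pd_supp[where R="R-1", OF s test_fn_supp[OF assms]]] by metis
  then obtain C1 where C1: "\<And>j x. \<bar>pd \<phi> j x\<bar> \<le> C1 j" by metis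
  have "\<bar>pd \<phi> j x\<bar> \<le> \<bar>C0\<bar> + \<bar>C1 1\<bar> + \<bar>C1 2\<bar>" for j x
    using C1[of j x] exhaust_2[of j] by auto
  moreover have "\<bar>\<phi> x\<bar> \<le> \<bar>C0\<bar> + \<bar>C1 1\<bar> + \<bar>C1 2\<bar>" for x using C0[of x] by linarith
  ultimately show ?thesis using that by blast
qed

lemma test_fn_meas: "test_fn \<Omega> \<phi> \<Longrightarrow> \<phi> \<in> borel_measurable lebesgue" "test_fn \<Omega> \<phi> \<Longrightarrow> pd \<phi> j \<in> borel_measurable lebesgue"
  by (auto intro: smooth_meas smooth_pd test_fn_smooth)

text \<open>Once the kernel radius is below the distance from K to the complement, the kernels
  centred at points of K are test functions.\<close>

lemma moll_deriv:
  assumes f: "h1 \<Omega> f D" and K: "compact K" "K \<subseteq> \<Omega>"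
  obtains N where "\<And>n x j. n \<ge> N \<Longrightarrow> x \<in> K \<Longrightarrow> pd (moll n f) j x = moll n (D j) x"
proof -
  obtain e where e: "e > 0" "(\<Union>x\<in>K. ball x e) \<subseteq> \<Omega>"
    using compact_subset_open_imp_ball_epsilon_subset[OF K(1) open_dom K(2)] by metis
  obtain N where N: "1 / real (Suc N) < e" using e(1) nat_approx_posE by blast
  show ?thesis
  proof (rule that[of N])
    fix n x j assume n: "n \<ge> N" and x: "x \<in> K"
    have "1 / real (Suc n) \<le> 1 / real (Suc N)" using n by (simp add: field_simps)
    then have "cball x (1 / real (Suc n)) \<subseteq> ball x e" using N by auto
    then have "cball x (1 / real (Suc n)) \<subseteq> \<Omega>" using e(2) x by blast
    from h1D(5)[OF f test_fn_eta[OF this], of j]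
    show "pd (moll n f) j x = moll n (D j) x"
      by (intro pd_moll_moll h1_integrable[OF f]) (simp add: mult.commute)
  qed
qed

lemma moll_h1:
  assumes f: "h1 \<Omega> f D"
  shows "smooth (moll n f)" "sqi (moll n f)" "sqi (moll n (D j))"
    "(\<lambda>n. nrm (\<lambda>x. moll n f x - f x)) \<longlonglongrightarrow> 0"
    "(\<lambda>n. nrm (\<lambda>x. moll n (D j) x - D j x)) \<longlonglongrightarrow> 0"
    "nrm (moll n f) \<le> nrm f" "nrm (moll n (D j)) \<le> nrm (D j)"
    "pd (pd (moll n f) i) k x = pd (pd (moll n f) k) i x"
  using smooth_moll[OF h1_integrable(1)[OF f]] moll_sqi[OF h1D(1)[OF f] h1_supp(1)[OF f]]
    moll_sqi[OF h1D(2)[OF f] h1_supp(2)[OF f]] moll_tendsto[OF h1D(1)[OF f] h1_supp(1)[OF f]]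
    moll_tendsto[OF h1D(2)[OF f] h1_supp(2)[OF f]] moll_pd_sym[OF h1_integrable(1)[OF f]]
  by blast+

text \<open>One factor is mollified, so that its product with the test function is again a test function.\<close>
lemma weak_product_rule:
  assumes f: "h1 \<Omega> f Df" and g: "h1 \<Omega> g Dg" and \<phi>: "test_fn \<Omega> \<phi>"
  shows "(\<integral>x. pd \<phi> j x * f x * g x \<partial>lebesgue) + (\<integral>x. \<phi> x * Df j x * g x \<partial>lebesgue)
     + (\<integral>x. \<phi> x * f x * Dg j x \<partial>lebesgue) = 0"
proof -
  let ?K = "closure {x. \<phi> x \<noteq> 0}"
  obtain C where C: "\<And>x. \<bar>\<phi> x\<bar> \<le> C" "\<And>x j. \<bar>pd \<phi> j x\<bar> \<le> C" by (rule test_fn_bounded[OF \<phi>]) blast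
  note m = test_fn_meas[OF \<phi>]
  have K: "compact ?K" "?K \<subseteq> \<Omega>" using \<phi> by (auto simp: test_fn_def)
  obtain N where N: "\<And>n x j. n \<ge> N \<Longrightarrow> x \<in> ?K \<Longrightarrow> pd (moll n g) j x = moll n (Dg j) x"
    by (rule moll_deriv[OF g K]) blast
  note g' = moll_h1[OF g]
  have eq: "(\<integral>x. pd \<phi> j x * f x * moll n g x \<partial>lebesgue) + (\<integral>x. \<phi> x * Df j x * moll n g x \<partial>lebesgue)
     + (\<integral>x. \<phi> x * f x * moll n (Dg j) x \<partial>lebesgue) = 0" if n: "n \<ge> N" for n
  proof -
    have "(\<integral>x. pd (\<lambda>x. \<phi> x * moll n g x) j x * f x \<partial>lebesgue) = - (\<integral>x. (\<phi> x * moll n g x) * Df j x \<partial>lebesgue)"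
      by (rule h1D(5)[OF f test_fn_mult[OF \<phi> g'(1)]])
    moreover have "pd (\<lambda>x. \<phi> x * moll n g x) j x * f x = pd \<phi> j x * f x * moll n g x + \<phi> x * f x * moll n (Dg j) x" for x
    proof (cases "x \<in> ?K")
      case True
      then show ?thesis using N[OF n True] by (simp add: pd_mult[OF test_fn_smooth[OF \<phi>] g'(1)] algebra_simps)
    next
      case False
      then have "\<phi> x = 0" by (rule not_in_supp)
      then show ?thesis by (simp add: pd_mult[OF test_fn_smooth[OF \<phi>] g'(1)])
    qed
    ultimately show ?thesis
      using sqi_int3[OF m(2) C(2) h1D(1)[OF f] g'(2)] sqi_int3[OF m(1) C(1) h1D(1)[OF f] g'(3)]
      by (simp add: mult_ac)
  qed
  have "(\<lambda>n. (\<integral>x. pd \<phi> j x * f x * moll n g x \<partial>lebesgue) + (\<integral>x. \<phi> x * Df j x * moll n g x \<partial>lebesgue)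
     + (\<integral>x. \<phi> x * f x * moll n (Dg j) x \<partial>lebesgue)) \<longlonglongrightarrow>
     (\<integral>x. pd \<phi> j x * f x * g x \<partial>lebesgue) + (\<integral>x. \<phi> x * Df j x * g x \<partial>lebesgue)
     + (\<integral>x. \<phi> x * f x * Dg j x \<partial>lebesgue)"
    by (intro tendsto_add triple_tendsto[OF _ _ _ _ _ _ m(2) C(2)] triple_tendsto[OF _ _ _ _ _ _ m(1) C(1)]
        h1D(1,2)[OF f] h1D(1,2)[OF g] g') (auto simp: nrm_def)
  moreover have "(\<lambda>n. (\<integral>x. pd \<phi> j x * f x * moll n g x \<partial>lebesgue) + (\<integral>x. \<phi> x * Df j x * moll n g x \<partial>lebesgue)
     + (\<integral>x. \<phi> x * f x * moll n (Dg j) x \<partial>lebesgue)) \<longlonglongrightarrow> 0"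
    by (rule tendsto_eventually) (use eq in \<open>auto simp: eventually_sequentially\<close>)
  ultimately show ?thesis by (rule LIMSEQ_unique)
qed

text \<open>The Jacobian is a divergence: with w_j = theta u d_j v, the integral of d_1 w_2 - d_2
  w_1 is 0 and the second derivatives of v cancel. This is done for mollified u and v and passes to
  the limit, since each side only involves products of two square-integrable factors.\<close>

lemma weak_jacobian:
  assumes u: "h1 \<Omega> u Du" and v: "h1 \<Omega> v Dv" and \<theta>: "test_fn \<Omega> \<theta>"
  shows "(\<integral>x. \<theta> x * Du 1 x * Dv 2 x \<partial>lebesgue) - (\<integral>x. \<theta> x * Du 2 x * Dv 1 x \<partial>lebesgue)
     = (\<integral>x. pd \<theta> 2 x * u x * Dv 1 x \<partial>lebesgue) - (\<integral>x. pd \<theta> 1 x * u x * Dv 2 x \<partial>lebesgue)"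
proof -
  let ?K = "closure {x. \<theta> x \<noteq> 0}"
  obtain C where C: "\<And>x. \<bar>\<theta> x\<bar> \<le> C" "\<And>x j. \<bar>pd \<theta> j x\<bar> \<le> C" by (rule test_fn_bounded[OF \<theta>]) blast
  note m = test_fn_meas[OF \<theta>]
  note s\<theta> = test_fn_smooth[OF \<theta>]
  have K: "compact ?K" "?K \<subseteq> \<Omega>" using \<theta> by (auto simp: test_fn_def)
  obtain N1 where N1: "\<And>n x j. n \<ge> N1 \<Longrightarrow> x \<in> ?K \<Longrightarrow> pd (moll n u) j x = moll n (Du j) x"
    by (rule moll_deriv[OF u K]) blast
  obtain N2 where N2: "\<And>n x j. n \<ge> N2 \<Longrightarrow> x \<in> ?K \<Longrightarrow> pd (moll n v) j x = moll n (Dv j) x"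
    by (rule moll_deriv[OF v K]) blast
  note u' = moll_h1[OF u] and v' = moll_h1[OF v]
  let ?J = "\<lambda>n. (\<integral>x. \<theta> x * moll n (Du 1) x * moll n (Dv 2) x \<partial>lebesgue) - (\<integral>x. \<theta> x * moll n (Du 2) x * moll n (Dv 1) x \<partial>lebesgue)
     - ((\<integral>x. pd \<theta> 2 x * moll n u x * moll n (Dv 1) x \<partial>lebesgue) - (\<integral>x. pd \<theta> 1 x * moll n u x * moll n (Dv 2) x \<partial>lebesgue))"
  have eq: "?J n = 0" if n: "n \<ge> N1" "n \<ge> N2" for n
  proof -
    define w where "w j x = \<theta> x * moll n u x * pd (moll n v) j x" for j x
    have sw: "smooth (w j)" for j
      unfolding w_def by (intro smooth_mult s\<theta> u' smooth_pd v')
    have w0: "w j x = 0" if "norm x > R - 1" for j x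
      using test_fn_supp[OF \<theta> that] by (simp add: w_def)
    have pw: "pd (w i) j x = pd \<theta> j x * moll n u x * pd (moll n v) i x + \<theta> x * pd (moll n u) j x * pd (moll n v) i x
       + \<theta> x * moll n u x * pd (pd (moll n v) i) j x" for i j x
      unfolding w_def by (simp add: pd_mult smooth_mult s\<theta> u' v' smooth_pd algebra_simps)
    have iw: "integrable lebesgue (pd (w i) j)" for i j
      by (rule continuous_supp_sqi(2)[OF smooth_continuous[OF smooth_pd[OF sw]] pd_supp[OF sw w0]])
    have i0: "(\<integral>x. pd (w 2) 1 x - pd (w 1) 2 x \<partial>lebesgue) = 0"
      using iw integral_pd_eq_0[OF sw w0] by simp
    have pt: "pd (w 2) 1 x - pd (w 1) 2 x =
        \<theta> x * moll n (Du 1) x * moll n (Dv 2) x - \<theta> x * moll n (Du 2) x * moll n (Dv 1) x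
       - (pd \<theta> 2 x * moll n u x * moll n (Dv 1) x - pd \<theta> 1 x * moll n u x * moll n (Dv 2) x)" for x
    proof (cases "x \<in> ?K")
      case True
      then show ?thesis
        using N1[OF n(1) True] N2[OF n(2) True] v'(8)[of n 2 1 x] by (simp add: pw algebra_simps)
    next
      case False
      then have "\<theta> x = 0" by (rule not_in_supp)
      moreover have "pd \<theta> j x = 0" for j
        by (rule pd_eq_0_outside[OF s\<theta>, of "- ?K"]) (use False in \<open>auto intro: not_in_supp\<close>)
      ultimately show ?thesis by (simp add: pw)
    qed
    show ?thesis
      using i0 unfolding pt
      by (simp add: sqi_int3[OF m(2) C(2)] sqi_int3[OF m(1) C(1)] u' v')
  qed
  have "?J \<longlonglongrightarrow> (\<integral>x. \<theta> x * Du 1 x * Dv 2 x \<partial>lebesgue) - (\<integral>x. \<theta> x * Du 2 x * Dv 1 x \<partial>lebesgue)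
     - ((\<integral>x. pd \<theta> 2 x * u x * Dv 1 x \<partial>lebesgue) - (\<integral>x. pd \<theta> 1 x * u x * Dv 2 x \<partial>lebesgue))"
    by (intro tendsto_diff triple_tendsto[OF _ _ _ _ _ _ m(2) C(2)] triple_tendsto[OF _ _ _ _ _ _ m(1) C(1)]
        h1D(1,2)[OF u] h1D(1,2)[OF v] u' v')
  moreover have "?J \<longlonglongrightarrow> 0"
    by (rule tendsto_eventually) (use eq in \<open>auto simp: eventually_sequentially intro!: exI[of _ "max N1 N2"]\<close>)
  ultimately have "(\<integral>x. \<theta> x * Du 1 x * Dv 2 x \<partial>lebesgue) - (\<integral>x. \<theta> x * Du 2 x * Dv 1 x \<partial>lebesgue)
     - ((\<integral>x. pd \<theta> 2 x * u x * Dv 1 x \<partial>lebesgue) - (\<integral>x. pd \<theta> 1 x * u x * Dv 2 x \<partial>lebesgue)) = 0"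
    by (rule LIMSEQ_unique)
  then show ?thesis by simp
qed

end

subsection \<open>Inequalities of Poincare and of Gagliardo and Nirenberg\<close>

text \<open>Integrate d_1(x_1 v^2) = v^2 + 2 x_1 v d_1 v over the plane and use |x_1| <= R on the
  support.\<close>

lemma Poincare:
  assumes v: "smooth v" "\<And>x. norm x > R \<Longrightarrow> v x = 0" and R: "R \<ge> 0"
  shows "nrm v \<le> 2 * R * nrm (pd v 1)"
proof -
  have sv: "sqi v" by (rule continuous_supp_sqi(1)[OF smooth_continuous[OF v(1)] v(2)])
  have sp: "sqi (pd v 1)"
    by (rule continuous_supp_sqi(1)[OF smooth_continuous[OF smooth_pd[OF v(1)]] pd_supp[OF v]])
  \<comment> \<open>A bounded version of the first coordinate that agrees with it wherever v can be
    nonzero.\<close>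
  define c where "c x = max (- R) (min R (x $ 1))" for x :: pt
  have c: "continuous_on UNIV c" "\<And>x. \<bar>c x\<bar> \<le> R" unfolding c_def using R by (auto intro!: continuous_intros)
  have s: "smooth (\<lambda>x. x $ 1 * (v x * v x))" by (intro smooth_mult smooth_component v)
  have "0 = (\<integral>x. pd (\<lambda>x. x $ 1 * (v x * v x)) 1 x \<partial>lebesgue)"
    by (rule integral_pd_eq_0[where R=R, OF s, symmetric]) (simp add: v(2))
  also have "\<dots> = (\<integral>x. (v x)^2 + 2 * (c x * v x * pd v 1 x) \<partial>lebesgue)"
  proof (rule Bochner_Integration.integral_cong)
    fix x
    have "c x * v x = x $ 1 * v x"
    proof (cases "norm x > R")
      case False
      then have "\<bar>x $ 1\<bar> \<le> R" using component_le_norm_cart[of x 1] by simp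
      then show ?thesis by (simp add: c_def abs_le_iff max_def min_def)
    qed (simp add: v(2))
    then show "pd (\<lambda>x. x $ 1 * (v x * v x)) 1 x = (v x)^2 + 2 * (c x * v x * pd v 1 x)"
      by (auto simp: pd_mult v smooth_mult pd_component power2_eq_square algebra_simps)
  qed simp
  also have "\<dots> = (nrm v)^2 + 2 * (\<integral>x. c x * v x * pd v 1 x \<partial>lebesgue)"
    using sqi_int3[OF continuous_meas[OF c(1)] c(2) sv sp] by (simp add: sqi_int sv nrm_power2)
  finally have "(nrm v)^2 \<le> 2 * \<bar>\<integral>x. c x * v x * pd v 1 x \<partial>lebesgue\<bar>" by linarith
  also have "\<dots> \<le> 2 * (R * nrm v * nrm (pd v 1))"
    by (intro mult_left_mono nrm_abs_int3[OF continuous_meas[OF c(1)] c(2) sv sp]) simp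
  finally have "nrm v * nrm v \<le> nrm v * (2 * R * nrm (pd v 1))" by (simp add: power2_eq_square mult_ac)
  then show ?thesis using nrm_nonneg[of v] R
    by (cases "nrm v = 0") (auto dest: mult_left_le_imp_le)
qed

section \<open>Lebesgue measure of the plane as a product measure\<close>

definition mkpt :: "real \<times> real \<Rightarrow> pt" where "mkpt p = fst p *\<^sub>R axis 1 1 + snd p *\<^sub>R axis 2 1"

lemma mkpt_nth [simp]: "mkpt p $ 1 = fst p" "mkpt p $ 2 = snd p"
  by (auto simp: mkpt_def axis_def)

lemma mkpt_continuous: "continuous_on UNIV mkpt"
  unfolding mkpt_def by (intro continuous_intros)

lemma mkpt_measurable [measurable]: "mkpt \<in> borel_measurable (borel \<Otimes>\<^sub>M borel)"
  unfolding borel_prod by (rule borel_measurable_continuous_onI[OF mkpt_continuous])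

lemma Basis_pt: "(Basis :: pt set) = {axis 1 1, axis 2 1}"
  by (auto simp: Basis_vec_def UNIV_2)

lemma lborel_mkpt: "(lborel :: pt measure) = distr (lborel \<Otimes>\<^sub>M lborel) borel mkpt"
proof (rule lborel_eqI)
  fix l u :: pt assume lu: "\<And>b. b \<in> Basis \<Longrightarrow> l \<bullet> b \<le> u \<bullet> b"
  have le: "l $ 1 \<le> u $ 1" "l $ 2 \<le> u $ 2"
    using lu[of "axis 1 1"] lu[of "axis 2 1"] by (auto simp: Basis_pt inner_axis)
  have "mkpt -` box l u \<inter> space (lborel \<Otimes>\<^sub>M lborel) = box (l $ 1) (u $ 1) \<times> box (l $ 2) (u $ 2)"
    by (auto simp: mem_box Basis_pt inner_axis space_pair_measure)
  moreover have "mkpt \<in> measurable (lborel \<Otimes>\<^sub>M lborel) borel" by measurable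
  ultimately have "emeasure (distr (lborel \<Otimes>\<^sub>M lborel) borel mkpt) (box l u)
     = emeasure (lborel \<Otimes>\<^sub>M lborel) (box (l $ 1) (u $ 1) \<times> box (l $ 2) (u $ 2))"
    by (simp add: emeasure_distr)
  also have "\<dots> = ennreal (u $ 1 - l $ 1) * ennreal (u $ 2 - l $ 2)"
    using le by (subst lborel.emeasure_pair_measure_Times) (auto simp: box_real)
  also have "\<dots> = (\<Prod>b\<in>Basis. (u - l) \<bullet> b)"
    using le by (simp add: Basis_pt inner_axis ennreal_mult axis_eq_axis)
  finally show "emeasure (distr (lborel \<Otimes>\<^sub>M lborel) borel mkpt) (box l u) = (\<Prod>b\<in>Basis. (u - l) \<bullet> b)" .
qed simp

lemma nn_integral_mkpt:
  assumes [measurable]: "g \<in> borel_measurable borel"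
  shows "(\<integral>\<^sup>+x. g x \<partial>lborel) = (\<integral>\<^sup>+s. (\<integral>\<^sup>+t. g (mkpt (s, t)) \<partial>lborel) \<partial>lborel)"
    "(\<integral>\<^sup>+x. g x \<partial>lborel) = (\<integral>\<^sup>+t. (\<integral>\<^sup>+s. g (mkpt (s, t)) \<partial>lborel) \<partial>lborel)"
proof -
  have m: "mkpt \<in> measurable (lborel \<Otimes>\<^sub>M lborel) borel" by measurable
  have "(\<integral>\<^sup>+x. g x \<partial>lborel) = (\<integral>\<^sup>+p. g (mkpt p) \<partial>(lborel \<Otimes>\<^sub>M lborel))"
    by (subst lborel_mkpt, subst nn_integral_distr[OF m]) auto
  moreover have gm: "(\<lambda>p. g (mkpt p)) \<in> borel_measurable (lborel \<Otimes>\<^sub>M lborel)"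
    using measurable_compose[OF m assms] .
  ultimately show "(\<integral>\<^sup>+x. g x \<partial>lborel) = (\<integral>\<^sup>+s. (\<integral>\<^sup>+t. g (mkpt (s, t)) \<partial>lborel) \<partial>lborel)"
    "(\<integral>\<^sup>+x. g x \<partial>lborel) = (\<integral>\<^sup>+t. (\<integral>\<^sup>+s. g (mkpt (s, t)) \<partial>lborel) \<partial>lborel)"
    using lborel.nn_integral_fst[OF gm] lborel_pair.nn_integral_snd[of "\<lambda>p. g (mkpt p)"] gm by auto
qed

lemma FTC_nn_bound:
  fixes F f :: "real \<Rightarrow> real"
  assumes d: "\<And>t. (F has_real_derivative f t) (at t)" and c: "continuous_on UNIV f"
    and z: "a \<le> s" "F a = 0"
  shows "ennreal \<bar>F s\<bar> \<le> (\<integral>\<^sup>+t. ennreal \<bar>f t\<bar> \<partial>lborel)"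
proof -
  have "(\<integral>x. indicator {a..s} x *\<^sub>R f x \<partial>lborel) = F s - F a"
    by (rule integral_FTC_atLeastAtMost[OF z(1)])
      (auto intro: continuous_on_subset[OF c] has_field_derivative_at_within[OF d]
        simp flip: has_real_derivative_iff_has_vector_derivative)
  moreover have "integrable lborel (\<lambda>x. indicator {a..s} x *\<^sub>R f x)"
    unfolding set_integrable_def[symmetric]
    by (rule borel_integrable_atLeastAtMost') (rule continuous_on_subset[OF c], simp)
  ultimately have "ennreal \<bar>F s\<bar> \<le> (\<integral>\<^sup>+x. norm (indicator {a..s} x *\<^sub>R f x) \<partial>lborel)"
    using integral_norm_bound_ennreal[of lborel "\<lambda>x. indicator {a..s} x *\<^sub>R f x"] z(2) by simp
  also have "\<dots> \<le> (\<integral>\<^sup>+t. ennreal \<bar>f t\<bar> \<partial>lborel)"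
    by (rule nn_integral_mono) (auto simp: indicator_def)
  finally show ?thesis .
qed

text \<open>Integrating along horizontal and vertical lines bounds |h(s,t)| by A(t) and by B(s).
  Hence h^2 <= A(t) B(s), whose integral factorises into the two integrals on the right.\<close>

lemma Gagliardo_Nirenberg:
  assumes h: "smooth h" "\<And>x. norm x > R \<Longrightarrow> h x = 0"
  shows "(\<integral>x. (h x)^2 \<partial>lebesgue) \<le> (\<integral>x. \<bar>pd h 1 x\<bar> \<partial>lebesgue) * (\<integral>x. \<bar>pd h 2 x\<bar> \<partial>lebesgue)"
proof -
  have hc: "continuous_on UNIV h" "continuous_on UNIV (pd h j)" for j
    by (intro smooth_continuous smooth_pd h)+
  have [measurable]: "h \<in> borel_measurable borel" "pd h j \<in> borel_measurable borel" for j
    by (intro borel_measurable_continuous_onI hc)+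
  have cs: "continuous_on UNIV (\<lambda>s. mkpt (s, t))" "continuous_on UNIV (\<lambda>s. mkpt (t, s))" for t
    by (auto intro!: continuous_on_compose2[OF mkpt_continuous] continuous_intros)
  have d1: "((\<lambda>s. h (mkpt (s, t))) has_real_derivative pd h 1 (mkpt (s, t))) (at s)" for s t
  proof -
    have "((\<lambda>s. mkpt (s, t)) has_derivative (\<lambda>r. r *\<^sub>R axis 1 1)) (at s)"
      unfolding mkpt_def by (auto intro!: derivative_eq_intros)
    from has_derivative_compose[OF this smooth_has_derivative[OF h(1)]]
    show ?thesis unfolding has_field_derivative_def
      by (rule has_derivative_eq_rhs) (auto simp: axis_def)
  qed
  have d2: "((\<lambda>t. h (mkpt (s, t))) has_real_derivative pd h 2 (mkpt (s, t))) (at t)" for s t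
  proof -
    have "((\<lambda>t. mkpt (s, t)) has_derivative (\<lambda>r. r *\<^sub>R axis 2 1)) (at t)"
      unfolding mkpt_def by (auto intro!: derivative_eq_intros)
    from has_derivative_compose[OF this smooth_has_derivative[OF h(1)]]
    show ?thesis unfolding has_field_derivative_def
      by (rule has_derivative_eq_rhs) (auto simp: axis_def)
  qed
  define A where "A t = (\<integral>\<^sup>+s. ennreal \<bar>pd h 1 (mkpt (s, t))\<bar> \<partial>lborel)" for t
  define B where "B s = (\<integral>\<^sup>+t. ennreal \<bar>pd h 2 (mkpt (s, t))\<bar> \<partial>lborel)" for s
  have [measurable]: "A \<in> borel_measurable lborel"
    unfolding A_def by measurable
  have [measurable]: "B \<in> borel_measurable lborel"
    unfolding B_def by measurable
  have hA: "ennreal \<bar>h (mkpt (s, t))\<bar> \<le> A t" for s t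
    unfolding A_def
  proof (rule FTC_nn_bound[OF d1])
    show "continuous_on UNIV (\<lambda>s. pd h 1 (mkpt (s, t)))" by (rule continuous_on_compose2[OF hc(2) cs(1)]) auto
    \<comment> \<open>The starting point of the line integral must lie left of s and outside the
      support; the minimum achieves both.\<close>
    show "min s (- \<bar>R\<bar> - 1) \<le> s" by simp
    have "norm (mkpt (min s (- \<bar>R\<bar> - 1), t)) > R"
      using component_le_norm_cart[of "mkpt (min s (- \<bar>R\<bar> - 1), t)" 1] by simp
    then show "h (mkpt (min s (- \<bar>R\<bar> - 1), t)) = 0" by (rule h(2))
  qed
  have hB: "ennreal \<bar>h (mkpt (s, t))\<bar> \<le> B s" for s t
    unfolding B_def
  proof (rule FTC_nn_bound[OF d2])
    show "continuous_on UNIV (\<lambda>t. pd h 2 (mkpt (s, t)))" by (rule continuous_on_compose2[OF hc(2) cs(2)]) auto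
    show "min t (- \<bar>R\<bar> - 1) \<le> t" by simp
    have "norm (mkpt (s, min t (- \<bar>R\<bar> - 1))) > R"
      using component_le_norm_cart[of "mkpt (s, min t (- \<bar>R\<bar> - 1))" 2] by simp
    then show "h (mkpt (s, min t (- \<bar>R\<bar> - 1))) = 0" by (rule h(2))
  qed
  have ip: "integrable lebesgue (\<lambda>x. \<bar>pd h j x\<bar>)" for j
    by (intro integrable_abs continuous_supp_sqi(2)[OF hc(2) pd_supp[OF h]])
  have nnp: "(\<integral>\<^sup>+x. ennreal \<bar>pd h j x\<bar> \<partial>lborel) = ennreal (\<integral>x. \<bar>pd h j x\<bar> \<partial>lebesgue)" for j
    using nn_integral_eq_integral[OF ip[of j]] by (simp add: nn_integral_completion)
  have "ennreal (\<integral>x. (h x)^2 \<partial>lebesgue) = (\<integral>\<^sup>+x. ennreal ((h x)^2) \<partial>lebesgue)"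
    by (rule nn_integral_eq_integral[symmetric]) (auto intro: sqi_int[OF continuous_supp_sqi(1)[OF hc(1) h(2)]])
  also have "\<dots> = (\<integral>\<^sup>+x. ennreal ((h x)^2) \<partial>lborel)" by (simp add: nn_integral_completion)
  also have "\<dots> = (\<integral>\<^sup>+s. (\<integral>\<^sup>+t. ennreal ((h (mkpt (s, t)))^2) \<partial>lborel) \<partial>lborel)"
    by (rule nn_integral_mkpt(1)) measurable
  also have "\<dots> \<le> (\<integral>\<^sup>+s. (\<integral>\<^sup>+t. A t * B s \<partial>lborel) \<partial>lborel)"
  proof (intro nn_integral_mono)
    fix s t
    have "ennreal ((h (mkpt (s, t)))^2) = ennreal \<bar>h (mkpt (s, t))\<bar> * ennreal \<bar>h (mkpt (s, t))\<bar>"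
      by (simp add: power2_eq_square flip: ennreal_mult)
    also have "\<dots> \<le> A t * B s" by (intro mult_mono hA hB) auto
    finally show "ennreal ((h (mkpt (s, t)))^2) \<le> A t * B s" .
  qed
  also have "\<dots> = (\<integral>\<^sup>+t. A t \<partial>lborel) * (\<integral>\<^sup>+s. B s \<partial>lborel)"
    by (simp add: nn_integral_multc nn_integral_cmult)
  also have "(\<integral>\<^sup>+t. A t \<partial>lborel) = ennreal (\<integral>x. \<bar>pd h 1 x\<bar> \<partial>lebesgue)"
    unfolding A_def nnp[symmetric] by (rule nn_integral_mkpt(2)[symmetric]) measurable
  also have "(\<integral>\<^sup>+s. B s \<partial>lborel) = ennreal (\<integral>x. \<bar>pd h 2 x\<bar> \<partial>lebesgue)"
    unfolding B_def nnp[symmetric] by (rule nn_integral_mkpt(1)[symmetric]) measurable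
  finally show ?thesis by (simp flip: ennreal_mult)
qed

subsection \<open>Cutoffs along a defining function\<close>

text \<open>Quantitative data of the domain: bounds for the defining function and its derivatives on
  the ball of radius R, a lower bound \<open>c0\<close> for the squared gradient on the collar
  |\<open>\<rho>\<close>| <= \<open>e0\<close>, and a fixed cutoff profile with its derivatives. The
  hypothesis \<open>conn\<close> on the positive side is what forces stream functions to vanish
  outside.\<close>

locale dom = bdd_open +
  fixes \<rho> :: "pt \<Rightarrow> real" and G c0 e0 :: real and T T1 T2 :: "real \<Rightarrow> real" and CT :: real
  assumes R1: "R \<ge> 1"
    and \<rho>_smooth: "smooth \<rho>" and dom_eq: "\<Omega> = {x. \<rho> x < 0}"
    and G_pos: "G > 0" and \<rho>1: "\<And>x i. norm x \<le> R \<Longrightarrow> \<bar>pd \<rho> i x\<bar> \<le> G"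
    and \<rho>2: "\<And>x i j. norm x \<le> R \<Longrightarrow> \<bar>pd (pd \<rho> i) j x\<bar> \<le> G"
    and c0: "c0 > 0" and e0: "e0 > 0"
    and far: "\<And>x. norm x > R - 1 \<Longrightarrow> \<rho> x > 0" and conn: "connected {x. \<rho> x > 0}"
    and nondeg: "\<And>x. norm x \<le> R \<Longrightarrow> \<bar>\<rho> x\<bar> \<le> e0 \<Longrightarrow> c0 \<le> (pd \<rho> 1 x)^2 + (pd \<rho> 2 x)^2"
    and T: "smooth1 T" "smooth1 T1" "smooth1 T2"
      "\<And>t. (T has_real_derivative T1 t) (at t)" "\<And>t. (T1 has_real_derivative T2 t) (at t)"
      "\<And>t. 0 \<le> T t" "\<And>t. T t \<le> 1" "\<And>t. t \<le> -2 \<Longrightarrow> T t = 1" "\<And>t. t \<ge> -1 \<Longrightarrow> T t = 0"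
      "\<And>t. T1 t \<le> 0" "\<And>t. t < -2 \<Longrightarrow> T1 t = 0" "\<And>t. t > -1 \<Longrightarrow> T1 t = 0"
      "\<And>t. t < -2 \<Longrightarrow> T2 t = 0" "\<And>t. t > -1 \<Longrightarrow> T2 t = 0"
      "\<And>t. \<bar>T1 t\<bar> \<le> CT" "\<And>t. \<bar>T2 t\<bar> \<le> CT"
begin

text \<open>Here \<open>mm\<close> and \<open>m2\<close> are the scalar factors in grad
  \<open>th\<close> = \<open>mm\<close> grad \<open>\<rho>\<close> and grad \<open>mm\<close> =
  \<open>m2\<close> grad \<open>\<rho>\<close>. They are of size 1/e and 1/e^2 and live on the strip
  between -2e and -e. As e tends to 0, \<open>- mm e\<close> plays the part of a surface measure on
  the boundary.\<close>

definition th :: "real \<Rightarrow> pt \<Rightarrow> real" where "th e x = T (\<rho> x / e)"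
definition mm :: "real \<Rightarrow> pt \<Rightarrow> real" where "mm e x = T1 (\<rho> x / e) / e"
definition m2 :: "real \<Rightarrow> pt \<Rightarrow> real" where "m2 e x = T2 (\<rho> x / e) / e^2"

lemma smooth_scaled: "smooth (\<lambda>x. \<rho> x / e)"
  unfolding divide_inverse by (intro smooth_mult smooth_const \<rho>_smooth)

lemma th_smooth: "smooth (th e)"
  unfolding th_def by (rule smooth_comp[OF T(1) smooth_scaled])
lemma mm_smooth: "smooth (mm e)"
  unfolding mm_def using smooth_mult[OF smooth_comp[OF T(2) smooth_scaled[of e]] smooth_const[of "inverse e"]]
  by (simp add: divide_inverse)
lemma m2_smooth: "smooth (m2 e)"
  unfolding m2_def using smooth_mult[OF smooth_comp[OF T(3) smooth_scaled[of e]] smooth_const[of "inverse (e^2)"]]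
  by (simp add: divide_inverse)

lemma pd_scaled: "pd (\<lambda>x. \<rho> x / e) j x = pd \<rho> j x / e"
  using pd_cmult[OF \<rho>_smooth, of "inverse e" j x] by (simp add: divide_inverse mult.commute)

lemma pd_th: "pd (th e) j x = mm e x * pd \<rho> j x"
  unfolding th_def mm_def by (subst pd_comp[OF smooth_scaled T(4)]) (simp add: pd_scaled)
lemma pd_mm: "pd (mm e) j x = m2 e x * pd \<rho> j x"
proof -
  have "mm e = (\<lambda>x. inverse e * T1 (\<rho> x / e))" by (rule ext) (simp add: mm_def divide_inverse)
  then have "pd (mm e) j x = inverse e * (T2 (\<rho> x / e) * (pd \<rho> j x / e))"
    unfolding pd_scaled[symmetric] pd_comp[OF smooth_scaled T(5), symmetric]
    by (simp only: pd_cmult[OF smooth_comp[OF T(2) smooth_scaled]])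
  then show ?thesis by (simp add: m2_def power2_eq_square field_simps)
qed

lemma \<rho>_cont: "continuous_on UNIV \<rho>" by (rule smooth_continuous[OF \<rho>_smooth])

lemma test_fn_cut:
  assumes "e > 0" "smooth \<phi>" "\<And>x. \<rho> x > - e \<Longrightarrow> \<phi> x = 0"
  shows "test_fn \<Omega> \<phi>"
proof (rule test_fnI[where K="{x. \<rho> x \<le> - e}"])
  have "closed {x. \<rho> x \<le> - e}" by (rule closed_Collect_le[OF \<rho>_cont continuous_on_const])
  moreover have "{x. \<rho> x \<le> - e} \<subseteq> ball 0 (R - 1)" using dom_sub assms(1) by (auto simp: dom_eq)
  ultimately show "compact {x. \<rho> x \<le> - e}" using bounded_subset[OF bounded_ball] by (auto simp: compact_eq_bounded_closed)
qed (use assms in \<open>auto simp: dom_eq\<close>)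

lemma th_test: "e > 0 \<Longrightarrow> test_fn \<Omega> (th e)"
  by (rule test_fn_cut[OF _ th_smooth]) (auto simp: th_def divide_simps intro!: T(9))
lemma mm_test: "e > 0 \<Longrightarrow> test_fn \<Omega> (mm e)"
  by (rule test_fn_cut[OF _ mm_smooth]) (auto simp: mm_def divide_simps intro!: T(12))

lemma th_bounds: "0 \<le> th e x" "th e x \<le> 1" "\<bar>th e x\<bar> \<le> 1"
  using T(6,7)[of "\<rho> x / e"] by (auto simp: th_def)

lemma mm_nonpos: "e > 0 \<Longrightarrow> mm e x \<le> 0"
  unfolding mm_def by (intro divide_nonpos_nonneg T) simp
lemma mm_bound: "e > 0 \<Longrightarrow> \<bar>mm e x\<bar> \<le> CT / e"
  unfolding mm_def by (simp add: divide_right_mono T(15))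
lemma m2_bound: "e > 0 \<Longrightarrow> \<bar>m2 e x\<bar> \<le> CT / e^2"
  unfolding m2_def by (simp add: divide_right_mono T(16))
lemma mm_strip: "e > 0 \<Longrightarrow> mm e x \<noteq> 0 \<Longrightarrow> - 2 * e \<le> \<rho> x \<and> \<rho> x \<le> - e"
  using T(11,12)[of "\<rho> x / e"] unfolding mm_def by (force simp: field_simps not_less)
lemma m2_strip: "e > 0 \<Longrightarrow> m2 e x \<noteq> 0 \<Longrightarrow> - 2 * e \<le> \<rho> x \<and> \<rho> x \<le> - e"
  using T(13,14)[of "\<rho> x / e"] unfolding m2_def by (force simp: field_simps not_less)
lemma th_meas: "th e \<in> borel_measurable lebesgue" "mm e \<in> borel_measurable lebesgue" "m2 e \<in> borel_measurable lebesgue"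
  by (intro smooth_meas th_smooth mm_smooth m2_smooth)+
lemma th_norm: "e > 0 \<Longrightarrow> th e x \<noteq> 0 \<Longrightarrow> norm x \<le> R"
  using test_fn_supp[OF th_test, of e x] by force
lemma mm_norm: "e > 0 \<Longrightarrow> mm e x \<noteq> 0 \<Longrightarrow> norm x \<le> R"
  using test_fn_supp[OF mm_test, of e x] by force
lemma CT_nonneg: "CT \<ge> 0" using T(15)[of 0] by linarith

text \<open>Derivatives of \<open>\<rho>\<close> are controlled only in the ball of radius R; the
  cutoff factor c confines the product to that ball.\<close>

lemma cut_coeff_bound:
  fixes c g :: "pt \<Rightarrow> real"
  assumes "\<And>x. \<bar>c x\<bar> \<le> B" "\<And>x. c x \<noteq> 0 \<Longrightarrow> norm x \<le> R" "\<And>x. norm x \<le> R \<Longrightarrow> \<bar>g x\<bar> \<le> H" "H \<ge> 0"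
  shows "\<bar>c x * g x\<bar> \<le> B * H"
proof (cases "c x = 0")
  case True
  have "B \<ge> 0" using assms(1)[of x] by linarith
  with True assms(4) show ?thesis by simp
next
  case False
  then show ?thesis unfolding abs_mult using assms(1)[of x] assms(3)[OF assms(2)[OF False]]
    by (intro mult_mono) auto
qed

text \<open>The product rule for f^2, tested with \<open>th e x * pd \<rho> i x\<close> and summed
  over i, isolates \<open>mm\<close> |grad \<open>\<rho>\<close>|^2 f^2; on the strip that weight is
  at least \<open>c0\<close> in modulus. The bound does not depend on e, so it is a trace inequality
  in disguise.\<close>

lemma trace_bound:
  assumes f: "h1 \<Omega> f D" and e: "0 < e" "2 * e \<le> e0"
  shows "(\<integral>x. (- mm e x) * f x * f x \<partial>lebesgue) \<le> 2 * G / c0 * ((nrm f)^2 + nrm f * (nrm (D 1) + nrm (D 2)))"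
proof -
  note sf = h1D(1)[OF f] and sD = h1D(2)[OF f]
  have \<rho>s: "smooth (pd \<rho> i)" "smooth (pd (pd \<rho> i) j)" for i j by (intro smooth_pd \<rho>_smooth)+
  have b1: "\<bar>th e x * pd \<rho> i x\<bar> \<le> 1 * G" for i x
    by (rule cut_coeff_bound) (use th_bounds th_norm[OF e(1)] \<rho>1 G_pos in auto)
  have b2: "\<bar>th e x * pd (pd \<rho> i) j x\<bar> \<le> 1 * G" for i j x
    by (rule cut_coeff_bound) (use th_bounds th_norm[OF e(1)] \<rho>2 G_pos in auto)
  have b3: "\<bar>mm e x * (pd \<rho> i x)^2\<bar> \<le> CT / e * G^2" for i x
    by (rule cut_coeff_bound) (use mm_bound[OF e(1)] mm_norm[OF e(1)] \<rho>1 G_pos in \<open>auto simp flip: abs_le_square_iff intro: order_trans[OF _ abs_ge_self]\<close>)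
  have meas: "(\<lambda>x. th e x * pd \<rho> i x) \<in> borel_measurable lebesgue"
    "(\<lambda>x. th e x * pd (pd \<rho> i) j x) \<in> borel_measurable lebesgue"
    "(\<lambda>x. mm e x * (pd \<rho> i x)^2) \<in> borel_measurable lebesgue" for i j
    by (intro borel_measurable_times borel_measurable_power th_meas smooth_meas \<rho>s)+
  have part: "- (\<integral>x. mm e x * (pd \<rho> i x)^2 * f x * f x \<partial>lebesgue) \<le> G * (nrm f)^2 + 2 * (G * nrm (D i) * nrm f)" for i
  proof -
    let ?\<phi> = "\<lambda>x. th e x * pd \<rho> i x"
    have "(\<integral>x. pd ?\<phi> i x * f x * f x \<partial>lebesgue) + (\<integral>x. ?\<phi> x * D i x * f x \<partial>lebesgue) + (\<integral>x. ?\<phi> x * f x * D i x \<partial>lebesgue) = 0"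
      by (rule weak_product_rule[OF f f test_fn_mult[OF th_test[OF e(1)] \<rho>s(1)]])
    moreover have "(\<integral>x. ?\<phi> x * f x * D i x \<partial>lebesgue) = (\<integral>x. ?\<phi> x * D i x * f x \<partial>lebesgue)"
      by (simp add: mult_ac)
    moreover have "(\<integral>x. pd ?\<phi> i x * f x * f x \<partial>lebesgue) = (\<integral>x. mm e x * (pd \<rho> i x)^2 * f x * f x + th e x * pd (pd \<rho> i) i x * f x * f x \<partial>lebesgue)"
      by (simp add: pd_mult th_smooth \<rho>s pd_th power2_eq_square algebra_simps)
    moreover have "\<dots> = (\<integral>x. mm e x * (pd \<rho> i x)^2 * f x * f x \<partial>lebesgue) + (\<integral>x. th e x * pd (pd \<rho> i) i x * f x * f x \<partial>lebesgue)"
      by (rule Bochner_Integration.integral_add) (rule sqi_int3[OF meas(3) b3 sf sf] sqi_int3[OF meas(2) b2 sf sf])+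
    moreover have "\<bar>\<integral>x. th e x * pd (pd \<rho> i) i x * f x * f x \<partial>lebesgue\<bar> \<le> G * nrm f * nrm f"
      using nrm_abs_int3[OF meas(2) b2 sf sf] by simp
    moreover have "\<bar>\<integral>x. ?\<phi> x * D i x * f x \<partial>lebesgue\<bar> \<le> G * nrm (D i) * nrm f"
      using nrm_abs_int3[OF meas(1) b1 sD sf] by simp
    ultimately show ?thesis unfolding power2_eq_square by (simp only: mult.assoc)
  qed
  have b3': "\<bar>- mm e x\<bar> \<le> CT / e" for x using mm_bound[OF e(1)] by simp
  have m3': "(\<lambda>x. - mm e x) \<in> borel_measurable lebesgue" using th_meas(2) by (rule borel_measurable_uminus)
  have i3: "integrable lebesgue (\<lambda>x. (- mm e x) * f x * f x)" by (rule sqi_int3[OF m3' b3' sf sf])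
  have i4: "integrable lebesgue (\<lambda>x. mm e x * (pd \<rho> i x)^2 * f x * f x)" for i by (rule sqi_int3[OF meas(3) b3 sf sf])
  have "c0 * (\<integral>x. (- mm e x) * f x * f x \<partial>lebesgue) = (\<integral>x. c0 * ((- mm e x) * f x * f x) \<partial>lebesgue)" by simp
  also have "\<dots> \<le> (\<integral>x. - (mm e x * (pd \<rho> 1 x)^2 * f x * f x) - mm e x * (pd \<rho> 2 x)^2 * f x * f x \<partial>lebesgue)"
  proof (rule integral_mono)
    fix x
    show "c0 * ((- mm e x) * f x * f x) \<le> - (mm e x * (pd \<rho> 1 x)^2 * f x * f x) - mm e x * (pd \<rho> 2 x)^2 * f x * f x"
    proof (cases "mm e x = 0")
      case False
      have "\<bar>\<rho> x\<bar> \<le> e0" using mm_strip[OF e(1) False] e by auto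
      then have "c0 \<le> (pd \<rho> 1 x)^2 + (pd \<rho> 2 x)^2" by (rule nondeg[OF mm_norm[OF e(1) False]])
      then have "c0 * ((- mm e x) * (f x * f x)) \<le> ((pd \<rho> 1 x)^2 + (pd \<rho> 2 x)^2) * ((- mm e x) * (f x * f x))"
        by (rule mult_right_mono) (use mm_nonpos[OF e(1), of x] in \<open>auto intro!: mult_nonpos_nonneg\<close>)
      then show ?thesis by (simp add: algebra_simps)
    qed simp
  qed (use i3 i4 in auto)
  also have "\<dots> = - (\<integral>x. mm e x * (pd \<rho> 1 x)^2 * f x * f x \<partial>lebesgue) - (\<integral>x. mm e x * (pd \<rho> 2 x)^2 * f x * f x \<partial>lebesgue)"
    using i4 by simp
  also have "\<dots> \<le> 2 * G * ((nrm f)^2 + nrm f * (nrm (D 1) + nrm (D 2)))"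
    using part[of 1] part[of 2] by (simp add: algebra_simps)
  finally show ?thesis using c0 by (simp add: field_simps)
qed

subsection \<open>The Sobolev embedding into the fourth power space\<close>

lemma Fatou_bound:
  fixes u :: "nat \<Rightarrow> pt \<Rightarrow> real"
  assumes m: "\<And>n. u n \<in> borel_measurable lebesgue" and lim: "AE x in lebesgue. (\<lambda>n. u n x) \<longlonglongrightarrow> v x"
    and b: "\<And>n. n \<ge> N \<Longrightarrow> (\<integral>\<^sup>+x. ennreal (u n x) \<partial>lebesgue) \<le> ennreal (P n)" and P: "P \<longlonglongrightarrow> p"
  shows "(\<integral>\<^sup>+x. ennreal (v x) \<partial>lebesgue) \<le> ennreal p"
proof -
  have "(\<integral>\<^sup>+x. ennreal (v x) \<partial>lebesgue) = (\<integral>\<^sup>+x. liminf (\<lambda>n. ennreal (u n x)) \<partial>lebesgue)"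
  proof (rule nn_integral_cong_AE)
    show "AE x in lebesgue. ennreal (v x) = liminf (\<lambda>n. ennreal (u n x))"
      using lim
    proof eventually_elim
      fix x assume "(\<lambda>n. u n x) \<longlonglongrightarrow> v x"
      then have "(\<lambda>n. ennreal (u n x)) \<longlonglongrightarrow> ennreal (v x)" by (rule tendsto_ennrealI)
      then have "liminf (\<lambda>n. ennreal (u n x)) = ennreal (v x)"
        by (rule lim_imp_Liminf[rotated]) simp
      then show "ennreal (v x) = liminf (\<lambda>n. ennreal (u n x))" by (rule sym)
    qed
  qed
  also have "\<dots> \<le> liminf (\<lambda>n. \<integral>\<^sup>+x. ennreal (u n x) \<partial>lebesgue)"
    by (rule nn_integral_liminf) (use m in measurable)
  also have "\<dots> \<le> liminf (\<lambda>n. ennreal (P n))"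
    by (rule Liminf_mono) (use b in \<open>auto simp: eventually_sequentially\<close>)
  also have "\<dots> = ennreal p"
    by (rule lim_imp_Liminf) (auto intro: tendsto_ennrealI P)
  finally show ?thesis .
qed

text \<open>The summand 1 comes from 2 |f| |D f| in the derivative of f^2, the other one from
  \<open>trace_bound\<close> applied to the derivative of the cutoff.\<close>

definition KS :: real where "KS = 1 + 4 * G^2 / c0"

definition En :: "(pt \<Rightarrow> real) \<Rightarrow> (2 \<Rightarrow> pt \<Rightarrow> real) \<Rightarrow> real" where
  "En f D = (nrm f)^2 + (nrm (D 1))^2 + (nrm (D 2))^2"

text \<open>The planar inequality needs smooth functions, so f is mollified inside the cutoff; the
  resulting bounds \<open>b n j\<close> converge, and Fatou's lemma carries the inequality over to
  f.\<close>

lemma Sobolev_cut: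
  assumes f: "h1 \<Omega> f D" and e: "0 < e" "2 * e \<le> e0"
  shows "(\<integral>\<^sup>+x. ennreal ((th e x * (f x * f x))^2) \<partial>lebesgue) \<le> ennreal ((KS * En f D)^2)"
proof -
  note sf = h1D(1)[OF f] and sD = h1D(2)[OF f] and g = moll_h1[OF f]
  have K: "compact (closure {x. th e x \<noteq> 0})" "closure {x. th e x \<noteq> 0} \<subseteq> \<Omega>"
    using th_test[OF e(1)] by (auto simp: test_fn_def)
  obtain N where N: "\<And>n x j. n \<ge> N \<Longrightarrow> x \<in> closure {x. th e x \<noteq> 0} \<Longrightarrow> pd (moll n f) j x = moll n (D j) x"
    by (rule moll_deriv[OF f K]) blast
  \<comment> \<open>This is |d_j \<open>th\<close>|: the derivative of the cutoff times f^2 is the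
    term that \<open>trace_bound\<close> controls.\<close>
  define c where "c j x = - mm e x * \<bar>pd \<rho> j x\<bar>" for j x
  have cm: "c j \<in> borel_measurable lebesgue" for j
    unfolding c_def by (intro borel_measurable_times borel_measurable_uminus borel_measurable_abs th_meas smooth_meas smooth_pd \<rho>_smooth)
  have cb: "\<bar>c j x\<bar> \<le> CT / e * G" for j x
    unfolding c_def by (rule cut_coeff_bound) (use mm_bound[OF e(1)] mm_norm[OF e(1)] \<rho>1 G_pos in auto)
  define b where "b n j = (\<integral>x. c j x * moll n f x * moll n f x \<partial>lebesgue) + 2 * (nrm f * nrm (D j))" for n j
  define bl where "bl j = (\<integral>x. c j x * f x * f x \<partial>lebesgue) + 2 * (nrm f * nrm (D j))" for j
  have blim: "(\<lambda>n. b n j) \<longlonglongrightarrow> bl j" for j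
    unfolding b_def bl_def by (intro tendsto_add tendsto_const triple_tendsto[OF _ _ _ _ _ _ cm cb] g sf)
  have c_nonneg: "c j x \<ge> 0" for j x
    unfolding c_def using mm_nonpos[OF e(1), of x] by (intro mult_nonneg_nonneg) auto
  have blb: "0 \<le> bl j" "bl j \<le> KS * En f D" for j
  proof -
    have "(\<integral>x. c j x * (f x * f x) \<partial>lebesgue) \<ge> 0"
      by (rule Bochner_Integration.integral_nonneg) (simp add: c_nonneg)
    then show "0 \<le> bl j" by (simp add: bl_def mult.assoc)
    have b3': "\<bar>- mm e x\<bar> \<le> CT / e" for x using mm_bound[OF e(1)] by simp
    have m3': "(\<lambda>x. - mm e x) \<in> borel_measurable lebesgue" using th_meas(2) by (rule borel_measurable_uminus)
    have i3: "integrable lebesgue (\<lambda>x. (- mm e x) * f x * f x)" by (rule sqi_int3[OF m3' b3' sf sf])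
    have "(\<integral>x. c j x * f x * f x \<partial>lebesgue) \<le> (\<integral>x. G * ((- mm e x) * f x * f x) \<partial>lebesgue)"
    proof (rule integral_mono)
      show "integrable lebesgue (\<lambda>x. c j x * f x * f x)" by (rule sqi_int3[OF cm cb sf sf])
      show "integrable lebesgue (\<lambda>x. G * ((- mm e x) * f x * f x))" using i3 by simp
      fix x
      have "c j x \<le> - mm e x * G"
      proof (cases "mm e x = 0")
        case False
        then show ?thesis unfolding c_def using \<rho>1[OF mm_norm[OF e(1) False]] mm_nonpos[OF e(1)]
          by (intro mult_left_mono) auto
      qed (simp add: c_def)
      then have "c j x * (f x * f x) \<le> - mm e x * G * (f x * f x)" by (rule mult_right_mono) simp
      then show "c j x * f x * f x \<le> G * ((- mm e x) * f x * f x)" by (simp add: algebra_simps)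
    qed
    also have "\<dots> = G * (\<integral>x. (- mm e x) * f x * f x \<partial>lebesgue)" by simp
    also have "\<dots> \<le> G * (2 * G / c0 * ((nrm f)^2 + nrm f * (nrm (D 1) + nrm (D 2))))"
      using G_pos by (intro mult_left_mono trace_bound[OF f e]) auto
    also have "\<dots> \<le> G * (2 * G / c0 * (2 * En f D))"
    proof -
      have "a^2 + a * (x + y) \<le> 2 * (a^2 + x^2 + y^2)" for a x y :: real
      proof -
        have "0 \<le> (a - x)^2 + (a - y)^2 + 3 * x^2 + 3 * y^2" by simp
        then show ?thesis unfolding power2_diff by (simp add: distrib_left)
      qed
      from this[of "nrm f" "nrm (D 1)" "nrm (D 2)"]
      have "(nrm f)^2 + nrm f * (nrm (D 1) + nrm (D 2)) \<le> 2 * En f D" unfolding En_def .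
      then show ?thesis using G_pos c0 by (intro mult_left_mono) auto
    qed
    finally have 1: "(\<integral>x. c j x * f x * f x \<partial>lebesgue) \<le> 4 * G^2 / c0 * En f D"
      by (simp add: power2_eq_square mult_ac)
    have "(nrm (D j))^2 \<le> (nrm (D 1))^2 + (nrm (D 2))^2" using exhaust_2[of j] by auto
    moreover have "2 * (nrm f * nrm (D j)) \<le> (nrm f)^2 + (nrm (D j))^2"
      using sum_squares_bound[of "nrm f" "nrm (D j)"] by (simp add: mult.assoc)
    ultimately have 2: "2 * (nrm f * nrm (D j)) \<le> En f D" unfolding En_def by linarith
    show "bl j \<le> KS * En f D" unfolding bl_def KS_def using 1 2 by (simp add: distrib_right)
  qed
  have main: "(\<integral>\<^sup>+x. ennreal ((th e x * (moll n f x * moll n f x))^2) \<partial>lebesgue) \<le> ennreal (b n 1 * b n 2)" if n: "n \<ge> N" for n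
  proof -
    let ?h = "\<lambda>x. th e x * (moll n f x * moll n f x)"
    have hs: "smooth ?h" by (intro smooth_mult th_smooth g)
    have h0: "?h x = 0" if "norm x > R" for x
      using th_norm[OF e(1), of x] that by force
    have ph: "pd ?h j x = mm e x * pd \<rho> j x * moll n f x * moll n f x + 2 * (th e x * moll n f x * moll n (D j) x)" for j x
    proof (cases "x \<in> closure {x. th e x \<noteq> 0}")
      case True
      then show ?thesis using N[OF n True, of j] by (simp add: pd_mult th_smooth g smooth_mult pd_th algebra_simps)
    next
      case False
      then have "th e x = 0" by (rule not_in_supp)
      then show ?thesis by (simp add: pd_mult th_smooth g smooth_mult pd_th algebra_simps)
    qed
    have ib: "(\<integral>x. \<bar>pd ?h j x\<bar> \<partial>lebesgue) \<le> b n j" for j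
    proof -
      have i1: "integrable lebesgue (\<lambda>x. c j x * moll n f x * moll n f x)" by (rule sqi_int3[OF cm cb g(2) g(2)])
      have i2: "integrable lebesgue (\<lambda>x. \<bar>moll n f x * moll n (D j) x\<bar>)" by (intro integrable_abs sqi_mult_integrable g)
      have "(\<integral>x. \<bar>pd ?h j x\<bar> \<partial>lebesgue) \<le> (\<integral>x. c j x * moll n f x * moll n f x + 2 * \<bar>moll n f x * moll n (D j) x\<bar> \<partial>lebesgue)"
      proof (rule integral_mono)
        show "integrable lebesgue (\<lambda>x. \<bar>pd ?h j x\<bar>)"
          by (intro integrable_abs continuous_supp_sqi(2)[OF smooth_continuous[OF smooth_pd[OF hs]] pd_supp[OF hs h0]])
        fix x
        have "\<bar>mm e x * pd \<rho> j x * moll n f x * moll n f x\<bar> = c j x * moll n f x * moll n f x"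
          using mm_nonpos[OF e(1), of x] by (simp add: c_def abs_mult)
        moreover have "\<bar>th e x * moll n f x * moll n (D j) x\<bar> \<le> 1 * \<bar>moll n f x * moll n (D j) x\<bar>"
          unfolding mult.assoc abs_mult[of "th e x"] using th_bounds[of e x] by (intro mult_right_mono) auto
        ultimately show "\<bar>pd ?h j x\<bar> \<le> c j x * moll n f x * moll n f x + 2 * \<bar>moll n f x * moll n (D j) x\<bar>"
          unfolding ph by linarith
      qed (use i1 i2 in auto)
      also have "\<dots> = (\<integral>x. c j x * moll n f x * moll n f x \<partial>lebesgue) + 2 * (\<integral>x. \<bar>moll n f x * moll n (D j) x\<bar> \<partial>lebesgue)"
        using i1 i2 by simp
      also have "(\<integral>x. \<bar>moll n f x * moll n (D j) x\<bar> \<partial>lebesgue) \<le> nrm f * nrm (D j)"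
        by (rule order_trans[OF Cauchy_Schwarz_abs[OF g(2,3)]]) (intro mult_mono g nrm_nonneg)
      finally show ?thesis by (simp add: b_def)
    qed
    have "(\<integral>x. (?h x)^2 \<partial>lebesgue) \<le> (\<integral>x. \<bar>pd ?h 1 x\<bar> \<partial>lebesgue) * (\<integral>x. \<bar>pd ?h 2 x\<bar> \<partial>lebesgue)"
      by (rule Gagliardo_Nirenberg[OF hs h0])
    also have "\<dots> \<le> b n 1 * b n 2"
      by (intro mult_mono ib) (auto intro: order_trans[OF _ ib[of 1]])
    finally have "(\<integral>x. (?h x)^2 \<partial>lebesgue) \<le> b n 1 * b n 2" .
    moreover have "integrable lebesgue (\<lambda>x. (?h x)^2)"
      by (rule sqi_int[OF continuous_supp_sqi(1)[OF smooth_continuous[OF hs] h0]])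
    ultimately show ?thesis by (subst nn_integral_eq_integral) (auto intro: ennreal_leI)
  qed
  have "(\<lambda>n. \<integral>x. norm ((moll n f x - f x)^2) \<partial>lebesgue) \<longlonglongrightarrow> 0"
    using tendsto_power[OF g(4), of 2] by (simp add: nrm_power2)
  \<comment> \<open>Convergence of the fourth powers is not known yet; almost everywhere convergence
    along a subsequence is enough for Fatou's lemma.\<close>
  from tendsto_L1_AE_subseq[OF sqi_int[OF sqi_diff[OF g(2) sf]] this]
  obtain r :: "nat \<Rightarrow> nat" where r: "strict_mono r" "AE x in lebesgue. (\<lambda>n. (moll (r n) f x - f x)^2) \<longlonglongrightarrow> 0" by blast
  have "(\<integral>\<^sup>+x. ennreal ((th e x * (f x * f x))^2) \<partial>lebesgue) \<le> ennreal (bl 1 * bl 2)"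
  proof (rule Fatou_bound)
    show "(\<lambda>x. (th e x * (moll (r n) f x * moll (r n) f x))^2) \<in> borel_measurable lebesgue" for n
      by (intro borel_measurable_power borel_measurable_times th_meas sqi_meas g)
    show "AE x in lebesgue. (\<lambda>n. (th e x * (moll (r n) f x * moll (r n) f x))^2) \<longlonglongrightarrow> (th e x * (f x * f x))^2"
      using r(2)
    proof eventually_elim
      fix x assume "(\<lambda>n. (moll (r n) f x - f x)^2) \<longlonglongrightarrow> 0"
      from tendsto_real_sqrt[OF this] have "(\<lambda>n. \<bar>moll (r n) f x - f x\<bar>) \<longlonglongrightarrow> 0" by simp
      then have "(\<lambda>n. moll (r n) f x) \<longlonglongrightarrow> f x" by (simp add: tendsto_rabs_zero_iff LIM_zero_iff)
      then show "(\<lambda>n. (th e x * (moll (r n) f x * moll (r n) f x))^2) \<longlonglongrightarrow> (th e x * (f x * f x))^2"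
        by (intro tendsto_intros)
    qed
    show "(\<lambda>n. b (r n) 1 * b (r n) 2) \<longlonglongrightarrow> bl 1 * bl 2"
      using LIMSEQ_subseq_LIMSEQ[OF tendsto_mult[OF blim[of 1] blim[of 2]] r(1)] by (simp add: o_def)
    show "(\<integral>\<^sup>+x. ennreal ((th e x * (moll (r n) f x * moll (r n) f x))^2) \<partial>lebesgue) \<le> ennreal (b (r n) 1 * b (r n) 2)"
      if "n \<ge> N" for n
      by (rule main) (use seq_suble[OF r(1), of n] that in linarith)
  qed
  also have "\<dots> \<le> ennreal ((KS * En f D)^2)"
    unfolding power2_eq_square[of "KS * En f D"]
    by (intro ennreal_leI mult_mono blb) (auto intro: order_trans[OF blb(1) blb(2)])
  finally show ?thesis .
qed

text \<open>The bound of \<open>Sobolev_cut\<close> is uniform in e and the cutoffs tend to 1 at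
  every point of the domain, so a second use of Fatou's lemma removes them.\<close>

theorem Sobolev:
  assumes f: "h1 \<Omega> f D"
  shows "integrable lebesgue (\<lambda>x. (f x)^4)" "(\<integral>x. (f x)^4 \<partial>lebesgue) \<le> (KS * En f D)^2"
proof -
  define e where "e n = e0 / (2 * real (Suc n))" for n
  have e: "e n > 0" "2 * e n \<le> e0" for n
    using e0 by (auto simp: e_def field_simps)
  have elim: "e \<longlonglongrightarrow> 0"
  proof -
    have "(\<lambda>n. (e0 / 2) * (1 / real (Suc n))) \<longlonglongrightarrow> (e0 / 2) * 0"
      by (intro tendsto_mult tendsto_const) (use LIMSEQ_inverse_real_of_nat in \<open>simp add: inverse_eq_divide\<close>)
    then show ?thesis by (simp add: e_def[abs_def])
  qed
  have f4: "(f x)^4 = (f x * f x)^2" for x by (simp add: power2_eq_square power4_eq_xxxx mult_ac)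
  have nn: "(\<integral>\<^sup>+x. ennreal ((f x)^4) \<partial>lebesgue) \<le> ennreal ((KS * En f D)^2)"
  proof (rule Fatou_bound)
    show "(\<lambda>x. (th (e n) x * (f x * f x))^2) \<in> borel_measurable lebesgue" for n
      by (intro borel_measurable_power borel_measurable_times th_meas sqi_meas h1D[OF f])
    show "AE x in lebesgue. (\<lambda>n. (th (e n) x * (f x * f x))^2) \<longlonglongrightarrow> (f x)^4"
    proof (rule always_eventually, rule allI)
      fix x
      show "(\<lambda>n. (th (e n) x * (f x * f x))^2) \<longlonglongrightarrow> (f x)^4"
      proof (cases "x \<in> \<Omega>")
        case True
        then have "\<rho> x < 0" by (simp add: dom_eq)
        then have "\<forall>\<^sub>F n in sequentially. e n < - \<rho> x / 2" by (intro order_tendstoD(2)[OF elim]) simp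
        then have "\<forall>\<^sub>F n in sequentially. (f x)^4 = (th (e n) x * (f x * f x))^2"
        proof eventually_elim
          fix n assume "e n < - \<rho> x / 2"
          then have "\<rho> x / e n \<le> -2" using e(1)[of n] by (simp add: field_simps)
          then show "(f x)^4 = (th (e n) x * (f x * f x))^2" by (simp add: th_def T(8) f4)
        qed
        then show ?thesis by (rule Lim_transform_eventually[OF tendsto_const])
      next
        case False
        then show ?thesis using h1D(3)[OF f False] by simp
      qed
    qed
    show "(\<integral>\<^sup>+x. ennreal ((th (e n) x * (f x * f x))^2) \<partial>lebesgue) \<le> ennreal ((KS * En f D)^2)" if "n \<ge> 0" for n
      by (rule Sobolev_cut[OF f e])
  qed (rule tendsto_const)
  have m: "(\<lambda>x. (f x)^4) \<in> borel_measurable lebesgue" by (intro borel_measurable_power sqi_meas h1D[OF f])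
  show i: "integrable lebesgue (\<lambda>x. (f x)^4)"
    by (rule integrableI_nonneg[OF m]) (use nn in \<open>auto intro: order_le_less_trans\<close>)
  show "(\<integral>x. (f x)^4 \<partial>lebesgue) \<le> (KS * En f D)^2"
    using nn nn_integral_eq_integral[OF i] by simp
qed

end

subsection \<open>The strip inequality\<close>

text \<open>To be read with a = v, d_i = d_i v, r_i = d_i \<open>\<rho>\<close>, s_i = d_i d_i
  \<open>\<rho>\<close>, and with q a weight of gradient (p/e) grad \<open>\<rho>\<close>: the right
  side is then the divergence of v^2 q grad \<open>\<rho>\<close>. The good term is at least (c/e) p
  a^2. Each of the two cross terms and each of the two second-derivative terms is paid for with
  c/(8e) p a^2, so half of it remains.\<close>

lemma strip_pointwise:
  fixes a d1 d2 r1 r2 s1 s2 p q e c G :: real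
  assumes p: "0 \<le> p" and q: "0 \<le> q" "q \<le> 16 * p" and G: "G > 0" "\<bar>r1\<bar> \<le> G" "\<bar>r2\<bar> \<le> G" "\<bar>s1\<bar> \<le> G" "\<bar>s2\<bar> \<le> G"
    and c: "0 < c" "c \<le> r1^2 + r2^2" and e: "e > 0" "e \<le> c / (128 * G)"
  shows "c / (2 * e) * (p * a^2) - 2048 * G^2 / c * e * (p * (d1^2 + d2^2))
    \<le> 2 * a * d1 * r1 * q + a^2 * (s1 * q + r1^2 * p / e) + (2 * a * d2 * r2 * q + a^2 * (s2 * q + r2^2 * p / e))"
proof -
  have t1: "- (p * (c / (8 * e) * a^2 + 2048 * G^2 * e / c * d^2)) \<le> 2 * a * d * r * q" if r: "\<bar>r\<bar> \<le> G" for d r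
  proof -
    \<comment> \<open>Weight for Young's inequality: its square is the share c/(8e) granted to each
      cross term. The factor 2048 is then 16^2 * 8, where 16 comes from q <= 16 p.\<close>
    define s where "s = sqrt (c / (8 * e))"
    have s: "s > 0" "s^2 = c / (8 * e)" using c e by (auto simp: s_def)
    have "0 \<le> (s * \<bar>a\<bar> - 16 * G / s * \<bar>d\<bar>)^2" by simp
    also have "\<dots> = s^2 * a^2 + 256 * G^2 / s^2 * d^2 - 32 * G * (\<bar>a\<bar> * \<bar>d\<bar>)"
      using s(1) by (simp add: power2_diff power_mult_distrib power_divide)
    also have "256 * G^2 / s^2 * d^2 = 2048 * G^2 * e / c * d^2"
      unfolding s(2) using c e by simp
    finally have y: "32 * G * (\<bar>a\<bar> * \<bar>d\<bar>) \<le> c / (8 * e) * a^2 + 2048 * G^2 * e / c * d^2" unfolding s(2) by linarith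
    have "\<bar>2 * a * d * r * q\<bar> = 2 * (\<bar>a\<bar> * \<bar>d\<bar>) * (\<bar>r\<bar> * q)" using q by (simp add: abs_mult)
    also have "\<dots> \<le> 2 * (\<bar>a\<bar> * \<bar>d\<bar>) * (G * (16 * p))"
      using r q G by (intro mult_left_mono mult_mono) auto
    also have "\<dots> = p * (32 * G * (\<bar>a\<bar> * \<bar>d\<bar>))" by simp
    also have "\<dots> \<le> p * (c / (8 * e) * a^2 + 2048 * G^2 * e / c * d^2)" by (rule mult_left_mono[OF y p])
    finally show ?thesis by linarith
  qed
  have t2: "- (c / (8 * e) * (p * a^2)) \<le> a^2 * (s * q)" if s: "\<bar>s\<bar> \<le> G" for s
  proof -
    have "\<bar>a^2 * (s * q)\<bar> = a^2 * (\<bar>s\<bar> * q)" using q by (simp add: abs_mult)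
    also have "\<dots> \<le> a^2 * (G * (16 * p))" using s q G by (intro mult_left_mono mult_mono) auto
    also have "\<dots> = 16 * G * (p * a^2)" by simp
    also have "\<dots> \<le> c / (8 * e) * (p * a^2)"
    proof (rule mult_right_mono)
      \<comment> \<open>This is the condition \<open>e \<le> c / (128 * G)\<close>
        rearranged.\<close>
      show "16 * G \<le> c / (8 * e)" using e G c by (simp add: field_simps)
    qed (use p in simp)
    finally show ?thesis by linarith
  qed
  have t3: "c / e * (p * a^2) \<le> a^2 * (r1^2 * p / e) + a^2 * (r2^2 * p / e)"
  proof -
    have "c / e * (p * a^2) = c * (p * a^2 / e)" by simp
    also have "\<dots> \<le> (r1^2 + r2^2) * (p * a^2 / e)" using p e by (intro mult_right_mono c) auto
    finally show ?thesis by (simp add: algebra_simps)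
  qed
  have "c / (2 * e) * (p * a^2) - 2048 * G^2 / c * e * (p * (d1^2 + d2^2)) =
     - (p * (c / (8 * e) * a^2 + 2048 * G^2 * e / c * d1^2)) - (p * (c / (8 * e) * a^2 + 2048 * G^2 * e / c * d2^2))
     - c / (8 * e) * (p * a^2) - c / (8 * e) * (p * a^2) + c / e * (p * a^2)"
    using c e by (simp add: field_simps)
  also have "\<dots> \<le> 2 * a * d1 * r1 * q + a^2 * (s1 * q + r1^2 * p / e) + (2 * a * d2 * r2 * q + a^2 * (s2 * q + r2^2 * p / e))"
    using t1[OF G(2), of d1] t1[OF G(3), of d2] t2[OF G(4)] t2[OF G(5)] t3 by (simp only: distrib_left)
  finally show ?thesis .
qed

lemma expinv_2_le: "expinv 2 t \<le> 2"
proof (cases "t > 0")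
  case True
  define y where "y = 1 / t"
  have "1 + y + y^2 / 2 \<le> exp y" using True by (intro exp_lower_Taylor_quadratic) (simp add: y_def)
  moreover have "y > 0" using True by (simp add: y_def)
  ultimately have "y^2 \<le> 2 * exp y" by linarith
  then have "y^2 * exp (- y) \<le> 2" by (simp add: exp_minus field_simps)
  then show ?thesis using True by (simp add: expinv_def y_def)
qed (simp add: expinv_def)

text \<open>The range [1, 4] is that of \<open>\<rho> x / e + 3\<close> on the part of the strip
  with -2e <= \<open>\<rho>\<close> <= e.\<close>

lemma expinv_2_ge: "1 \<le> t \<Longrightarrow> t \<le> 4 \<Longrightarrow> exp (-1) / 16 \<le> expinv 2 t"
proof -
  assume t: "1 \<le> t" "t \<le> 4"
  have "1 / 16 \<le> (1 / t)^2" using power_mono[of "1/4" "1/t" 2] t by (simp add: field_simps power2_eq_square)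
  moreover have "exp (-1) \<le> exp (- (1 / t))" using t by (simp add: field_simps)
  ultimately have "1 / 16 * exp (-1) \<le> (1 / t)^2 * exp (- (1 / t))" by (intro mult_mono) auto
  then show ?thesis using t by (simp add: expinv_def)
qed

context dom
begin

abbreviation strip_nrm :: "real \<Rightarrow> (pt \<Rightarrow> real) \<Rightarrow> real" where
  "strip_nrm e f \<equiv> nrm (\<lambda>x. indicator {x. - 3 * e < \<rho> x} x * f x)"

text \<open>The first bound keeps -3e < \<open>\<rho>\<close> < e inside the collar where the
  gradient is nondegenerate; the second is the smallness required by
  \<open>strip_pointwise\<close>.\<close>

definition e1 :: real where "e1 = min (e0 / 3) (c0 / (128 * G))"
text \<open>The factor 64 * exp 1 collects 16 * exp 1 from the lower bound for the weight on the
  strip, 2 from its upper bound, and 2 from dividing by \<open>c0 / (2 * e)\<close>.\<close>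

definition CS :: real where "CS = 64 * exp 1 * (2048 * G^2 / c0) / c0"

lemma e1_pos: "e1 > 0" using e0 c0 G_pos by (simp add: e1_def)
lemma CS_nonneg: "CS \<ge> 0" using c0 by (simp add: CS_def)

lemma \<rho>_sets: "{x. a \<le> \<rho> x} \<in> sets lebesgue" "{x. a < \<rho> x} \<in> sets lebesgue"
proof -
  have "closed {x. a \<le> \<rho> x}" "open {x. a < \<rho> x}"
    by (rule closed_Collect_le open_Collect_less, rule continuous_on_const, rule \<rho>_cont)+
  then show "{x. a \<le> \<rho> x} \<in> sets lebesgue" "{x. a < \<rho> x} \<in> sets lebesgue" by auto
qed

text \<open>A weighted Poincare inequality across a layer of width of order e, whence the factor
  e^2. Integrate the divergence of v^2 q grad \<open>\<rho>\<close>: the weight q vanishes for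
  \<open>\<rho>\<close> <= -3e and v vanishes for \<open>\<rho>\<close> >= e, so no boundary term
  appears on either side and only the gradient over the layer enters.\<close>

lemma strip_inequality:
  assumes e: "0 < e" "e \<le> e1" and v: "smooth v" "\<And>x. norm x > R \<Longrightarrow> v x = 0" "\<And>x. \<rho> x \<ge> e \<Longrightarrow> v x = 0"
  shows "(nrm (\<lambda>x. indicator {x. - 2 * e \<le> \<rho> x} x * v x))^2
    \<le> CS * e^2 * ((strip_nrm e (pd v 1))^2 + (strip_nrm e (pd v 2))^2)"
proof -
  \<comment> \<open>With s = \<open>\<rho> x / e + 3\<close>, exp(-1/s) has derivative s^(-2)
    exp(-1/s) in s. Thus grad q = (p/e) grad \<open>\<rho>\<close> and q = s^2 p <= 16 p for 0 < s <
    4, while both weights stay smooth at the inner edge s = 0.\<close>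
  define p where "p x = expinv 2 (\<rho> x / e + 3)" for x
  define q where "q x = expinv 0 (\<rho> x / e + 3)" for x
  define A where "A = 2048 * G^2 / c0"
  have A: "A > 0" using G_pos c0 by (simp add: A_def)
  have sc: "smooth (\<lambda>x. \<rho> x / e + 3)" by (intro smooth_add smooth_scaled smooth_const)
  have sp: "smooth p" "smooth q" unfolding p_def q_def by (intro smooth_comp[OF smooth1_expinv sc])+
  have d0: "(expinv 0 has_real_derivative expinv 2 t) (at t)" for t
    using expinv_deriv[of 0 t] by (simp add: numeral_2_eq_2)
  have pq: "pd q i x = p x * pd \<rho> i x / e" for i x
  proof -
    have "pd q i x = expinv 2 (\<rho> x / e + 3) * pd (\<lambda>x. \<rho> x / e + 3) i x"
      unfolding q_def by (rule pd_comp[OF sc d0])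
    then show ?thesis by (simp add: pd_add smooth_scaled pd_scaled p_def)
  qed
  define w where "w i x = v x * v x * (pd \<rho> i x * q x)" for i x
  have sw: "smooth (w i)" for i unfolding w_def by (intro smooth_mult v smooth_pd \<rho>_smooth sp)
  have w0: "w i x = 0" if "norm x > R" for i x using v(2)[OF that] by (simp add: w_def)
  have pw: "pd (w i) i x = 2 * v x * pd v i x * pd \<rho> i x * q x + (v x)^2 * (pd (pd \<rho> i) i x * q x + (pd \<rho> i x)^2 * p x / e)" for i x
    unfolding w_def by (simp add: pd_mult smooth_mult v smooth_pd \<rho>_smooth sp pq power2_eq_square algebra_simps)
  have iw: "integrable lebesgue (pd (w i) i)" "(\<integral>x. pd (w i) i x \<partial>lebesgue) = 0" for i
    using continuous_supp_sqi(2)[where R=R, OF smooth_continuous[OF smooth_pd[OF sw]] pd_supp[where R=R, OF sw w0]]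
      integral_pd_eq_0[where R=R, OF sw w0] by auto
  have pos: "p x \<ge> 0" "q x \<ge> 0" for x by (auto simp: p_def q_def expinv_nonneg)
  have nz: "norm x \<le> R \<and> \<rho> x < e" if "v x \<noteq> 0" for x using v(2,3)[of x] that by force
  have pw_ge: "c0 / (2 * e) * (p x * (v x)^2) - A * e * (p x * ((pd v 1 x)^2 + (pd v 2 x)^2)) \<le> pd (w 1) 1 x + pd (w 2) 2 x" for x
  proof (cases "v x = 0 \<or> \<rho> x / e + 3 \<le> 0")
    case True
    then have "pd (w 1) 1 x + pd (w 2) 2 x = 0" "p x * (v x)^2 = 0" unfolding pw by (auto simp: p_def q_def expinv_eq_0)
    moreover have "0 \<le> A * e * (p x * ((pd v 1 x)^2 + (pd v 2 x)^2))" using A e pos[of x] by simp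
    ultimately show ?thesis by (simp only: mult_zero_right diff_0 neg_le_0_iff_le)
  next
    case False
    let ?s = "\<rho> x / e + 3"
    have x: "norm x \<le> R" "\<rho> x < e" using nz False by auto
    have s: "0 < ?s" "?s < 4" using False x(2) e by (auto simp: field_simps)
    have "\<bar>\<rho> x\<bar> \<le> e0" using s e x unfolding e1_def by (auto simp: field_simps abs_le_iff)
    then have nd: "c0 \<le> (pd \<rho> 1 x)^2 + (pd \<rho> 2 x)^2" by (rule nondeg[OF x(1)])
    have "q x = ?s^2 * p x" unfolding p_def q_def using s by (simp add: expinv_def power2_eq_square)
    also have "\<dots> \<le> 4^2 * p x" using s by (intro mult_right_mono power_mono pos) auto
    finally have q16: "q x \<le> 16 * p x" by simp
    have "e \<le> c0 / (128 * G)" using e by (simp add: e1_def)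
    from strip_pointwise[OF pos(1)[of x] pos(2)[of x] q16 G_pos \<rho>1[OF x(1)] \<rho>1[OF x(1)] \<rho>2[OF x(1)] \<rho>2[OF x(1)] c0 nd e(1) this]
    show ?thesis unfolding pw A_def .
  qed
  have sv: "sqi v" "sqi (pd v i)" for i
    using continuous_supp_sqi(1)[where R=R, OF smooth_continuous[OF v(1)] v(2)]
      continuous_supp_sqi(1)[where R=R, OF smooth_continuous[OF smooth_pd[OF v(1)]] pd_supp[where R=R, OF v(1,2)]] by auto
  have pb: "\<bar>p x\<bar> \<le> 2" for x using pos(1)[of x] expinv_2_le unfolding p_def by simp
  have ip: "integrable lebesgue (\<lambda>x. p x * (f x)^2)" if "sqi f" for f
    using sqi_int3[OF smooth_meas[OF sp(1)] pb that that] by (simp add: power2_eq_square mult.assoc)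
  have "(\<integral>x. c0 / (2 * e) * (p x * (v x)^2) - A * e * (p x * ((pd v 1 x)^2 + (pd v 2 x)^2)) \<partial>lebesgue)
     \<le> (\<integral>x. pd (w 1) 1 x + pd (w 2) 2 x \<partial>lebesgue)"
    by (rule integral_mono[OF _ _ pw_ge]) (use iw ip sv in \<open>auto simp: distrib_left\<close>)
  also have "\<dots> = 0" using iw by simp
  finally have "(\<integral>x. c0 / (2 * e) * (p x * (v x)^2) - A * e * (p x * ((pd v 1 x)^2 + (pd v 2 x)^2)) \<partial>lebesgue) \<le> 0" .
  moreover have "(\<integral>x. c0 / (2 * e) * (p x * (v x)^2) - A * e * (p x * ((pd v 1 x)^2 + (pd v 2 x)^2)) \<partial>lebesgue)
      = c0 / (2 * e) * (\<integral>x. p x * (v x)^2 \<partial>lebesgue) - A * e * ((\<integral>x. p x * (pd v 1 x)^2 \<partial>lebesgue) + (\<integral>x. p x * (pd v 2 x)^2 \<partial>lebesgue))"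
    using ip sv by (simp add: distrib_left)
  ultimately have main: "c0 / (2 * e) * (\<integral>x. p x * (v x)^2 \<partial>lebesgue) \<le> A * e * ((\<integral>x. p x * (pd v 1 x)^2 \<partial>lebesgue) + (\<integral>x. p x * (pd v 2 x)^2 \<partial>lebesgue))"
    by linarith
  have low: "(nrm (\<lambda>x. indicator {x. - 2 * e \<le> \<rho> x} x * v x))^2 \<le> 16 * exp 1 * (\<integral>x. p x * (v x)^2 \<partial>lebesgue)"
  proof -
    have "(\<integral>x. (indicator {x. - 2 * e \<le> \<rho> x} x * v x)^2 \<partial>lebesgue) \<le> (\<integral>x. 16 * exp 1 * (p x * (v x)^2) \<partial>lebesgue)"
    proof (rule integral_mono)
      show "integrable lebesgue (\<lambda>x. (indicator {x. - 2 * e \<le> \<rho> x} x * v x)^2)"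
        by (rule sqi_int[OF sqi_indicator[OF sv(1) \<rho>_sets(1)]])
      show "integrable lebesgue (\<lambda>x. 16 * exp 1 * (p x * (v x)^2))" using ip[OF sv(1)] by simp
      fix x
      show "(indicator {x. - 2 * e \<le> \<rho> x} x * v x)^2 \<le> 16 * exp 1 * (p x * (v x)^2)"
      proof (cases "v x \<noteq> 0 \<and> - 2 * e \<le> \<rho> x")
        case True
        then have "exp (-1) / 16 \<le> p x" unfolding p_def using nz[of x] e by (intro expinv_2_ge) (auto simp: field_simps)
        then have "1 \<le> 16 * exp 1 * p x" by (simp add: exp_minus field_simps)
        then have "1 * (v x)^2 \<le> 16 * exp 1 * p x * (v x)^2" by (rule mult_right_mono) simp
        then show ?thesis using True by (simp add: mult.assoc)
      next
        case False
        then show ?thesis using pos(1)[of x] by (auto simp: indicator_def)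
      qed
    qed
    then show ?thesis by (simp add: nrm_power2)
  qed
  have up: "(\<integral>x. p x * (pd v i x)^2 \<partial>lebesgue) \<le> 2 * (strip_nrm e (pd v i))^2" for i
  proof -
    have "(\<integral>x. p x * (pd v i x)^2 \<partial>lebesgue) \<le> (\<integral>x. 2 * (indicator {x. - 3 * e < \<rho> x} x * pd v i x)^2 \<partial>lebesgue)"
    proof (rule integral_mono)
      show "integrable lebesgue (\<lambda>x. 2 * (indicator {x. - 3 * e < \<rho> x} x * pd v i x)^2)"
        using sqi_int[OF sqi_indicator[OF sv(2) \<rho>_sets(2)]] by simp
      fix x
      show "p x * (pd v i x)^2 \<le> 2 * (indicator {x. - 3 * e < \<rho> x} x * pd v i x)^2"
      proof (cases "- 3 * e < \<rho> x")
        case True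
        then show ?thesis using pb[of x] by (auto intro!: mult_right_mono)
      next
        case False
        then have "p x = 0" unfolding p_def using e by (intro expinv_eq_0) (auto simp: field_simps)
        then show ?thesis by simp
      qed
    qed (rule ip[OF sv(2)])
    then show ?thesis by (simp add: nrm_power2)
  qed
  let ?n1 = "(strip_nrm e (pd v 1))^2"
  let ?n2 = "(strip_nrm e (pd v 2))^2"
  have "c0 / (2 * e) * (\<integral>x. p x * (v x)^2 \<partial>lebesgue) \<le> A * e * (2 * ?n1 + 2 * ?n2)"
    using main up[of 1] up[of 2] A e by (smt (verit) mult_left_mono mult_pos_pos)
  then have "(\<integral>x. p x * (v x)^2 \<partial>lebesgue) \<le> A * e * (2 * ?n1 + 2 * ?n2) * (2 * e) / c0"
    using c0 e by (simp add: field_simps)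
  then have "16 * exp 1 * (\<integral>x. p x * (v x)^2 \<partial>lebesgue) \<le> 16 * exp 1 * (A * e * (2 * ?n1 + 2 * ?n2) * (2 * e) / c0)"
    by (intro mult_left_mono) auto
  also have "\<dots> = CS * e^2 * (?n1 + ?n2)"
    by (simp add: CS_def A_def power2_eq_square field_simps)
  finally show ?thesis using low by linarith
qed

text \<open>Everything outside \<open>\<Omega>\<close> is reached from infinity, since \<open>{x. \<rho> x > 0}\<close> is connected.\<close>
lemma vanishes_outside:
  fixes u :: "nat \<Rightarrow> pt \<Rightarrow> real"
  assumes u: "\<And>n. smooth (u n)"
    and flat: "\<And>n x j. (\<And>y. y \<in> \<Omega> \<Longrightarrow> dist x y \<ge> 1 / real (Suc n)) \<Longrightarrow> pd (u n) j x = 0"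
    and left: "\<And>n x. x $ 1 < - R \<Longrightarrow> u n x = 0"
  shows "norm x > R \<Longrightarrow> u n x = 0"
    and "\<tau> > 0 \<Longrightarrow> \<exists>N. \<forall>n\<ge>N. \<forall>x. \<rho> x \<ge> \<tau> \<longrightarrow> u n x = 0"
proof -
  \<comment> \<open>On a connected open set at distance at least 1/(n+1) from the domain the
    gradient vanishes, so \<open>u n\<close> is constant there.\<close>
  have const: "u n x = u n y" if "open S" "connected S" "x \<in> S" "y \<in> S"
    "\<And>z w. z \<in> S \<Longrightarrow> w \<in> \<Omega> \<Longrightarrow> dist z w \<ge> 1 / real (Suc n)" for S n x y
  proof (rule has_derivative_zero_unique_connected[OF that(1,2) _ that(3,4)])
    fix z assume "z \<in> S"
    then have "pd (u n) j z = 0" for j using that(5) by (intro flat) auto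
    then show "(u n has_derivative (\<lambda>h. 0)) (at z)" using smooth_has_derivative[OF u[of n], of z] by simp
  qed
  show out: "u n x = 0" if x: "norm x > R" for n x
  proof -
    have n1: "1 / real (Suc n) \<le> 1" by simp
    define b :: pt where "b = (- R - 1) *\<^sub>R axis 1 1"
    have b: "b $ 1 = - R - 1" "norm b > R" using R1 by (auto simp: b_def norm_axis_1)
    have "connected (- cball (0::pt) R)"
      by (rule connected_complement_bounded_convex) auto
    then have "u n x = u n b"
    proof (rule const[rotated])
      show "dist z w \<ge> 1 / real (Suc n)" if "z \<in> - cball 0 R" "w \<in> \<Omega>" for z w
      proof -
        have "norm z > R" "norm w < R - 1" using that dom_norm by auto
        then have "dist z w \<ge> 1" using norm_triangle_ineq2[of z w] unfolding dist_norm by linarith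
        with n1 show ?thesis by linarith
      qed
    qed (use x b in auto)
    also have "u n b = 0" by (rule left) (use b in simp)
    finally show ?thesis .
  qed
  define W where "W = {x. \<rho> x > 0}"
  \<comment> \<open>Points of W near which \<open>u n\<close> is eventually zero. S is open, its
    complement in W is open because \<open>u n\<close> is eventually constant near each point of W,
    and S contains a far point on the left; so connectedness of W gives S = W.\<close>
  define S where "S = {p\<in>W. \<exists>r>0. \<exists>N. \<forall>n\<ge>N. \<forall>x\<in>ball p r. u n x = 0}"
  have W: "open W" unfolding W_def by (rule open_Collect_less[OF continuous_on_const \<rho>_cont])
  have loc: "\<exists>r>0. ball p r \<subseteq> W \<and> (\<exists>N. \<forall>n\<ge>N. \<forall>x\<in>ball p r. \<forall>y\<in>ball p r. u n x = u n y)" if p: "p \<in> W" for p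
  proof -
    obtain r where r: "r > 0" "ball p (2 * r) \<subseteq> W"
      using W p by (metis openE field_sum_of_halves mult_2 half_gt_zero)
    obtain N where N: "1 / real (Suc N) < r" using r(1) nat_approx_posE by blast
    have "u n x = u n y" if n: "n \<ge> N" and xy: "x \<in> ball p r" "y \<in> ball p r" for n x y
    proof (rule const[OF open_ball connected_ball xy])
      fix z w assume z: "z \<in> ball p r" and w: "w \<in> \<Omega>"
      have "w \<notin> ball p (2 * r)" using r(2) w by (auto simp: W_def dom_eq)
      then have "dist z w \<ge> r" using z dist_triangle[of p w z] by auto
      moreover have "1 / real (Suc n) \<le> 1 / real (Suc N)" using n by (simp add: field_simps)
      ultimately show "dist z w \<ge> 1 / real (Suc n)" using N by linarith
    qed
    moreover have "ball p r \<subseteq> W" using r by (auto intro: subset_trans[OF subset_ball])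
    ultimately show ?thesis using r(1) by blast
  qed
  have "open S"
    unfolding open_contains_ball
  proof
    fix p assume "p \<in> S"
    then obtain r N where p: "p \<in> W" "r > 0" "\<forall>n\<ge>N. \<forall>x\<in>ball p r. u n x = 0" by (auto simp: S_def)
    obtain r' where r': "r' > 0" "ball p r' \<subseteq> W" using W p(1) by (metis openE)
    have "ball p (min r r') \<subseteq> S"
    proof
      fix q assume q: "q \<in> ball p (min r r')"
      then have "ball q (r - dist p q) \<subseteq> ball p r" by (intro ball_subset_ball_iff[THEN iffD2]) (auto simp: dist_commute)
      then have "\<forall>n\<ge>N. \<forall>x\<in>ball q (r - dist p q). u n x = 0" using p(3) by blast
      moreover have "r - dist p q > 0" "q \<in> W" using q r' by auto
      ultimately show "q \<in> S" unfolding S_def by blast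
    qed
    then show "\<exists>e>0. ball p e \<subseteq> S" using p(2) r'(1) by (intro exI[of _ "min r r'"]) auto
  qed
  moreover have "open (W - S)"
    unfolding open_contains_ball
  proof
    fix p assume p: "p \<in> W - S"
    then obtain r N where r: "r > 0" "ball p r \<subseteq> W" "\<forall>n\<ge>N. \<forall>x\<in>ball p r. \<forall>y\<in>ball p r. u n x = u n y"
      using loc by blast
    have "q \<notin> S" if q: "q \<in> ball p r" for q
    proof
      assume "q \<in> S"
      then obtain s M where s: "s > 0" "\<forall>n\<ge>M. \<forall>x\<in>ball q s. u n x = 0" by (auto simp: S_def)
      then have "\<forall>n\<ge>M. u n q = 0" by simp
      then have "\<forall>n\<ge>max M N. \<forall>x\<in>ball p r. u n x = 0" using r(3) q by (metis max.bounded_iff)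
      then have "p \<in> S" using p r(1) unfolding S_def by blast
      with p show False by simp
    qed
    then show "\<exists>e>0. ball p e \<subseteq> W - S" using r by blast
  qed
  moreover have "S \<inter> W \<noteq> {}"
  proof -
    define b :: pt where "b = (- R - 1) *\<^sub>R axis 1 1"
    have nb: "norm b = R + 1" using R1 by (auto simp: b_def norm_axis_1)
    have "u n x = 0" if "x \<in> ball b 1" for n x
      using that norm_triangle_ineq2[of b x] nb by (intro out) (simp add: dist_norm)
    moreover have "b \<in> W" unfolding W_def using far[of b] nb by simp
    ultimately have "b \<in> S" unfolding S_def by (auto intro!: exI[of _ "1::real"])
    with \<open>b \<in> W\<close> show ?thesis by blast
  qed
  ultimately have "W - S = {}"
    using connectedD[OF conn, folded W_def, of S "W - S"] by (auto simp: S_def)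
  then have WS: "W \<subseteq> S" by blast
  show "\<exists>N. \<forall>n\<ge>N. \<forall>x. \<rho> x \<ge> \<tau> \<longrightarrow> u n x = 0" if \<tau>: "\<tau> > 0"
  proof -
    \<comment> \<open>The index in S depends on the point; a finite cover of this compact set makes
      it uniform. Outside the ball \<open>u n\<close> vanishes for every n.\<close>
    let ?K = "{x. \<tau> \<le> \<rho> x} \<inter> cball 0 R"
    have K: "compact ?K" by (intro closed_Int_compact closed_Collect_le continuous_on_const \<rho>_cont compact_cball)
    have "\<forall>p\<in>?K. \<exists>r>0. \<exists>N. \<forall>n\<ge>N. \<forall>x\<in>ball p r. u n x = 0"
      using WS \<tau> by (force simp: W_def S_def)
    then obtain r N where rN: "\<And>p. p \<in> ?K \<Longrightarrow> r p > 0" "\<And>p n x. p \<in> ?K \<Longrightarrow> n \<ge> N p \<Longrightarrow> x \<in> ball p (r p) \<Longrightarrow> u n x = (0::real)"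
      by metis
    obtain C where C: "C \<subseteq> ?K" "finite C" "?K \<subseteq> (\<Union>p\<in>C. ball p (r p))"
      by (rule compactE_image[OF K, of ?K "\<lambda>p. ball p (r p)"]) (use rN(1) in auto)
    have "u n x = 0" if n: "n \<ge> (\<Sum>p\<in>C. N p)" and x: "\<rho> x \<ge> \<tau>" for n x
    proof (cases "norm x > R")
      case False
      then obtain p where p: "p \<in> C" "x \<in> ball p (r p)" using C(3) x by force
      have "N p \<le> (\<Sum>p\<in>C. N p)" using C(2) p(1) by (intro member_le_sum) auto
      then have "N p \<le> n" using n by linarith
      moreover have "p \<in> ?K" using p(1) C(1) by blast
      ultimately show ?thesis using rN(2) p(2) by blast
    qed (rule out)
    then show ?thesis by blast
  qed
qed

end

subsection \<open>Stream functions\<close>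

lemma shift_integrable:
  assumes "continuous_on UNIV (k :: pt \<Rightarrow> real)"
  shows "(\<lambda>s. k (x - s *\<^sub>R c)) integrable_on {a..b}"
  by (rule integrable_continuous_real) (auto intro!: continuous_on_compose2[OF assms] continuous_intros)

lemma shift_integral_has_derivative:
  assumes k: "smooth k" "\<And>x. norm x > Q \<Longrightarrow> k x = 0" and L: "L \<ge> 0"
  shows "((\<lambda>x. integral {0..L} (\<lambda>s. k (x - s *\<^sub>R c))) has_derivative
    (\<lambda>v. v $ 1 * integral {0..L} (\<lambda>s. pd k 1 (x - s *\<^sub>R c)) + v $ 2 * integral {0..L} (\<lambda>s. pd k 2 (x - s *\<^sub>R c)))) (at x)"
  unfolding has_derivative_at_alt
proof (intro conjI allI impI)
  show "bounded_linear (\<lambda>v. v $ 1 * integral {0..L} (\<lambda>s. pd k 1 (x - s *\<^sub>R c)) + v $ 2 * integral {0..L} (\<lambda>s. pd k 2 (x - s *\<^sub>R c)))"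
    by (intro bounded_linear_intros bounded_linear_vec_nth)
next
  fix e :: real assume e: "e > 0"
  then have e': "e / (L + 1) > 0" using L by simp
  obtain d where d: "d > 0" "\<And>z h. norm h < d \<Longrightarrow>
      \<bar>k (z + h) - k z - (h $ 1 * pd k 1 z + h $ 2 * pd k 2 z)\<bar> \<le> e / (L + 1) * norm h"
    by (rule uniform_differentiable[where R=Q, OF k e']) blast+
  note ik = shift_integrable[OF smooth_continuous[OF k(1)]]
    and ip = shift_integrable[OF smooth_continuous[OF smooth_pd[OF k(1)]]]
  show "\<exists>d>0. \<forall>y. norm (y - x) < d \<longrightarrow>
     norm (integral {0..L} (\<lambda>s. k (y - s *\<^sub>R c)) - integral {0..L} (\<lambda>s. k (x - s *\<^sub>R c)) -
       ((y - x) $ 1 * integral {0..L} (\<lambda>s. pd k 1 (x - s *\<^sub>R c)) + (y - x) $ 2 * integral {0..L} (\<lambda>s. pd k 2 (x - s *\<^sub>R c))))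
       \<le> e * norm (y - x)"
  proof (intro exI[of _ d] conjI allI impI d(1))
    fix y assume y: "norm (y - x) < d"
    let ?h = "y - x"
    let ?R = "\<lambda>s. k (y - s *\<^sub>R c) - k (x - s *\<^sub>R c) - (?h $ 1 * pd k 1 (x - s *\<^sub>R c) + ?h $ 2 * pd k 2 (x - s *\<^sub>R c))"
    have hi: "((\<lambda>s. ?R s) has_integral (integral {0..L} (\<lambda>s. k (y - s *\<^sub>R c)) - integral {0..L} (\<lambda>s. k (x - s *\<^sub>R c)) -
       (?h $ 1 * integral {0..L} (\<lambda>s. pd k 1 (x - s *\<^sub>R c)) + ?h $ 2 * integral {0..L} (\<lambda>s. pd k 2 (x - s *\<^sub>R c))))) {0..L}"
      by (intro has_integral_diff has_integral_add has_integral_mult_right integrable_integral ik ip)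
    have "norm (integral {0..L} (\<lambda>s. k (y - s *\<^sub>R c)) - integral {0..L} (\<lambda>s. k (x - s *\<^sub>R c)) -
       (?h $ 1 * integral {0..L} (\<lambda>s. pd k 1 (x - s *\<^sub>R c)) + ?h $ 2 * integral {0..L} (\<lambda>s. pd k 2 (x - s *\<^sub>R c))))
       \<le> (e / (L + 1) * norm ?h) * measure lborel {0..L}"
    proof (rule has_integral_bound_real[OF _ finite.emptyI hi])
      show "norm (?R s) \<le> e / (L + 1) * norm ?h" if "s \<in> {0..L} - {}" for s
        using d(2)[OF y, of "x - s *\<^sub>R c"] by (simp add: algebra_simps)
    qed (use e L in simp)
    also have "\<dots> = (e * norm ?h) * (L / (L + 1))" using L by simp
    also have "\<dots> \<le> (e * norm ?h) * 1" using e L by (intro mult_left_mono) auto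
    finally show "norm (integral {0..L} (\<lambda>s. k (y - s *\<^sub>R c)) - integral {0..L} (\<lambda>s. k (x - s *\<^sub>R c)) -
       (?h $ 1 * integral {0..L} (\<lambda>s. pd k 1 (x - s *\<^sub>R c)) + ?h $ 2 * integral {0..L} (\<lambda>s. pd k 2 (x - s *\<^sub>R c))))
       \<le> e * norm ?h" by (simp only: mult_1_right)
  qed
qed

lemma shift_integral_FTC:
  assumes k: "smooth k" and L: "L \<ge> 0"
  shows "integral {0..L} (\<lambda>s. pd k 1 (x - s *\<^sub>R axis 1 1)) = k x - k (x - L *\<^sub>R axis 1 1)"
proof -
  have "((\<lambda>s. - k (x - s *\<^sub>R axis 1 1)) has_vector_derivative pd k 1 (x - s *\<^sub>R axis 1 1)) (at s within {0..L})" for s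
  proof -
    have "((\<lambda>s. x - s *\<^sub>R axis 1 1) has_derivative (\<lambda>r. - (r *\<^sub>R axis 1 1))) (at s)"
      by (auto intro!: derivative_eq_intros)
    from has_derivative_minus[OF has_derivative_compose[OF this smooth_has_derivative[OF k]]]
    have "((\<lambda>s. - k (x - s *\<^sub>R axis 1 1)) has_real_derivative pd k 1 (x - s *\<^sub>R axis 1 1)) (at s)"
      unfolding has_field_derivative_def
      by (rule has_derivative_eq_rhs) (auto simp: axis_def)
    then show ?thesis
      by (simp add: has_real_derivative_iff_has_vector_derivative has_vector_derivative_at_within)
  qed
  from fundamental_theorem_of_calculus[OF L this] show ?thesis by (simp add: integral_unique)
qed

text \<open>u(x) is minus the integral of b2 over the horizontal ray from x to the left. Then d_1 u
  = - b2 by the fundamental theorem, and d_2 u = b1 because d_2 b2 = - d_1 b1. Left of the support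
  the ray never meets it, so u vanishes there.\<close>

lemma stream_function:
  assumes b: "smooth b1" "smooth b2" "\<And>x. norm x > Q \<Longrightarrow> b1 x = 0" "\<And>x. norm x > Q \<Longrightarrow> b2 x = 0"
    and div: "\<And>x. pd b1 1 x + pd b2 2 x = 0" and Q: "Q \<ge> 0"
  obtains u where "smooth u" "\<And>x. pd u 1 x = - b2 x" "\<And>x. pd u 2 x = b1 x" "\<And>x. x $ 1 < - Q \<Longrightarrow> u x = 0"
proof -
  let ?c = "axis 1 1 :: pt"
  define I where "I L x = integral {0..L} (\<lambda>s. b2 (x - s *\<^sub>R ?c))" for L x
  define u where "u x = - I (norm x + Q + 1) x" for x
  have z: "norm (x - s *\<^sub>R ?c) > Q" if "s > norm x + Q" for x s
    using that norm_triangle_ineq2[of "s *\<^sub>R ?c" x] Q by (simp add: norm_minus_commute)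
  have I_indep: "I L x = I (norm x + Q + 1) x" if "L \<ge> norm x + Q + 1" for L x
  proof -
    have "integral {norm x + Q + 1..L} (\<lambda>s. b2 (x - s *\<^sub>R ?c)) = integral {norm x + Q + 1..L} (\<lambda>s. 0)"
      by (rule integral_cong) (use z b(4) in auto)
    then show ?thesis unfolding I_def
      using Henstock_Kurzweil_Integration.integral_combine[of 0 "norm x + Q + 1" L "\<lambda>s. b2 (x - s *\<^sub>R ?c)"]
        that Q shift_integrable[OF smooth_continuous[OF b(2)]] by simp
  qed
  have du: "(u has_derivative (\<lambda>v. v $ 1 * (- b2 x) + v $ 2 * b1 x)) (at x)" for x
  proof -
    \<comment> \<open>The ray is truncated beyond the support at a length depending on x. For
      differentiation one length L is used that is long enough for all points within distance 1 of
      x.\<close>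
    define L where "L = norm x + Q + 2"
    have L: "L \<ge> 0" using Q by (simp add: L_def)
    have 1: "integral {0..L} (\<lambda>s. pd b2 1 (x - s *\<^sub>R ?c)) = b2 x"
      using shift_integral_FTC[OF b(2) L, of x] b(4)[OF z[of x L]] by (simp add: L_def)
    have "integral {0..L} (\<lambda>s. pd b2 2 (x - s *\<^sub>R ?c)) = integral {0..L} (\<lambda>s. - pd b1 1 (x - s *\<^sub>R ?c))"
      using div by (intro integral_cong) (simp add: add_eq_0_iff)
    also have "\<dots> = - b1 x"
      using shift_integral_FTC[OF b(1) L, of x] b(3)[OF z[of x L]] by (simp add: L_def)
    finally have 2: "integral {0..L} (\<lambda>s. pd b2 2 (x - s *\<^sub>R ?c)) = - b1 x" .
    have "(I L has_derivative (\<lambda>v. v $ 1 * b2 x + v $ 2 * (- b1 x))) (at x)"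
      unfolding I_def using shift_integral_has_derivative[where c="axis 1 1" and x=x and Q=Q, OF b(2,4) L] unfolding 1 2 .
    from has_derivative_minus[OF this]
    have "((\<lambda>y. - I L y) has_derivative (\<lambda>v. v $ 1 * (- b2 x) + v $ 2 * b1 x)) (at x)"
      by (rule has_derivative_eq_rhs) (simp add: algebra_simps)
    then show ?thesis
    proof (rule has_derivative_transform_within_open[of _ _ _ _ "ball x 1"])
      fix y assume y: "y \<in> ball x 1"
      then have "norm y < norm x + 1" using norm_triangle_ineq2[of y x] by (simp add: dist_norm norm_minus_commute)
      then show "- I L y = u y" unfolding u_def using I_indep[of y L] by (simp add: L_def)
    qed auto
  qed
  show ?thesis
  proof (rule that)
    show "smooth u" by (rule smoothI[OF du]) (intro smooth_uminus b)+
    show "pd u 1 x = - b2 x" "pd u 2 x = b1 x" for x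
      using pd_of_has_derivative[OF du, of _ x] by (auto simp: axis_def)
    show "u x = 0" if x: "x $ 1 < - Q" for x
    proof -
      have "b2 (x - s *\<^sub>R ?c) = 0" if "s \<ge> 0" for s
      proof (rule b(4))
        have "(x - s *\<^sub>R ?c) $ 1 = x $ 1 - s" by (simp add: axis_def)
        then show "norm (x - s *\<^sub>R ?c) > Q" using component_le_norm_cart[of "x - s *\<^sub>R ?c" 1] x that by linarith
      qed
      then have "I L x = integral {0..L} (\<lambda>s. 0)" for L unfolding I_def by (intro integral_cong) auto
      then show ?thesis by (simp add: u_def)
    qed
  qed
qed

subsection \<open>The div-curl estimate in the mean square\<close>

context dom
begin

text \<open>\<open>H1div\<close> for zero extensions. Since the last clause admits all smooth test
  functions, not only those supported in the domain, it says that B extended by zero is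
  divergence-free on the whole plane.\<close>

definition tang :: "(2 \<Rightarrow> pt \<Rightarrow> real) \<Rightarrow> (2 \<Rightarrow> 2 \<Rightarrow> pt \<Rightarrow> real) \<Rightarrow> bool" where
  "tang B DB \<longleftrightarrow> (\<forall>i. h1 \<Omega> (B i) (DB i)) \<and> (AE x in lebesgue. DB 1 1 x + DB 2 2 x = 0) \<and>
    (\<forall>\<phi>. smooth \<phi> \<longrightarrow> (\<integral>x. B 1 x * pd \<phi> 1 x + B 2 x * pd \<phi> 2 x \<partial>lebesgue) = 0)"

lemma tangD:
  assumes "tang B DB"
  shows "h1 \<Omega> (B i) (DB i)" "AE x in lebesgue. DB 1 1 x + DB 2 2 x = 0"
    "smooth \<phi> \<Longrightarrow> (\<integral>x. B 1 x * pd \<phi> 1 x + B 2 x * pd \<phi> 2 x \<partial>lebesgue) = 0"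
  using assms unfolding tang_def by blast+

lemma moll_zero_far:
  assumes "\<And>y. y \<notin> \<Omega> \<Longrightarrow> f y = 0" "\<And>y. y \<in> \<Omega> \<Longrightarrow> dist x y \<ge> 1 / real (Suc n)"
  shows "moll n f x = 0"
proof -
  have "f y * eta n (x - y) = 0" for y
    using assms(1)[of y] assms(2)[of y] eta_supp[of n "x - y"] by (cases "y \<in> \<Omega>") (auto simp: dist_norm)
  then show ?thesis by (simp only: conv_def integral_zero)
qed

lemma moll_supp:
  assumes "\<And>y. y \<notin> \<Omega> \<Longrightarrow> f y = 0" "norm x > R"
  shows "moll n f x = 0"
proof (rule moll_zero_far[OF assms(1)])
  fix y assume "y \<in> \<Omega>"
  then have "norm y < R - 1" by (rule dom_norm)
  then have "dist x y \<ge> 1" using norm_triangle_ineq2[of x y] assms(2) unfolding dist_norm by linarith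
  moreover have "1 / real (Suc n) \<le> 1" by simp
  ultimately show "1 / real (Suc n) \<le> dist x y" by linarith
qed

definition ee :: "nat \<Rightarrow> real" where "ee n = e1 / real (Suc n)"

lemma ee: "0 < ee n" "ee n \<le> e1" "2 * ee n \<le> e0" "ee \<longlonglongrightarrow> 0"
proof -
  show 1: "0 < ee n" "ee n \<le> e1" using e1_pos by (auto simp: ee_def field_simps)
  show "2 * ee n \<le> e0" using 1 e0 unfolding e1_def by simp
  have "(\<lambda>n. e1 * (1 / real (Suc n))) \<longlonglongrightarrow> e1 * 0"
    by (intro tendsto_mult tendsto_const) (use LIMSEQ_inverse_real_of_nat in \<open>simp add: inverse_eq_divide\<close>)
  then show "ee \<longlonglongrightarrow> 0" by (simp add: ee_def[abs_def])
qed

lemma cut_limit: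
  assumes g: "integrable lebesgue g" "\<And>x. x \<notin> \<Omega> \<Longrightarrow> g x = 0"
  shows "(\<lambda>n. \<integral>x. th (ee n) x * g x \<partial>lebesgue) \<longlonglongrightarrow> (\<integral>x. g x \<partial>lebesgue)"
proof (rule integral_dominated_convergence)
  show "integrable lebesgue (\<lambda>x. \<bar>g x\<bar>)" using g(1) by (rule integrable_abs)
  show "AE x in lebesgue. norm (th (ee n) x * g x) \<le> \<bar>g x\<bar>" for n
    using th_bounds(3) by (auto simp: abs_mult intro!: mult_left_le_one_le)
  show "AE x in lebesgue. (\<lambda>n. th (ee n) x * g x) \<longlonglongrightarrow> g x"
  proof (rule always_eventually, rule allI)
    fix x
    show "(\<lambda>n. th (ee n) x * g x) \<longlonglongrightarrow> g x"
    proof (cases "x \<in> \<Omega>")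
      case True
      then have "\<rho> x < 0" by (simp add: dom_eq)
      then have "\<forall>\<^sub>F n in sequentially. ee n < - \<rho> x / 2" by (intro order_tendstoD(2)[OF ee(4)]) simp
      then have "\<forall>\<^sub>F n in sequentially. g x = th (ee n) x * g x"
      proof eventually_elim
        fix n assume "ee n < - \<rho> x / 2"
        then have "\<rho> x / ee n \<le> -2" using ee(1)[of n] by (simp add: field_simps)
        then show "g x = th (ee n) x * g x" by (simp add: th_def T(8))
      qed
      then show ?thesis by (rule Lim_transform_eventually[OF tendsto_const])
    qed (simp add: g(2))
  qed
qed (use g(1) th_meas in \<open>auto intro: borel_measurable_times\<close>)

text \<open>The sets \<open>- 3 * e < \<rho> x\<close> shrink to the complement of the domain as e
  tends to 0, and f vanishes there.\<close>

lemma strip_limit: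
  assumes f: "sqi f" "\<And>x. x \<notin> \<Omega> \<Longrightarrow> f x = 0"
  shows "(\<lambda>n. strip_nrm (ee n) f) \<longlonglongrightarrow> 0"
proof (rule nrm_tendsto_0_dominated[OF _ f(1)])
  show "(\<lambda>x. indicator {x. - 3 * ee n < \<rho> x} x * f x) \<in> borel_measurable lebesgue" for n
    by (rule sqi_meas[OF sqi_indicator[OF f(1) \<rho>_sets(2)]])
  show "\<bar>indicator {x. - 3 * ee n < \<rho> x} x * f x\<bar> \<le> \<bar>f x\<bar>" for n x by (simp add: indicator_def)
  show "AE x in lebesgue. (\<lambda>n. indicator {x. - 3 * ee n < \<rho> x} x * f x) \<longlonglongrightarrow> 0"
  proof (rule always_eventually, rule allI)
    fix x
    show "(\<lambda>n. indicator {x. - 3 * ee n < \<rho> x} x * f x) \<longlonglongrightarrow> 0"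
    proof (cases "x \<in> \<Omega>")
      case True
      then have "\<rho> x < 0" by (simp add: dom_eq)
      then have "\<forall>\<^sub>F n in sequentially. ee n < - \<rho> x / 3" by (intro order_tendstoD(2)[OF ee(4)]) simp
      then have "\<forall>\<^sub>F n in sequentially. 0 = indicator {x. - 3 * ee n < \<rho> x} x * f x"
        by eventually_elim (auto simp: indicator_def)
      then show ?thesis by (rule Lim_transform_eventually[OF tendsto_const])
    qed (simp add: f(2))
  qed
qed

lemma nrm_indicator_diff:
  assumes "sqi f" "sqi g" "S \<in> sets lebesgue"
  shows "nrm (\<lambda>x. indicator S x * f x - indicator S x * g x) \<le> nrm (\<lambda>x. f x - g x)"
proof (rule nrm_mono[OF sqi_diff[OF assms(1,2)]])
  show "(\<lambda>x. indicator S x * f x - indicator S x * g x) \<in> borel_measurable lebesgue"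
    by (rule sqi_meas[OF sqi_diff[OF sqi_indicator[OF assms(1,3)] sqi_indicator[OF assms(2,3)]]])
qed (simp add: indicator_def)

text \<open>Testing the tangency condition with the mollifying kernel shows that the mollified field
  is divergence-free on the plane, so it has a stream function. The gradient of that function
  vanishes away from the domain, so \<open>vanishes_outside\<close> applies.\<close>

lemma tang_moll:
  assumes B: "tang B DB"
  obtains u where "\<And>n. smooth (u n)" "\<And>n x. pd (u n) 1 x = - moll n (B 2) x" "\<And>n x. pd (u n) 2 x = moll n (B 1) x"
    "\<And>n x. norm x > R \<Longrightarrow> u n x = 0" "\<And>\<tau>. \<tau> > 0 \<Longrightarrow> \<exists>N. \<forall>n\<ge>N. \<forall>x. \<rho> x \<ge> \<tau> \<longrightarrow> u n x = 0"
proof -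
  note B1 = tangD(1)[OF B]
  have div: "pd (moll n (B 1)) 1 x + pd (moll n (B 2)) 2 x = 0" for n x
  proof -
    have pc: "pd (moll n (B i)) j x = (\<integral>y. B i y * pd (eta n) j (x - y) \<partial>lebesgue)" for i j
      unfolding conv_def[symmetric] by (rule pd_conv[OF h1_integrable(1)[OF B1] eta_smooth eta_supp1])
    have i: "integrable lebesgue (\<lambda>y. B i y * pd (eta n) j (x - y))" for i j
      by (rule conv_integrable[OF h1_integrable(1)[OF B1] smooth_continuous[OF smooth_pd[OF eta_smooth]] pd_supp[OF eta_smooth eta_supp1]])
    have p: "pd (\<lambda>y. eta n (x - y)) j y = - pd (eta n) j (x - y)" for y j
      using pd_affine[OF eta_smooth[of n], of "-1" x j y] by (simp add: algebra_simps)
    have "(\<integral>y. B 1 y * pd (eta n) 1 (x - y) + B 2 y * pd (eta n) 2 (x - y) \<partial>lebesgue)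
      = - (\<integral>y. B 1 y * pd (\<lambda>y. eta n (x - y)) 1 y + B 2 y * pd (\<lambda>y. eta n (x - y)) 2 y \<partial>lebesgue)"
      unfolding p by (subst Bochner_Integration.integral_minus[symmetric]) (simp add: add.commute)
    also have "\<dots> = 0" using tangD(3)[OF B eta_shift_smooth] by simp
    finally show ?thesis using i unfolding pc by simp
  qed
  have z: "y \<notin> \<Omega> \<Longrightarrow> B i y = 0" for i y using h1D(3)[OF B1] .
  have "\<exists>u. smooth u \<and> (\<forall>x. pd u 1 x = - moll n (B 2) x) \<and> (\<forall>x. pd u 2 x = moll n (B 1) x) \<and> (\<forall>x. x $ 1 < - R \<longrightarrow> u x = 0)" for n
    using stream_function[where Q=R, OF moll_h1(1)[OF B1] moll_h1(1)[OF B1] moll_supp[OF z] moll_supp[OF z] div] R1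
    by (metis order_trans zero_le_one)
  then obtain u where u: "\<And>n. smooth (u n)" "\<And>n x. pd (u n) 1 x = - moll n (B 2) x" "\<And>n x. pd (u n) 2 x = moll n (B 1) x"
    "\<And>n x. x $ 1 < - R \<Longrightarrow> u n x = 0" by metis
  have flat: "pd (u n) j x = 0" if "\<And>y. y \<in> \<Omega> \<Longrightarrow> dist x y \<ge> 1 / real (Suc n)" for n x j
    using exhaust_2[of j] u(2,3)[of n x] moll_zero_far[OF z that] by auto
  show ?thesis
  proof (rule that[of u])
    show "u n x = 0" if "norm x > R" for n x
      by (rule vanishes_outside(1)[of u]) (use u(1,4) flat that in \<open>assumption | blast\<close>)+
    show "\<exists>N. \<forall>n\<ge>N. \<forall>x. \<rho> x \<ge> \<tau> \<longrightarrow> u n x = 0" if "\<tau> > 0" for \<tau>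
      by (rule vanishes_outside(2)[of u]) (use u(1,4) flat that in \<open>assumption | blast\<close>)+
  qed (rule u)+
qed

definition wcurl2 :: "(2 \<Rightarrow> 2 \<Rightarrow> pt \<Rightarrow> real) \<Rightarrow> pt \<Rightarrow> real" where
  "wcurl2 DB x = DB 2 1 x - DB 1 2 x"

lemma wcurl2_sqi: "tang B DB \<Longrightarrow> sqi (wcurl2 DB)"
  unfolding wcurl2_def using tangD(1)[of B DB] by (intro sqi_diff h1D(2)) blast+

text \<open>Test the weak derivatives of B with \<open>th\<close> times the stream function u of the
  mollified field. The curl term is bounded with \<open>Poincare\<close> for u. The boundary term
  carries \<open>mm\<close>, of size 1/e, but u is of order e on the strip by
  \<open>strip_inequality\<close>, so what remains is a strip norm.\<close>

lemma div_curl_cut: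
  assumes B: "tang B DB"
  shows "(\<integral>x. th (ee k) x * (B 1 x * B 1 x + B 2 x * B 2 x) \<partial>lebesgue)
    \<le> 2 * R * nrm (B 2) * nrm (wcurl2 DB) + CT * G * sqrt CS *
      (strip_nrm (ee k) (B 1) + strip_nrm (ee k) (B 2))
      * (nrm (B 1) + nrm (B 2))"
proof -
  let ?e = "ee k"
  note B1 = tangD(1)[OF B]
  note sB = h1D(1)[OF B1] and sDB = h1D(2)[OF B1] and Bm = moll_h1[OF B1]
  note e = ee(1)[of k] ee(2)[of k]
  obtain u where u: "\<And>n. smooth (u n)" "\<And>n x. pd (u n) 1 x = - moll n (B 2) x" "\<And>n x. pd (u n) 2 x = moll n (B 1) x"
    "\<And>n x. norm x > R \<Longrightarrow> u n x = 0" "\<And>\<tau>. \<tau> > 0 \<Longrightarrow> \<exists>N. \<forall>n\<ge>N. \<forall>x. \<rho> x \<ge> \<tau> \<longrightarrow> u n x = 0"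
    by (rule tang_moll[OF B]) blast
  \<comment> \<open>Here the mollification index is tied to the fixed strip width: from N on, the
    stream functions vanish where \<open>strip_inequality\<close> requires it.\<close>
  obtain N where N: "\<And>n x. n \<ge> N \<Longrightarrow> \<rho> x \<ge> ?e \<Longrightarrow> u n x = 0" using u(5)[OF e(1)] by blast
  have su: "sqi (u n)" for n by (rule continuous_supp_sqi(1)[OF smooth_continuous[OF u(1)] u(4)])
  let ?I2 = "\<lambda>x. indicator {x. - 2 * ?e \<le> \<rho> x} x :: real"
  let ?I3 = "\<lambda>x. indicator {x. - 3 * ?e < \<rho> x} x :: real"
  define s where "s n = nrm (\<lambda>x. ?I3 x * moll n (B 1) x) + nrm (\<lambda>x. ?I3 x * moll n (B 2) x)" for n
  have ident: "(\<integral>x. th ?e x * moll n (B 1) x * B 1 x \<partial>lebesgue) + (\<integral>x. th ?e x * moll n (B 2) x * B 2 x \<partial>lebesgue)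
     = (\<integral>x. th ?e x * u n x * wcurl2 DB x \<partial>lebesgue)
       - (\<integral>x. mm ?e x * pd \<rho> 2 x * (?I2 x * u n x) * B 1 x \<partial>lebesgue) + (\<integral>x. mm ?e x * pd \<rho> 1 x * (?I2 x * u n x) * B 2 x \<partial>lebesgue)" for n
  proof -
    let ?\<phi> = "\<lambda>x. th ?e x * u n x"
    have t: "test_fn \<Omega> ?\<phi>" by (rule test_fn_mult[OF th_test[OF e(1)] u(1)])
    \<comment> \<open>The factor \<open>mm\<close> lives on the strip, so the indicator can be
      inserted; afterwards only the norm of u over the strip matters.\<close>
    have I2: "mm ?e x * pd \<rho> j x * (?I2 x * u n x) = mm ?e x * pd \<rho> j x * u n x" for j x
      using mm_strip[OF e(1), of x] by (cases "mm ?e x = 0") auto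
    have cb: "\<bar>mm ?e x * pd \<rho> j x\<bar> \<le> CT / ?e * G" for j x
      by (rule cut_coeff_bound) (use mm_bound[OF e(1)] mm_norm[OF e(1)] \<rho>1 G_pos in auto)
    have cm: "(\<lambda>x. mm ?e x * pd \<rho> j x) \<in> borel_measurable lebesgue" for j
      by (intro borel_measurable_times th_meas smooth_meas smooth_pd \<rho>_smooth)
    note i1 = sqi_int3[OF cm cb su sB] and i2 = sqi_int3[OF th_meas(1) th_bounds(3) Bm(2) sB]
      and i3 = sqi_int3[OF th_meas(1) th_bounds(3) su sDB]
    have e2: "(\<integral>x. pd ?\<phi> 2 x * B 1 x \<partial>lebesgue) = - (\<integral>x. ?\<phi> x * DB 1 2 x \<partial>lebesgue)"
      and e1: "(\<integral>x. pd ?\<phi> 1 x * B 2 x \<partial>lebesgue) = - (\<integral>x. ?\<phi> x * DB 2 1 x \<partial>lebesgue)"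
      by (rule h1D(5)[OF B1 t])+
    have "(\<integral>x. pd ?\<phi> 2 x * B 1 x \<partial>lebesgue) = (\<integral>x. mm ?e x * pd \<rho> 2 x * u n x * B 1 x + th ?e x * moll n (B 1) x * B 1 x \<partial>lebesgue)"
      by (simp add: pd_mult th_smooth u pd_th algebra_simps)
    also have "\<dots> = (\<integral>x. mm ?e x * pd \<rho> 2 x * u n x * B 1 x \<partial>lebesgue) + (\<integral>x. th ?e x * moll n (B 1) x * B 1 x \<partial>lebesgue)"
      by (rule Bochner_Integration.integral_add[OF i1 i2])
    finally have f2: "(\<integral>x. pd ?\<phi> 2 x * B 1 x \<partial>lebesgue) = \<dots>" .
    have "(\<integral>x. pd ?\<phi> 1 x * B 2 x \<partial>lebesgue) = (\<integral>x. mm ?e x * pd \<rho> 1 x * u n x * B 2 x - th ?e x * moll n (B 2) x * B 2 x \<partial>lebesgue)"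
      by (simp add: pd_mult th_smooth u pd_th algebra_simps)
    also have "\<dots> = (\<integral>x. mm ?e x * pd \<rho> 1 x * u n x * B 2 x \<partial>lebesgue) - (\<integral>x. th ?e x * moll n (B 2) x * B 2 x \<partial>lebesgue)"
      by (rule Bochner_Integration.integral_diff[OF i1 i2])
    finally have f1: "(\<integral>x. pd ?\<phi> 1 x * B 2 x \<partial>lebesgue) = \<dots>" .
    have "(\<integral>x. th ?e x * u n x * wcurl2 DB x \<partial>lebesgue) = (\<integral>x. ?\<phi> x * DB 2 1 x \<partial>lebesgue) - (\<integral>x. ?\<phi> x * DB 1 2 x \<partial>lebesgue)"
      unfolding wcurl2_def right_diff_distrib by (rule Bochner_Integration.integral_diff[OF i3 i3])
    then show ?thesis unfolding I2 using e1 e2 f1 f2 by linarith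
  qed
  have est: "(\<integral>x. th ?e x * moll n (B 1) x * B 1 x \<partial>lebesgue) + (\<integral>x. th ?e x * moll n (B 2) x * B 2 x \<partial>lebesgue)
     \<le> 2 * R * nrm (B 2) * nrm (wcurl2 DB) + CT * G * sqrt CS * s n * (nrm (B 1) + nrm (B 2))" if n: "n \<ge> N" for n
  proof -
    have sI: "sqi (\<lambda>x. ?I2 x * u n x)" by (rule sqi_indicator[OF su \<rho>_sets(1)])
    have "(nrm (\<lambda>x. ?I2 x * u n x))^2 \<le> CS * ?e^2 * ((nrm (\<lambda>x. ?I3 x * pd (u n) 1 x))^2 + (nrm (\<lambda>x. ?I3 x * pd (u n) 2 x))^2)"
      by (rule strip_inequality[OF e u(1) u(4) N[OF n]])
    also have "\<dots> = CS * ?e^2 * ((nrm (\<lambda>x. ?I3 x * moll n (B 2) x))^2 + (nrm (\<lambda>x. ?I3 x * moll n (B 1) x))^2)"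
      unfolding u(2,3) by (simp add: nrm_uminus)
    also have "\<dots> \<le> CS * ?e^2 * (s n)^2"
      unfolding s_def using CS_nonneg by (intro mult_left_mono) (auto simp: power2_sum)
    also have "\<dots> = (sqrt CS * ?e * s n)^2" using CS_nonneg by (simp add: power_mult_distrib)
    finally have nI: "nrm (\<lambda>x. ?I2 x * u n x) \<le> sqrt CS * ?e * s n"
      by (rule power2_le_imp_le) (use CS_nonneg e in \<open>simp add: s_def\<close>)
    have cb: "\<bar>mm ?e x * pd \<rho> j x\<bar> \<le> CT / ?e * G" for j x
      by (rule cut_coeff_bound) (use mm_bound[OF e(1)] mm_norm[OF e(1)] \<rho>1 G_pos in auto)
    have cm: "(\<lambda>x. mm ?e x * pd \<rho> j x) \<in> borel_measurable lebesgue" for j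
      by (intro borel_measurable_times th_meas smooth_meas smooth_pd \<rho>_smooth)
    have bd: "\<bar>\<integral>x. mm ?e x * pd \<rho> j x * (?I2 x * u n x) * B i x \<partial>lebesgue\<bar> \<le> CT * G * sqrt CS * s n * nrm (B i)" for i j
    proof -
      have "\<bar>\<integral>x. mm ?e x * pd \<rho> j x * (?I2 x * u n x) * B i x \<partial>lebesgue\<bar> \<le> CT / ?e * G * nrm (\<lambda>x. ?I2 x * u n x) * nrm (B i)"
        by (rule nrm_abs_int3[OF cm cb sI sB])
      also have "\<dots> \<le> CT / ?e * G * (sqrt CS * ?e * s n) * nrm (B i)"
        using CT_nonneg e G_pos nI by (intro mult_right_mono mult_left_mono) auto
      also have "\<dots> = CT * G * sqrt CS * s n * nrm (B i)" using e by simp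
      finally show ?thesis .
    qed
    have "\<bar>\<integral>x. th ?e x * u n x * wcurl2 DB x \<partial>lebesgue\<bar> \<le> 1 * nrm (u n) * nrm (wcurl2 DB)"
      by (rule nrm_abs_int3[OF th_meas(1) th_bounds(3) su wcurl2_sqi[OF B]])
    also have "\<dots> \<le> 1 * (2 * R * nrm (B 2)) * nrm (wcurl2 DB)"
    proof -
      have R0: "R \<ge> 0" using R1 by simp
      have "nrm (u n) \<le> 2 * R * nrm (pd (u n) 1)" by (rule Poincare[OF u(1) u(4) R0])
      also have "nrm (pd (u n) 1) = nrm (moll n (B 2))" by (simp add: u(2)[abs_def] nrm_uminus cong: nrm_def) (simp add: nrm_def u(2))
      also have "2 * R * nrm (moll n (B 2)) \<le> 2 * R * nrm (B 2)" using Bm(6) R0 by (intro mult_left_mono) auto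
      finally show ?thesis by (intro mult_right_mono mult_left_mono) auto
    qed
    finally have "\<bar>\<integral>x. th ?e x * u n x * wcurl2 DB x \<partial>lebesgue\<bar> \<le> 2 * R * nrm (B 2) * nrm (wcurl2 DB)" by simp
    then show ?thesis unfolding ident distrib_left using bd[of 2 1] bd[of 1 2] by linarith
  qed
  have "(\<lambda>n. (\<integral>x. th ?e x * moll n (B 1) x * B 1 x \<partial>lebesgue) + (\<integral>x. th ?e x * moll n (B 2) x * B 2 x \<partial>lebesgue))
     \<longlonglongrightarrow> (\<integral>x. th ?e x * B 1 x * B 1 x \<partial>lebesgue) + (\<integral>x. th ?e x * B 2 x * B 2 x \<partial>lebesgue)"
    by (intro tendsto_add triple_tendsto[OF _ _ _ _ _ _ th_meas(1) th_bounds(3)] Bm sB) (simp_all add: nrm_def)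
  moreover have "(\<lambda>n. 2 * R * nrm (B 2) * nrm (wcurl2 DB) + CT * G * sqrt CS * s n * (nrm (B 1) + nrm (B 2)))
     \<longlonglongrightarrow> 2 * R * nrm (B 2) * nrm (wcurl2 DB) + CT * G * sqrt CS *
      (nrm (\<lambda>x. ?I3 x * B 1 x) + nrm (\<lambda>x. ?I3 x * B 2 x)) * (nrm (B 1) + nrm (B 2))"
  proof -
    have "(\<lambda>n. nrm (\<lambda>x. ?I3 x * moll n (B i) x)) \<longlonglongrightarrow> nrm (\<lambda>x. ?I3 x * B i x)" for i
    proof (rule nrm_tendsto)
      show "(\<lambda>n. nrm (\<lambda>x. ?I3 x * moll n (B i) x - ?I3 x * B i x)) \<longlonglongrightarrow> 0"
        by (rule tendsto_sandwich[OF _ _ tendsto_const Bm(4)])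
          (auto intro!: always_eventually nrm_indicator_diff Bm sB \<rho>_sets)
    qed (intro sqi_indicator Bm sB \<rho>_sets)+
    then show ?thesis unfolding s_def by (intro tendsto_intros)
  qed
  ultimately have "(\<integral>x. th ?e x * B 1 x * B 1 x \<partial>lebesgue) + (\<integral>x. th ?e x * B 2 x * B 2 x \<partial>lebesgue)
    \<le> 2 * R * nrm (B 2) * nrm (wcurl2 DB) + CT * G * sqrt CS *
      (nrm (\<lambda>x. ?I3 x * B 1 x) + nrm (\<lambda>x. ?I3 x * B 2 x)) * (nrm (B 1) + nrm (B 2))"
    by (rule LIMSEQ_le) (use est in blast)
  moreover have "(\<integral>x. th ?e x * (B 1 x * B 1 x + B 2 x * B 2 x) \<partial>lebesgue)
     = (\<integral>x. th ?e x * B 1 x * B 1 x \<partial>lebesgue) + (\<integral>x. th ?e x * B 2 x * B 2 x \<partial>lebesgue)"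
    unfolding distrib_left mult.assoc[symmetric]
    by (intro Bochner_Integration.integral_add sqi_int3[OF th_meas(1) th_bounds(3)] sB)
  ultimately show ?thesis by simp
qed

text \<open>As the width tends to 0 the cutoffs tend to 1 and the strip norms of B to 0, so only the
  curl term of \<open>div_curl_cut\<close> survives.\<close>

theorem div_curl_L2:
  assumes B: "tang B DB"
  shows "(nrm (B 1))^2 + (nrm (B 2))^2 \<le> 4 * R^2 * (nrm (wcurl2 DB))^2"
proof -
  note B1 = tangD(1)[OF B]
  note sB = h1D(1)[OF B1]
  have "(\<lambda>k. \<integral>x. th (ee k) x * (B 1 x * B 1 x + B 2 x * B 2 x) \<partial>lebesgue) \<longlonglongrightarrow> (\<integral>x. B 1 x * B 1 x + B 2 x * B 2 x \<partial>lebesgue)"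
    by (rule cut_limit) (auto intro!: Bochner_Integration.integrable_add sqi_mult_integrable sB simp: h1D(3)[OF B1])
  moreover have "(\<lambda>k. 2 * R * nrm (B 2) * nrm (wcurl2 DB) + CT * G * sqrt CS *
      (strip_nrm (ee k) (B 1) + strip_nrm (ee k) (B 2))
      * (nrm (B 1) + nrm (B 2))) \<longlonglongrightarrow> 2 * R * nrm (B 2) * nrm (wcurl2 DB) + CT * G * sqrt CS * (0 + 0) * (nrm (B 1) + nrm (B 2))"
    by (intro tendsto_intros strip_limit sB h1D(3)[OF B1])
  ultimately have "(\<integral>x. B 1 x * B 1 x + B 2 x * B 2 x \<partial>lebesgue)
     \<le> 2 * R * nrm (B 2) * nrm (wcurl2 DB) + CT * G * sqrt CS * (0 + 0) * (nrm (B 1) + nrm (B 2))"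
    by (rule LIMSEQ_le) (use div_curl_cut[OF B] in blast)
  moreover have "(\<integral>x. B 1 x * B 1 x + B 2 x * B 2 x \<partial>lebesgue) = (nrm (B 1))^2 + (nrm (B 2))^2"
    using sqi_mult_integrable[OF sB sB] unfolding nrm_power2 unfolding power2_eq_square by simp
  ultimately have *: "(nrm (B 1))^2 + (nrm (B 2))^2 \<le> 2 * R * nrm (B 2) * nrm (wcurl2 DB)" by simp
  \<comment> \<open>Young's inequality; the resulting square of \<open>nrm (B 2)\<close> is absorbed
    on the left.\<close>
  have "2 * (2 * R * nrm (B 2) * nrm (wcurl2 DB)) \<le> (nrm (B 2))^2 + (2 * R * nrm (wcurl2 DB))^2"
    using sum_squares_bound[of "nrm (B 2)" "2 * R * nrm (wcurl2 DB)"] by (simp add: mult_ac)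
  moreover have "a + b \<le> q" if "2 * p \<le> b + q" "a + b \<le> p" "0 \<le> a" for a b p q :: real
    using that by linarith
  ultimately have "(nrm (B 1))^2 + (nrm (B 2))^2 \<le> (2 * R * nrm (wcurl2 DB))^2"
    using * zero_le_power2 by blast
  then show ?thesis by (simp add: power_mult_distrib)
qed

end

subsection \<open>The div-curl estimate for the gradient\<close>

context dom
begin

definition normal_part :: "(2 \<Rightarrow> pt \<Rightarrow> real) \<Rightarrow> pt \<Rightarrow> real" where
  "normal_part B x = indicator \<Omega> x * (pd \<rho> 1 x * B 1 x + pd \<rho> 2 x * B 2 x)"

definition D_normal_part :: "(2 \<Rightarrow> pt \<Rightarrow> real) \<Rightarrow> (2 \<Rightarrow> 2 \<Rightarrow> pt \<Rightarrow> real) \<Rightarrow> 2 \<Rightarrow> pt \<Rightarrow> real" where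
  "D_normal_part B DB j x = indicator \<Omega> x * (pd \<rho> 1 x * DB 1 j x + pd \<rho> 2 x * DB 2 j x
     + (pd (pd \<rho> 1) j x * B 1 x + pd (pd \<rho> 2) j x * B 2 x))"

lemma dom_meas: "\<Omega> \<in> sets lebesgue" using open_dom by auto

lemma sqi_dom_mult:
  assumes "sqi f" "smooth g" "\<And>x. norm x \<le> R \<Longrightarrow> \<bar>g x\<bar> \<le> H" "H \<ge> 0"
  shows "sqi (\<lambda>x. indicator \<Omega> x * g x * f x)" "nrm (\<lambda>x. indicator \<Omega> x * g x * f x) \<le> H * nrm f"
proof -
  have b: "\<bar>indicator \<Omega> x * g x\<bar> \<le> H" for x
    using assms(3,4) dom_norm[of x] by (auto simp: indicator_def)
  have m: "(\<lambda>x. indicator \<Omega> x * g x) \<in> borel_measurable lebesgue"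
    using dom_meas by (intro borel_measurable_times smooth_meas assms borel_measurable_indicator)
  show "sqi (\<lambda>x. indicator \<Omega> x * g x * f x)" by (rule sqi_bounded_mult[OF assms(1) m b])
  show "nrm (\<lambda>x. indicator \<Omega> x * g x * f x) \<le> H * nrm f" by (rule nrm_bounded_mult[OF assms(1) m b])
qed

lemma h1_dom_mult:
  assumes f: "h1 \<Omega> f D" and g: "smooth g" "\<And>x. norm x \<le> R \<Longrightarrow> \<bar>g x\<bar> \<le> H" "\<And>x j. norm x \<le> R \<Longrightarrow> \<bar>pd g j x\<bar> \<le> H" "H \<ge> 0"
  shows "h1 \<Omega> (\<lambda>x. indicator \<Omega> x * g x * f x) (\<lambda>j x. indicator \<Omega> x * g x * D j x + indicator \<Omega> x * pd g j x * f x)"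
  unfolding h1_def
proof (intro conjI allI impI)
  note sf = h1D(1)[OF f] and sD = h1D(2)[OF f]
  show "sqi (\<lambda>x. indicator \<Omega> x * g x * f x)" by (rule sqi_dom_mult(1)[OF sf g(1,2,4)])
  show "sqi (\<lambda>x. indicator \<Omega> x * g x * D j x + indicator \<Omega> x * pd g j x * f x)" for j
    by (intro sqi_add sqi_dom_mult(1)[OF sD g(1,2,4)] sqi_dom_mult(1)[OF sf smooth_pd[OF g(1)] g(3,4)])
  fix \<phi> j assume \<phi>: "test_fn \<Omega> \<phi>"
  have t: "test_fn \<Omega> (\<lambda>x. \<phi> x * g x)" by (rule test_fn_mult[OF \<phi> g(1)])
  obtain C where C: "\<And>x. \<bar>\<phi> x\<bar> \<le> C" "\<And>x j. \<bar>pd \<phi> j x\<bar> \<le> C" by (rule test_fn_bounded[OF \<phi>]) blast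
  note m = test_fn_meas[OF \<phi>]
  have z: "x \<notin> \<Omega> \<Longrightarrow> f x = 0" "x \<notin> \<Omega> \<Longrightarrow> D j x = 0" for x using h1D(3,4)[OF f] by blast+
  have i1: "integrable lebesgue (\<lambda>x. pd \<phi> j x * (indicator \<Omega> x * g x * f x))"
  proof -
    have "sqi (\<lambda>x. pd \<phi> j x * (indicator \<Omega> x * g x * f x))"
      by (rule sqi_bounded_mult[OF sqi_dom_mult(1)[OF sf g(1,2,4)] m(2) C(2)])
    moreover have "pd \<phi> j x * (indicator \<Omega> x * g x * f x) = 0" if "norm x > R" for x
      using that dom_norm[of x] by (cases "x \<in> \<Omega>") auto
    ultimately show ?thesis by (rule sqi_supp_integrable)
  qed
  have i2: "integrable lebesgue (\<lambda>x. \<phi> x * (indicator \<Omega> x * g' x * h x))" if "sqi (\<lambda>x. indicator \<Omega> x * g' x * h x)" for g' h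
  proof -
    have "sqi (\<lambda>x. \<phi> x * (indicator \<Omega> x * g' x * h x))" by (rule sqi_bounded_mult[OF that m(1) C(1)])
    moreover have "\<phi> x * (indicator \<Omega> x * g' x * h x) = 0" if "norm x > R" for x
      using that dom_norm[of x] by (cases "x \<in> \<Omega>") auto
    ultimately show ?thesis by (rule sqi_supp_integrable)
  qed
  note i3 = i2[OF sqi_dom_mult(1)[OF sD g(1,2,4)]] and i4 = i2[OF sqi_dom_mult(1)[OF sf smooth_pd[OF g(1)] g(3,4)]]
  have "(\<integral>x. pd (\<lambda>x. \<phi> x * g x) j x * f x \<partial>lebesgue) = - (\<integral>x. \<phi> x * g x * D j x \<partial>lebesgue)"
    by (rule h1D(5)[OF f t])
  moreover have "pd (\<lambda>x. \<phi> x * g x) j x * f x = pd \<phi> j x * (indicator \<Omega> x * g x * f x) + \<phi> x * (indicator \<Omega> x * pd g j x * f x)" for x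
    using z(1)[of x] by (simp add: pd_mult test_fn_smooth[OF \<phi>] g indicator_def algebra_simps)
  moreover have "\<phi> x * g x * D j x = \<phi> x * (indicator \<Omega> x * g x * D j x)" for x
    using z(2)[of x] by (cases "x \<in> \<Omega>") auto
  ultimately have "(\<integral>x. pd \<phi> j x * (indicator \<Omega> x * g x * f x) + \<phi> x * (indicator \<Omega> x * pd g j x * f x) \<partial>lebesgue)
     = - (\<integral>x. \<phi> x * (indicator \<Omega> x * g x * D j x) \<partial>lebesgue)" by simp
  then show "(\<integral>x. pd \<phi> j x * (indicator \<Omega> x * g x * f x) \<partial>lebesgue)
     = - (\<integral>x. \<phi> x * (indicator \<Omega> x * g x * D j x + indicator \<Omega> x * pd g j x * f x) \<partial>lebesgue)"
    using i1 i3 i4 by (simp add: distrib_left)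
qed (simp_all add: indicator_def)

lemma h1_add:
  assumes f: "h1 \<Omega> f D" and g: "h1 \<Omega> g E"
  shows "h1 \<Omega> (\<lambda>x. f x + g x) (\<lambda>j x. D j x + E j x)"
  unfolding h1_def
proof (intro conjI allI impI)
  fix \<phi> j assume \<phi>: "test_fn \<Omega> \<phi>"
  obtain C where C: "\<And>x. \<bar>\<phi> x\<bar> \<le> C" "\<And>x j. \<bar>pd \<phi> j x\<bar> \<le> C" by (rule test_fn_bounded[OF \<phi>]) blast
  have sphi: "sqi \<phi>" "sqi (pd \<phi> j)" for j
    using continuous_supp_sqi(1)[OF smooth_continuous[OF test_fn_smooth[OF \<phi>]] test_fn_supp[OF \<phi>]]
      continuous_supp_sqi(1)[OF smooth_continuous[OF smooth_pd[OF test_fn_smooth[OF \<phi>]]] pd_supp[where R="R - 1", OF test_fn_smooth[OF \<phi>] test_fn_supp[OF \<phi>]]]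
    by auto
  show "(\<integral>x. pd \<phi> j x * (f x + g x) \<partial>lebesgue) = - (\<integral>x. \<phi> x * (D j x + E j x) \<partial>lebesgue)"
    using h1D(5)[OF f \<phi>, of j] h1D(5)[OF g \<phi>, of j] sqi_mult_integrable[OF sphi(2) h1D(1)[OF f]]
      sqi_mult_integrable[OF sphi(2) h1D(1)[OF g]] sqi_mult_integrable[OF sphi(1) h1D(2)[OF f]] sqi_mult_integrable[OF sphi(1) h1D(2)[OF g]]
    by (simp add: distrib_left)
qed (use h1D[OF f] h1D[OF g] in \<open>auto intro: sqi_add\<close>)

lemma h1_normal_part:
  assumes B: "tang B DB"
  shows "h1 \<Omega> (normal_part B) (D_normal_part B DB)"
proof -
  have 1: "h1 \<Omega> (\<lambda>x. indicator \<Omega> x * pd \<rho> i x * B i x) (\<lambda>j x. indicator \<Omega> x * pd \<rho> i x * DB i j x + indicator \<Omega> x * pd (pd \<rho> i) j x * B i x)" for i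
    by (rule h1_dom_mult[OF tangD(1)[OF B] smooth_pd[OF \<rho>_smooth] \<rho>1 \<rho>2]) (use G_pos in auto)
  have "normal_part B = (\<lambda>x. indicator \<Omega> x * pd \<rho> 1 x * B 1 x + indicator \<Omega> x * pd \<rho> 2 x * B 2 x)"
    "D_normal_part B DB = (\<lambda>j x. (indicator \<Omega> x * pd \<rho> 1 x * DB 1 j x + indicator \<Omega> x * pd (pd \<rho> 1) j x * B 1 x)
       + (indicator \<Omega> x * pd \<rho> 2 x * DB 2 j x + indicator \<Omega> x * pd (pd \<rho> 2) j x * B 2 x))"
    by (auto simp: normal_part_def D_normal_part_def fun_eq_iff algebra_simps)
  with h1_add[OF 1[of 1] 1[of 2]] show ?thesis by simp
qed

lemma smooth_sqi_integrable:
  assumes f: "sqi f" "\<And>x. x \<notin> \<Omega> \<Longrightarrow> f x = 0" and g: "smooth g"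
  shows "integrable lebesgue (\<lambda>x. g x * f x)"
proof -
  have "continuous_on UNIV g" by (rule smooth_continuous[OF g])
  then have "compact (g ` cball 0 R)" by (intro compact_continuous_image) (auto intro: continuous_on_subset)
  then obtain C where "\<forall>x\<in>cball 0 R. \<bar>g x\<bar> \<le> C" using compact_imp_bounded bounded_iff[of "g ` cball 0 R"] by auto
  then have C: "norm x \<le> R \<Longrightarrow> \<bar>g x\<bar> \<le> \<bar>C\<bar>" for x by force
  have "sqi (\<lambda>x. indicator \<Omega> x * g x * f x)" by (rule sqi_dom_mult(1)[OF f(1) g C]) auto
  moreover have "indicator \<Omega> x * g x * f x = g x * f x" for x using f(2)[of x] by (cases "x \<in> \<Omega>") auto
  ultimately have "sqi (\<lambda>x. g x * f x)" by simp
  moreover have "g x * f x = 0" if "norm x > R" for x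
    using that dom_norm[of x] f(2)[of x] by (cases "x \<in> \<Omega>") auto
  ultimately show ?thesis by (rule sqi_supp_integrable)
qed

text \<open>The normal component has zero trace, so that its extension by zero is weakly differentiable on the plane.\<close>
lemma normal_part_zero_trace:
  assumes B: "tang B DB" and \<xi>: "smooth \<xi>"
  shows "(\<integral>x. pd \<xi> j x * normal_part B x \<partial>lebesgue) = - (\<integral>x. \<xi> x * D_normal_part B DB j x \<partial>lebesgue)"
proof -
  note B1 = tangD(1)[OF B] and hw = h1_normal_part[OF B]
  have zB: "x \<notin> \<Omega> \<Longrightarrow> B i x = 0" for i x using h1D(3)[OF B1] .
  note int_sm = smooth_sqi_integrable
  let ?A = "\<lambda>x. pd \<xi> j x * normal_part B x + \<xi> x * D_normal_part B DB j x"
  \<comment> \<open>The weak derivative of \<open>normal_part B\<close> is tested with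
    \<open>th * \<xi>\<close> and the tangency condition with \<open>th * ?P\<close>. Both produce
    the same term \<open>?M\<close>, containing \<open>mm\<close>, so in the difference no
    derivative of the cutoff is left and the limit is harmless.\<close>
  let ?P = "\<lambda>x. pd \<rho> j x * \<xi> x"
  let ?T = "\<lambda>x. B 1 x * pd ?P 1 x + B 2 x * pd ?P 2 x"
  have sP: "smooth ?P" by (intro smooth_mult smooth_pd \<rho>_smooth \<xi>)
  have iA: "integrable lebesgue ?A"
    using int_sm[OF h1D(1)[OF hw] h1D(3)[OF hw] smooth_pd[OF \<xi>]] int_sm[OF h1D(2)[OF hw] h1D(4)[OF hw] \<xi>]
    by (intro Bochner_Integration.integrable_add) auto
  have iT1: "integrable lebesgue (\<lambda>x. g x * B i x)" if "smooth g" for g i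
    by (rule int_sm[OF h1D(1)[OF B1] zB that])
  have iT: "integrable lebesgue ?T"
    using iT1[OF smooth_pd[OF sP]] by (intro Bochner_Integration.integrable_add) (simp_all add: mult.commute)
  have key: "(\<integral>x. th (ee n) x * ?A x \<partial>lebesgue) = (\<integral>x. th (ee n) x * ?T x \<partial>lebesgue)" for n
  proof -
    let ?\<theta> = "th (ee n)"
    have t: "test_fn \<Omega> (\<lambda>x. ?\<theta> x * \<xi> x)" by (rule test_fn_mult[OF th_test[OF ee(1)] \<xi>])
    have 1: "(\<integral>x. pd (\<lambda>x. ?\<theta> x * \<xi> x) j x * normal_part B x \<partial>lebesgue) = - (\<integral>x. ?\<theta> x * \<xi> x * D_normal_part B DB j x \<partial>lebesgue)"
      by (rule h1D(5)[OF hw t])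
    have sm: "smooth (\<lambda>x. ?\<theta> x * ?P x)" by (intro smooth_mult th_smooth sP)
    have 2: "(\<integral>x. B 1 x * pd (\<lambda>x. ?\<theta> x * ?P x) 1 x + B 2 x * pd (\<lambda>x. ?\<theta> x * ?P x) 2 x \<partial>lebesgue) = 0"
      by (rule tangD(3)[OF B sm])
    let ?M = "\<lambda>x. mm (ee n) x * pd \<rho> j x * \<xi> x * normal_part B x"
    have iM: "integrable lebesgue ?M"
      by (rule int_sm[OF h1D(1)[OF hw] h1D(3)[OF hw]]) (auto intro!: smooth_mult mm_smooth smooth_pd \<rho>_smooth \<xi>)
    have iA1: "integrable lebesgue (\<lambda>x. ?\<theta> x * pd \<xi> j x * normal_part B x)"
      by (rule int_sm[OF h1D(1)[OF hw] h1D(3)[OF hw]]) (auto intro!: smooth_mult th_smooth smooth_pd \<xi>)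
    have iA2: "integrable lebesgue (\<lambda>x. ?\<theta> x * \<xi> x * D_normal_part B DB j x)"
      by (rule int_sm[OF h1D(2)[OF hw] h1D(4)[OF hw]]) (auto intro!: smooth_mult th_smooth \<xi>)
    have iT2: "integrable lebesgue (\<lambda>x. ?\<theta> x * ?T x)"
      using iT1[OF smooth_mult[OF th_smooth[of "ee n"] smooth_pd[OF sP, of 1]], of 1]
        iT1[OF smooth_mult[OF th_smooth[of "ee n"] smooth_pd[OF sP, of 2]], of 2]
      by (auto simp: distrib_left mult_ac intro!: Bochner_Integration.integrable_add)
    have "(\<integral>x. ?M x \<partial>lebesgue) + (\<integral>x. ?\<theta> x * pd \<xi> j x * normal_part B x \<partial>lebesgue) = (\<integral>x. pd (\<lambda>x. ?\<theta> x * \<xi> x) j x * normal_part B x \<partial>lebesgue)"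
      by (subst Bochner_Integration.integral_add[OF iM iA1, symmetric])
        (simp add: pd_mult th_smooth \<xi> pd_th algebra_simps)
    moreover have "(\<integral>x. ?\<theta> x * ?A x \<partial>lebesgue) = (\<integral>x. ?\<theta> x * pd \<xi> j x * normal_part B x \<partial>lebesgue) + (\<integral>x. ?\<theta> x * \<xi> x * D_normal_part B DB j x \<partial>lebesgue)"
      by (subst Bochner_Integration.integral_add[OF iA1 iA2, symmetric]) (simp add: algebra_simps)
    moreover have "(\<integral>x. ?M x \<partial>lebesgue) + (\<integral>x. ?\<theta> x * ?T x \<partial>lebesgue)
       = (\<integral>x. B 1 x * pd (\<lambda>x. ?\<theta> x * ?P x) 1 x + B 2 x * pd (\<lambda>x. ?\<theta> x * ?P x) 2 x \<partial>lebesgue)"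
    proof (subst Bochner_Integration.integral_add[OF iM iT2, symmetric], rule Bochner_Integration.integral_cong)
      fix x
      have p: "pd (\<lambda>x. ?\<theta> x * ?P x) i x = mm (ee n) x * pd \<rho> i x * ?P x + ?\<theta> x * pd ?P i x" for i
        by (simp only: pd_mult[OF th_smooth sP] pd_th)
      have wx: "normal_part B x = pd \<rho> 1 x * B 1 x + pd \<rho> 2 x * B 2 x"
        using zB[of x] by (cases "x \<in> \<Omega>") (auto simp: normal_part_def)
      show "?M x + ?\<theta> x * ?T x = B 1 x * pd (\<lambda>x. ?\<theta> x * ?P x) 1 x + B 2 x * pd (\<lambda>x. ?\<theta> x * ?P x) 2 x"
        unfolding p wx by (simp only: algebra_simps)
    qed simp
    ultimately show ?thesis using 1 2 by linarith
  qed
  have "(\<lambda>n. \<integral>x. th (ee n) x * ?A x \<partial>lebesgue) \<longlonglongrightarrow> (\<integral>x. ?A x \<partial>lebesgue)"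
    by (rule cut_limit[OF iA]) (simp add: h1D(3,4)[OF hw])
  moreover have "(\<lambda>n. \<integral>x. th (ee n) x * ?T x \<partial>lebesgue) \<longlonglongrightarrow> (\<integral>x. ?T x \<partial>lebesgue)"
    by (rule cut_limit[OF iT]) (simp add: zB)
  ultimately have "(\<integral>x. ?A x \<partial>lebesgue) = (\<integral>x. ?T x \<partial>lebesgue)"
    unfolding key by (rule LIMSEQ_unique)
  also have "\<dots> = 0" by (rule tangD(3)[OF B sP])
  finally show ?thesis
    using int_sm[OF h1D(1)[OF hw] h1D(3)[OF hw] smooth_pd[OF \<xi>]] int_sm[OF h1D(2)[OF hw] h1D(4)[OF hw] \<xi>] by simp
qed

text \<open>By the zero trace, differentiation commutes with mollification on the whole plane, so
  \<open>strip_inequality\<close> applies to the mollified normal part and its estimate passes to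
  the limit.\<close>

lemma normal_part_strip:
  assumes B: "tang B DB"
  shows "(nrm (\<lambda>x. indicator {x. - 2 * ee k \<le> \<rho> x} x * normal_part B x))^2 \<le> CS * (ee k)^2 *
    ((strip_nrm (ee k) (D_normal_part B DB 1))^2 + (strip_nrm (ee k) (D_normal_part B DB 2))^2)"
proof -
  note hw = h1_normal_part[OF B]
  note m = moll_h1[OF hw]
  have pdm: "pd (moll n (normal_part B)) j x = moll n (D_normal_part B DB j) x" for n j x
  proof (rule pd_moll_moll[OF h1_integrable[OF hw]])
    show "(\<integral>y. normal_part B y * pd (\<lambda>y. eta n (x - y)) j y \<partial>lebesgue) = - (\<integral>y. D_normal_part B DB j y * eta n (x - y) \<partial>lebesgue)"
      using normal_part_zero_trace[OF B eta_shift_smooth[of n x], where j=j] by (simp add: mult.commute)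
  qed
  have zw: "x \<notin> \<Omega> \<Longrightarrow> normal_part B x = 0" for x using h1D(3)[OF hw] .
  \<comment> \<open>A positive distance separates the compact set where \<open>\<rho>\<close> >=
    \<open>ee k\<close> from the closed set where \<open>\<rho>\<close> <= 0; kernels of smaller
    radius do not bridge it.\<close>
  obtain d where d: "d > 0" "\<And>x y. \<rho> x \<ge> ee k \<Longrightarrow> norm x \<le> R \<Longrightarrow> y \<in> \<Omega> \<Longrightarrow> dist x y \<ge> d"
  proof -
    have "\<exists>d>0. \<forall>x\<in>{x. ee k \<le> \<rho> x} \<inter> cball 0 R. \<forall>y\<in>{x. \<rho> x \<le> 0}. d \<le> dist x y"
      by (rule separate_compact_closed)
        (use ee(1)[of k] in \<open>auto intro!: closed_Int_compact closed_Collect_le continuous_on_const \<rho>_cont\<close>)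
    then show ?thesis using that by (force simp: dom_eq)
  qed
  obtain N where N: "1 / real (Suc N) < d" using d(1) nat_approx_posE by blast
  let ?I2 = "\<lambda>x. indicator {x. - 2 * ee k \<le> \<rho> x} x :: real"
  let ?I3 = "\<lambda>x. indicator {x. - 3 * ee k < \<rho> x} x :: real"
  have est: "(nrm (\<lambda>x. ?I2 x * moll n (normal_part B) x))^2 \<le> CS * (ee k)^2 *
    ((nrm (\<lambda>x. ?I3 x * moll n (D_normal_part B DB 1) x))^2 + (nrm (\<lambda>x. ?I3 x * moll n (D_normal_part B DB 2) x))^2)" if n: "n \<ge> N" for n
  proof -
    have out: "moll n (normal_part B) x = 0" if "norm x > R" for x by (rule moll_supp) (use zw that in auto)
    have "moll n (normal_part B) x = 0" if x: "\<rho> x \<ge> ee k" for x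
    proof (cases "norm x > R")
      case True then show ?thesis by (rule out)
    next
      case False
      have "1 / real (Suc n) \<le> 1 / real (Suc N)" using n by (simp add: field_simps)
      then have "1 / real (Suc n) \<le> d" using N by linarith
      then have "1 / real (Suc n) \<le> dist x y" if "y \<in> \<Omega>" for y
        using d(2)[OF x _ that] False by force
      then show ?thesis by (rule moll_zero_far[rotated]) (use zw in auto)
    qed
    from strip_inequality[OF ee(1,2) m(1) out this]
    show ?thesis unfolding pdm by blast
  qed
  have lim: "(\<lambda>n. nrm (\<lambda>x. indicator S x * moll n f x)) \<longlonglongrightarrow> nrm (\<lambda>x. indicator S x * f x)"
    if "\<And>n. sqi (moll n f)" "sqi f" "(\<lambda>n. nrm (\<lambda>x. moll n f x - f x)) \<longlonglongrightarrow> 0" "S \<in> sets lebesgue" for S f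
  proof (rule nrm_tendsto)
    show "(\<lambda>n. nrm (\<lambda>x. indicator S x * moll n f x - indicator S x * f x)) \<longlonglongrightarrow> 0"
      by (rule tendsto_sandwich[OF _ _ tendsto_const that(3)])
        (auto intro!: always_eventually nrm_indicator_diff that)
  qed (intro sqi_indicator that)+
  have l1: "(\<lambda>n. (nrm (\<lambda>x. ?I2 x * moll n (normal_part B) x))^2) \<longlonglongrightarrow> (nrm (\<lambda>x. ?I2 x * normal_part B x))^2"
    by (intro tendsto_power lim m h1D(1)[OF hw] \<rho>_sets)
  have l2: "(\<lambda>n. CS * (ee k)^2 * ((nrm (\<lambda>x. ?I3 x * moll n (D_normal_part B DB 1) x))^2 + (nrm (\<lambda>x. ?I3 x * moll n (D_normal_part B DB 2) x))^2))
     \<longlonglongrightarrow> CS * (ee k)^2 * ((nrm (\<lambda>x. ?I3 x * D_normal_part B DB 1 x))^2 + (nrm (\<lambda>x. ?I3 x * D_normal_part B DB 2 x))^2)"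
    by (intro tendsto_intros lim m h1D(2)[OF hw] \<rho>_sets)
  show ?thesis by (rule LIMSEQ_le[OF l1 l2]) (use est in blast)
qed

definition grad2 :: "(2 \<Rightarrow> 2 \<Rightarrow> pt \<Rightarrow> real) \<Rightarrow> real" where
  "grad2 DB = (nrm (DB 1 1))^2 + (nrm (DB 1 2))^2 + (nrm (DB 2 1))^2 + (nrm (DB 2 2))^2"

text \<open>Two applications of \<open>weak_jacobian\<close>, with the roles of B_1 and B_2
  exchanged, and div B = 0 turn twice the cut-off determinant into the terms \<open>mm\<close> B_j
  d_j(B . grad \<open>\<rho>\<close>), minus Hessian terms \<open>mm\<close> (d_i d_j
  \<open>\<rho>\<close>) B_i B_j. The latter are the curvature contribution, controlled by
  \<open>trace_bound\<close>. The former are integrated by parts once more, which yields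
  \<open>m2\<close> (B . grad \<open>\<rho>\<close>)^2: the factor 1/e^2 is compensated by
  \<open>normal_part_strip\<close>.\<close>

lemma grad_cut:
  assumes B: "tang B DB"
  shows "(\<integral>x. th (ee k) x * ((DB 1 1 x)^2 + (DB 1 2 x)^2 + (DB 2 1 x)^2 + (DB 2 2 x)^2) \<partial>lebesgue)
    \<le> (nrm (wcurl2 DB))^2 + CT * CS * ((strip_nrm (ee k) (D_normal_part B DB 1))^2
        + (strip_nrm (ee k) (D_normal_part B DB 2))^2)
      + 2 * G * (2 * G / c0) * ((nrm (B 1))^2 + nrm (B 1) * (nrm (DB 1 1) + nrm (DB 1 2))
        + ((nrm (B 2))^2 + nrm (B 2) * (nrm (DB 2 1) + nrm (DB 2 2))))"
proof -
  let ?e = "ee k"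
  note B1 = tangD(1)[OF B] and hw = h1_normal_part[OF B]
  note sB = h1D(1)[OF B1] and sDB = h1D(2)[OF B1] and e = ee(1)[of k] ee(3)[of k]
  have divz: "AE x in lebesgue. DB 2 2 x = - DB 1 1 x" using tangD(2)[OF B] by eventually_elim simp
  have zB: "x \<notin> \<Omega> \<Longrightarrow> B i x = 0" for i x using h1D(3)[OF B1] .
  have cb: "\<bar>mm ?e x * pd \<rho> j x\<bar> \<le> CT / ?e * G" for j x
    by (rule cut_coeff_bound) (use mm_bound[OF e(1)] mm_norm[OF e(1)] \<rho>1 G_pos in auto)
  have cm: "(\<lambda>x. mm ?e x * pd \<rho> j x) \<in> borel_measurable lebesgue" for j
    by (intro borel_measurable_times th_meas smooth_meas smooth_pd \<rho>_smooth)
  have cb2: "\<bar>mm ?e x * pd (pd \<rho> i) j x\<bar> \<le> CT / ?e * G" for i j x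
    by (rule cut_coeff_bound) (use mm_bound[OF e(1)] mm_norm[OF e(1)] \<rho>2 G_pos in auto)
  have cm2: "(\<lambda>x. mm ?e x * pd (pd \<rho> i) j x) \<in> borel_measurable lebesgue" for i j
    by (intro borel_measurable_times th_meas smooth_meas smooth_pd \<rho>_smooth)
  note iB = sqi_int3[OF cm cb sB sDB] and iBB = sqi_int3[OF cm2 cb2 sB sB]
    and iD = sqi_int3[OF th_meas(1) th_bounds(3) sDB sDB] and iw = sqi_int3[OF th_meas(2) mm_bound[OF e(1)] sB h1D(2)[OF hw]]
  let ?J = "(\<integral>x. th ?e x * DB 1 1 x * DB 2 2 x \<partial>lebesgue) - (\<integral>x. th ?e x * DB 1 2 x * DB 2 1 x \<partial>lebesgue)"
  have J1: "?J = (\<integral>x. mm ?e x * pd \<rho> 2 x * B 1 x * DB 2 1 x \<partial>lebesgue) - (\<integral>x. mm ?e x * pd \<rho> 1 x * B 1 x * DB 2 2 x \<partial>lebesgue)"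
    using weak_jacobian[OF B1[of 1] B1[of 2] th_test[OF e(1)]] by (simp add: pd_th)
  have J2: "- ?J = (\<integral>x. mm ?e x * pd \<rho> 2 x * B 2 x * DB 1 1 x \<partial>lebesgue) - (\<integral>x. mm ?e x * pd \<rho> 1 x * B 2 x * DB 1 2 x \<partial>lebesgue)"
    using weak_jacobian[OF B1[of 2] B1[of 1] th_test[OF e(1)]] by (simp add: pd_th mult_ac)
  have c1: "(\<integral>x. mm ?e x * pd \<rho> 1 x * B 1 x * DB 2 2 x \<partial>lebesgue) = - (\<integral>x. mm ?e x * pd \<rho> 1 x * B 1 x * DB 1 1 x \<partial>lebesgue)"
    by (subst Bochner_Integration.integral_minus[symmetric], rule integral_cong_AE)
      (use iB divz in \<open>auto intro!: borel_measurable_integrable elim!: eventually_mono\<close>)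
  have c2: "(\<integral>x. mm ?e x * pd \<rho> 2 x * B 2 x * DB 2 2 x \<partial>lebesgue) = - (\<integral>x. mm ?e x * pd \<rho> 2 x * B 2 x * DB 1 1 x \<partial>lebesgue)"
    by (subst Bochner_Integration.integral_minus[symmetric], rule integral_cong_AE)
      (use iB divz in \<open>auto intro!: borel_measurable_integrable elim!: eventually_mono\<close>)
  let ?X = "\<lambda>j. (\<integral>x. mm ?e x * B j x * D_normal_part B DB j x \<partial>lebesgue)"
  let ?H = "\<lambda>i j. (\<integral>x. mm ?e x * pd (pd \<rho> i) j x * B i x * B j x \<partial>lebesgue)"
  have X: "?X j = (\<integral>x. mm ?e x * pd \<rho> 1 x * B j x * DB 1 j x \<partial>lebesgue) + (\<integral>x. mm ?e x * pd \<rho> 2 x * B j x * DB 2 j x \<partial>lebesgue)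
     + (?H 1 j + ?H 2 j)" for j
  proof -
    have "mm ?e x * B j x * D_normal_part B DB j x = mm ?e x * pd \<rho> 1 x * B j x * DB 1 j x + mm ?e x * pd \<rho> 2 x * B j x * DB 2 j x
      + (mm ?e x * pd (pd \<rho> 1) j x * B 1 x * B j x + mm ?e x * pd (pd \<rho> 2) j x * B 2 x * B j x)" for x
      using zB[of x] by (simp add: D_normal_part_def indicator_def algebra_simps)
    then show ?thesis using iB iBB by simp
  qed
  have twoJ: "2 * ?J = ?X 1 + ?X 2 - (?H 1 1 + ?H 2 1 + ?H 1 2 + ?H 2 2)"
  proof -
    have gen: "2 * J = P' + Y + (h1 + h2) + (V + W + (h3 + h4)) - (h1 + h2 + h3 + h4)"
      if "J = Y - P" "- J = Z - V" "P = - P'" "W = - Z" for J Y P Z V P' W h1 h2 h3 h4 :: real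
      using that by linarith
    show ?thesis unfolding X by (rule gen[OF J1 J2 c1 c2])
  qed
  have Xw: "\<bar>?X 1 + ?X 2\<bar> \<le> CT * CS * ((strip_nrm ?e (D_normal_part B DB 1))^2
        + (strip_nrm ?e (D_normal_part B DB 2))^2)"
  proof -
    have m2b: "\<bar>m2 ?e x\<bar> \<le> CT / ?e^2" for x using m2_bound[OF e(1)] .
    have m2n: "norm x \<le> R" if "m2 ?e x \<noteq> 0" for x
      using m2_strip[OF e(1) that] e(1) dom_norm[of x] by (simp add: dom_eq)
    have cb3: "\<bar>m2 ?e x * pd \<rho> j x\<bar> \<le> CT / ?e^2 * G" for j x
      by (rule cut_coeff_bound) (use m2b m2n \<rho>1 G_pos in auto)
    have cm3: "(\<lambda>x. m2 ?e x * pd \<rho> j x) \<in> borel_measurable lebesgue" for j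
      by (intro borel_measurable_times th_meas smooth_meas smooth_pd \<rho>_smooth)
    \<comment> \<open>The second integration by parts. Summed over j, the middle terms cancel
      because the divergence of B vanishes.\<close>
    have pr: "(\<integral>x. m2 ?e x * pd \<rho> j x * B j x * normal_part B x \<partial>lebesgue) + (\<integral>x. mm ?e x * DB j j x * normal_part B x \<partial>lebesgue) + ?X j = 0" for j
      using weak_product_rule[OF B1[of j] hw mm_test[OF e(1)], of j] by (simp add: pd_mm)
    have c3: "(\<integral>x. mm ?e x * DB 2 2 x * normal_part B x \<partial>lebesgue) = - (\<integral>x. mm ?e x * DB 1 1 x * normal_part B x \<partial>lebesgue)"
      by (subst Bochner_Integration.integral_minus[symmetric], rule integral_cong_AE)
        (use sqi_int3[OF th_meas(2) mm_bound[OF e(1)] sDB h1D(1)[OF hw]] divz in \<open>auto intro!: borel_measurable_integrable elim!: eventually_mono\<close>)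
    let ?I2 = "\<lambda>x. indicator {x. - 2 * ?e \<le> \<rho> x} x :: real"
    have sI: "sqi (\<lambda>x. ?I2 x * normal_part B x)" by (rule sqi_indicator[OF h1D(1)[OF hw] \<rho>_sets(1)])
    have "(\<integral>x. m2 ?e x * pd \<rho> 1 x * B 1 x * normal_part B x \<partial>lebesgue) + (\<integral>x. m2 ?e x * pd \<rho> 2 x * B 2 x * normal_part B x \<partial>lebesgue)
       = (\<integral>x. m2 ?e x * pd \<rho> 1 x * B 1 x * normal_part B x + m2 ?e x * pd \<rho> 2 x * B 2 x * normal_part B x \<partial>lebesgue)"
      by (rule Bochner_Integration.integral_add[symmetric]; rule sqi_int3[OF cm3 cb3 sB h1D(1)[OF hw]])
    \<comment> \<open>The sum over j reassembles the normal part, which therefore occurs squared;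
      each copy is then of order e on the strip.\<close>
    also have "\<dots> = (\<integral>x. m2 ?e x * (?I2 x * normal_part B x) * (?I2 x * normal_part B x) \<partial>lebesgue)"
    proof (rule Bochner_Integration.integral_cong)
      fix x
      have wx: "normal_part B x = pd \<rho> 1 x * B 1 x + pd \<rho> 2 x * B 2 x"
        using zB[of x] by (cases "x \<in> \<Omega>") (auto simp: normal_part_def)
      show "m2 ?e x * pd \<rho> 1 x * B 1 x * normal_part B x + m2 ?e x * pd \<rho> 2 x * B 2 x * normal_part B x = m2 ?e x * (?I2 x * normal_part B x) * (?I2 x * normal_part B x)"
      proof (cases "m2 ?e x = 0")
        case False
        then have "?I2 x = 1" using m2_strip[OF e(1) False] by simp
        then show ?thesis by (simp only: mult_1_left) (simp add: wx algebra_simps)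
      qed simp
    qed simp
    finally have "\<bar>?X 1 + ?X 2\<bar> = \<bar>\<integral>x. m2 ?e x * (?I2 x * normal_part B x) * (?I2 x * normal_part B x) \<partial>lebesgue\<bar>"
      using pr[of 1] pr[of 2] c3 by linarith
    also have "\<dots> \<le> CT / ?e^2 * nrm (\<lambda>x. ?I2 x * normal_part B x) * nrm (\<lambda>x. ?I2 x * normal_part B x)"
      by (rule nrm_abs_int3[OF th_meas(3) m2b sI sI])
    also have "\<dots> = CT / ?e^2 * (nrm (\<lambda>x. ?I2 x * normal_part B x))^2" by (simp add: power2_eq_square)
    also have "\<dots> \<le> CT / ?e^2 * (CS * ?e^2 * ((strip_nrm ?e (D_normal_part B DB 1))^2
        + (strip_nrm ?e (D_normal_part B DB 2))^2))"
      using CT_nonneg by (intro mult_left_mono normal_part_strip[OF B]) auto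
    also have "\<dots> = CT * CS * ((strip_nrm ?e (D_normal_part B DB 1))^2
        + (strip_nrm ?e (D_normal_part B DB 2))^2)"
      using e(1) by simp
    finally show ?thesis .
  qed
  have Hb: "\<bar>?H 1 1 + ?H 2 1 + ?H 1 2 + ?H 2 2\<bar> \<le> 2 * G * (2 * G / c0) * ((nrm (B 1))^2 + nrm (B 1) * (nrm (DB 1 1) + nrm (DB 1 2))
        + ((nrm (B 2))^2 + nrm (B 2) * (nrm (DB 2 1) + nrm (DB 2 2))))"
  proof -
    have b3': "\<bar>- mm ?e x\<bar> \<le> CT / ?e" for x using mm_bound[OF e(1)] by simp
    have m3': "(\<lambda>x. - mm ?e x) \<in> borel_measurable lebesgue" using th_meas(2) by (rule borel_measurable_uminus)
    note im = sqi_int3[OF m3' b3' sB sB]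
    let ?t = "\<lambda>i. (\<integral>x. (- mm ?e x) * B i x * B i x \<partial>lebesgue)"
    have "\<bar>?H i j\<bar> \<le> G / 2 * (?t i + ?t j)" for i j
    proof -
      have "\<bar>?H i j\<bar> \<le> (\<integral>x. \<bar>mm ?e x * pd (pd \<rho> i) j x * B i x * B j x\<bar> \<partial>lebesgue)" by (rule integral_abs_bound)
      also have "\<dots> \<le> (\<integral>x. G / 2 * ((- mm ?e x) * B i x * B i x + (- mm ?e x) * B j x * B j x) \<partial>lebesgue)"
      proof (rule integral_mono)
        show "integrable lebesgue (\<lambda>x. \<bar>mm ?e x * pd (pd \<rho> i) j x * B i x * B j x\<bar>)" using iBB by (rule integrable_abs)
        show "integrable lebesgue (\<lambda>x. G / 2 * ((- mm ?e x) * B i x * B i x + (- mm ?e x) * B j x * B j x))"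
          by (intro integrable_mult_right Bochner_Integration.integrable_add im)
        fix x
        show "\<bar>mm ?e x * pd (pd \<rho> i) j x * B i x * B j x\<bar> \<le> G / 2 * ((- mm ?e x) * B i x * B i x + (- mm ?e x) * B j x * B j x)"
        proof (cases "mm ?e x = 0")
          case False
          have mp: "0 \<le> - mm ?e x" using mm_nonpos[OF e(1), of x] by simp
          have "2 * \<bar>B i x * B j x\<bar> \<le> B i x * B i x + B j x * B j x"
          proof -
            show ?thesis using sum_squares_bound[of "\<bar>B i x\<bar>" "\<bar>B j x\<bar>"]
              by (simp add: abs_mult power2_eq_square mult.assoc)
          qed
          then have y: "\<bar>B i x * B j x\<bar> \<le> (B i x * B i x + B j x * B j x) / 2"
            unfolding add_divide_distrib by linarith
          have "\<bar>mm ?e x * pd (pd \<rho> i) j x * B i x * B j x\<bar> = (- mm ?e x) * (\<bar>pd (pd \<rho> i) j x\<bar> * \<bar>B i x * B j x\<bar>)"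
            using mp by (simp add: abs_mult)
          also have "\<dots> \<le> (- mm ?e x) * (G * ((B i x * B i x + B j x * B j x) / 2))"
            using G_pos by (intro mult_left_mono[OF _ mp] mult_mono \<rho>2[OF mm_norm[OF e(1) False]] y) auto
          finally show ?thesis by (simp add: algebra_simps)
        qed simp
      qed
      also have "\<dots> = G / 2 * (?t i + ?t j)" using im by (simp only: integral_mult_right_zero Bochner_Integration.integral_add)
      finally show ?thesis .
    qed
    note h = this
    have "\<bar>?H 1 1 + ?H 2 1 + ?H 1 2 + ?H 2 2\<bar> \<le> 2 * G * (?t 1 + ?t 2)"
      using h[of 1 1] h[of 2 1] h[of 1 2] h[of 2 2] by (simp add: algebra_simps)
    also have "\<dots> \<le> 2 * G * (2 * G / c0 * ((nrm (B 1))^2 + nrm (B 1) * (nrm (DB 1 1) + nrm (DB 1 2)))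
        + 2 * G / c0 * ((nrm (B 2))^2 + nrm (B 2) * (nrm (DB 2 1) + nrm (DB 2 2))))"
      using G_pos by (intro mult_left_mono add_mono trace_bound[OF B1 e]) auto
    finally show ?thesis by (simp add: algebra_simps)
  qed
  note iDD = iD
  have ic: "integrable lebesgue (\<lambda>x. th ?e x * wcurl2 DB x * wcurl2 DB x)"
    by (rule sqi_int3[OF th_meas(1) th_bounds(3) wcurl2_sqi[OF B] wcurl2_sqi[OF B]])
  have "(\<integral>x. th ?e x * ((DB 1 1 x)^2 + (DB 1 2 x)^2 + (DB 2 1 x)^2 + (DB 2 2 x)^2) \<partial>lebesgue)
     = (\<integral>x. th ?e x * wcurl2 DB x * wcurl2 DB x - 2 * (th ?e x * DB 1 1 x * DB 2 2 x - th ?e x * DB 1 2 x * DB 2 1 x) \<partial>lebesgue)"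
  proof (rule integral_cong_AE)
    show "(\<lambda>x. th ?e x * ((DB 1 1 x)^2 + (DB 1 2 x)^2 + (DB 2 1 x)^2 + (DB 2 2 x)^2)) \<in> borel_measurable lebesgue"
      by (intro borel_measurable_times borel_measurable_add borel_measurable_power th_meas sqi_meas sDB)
    show "(\<lambda>x. th ?e x * wcurl2 DB x * wcurl2 DB x - 2 * (th ?e x * DB 1 1 x * DB 2 2 x - th ?e x * DB 1 2 x * DB 2 1 x)) \<in> borel_measurable lebesgue"
      by (intro borel_measurable_times borel_measurable_diff borel_measurable_const th_meas sqi_meas sDB wcurl2_sqi[OF B])
    show "AE x in lebesgue. th ?e x * ((DB 1 1 x)^2 + (DB 1 2 x)^2 + (DB 2 1 x)^2 + (DB 2 2 x)^2)
      = th ?e x * wcurl2 DB x * wcurl2 DB x - 2 * (th ?e x * DB 1 1 x * DB 2 2 x - th ?e x * DB 1 2 x * DB 2 1 x)"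
      using divz by eventually_elim (simp add: wcurl2_def power2_eq_square algebra_simps)
  qed
  also have "\<dots> = (\<integral>x. th ?e x * wcurl2 DB x * wcurl2 DB x \<partial>lebesgue) - 2 * ?J"
    using iDD ic by simp
  also have "(\<integral>x. th ?e x * wcurl2 DB x * wcurl2 DB x \<partial>lebesgue) \<le> (nrm (wcurl2 DB))^2"
    using nrm_abs_int3[OF th_meas(1) th_bounds(3) wcurl2_sqi[OF B] wcurl2_sqi[OF B], of ?e]
    by (simp add: power2_eq_square)
  finally show ?thesis using twoJ Xw Hb by linarith
qed

text \<open>A generous choice: with a = \<open>4 * G^2 / c0\<close> it dominates both 2 and 2 (a + 2
  a^2).\<close>

definition KG :: real where "KG = 2 + 64 * (1 + 4 * G^2 / c0)^2"

theorem div_curl_grad: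
  assumes B: "tang B DB"
  shows "grad2 DB \<le> KG * ((nrm (wcurl2 DB))^2 + ((nrm (B 1))^2 + (nrm (B 2))^2))"
proof -
  note B1 = tangD(1)[OF B] and hw = h1_normal_part[OF B]
  note sB = h1D(1)[OF B1] and sDB = h1D(2)[OF B1]
  define Q where "Q = (nrm (B 1))^2 + nrm (B 1) * (nrm (DB 1 1) + nrm (DB 1 2)) + ((nrm (B 2))^2 + nrm (B 2) * (nrm (DB 2 1) + nrm (DB 2 2)))"
  define a where "a = 4 * G^2 / c0"
  have a: "a \<ge> 0" using c0 by (simp add: a_def)
  have "(\<lambda>k. \<integral>x. th (ee k) x * ((DB 1 1 x)^2 + (DB 1 2 x)^2 + (DB 2 1 x)^2 + (DB 2 2 x)^2) \<partial>lebesgue)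
     \<longlonglongrightarrow> (\<integral>x. (DB 1 1 x)^2 + (DB 1 2 x)^2 + (DB 2 1 x)^2 + (DB 2 2 x)^2 \<partial>lebesgue)"
    by (rule cut_limit) (auto intro!: Bochner_Integration.integrable_add sqi_int sDB simp: h1D(4)[OF B1])
  moreover have "(\<lambda>k. (nrm (wcurl2 DB))^2 + CT * CS * ((strip_nrm (ee k) (D_normal_part B DB 1))^2
        + (strip_nrm (ee k) (D_normal_part B DB 2))^2)
      + 2 * G * (2 * G / c0) * Q) \<longlonglongrightarrow> (nrm (wcurl2 DB))^2 + CT * CS * (0^2 + 0^2) + 2 * G * (2 * G / c0) * Q"
    by (intro tendsto_intros strip_limit h1D(2)[OF hw] h1D(4)[OF hw])
  ultimately have "(\<integral>x. (DB 1 1 x)^2 + (DB 1 2 x)^2 + (DB 2 1 x)^2 + (DB 2 2 x)^2 \<partial>lebesgue)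
     \<le> (nrm (wcurl2 DB))^2 + CT * CS * (0^2 + 0^2) + 2 * G * (2 * G / c0) * Q"
    by (rule LIMSEQ_le) (use grad_cut[OF B] in \<open>auto simp: Q_def\<close>)
  moreover have "(\<integral>x. (DB 1 1 x)^2 + (DB 1 2 x)^2 + (DB 2 1 x)^2 + (DB 2 2 x)^2 \<partial>lebesgue) = grad2 DB"
    by (simp add: sqi_int sDB grad2_def nrm_power2)
  ultimately have 1: "grad2 DB \<le> (nrm (wcurl2 DB))^2 + a * Q"
    by (simp add: a_def power2_eq_square)
  \<comment> \<open>The weights are chosen so that the four mixed terms of \<open>a * Q\<close>
    together produce only a quarter of \<open>grad2 DB\<close>, which is absorbed on the
    left.\<close>
  have y: "a * (b * d) \<le> a^2 * b^2 + d^2 / 4" for b d :: real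
  proof -
    have "0 \<le> (a * b - d / 2)^2" by simp
    then show ?thesis by (simp add: power2_diff power_mult_distrib power_divide)
  qed
  have "a * Q = a * (nrm (B 1))^2 + (a * (nrm (B 1) * nrm (DB 1 1)) + a * (nrm (B 1) * nrm (DB 1 2)))
     + (a * (nrm (B 2))^2 + (a * (nrm (B 2) * nrm (DB 2 1)) + a * (nrm (B 2) * nrm (DB 2 2))))"
    by (simp add: Q_def algebra_simps)
  also have "\<dots> \<le> (a + 2 * a^2) * ((nrm (B 1))^2 + (nrm (B 2))^2) + grad2 DB / 4"
  proof -
    have gen: "a * u + (t1 + t2) + (a * v + (t3 + t4)) \<le> (a + 2 * a^2) * (u + v) + (d1 + d2 + d3 + d4) / 4"
      if "t1 \<le> a^2 * u + d1 / 4" "t2 \<le> a^2 * u + d2 / 4" "t3 \<le> a^2 * v + d3 / 4" "t4 \<le> a^2 * v + d4 / 4"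
      for t1 t2 t3 t4 u v d1 d2 d3 d4 :: real
    proof -
      have "(a + 2 * a^2) * (u + v) = a * u + a * v + 2 * (a^2 * u) + 2 * (a^2 * v)" by (simp add: algebra_simps)
      then show ?thesis using that unfolding add_divide_distrib by linarith
    qed
    show ?thesis unfolding grad2_def by (rule gen) (rule y)+
  qed
  finally have 2: "a * Q \<le> (a + 2 * a^2) * ((nrm (B 1))^2 + (nrm (B 2))^2) + grad2 DB / 4" .
  let ?b = "(nrm (B 1))^2 + (nrm (B 2))^2"
  have "grad2 DB \<le> 2 * (nrm (wcurl2 DB))^2 + 2 * ((a + 2 * a^2) * ?b)"
  proof -
    have "grad2 DB \<ge> 0" by (simp add: grad2_def)
    then show ?thesis using 1 2 zero_le_power2[of "nrm (wcurl2 DB)"] mult_nonneg_nonneg[of "a + 2 * a^2" ?b] a by simp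
  qed
  also have "\<dots> \<le> KG * (nrm (wcurl2 DB))^2 + KG * ?b"
  proof (intro add_mono)
    show "2 * (nrm (wcurl2 DB))^2 \<le> KG * (nrm (wcurl2 DB))^2" by (intro mult_right_mono) (auto simp: KG_def)
    have "2 * (a + 2 * a^2) \<le> KG"
      unfolding KG_def a_def[symmetric] using a by (simp add: power2_sum)
    then have "2 * (a + 2 * a^2) * ?b \<le> KG * ?b" by (intro mult_right_mono) auto
    then show "2 * ((a + 2 * a^2) * ?b) \<le> KG * ?b" by (simp only: mult.assoc)
  qed
  finally show ?thesis by (simp add: distrib_left)
qed

text \<open>\<open>div_curl_L2\<close> and \<open>div_curl_grad\<close> bound the full first order
  energy of B by its curl, and \<open>Sobolev\<close> converts that energy into fourth powers. C
  depends on the domain data only.\<close>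

theorem div_curl_L4:
  obtains C where "C > 0"
    "\<And>B DB i. tang B DB \<Longrightarrow> integrable lebesgue (\<lambda>x. (B i x)^4) \<and> (\<integral>x. (B i x)^4 \<partial>lebesgue) \<le> (C * (nrm (wcurl2 DB))^2)^2"
proof -
  define L where "L = 4 * R^2 + KG * (1 + 4 * R^2)"
  have KS: "KS > 0" unfolding KS_def using c0 by (intro add_pos_nonneg) auto
  have KG: "KG > 0" unfolding KG_def by (intro add_pos_nonneg) auto
  have L: "L > 0" unfolding L_def using KG by (intro add_nonneg_pos) (auto intro!: mult_pos_pos add_pos_nonneg)
  show ?thesis
  proof (rule that[of "KS * L"])
    show "KS * L > 0" using KS L by simp
    fix B DB i assume B: "tang B DB"
    let ?f = "(nrm (wcurl2 DB))^2"
    have b: "(nrm (B 1))^2 + (nrm (B 2))^2 \<le> 4 * R^2 * ?f" by (rule div_curl_L2[OF B])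
    have "grad2 DB \<le> KG * (?f + 4 * R^2 * ?f)"
      using div_curl_grad[OF B] b KG by (meson add_left_mono less_imp_le mult_left_mono order_trans)
    also have "\<dots> = KG * (1 + 4 * R^2) * ?f" by (simp add: algebra_simps)
    finally have g: "grad2 DB \<le> KG * (1 + 4 * R^2) * ?f" .
    have "En (B i) (DB i) \<le> (nrm (B 1))^2 + (nrm (B 2))^2 + grad2 DB"
      using exhaust_2[of i] unfolding En_def grad2_def by auto
    also have "\<dots> \<le> L * ?f" using b g by (simp add: L_def distrib_right)
    finally have E: "En (B i) (DB i) \<le> L * ?f" .
    have E0: "0 \<le> En (B i) (DB i)" by (simp add: En_def)
    have "(KS * En (B i) (DB i))^2 \<le> (KS * L * ?f)^2"
      using E E0 KS by (intro power_mono) (auto simp: mult.assoc)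
    with Sobolev[OF tangD(1)[OF B], of i]
    show "integrable lebesgue (\<lambda>x. (B i x)^4) \<and> (\<integral>x. (B i x)^4 \<partial>lebesgue) \<le> (KS * L * ?f)^2" by simp
  qed
qed

end

subsection \<open>Zero extensions of the given fields\<close>

definition ext :: "pt set \<Rightarrow> (pt \<Rightarrow> real) \<Rightarrow> pt \<Rightarrow> real" where "ext \<Omega> f x = indicator \<Omega> x * f x"

lemma ext_in [simp]: "x \<in> \<Omega> \<Longrightarrow> ext \<Omega> f x = f x" and ext_out [simp]: "x \<notin> \<Omega> \<Longrightarrow> ext \<Omega> f x = 0"
  by (auto simp: ext_def)

lemma set_lint_eq: "(LINT x:\<Omega>|lebesgue. f x) = (\<integral>x. indicator \<Omega> x * f x \<partial>lebesgue)" for f :: "pt \<Rightarrow> real"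
  by (simp add: set_lebesgue_integral_def)

lemma L2_real_iff: "L2 \<Omega> f \<longleftrightarrow> sqi (ext \<Omega> f)" for f :: "pt \<Rightarrow> real"
proof -
  have "(\<lambda>x. indicator \<Omega> x *\<^sub>R (norm (f x))^2) = (\<lambda>x. (ext \<Omega> f x)^2)"
    by (auto simp: ext_def indicator_def fun_eq_iff)
  moreover have "(\<lambda>x. indicator \<Omega> x *\<^sub>R f x) = ext \<Omega> f" by (simp add: ext_def fun_eq_iff)
  ultimately show ?thesis
    unfolding L2_def sqi_def set_borel_measurable_def set_integrable_def by simp
qed

lemma L2norm_eq: "L2norm \<Omega> u = nrm (ext \<Omega> (\<lambda>x. norm (u x)))"
proof -
  have "indicator \<Omega> x *\<^sub>R (norm (u x))^2 = (ext \<Omega> (\<lambda>x. norm (u x)) x)^2" for x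
    by (simp add: ext_def indicator_def)
  then show ?thesis unfolding L2norm_def nrm_def set_lebesgue_integral_def by simp
qed

lemma H1_real_iff: "H1 \<Omega> f Df \<longleftrightarrow> h1 \<Omega> (ext \<Omega> f) (\<lambda>j. ext \<Omega> (\<lambda>x. Df x $ j))" for f :: "pt \<Rightarrow> real"
proof -
  have 1: "(LINT x:\<Omega>|lebesgue. pd \<phi> j x *\<^sub>R f x) = (\<integral>x. pd \<phi> j x * ext \<Omega> f x \<partial>lebesgue)"
    "(LINT x:\<Omega>|lebesgue. \<phi> x *\<^sub>R Df x $ j) = (\<integral>x. \<phi> x * ext \<Omega> (\<lambda>x. Df x $ j) x \<partial>lebesgue)" for \<phi> j
    unfolding set_lint_eq by (simp_all add: ext_def mult_ac)
  show ?thesis unfolding H1_def h1_def L2_real_iff weak_partial_def 1 by auto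
qed

lemma set_lint_complex_part:
  fixes g :: "pt \<Rightarrow> complex"
  assumes "integrable lebesgue (\<lambda>x. indicator \<Omega> x *\<^sub>R g x)"
  shows "Re (LINT x:\<Omega>|lebesgue. g x) = (\<integral>x. indicator \<Omega> x * Re (g x) \<partial>lebesgue)"
    "Im (LINT x:\<Omega>|lebesgue. g x) = (\<integral>x. indicator \<Omega> x * Im (g x) \<partial>lebesgue)"
  unfolding set_lebesgue_integral_def using assms
  by (simp_all flip: integral_Re integral_Im)

context dom
begin

lemma L2_complex:
  fixes u :: "pt \<Rightarrow> complex"
  assumes "L2 \<Omega> u"
  shows "(\<lambda>x. indicator \<Omega> x *\<^sub>R u x) \<in> borel_measurable lebesgue" "sqi (ext \<Omega> (\<lambda>x. cmod (u x)))"
    "sqi (ext \<Omega> (\<lambda>x. Re (u x)))" "sqi (ext \<Omega> (\<lambda>x. Im (u x)))" "integrable lebesgue (\<lambda>x. indicator \<Omega> x *\<^sub>R u x)"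
proof -
  show m: "(\<lambda>x. indicator \<Omega> x *\<^sub>R u x) \<in> borel_measurable lebesgue"
    using assms by (simp add: L2_def set_borel_measurable_def)
  have e: "ext \<Omega> (\<lambda>x. cmod (u x)) = (\<lambda>x. norm (indicator \<Omega> x *\<^sub>R u x))"
    "ext \<Omega> (\<lambda>x. Re (u x)) = (\<lambda>x. Re (indicator \<Omega> x *\<^sub>R u x))" "ext \<Omega> (\<lambda>x. Im (u x)) = (\<lambda>x. Im (indicator \<Omega> x *\<^sub>R u x))"
    by (auto simp: ext_def indicator_def fun_eq_iff)
  have me: "ext \<Omega> (\<lambda>x. cmod (u x)) \<in> borel_measurable lebesgue" "ext \<Omega> (\<lambda>x. Re (u x)) \<in> borel_measurable lebesgue"
    "ext \<Omega> (\<lambda>x. Im (u x)) \<in> borel_measurable lebesgue"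
    unfolding e using m by measurable
  have "(\<lambda>x. indicator \<Omega> x *\<^sub>R (norm (u x))^2) = (\<lambda>x. (ext \<Omega> (\<lambda>x. cmod (u x)) x)^2)"
    by (auto simp: ext_def indicator_def fun_eq_iff)
  then show s: "sqi (ext \<Omega> (\<lambda>x. cmod (u x)))"
    using assms me unfolding L2_def sqi_def set_integrable_def by simp
  show "sqi (ext \<Omega> (\<lambda>x. Re (u x)))" "sqi (ext \<Omega> (\<lambda>x. Im (u x)))"
    unfolding sqi_def
    by (intro conjI me Bochner_Integration.integrable_bound[OF sqi_int[OF s]] borel_measurable_power always_eventually allI;
        simp add: ext_def indicator_def abs_Re_le_cmod abs_Im_le_cmod flip: abs_le_square_iff)+
  have "integrable lebesgue (ext \<Omega> (\<lambda>x. cmod (u x)))"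
  proof (rule sqi_supp_integrable[OF s])
    show "ext \<Omega> (\<lambda>x. cmod (u x)) x = 0" if "norm x > R" for x
      using that dom_norm[of x] by (cases "x \<in> \<Omega>") auto
  qed
  then show "integrable lebesgue (\<lambda>x. indicator \<Omega> x *\<^sub>R u x)"
    unfolding e by (rule integrable_norm_cancel) (rule m)
qed

lemma H1_complex:
  fixes \<psi> :: "pt \<Rightarrow> complex"
  assumes H: "H1 \<Omega> \<psi> D"
  shows "h1 \<Omega> (ext \<Omega> (\<lambda>x. Re (\<psi> x))) (\<lambda>j. ext \<Omega> (\<lambda>x. Re (D x $ j)))"
    "h1 \<Omega> (ext \<Omega> (\<lambda>x. Im (\<psi> x))) (\<lambda>j. ext \<Omega> (\<lambda>x. Im (D x $ j)))"
proof -
  have L: "L2 \<Omega> \<psi>" "L2 \<Omega> (\<lambda>x. D x $ j)" for j using H by (auto simp: H1_def)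
  have i: "integrable lebesgue (\<lambda>x. indicator \<Omega> x *\<^sub>R (m x *\<^sub>R u x))"
    if "L2 \<Omega> u" "m \<in> borel_measurable lebesgue" "\<And>x. \<bar>m x\<bar> \<le> C" for m C and u :: "pt \<Rightarrow> complex"
  proof (rule Bochner_Integration.integrable_bound)
    show "integrable lebesgue (\<lambda>x. C *\<^sub>R (indicator \<Omega> x *\<^sub>R u x))"
      by (rule integrable_scaleR_right) (rule L2_complex(5)[OF that(1)])
    have "(\<lambda>x. m x *\<^sub>R (indicator \<Omega> x *\<^sub>R u x)) \<in> borel_measurable lebesgue"
      by (rule borel_measurable_scaleR[OF that(2) L2_complex(1)[OF that(1)]])
    then show "(\<lambda>x. indicator \<Omega> x *\<^sub>R (m x *\<^sub>R u x)) \<in> borel_measurable lebesgue" by (simp add: mult.commute)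
    show "AE x in lebesgue. norm (indicator \<Omega> x *\<^sub>R (m x *\<^sub>R u x)) \<le> norm (C *\<^sub>R (indicator \<Omega> x *\<^sub>R u x))"
      by (intro always_eventually allI) (auto simp: indicator_def intro!: mult_right_mono order_trans[OF that(3) abs_ge_self])
  qed
  have parts: "(\<integral>x. pd \<phi> j x * ext \<Omega> (\<lambda>x. Re (\<psi> x)) x \<partial>lebesgue) = - (\<integral>x. \<phi> x * ext \<Omega> (\<lambda>x. Re (D x $ j)) x \<partial>lebesgue)"
    "(\<integral>x. pd \<phi> j x * ext \<Omega> (\<lambda>x. Im (\<psi> x)) x \<partial>lebesgue) = - (\<integral>x. \<phi> x * ext \<Omega> (\<lambda>x. Im (D x $ j)) x \<partial>lebesgue)"
    if \<phi>: "test_fn \<Omega> \<phi>" for \<phi> j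
  proof -
    obtain C where C: "\<And>x. \<bar>\<phi> x\<bar> \<le> C" "\<And>x j. \<bar>pd \<phi> j x\<bar> \<le> C" by (rule test_fn_bounded[OF \<phi>]) blast
    have w: "(LINT x:\<Omega>|lebesgue. pd \<phi> j x *\<^sub>R \<psi> x) = - (LINT x:\<Omega>|lebesgue. \<phi> x *\<^sub>R D x $ j)"
      using H \<phi> by (auto simp: H1_def weak_partial_def)
    note i1 = i[OF L(1) test_fn_meas(2)[OF \<phi>] C(2)] and i2 = i[OF L(2) test_fn_meas(1)[OF \<phi>] C(1)]
    show "(\<integral>x. pd \<phi> j x * ext \<Omega> (\<lambda>x. Re (\<psi> x)) x \<partial>lebesgue) = - (\<integral>x. \<phi> x * ext \<Omega> (\<lambda>x. Re (D x $ j)) x \<partial>lebesgue)"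
      using arg_cong[OF w, of Re] unfolding uminus_complex.sel set_lint_complex_part(1)[OF i1] set_lint_complex_part(1)[OF i2]
      by (simp add: ext_def mult_ac)
    show "(\<integral>x. pd \<phi> j x * ext \<Omega> (\<lambda>x. Im (\<psi> x)) x \<partial>lebesgue) = - (\<integral>x. \<phi> x * ext \<Omega> (\<lambda>x. Im (D x $ j)) x \<partial>lebesgue)"
      using arg_cong[OF w, of Im] unfolding uminus_complex.sel set_lint_complex_part(2)[OF i1] set_lint_complex_part(2)[OF i2]
      by (simp add: ext_def mult_ac)
  qed
  show "h1 \<Omega> (ext \<Omega> (\<lambda>x. Re (\<psi> x))) (\<lambda>j. ext \<Omega> (\<lambda>x. Re (D x $ j)))"
    "h1 \<Omega> (ext \<Omega> (\<lambda>x. Im (\<psi> x))) (\<lambda>j. ext \<Omega> (\<lambda>x. Im (D x $ j)))"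
    unfolding h1_def using parts L2_complex(3,4)[OF L(1)] L2_complex(3,4)[OF L(2)] by simp_all
qed

lemma modulus_fourth_integrable:
  assumes H: "H1 \<Omega> \<psi> D"
  shows "integrable lebesgue (\<lambda>x. (ext \<Omega> (\<lambda>x. cmod (\<psi> x)) x)^4)"
proof -
  let ?r = "ext \<Omega> (\<lambda>x. Re (\<psi> x))" and ?i = "ext \<Omega> (\<lambda>x. Im (\<psi> x))"
  have L: "L2 \<Omega> \<psi>" using H by (simp add: H1_def)
  show ?thesis
  proof (rule Bochner_Integration.integrable_bound)
    show "integrable lebesgue (\<lambda>x. 2 * (?r x)^4 + 2 * (?i x)^4)"
      using Sobolev(1)[OF H1_complex(1)[OF H]] Sobolev(1)[OF H1_complex(2)[OF H]] by simp
    show "(\<lambda>x. (ext \<Omega> (\<lambda>x. cmod (\<psi> x)) x)^4) \<in> borel_measurable lebesgue"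
      by (intro borel_measurable_power sqi_meas L2_complex(2)[OF L])
    have "(cmod z)^4 \<le> 2 * (Re z)^4 + 2 * (Im z)^4" for z
    proof -
      have "(cmod z)^4 = ((Re z)^2 + (Im z)^2)^2" by (simp only: cmod_power2[symmetric]) (simp flip: power_mult)
      also have "\<dots> \<le> 2 * ((Re z)^2)^2 + 2 * ((Im z)^2)^2"
        using sum_squares_bound[of "(Re z)^2" "(Im z)^2"] by (simp add: power2_sum)
      finally show ?thesis by (simp flip: power_mult)
    qed
    then show "AE x in lebesgue. norm ((ext \<Omega> (\<lambda>x. cmod (\<psi> x)) x)^4) \<le> norm (2 * (?r x)^4 + 2 * (?i x)^4)"
      by (intro always_eventually allI) (auto simp: ext_def indicator_def intro: order_trans[OF _ abs_ge_self])
  qed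
qed

definition extV :: "(pt \<Rightarrow> real^2) \<Rightarrow> 2 \<Rightarrow> pt \<Rightarrow> real" where "extV A i = ext \<Omega> (\<lambda>x. A x $ i)"
definition extD :: "(pt \<Rightarrow> real^2^2) \<Rightarrow> 2 \<Rightarrow> 2 \<Rightarrow> pt \<Rightarrow> real" where "extD DA i j = ext \<Omega> (\<lambda>x. DA x $ i $ j)"

lemma H1div_iff_tang: "H1div \<Omega> A DA \<longleftrightarrow> tang (extV A) (extD DA)"
proof -
  have 1: "H1_vec \<Omega> A DA \<longleftrightarrow> (\<forall>i. h1 \<Omega> (extV A i) (extD DA i))"
    unfolding H1_vec_def H1_real_iff extV_def extD_def by (simp add: fun_eq_iff)
  have 2: "(AE x in lebesgue. x \<in> \<Omega> \<longrightarrow> wdiv DA x = 0) \<longleftrightarrow> (AE x in lebesgue. extD DA 1 1 x + extD DA 2 2 x = 0)"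
    by (rule AE_cong) (auto simp: wdiv_def extD_def ext_def indicator_def)
  have 3: "(LINT x:\<Omega>|lebesgue. A x \<bullet> grad \<phi> x) = (\<integral>x. extV A 1 x * pd \<phi> 1 x + extV A 2 x * pd \<phi> 2 x \<partial>lebesgue)" for \<phi>
    unfolding set_lint_eq extV_def ext_def by (simp add: inner_vec_def sum_2 grad_def algebra_simps)
  show ?thesis unfolding H1div_def tang_def 1 2 3 by blast
qed

lemma h1_uminus: "h1 \<Omega> f D \<Longrightarrow> h1 \<Omega> (\<lambda>x. - f x) (\<lambda>j x. - D j x)"
  unfolding h1_def by (auto simp: sqi_uminus)

lemma tang_diff:
  assumes A: "tang A DA" and B: "tang B DB"
  shows "tang (\<lambda>i x. A i x - B i x) (\<lambda>i j x. DA i j x - DB i j x)"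
  unfolding tang_def
proof (intro conjI allI impI)
  show "h1 \<Omega> (\<lambda>x. A i x - B i x) (\<lambda>j x. DA i j x - DB i j x)" for i
    using h1_add[OF tangD(1)[OF A] h1_uminus[OF tangD(1)[OF B]], of i i] by simp
  show "AE x in lebesgue. DA 1 1 x - DB 1 1 x + (DA 2 2 x - DB 2 2 x) = 0"
    using tangD(2)[OF A] tangD(2)[OF B] by eventually_elim linarith
  fix \<phi> :: "pt \<Rightarrow> real" assume \<phi>: "smooth \<phi>"
  have iA: "integrable lebesgue (\<lambda>x. pd \<phi> i x * A i x)" for i
    by (rule smooth_sqi_integrable[OF h1D(1)[OF tangD(1)[OF A]] h1D(3)[OF tangD(1)[OF A]] smooth_pd[OF \<phi>]])
  have iB: "integrable lebesgue (\<lambda>x. pd \<phi> i x * B i x)" for i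
    by (rule smooth_sqi_integrable[OF h1D(1)[OF tangD(1)[OF B]] h1D(3)[OF tangD(1)[OF B]] smooth_pd[OF \<phi>]])
  have "(\<integral>x. (A 1 x - B 1 x) * pd \<phi> 1 x + (A 2 x - B 2 x) * pd \<phi> 2 x \<partial>lebesgue)
     = (\<integral>x. (A 1 x * pd \<phi> 1 x + A 2 x * pd \<phi> 2 x) - (B 1 x * pd \<phi> 1 x + B 2 x * pd \<phi> 2 x) \<partial>lebesgue)"
    by (simp add: algebra_simps)
  also have "\<dots> = (\<integral>x. A 1 x * pd \<phi> 1 x + A 2 x * pd \<phi> 2 x \<partial>lebesgue) - (\<integral>x. B 1 x * pd \<phi> 1 x + B 2 x * pd \<phi> 2 x \<partial>lebesgue)"
    by (rule Bochner_Integration.integral_diff)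
      (use iA iB in \<open>auto simp: mult.commute intro!: Bochner_Integration.integrable_add\<close>)
  also have "\<dots> = 0" using tangD(3)[OF A \<phi>] tangD(3)[OF B \<phi>] by simp
  finally show "(\<integral>x. (A 1 x - B 1 x) * pd \<phi> 1 x + (A 2 x - B 2 x) * pd \<phi> 2 x \<partial>lebesgue) = 0" .
qed

end

text \<open>Covers non-integrable f as well: its integral is then 0 by convention, while g is
  nonnegative.\<close>

lemma abs_integral_le:
  fixes f g :: "'a \<Rightarrow> real"
  assumes "integrable M g" "\<And>x. \<bar>f x\<bar> \<le> g x"
  shows "\<bar>\<integral>x. f x \<partial>M\<bar> \<le> (\<integral>x. g x \<partial>M)"
proof (cases "integrable M f")
  case True
  have "\<bar>\<integral>x. f x \<partial>M\<bar> \<le> (\<integral>x. \<bar>f x\<bar> \<partial>M)" by (rule integral_abs_bound)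
  also have "\<dots> \<le> (\<integral>x. g x \<partial>M)" by (rule integral_mono) (use True assms in auto)
  finally show ?thesis .
next
  case False
  have "0 \<le> g x" for x using assms(2)[of x] by linarith
  then show ?thesis using False by (simp add: not_integrable_integral_eq)
qed

lemma sqi_bound:
  assumes "sqi g" "f \<in> borel_measurable lebesgue" "\<And>x. \<bar>f x\<bar> \<le> \<bar>g x\<bar>"
  shows "sqi f"
  unfolding sqi_def
proof
  show "integrable lebesgue (\<lambda>x. (f x)^2)"
    by (rule Bochner_Integration.integrable_bound[OF sqi_int[OF assms(1)]])
      (use assms in \<open>auto intro!: borel_measurable_power simp: abs_le_square_iff\<close>)
qed (rule assms)

subsection \<open>Topology of the complement\<close>

text \<open>For bounded open sets of complex numbers, simple connectedness amounts to connectedness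
  of the complement; this is transported along the linear identification c of the plane with the
  complex numbers.\<close>

lemma connected_complement:
  fixes \<Omega> :: "pt set"
  assumes "open \<Omega>" "bounded \<Omega>" "simply_connected \<Omega>"
  shows "connected (- \<Omega>)"
proof -
  define c :: "pt \<Rightarrow> complex" where "c x = Complex (x $ 1) (x $ 2)" for x
  define d :: "complex \<Rightarrow> pt" where "d z = Re z *\<^sub>R axis 1 1 + Im z *\<^sub>R axis 2 1" for z
  have cd: "c (d z) = z" for z by (simp add: c_def d_def axis_def)
  have dc: "d (c x) = x" for x by (simp add: c_def d_def vec_eq_iff forall_2 axis_def)
  have cc: "continuous_on S c" for S
    unfolding c_def Complex_eq by (intro continuous_intros)
  have dcont: "continuous_on S d" for S unfolding d_def by (intro continuous_intros)
  have im: "c ` S = d -` S" for S using cd dc by (auto simp: image_iff) (metis dc)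
  have lin: "bounded_linear c"
    by (rule linear_conv_bounded_linear[THEN iffD1])
      (auto simp: c_def linear_iff complex_eq_iff)
  have "open (c ` \<Omega>)" unfolding im using assms(1) dcont[of UNIV] by (simp add: continuous_on_open_vimage)
  moreover have "bounded (c ` \<Omega>)" using assms(2) lin by (rule bounded_linear_image)
  moreover have "simply_connected (c ` \<Omega>)"
  proof (rule homeomorphic_simply_connected[OF _ assms(3)])
    show "\<Omega> homeomorphic c ` \<Omega>"
      unfolding homeomorphic_def homeomorphism_def
      by (intro exI[of _ c] exI[of _ d]) (auto simp: cc dcont cd dc image_image)
  qed
  ultimately have "connected (- (c ` \<Omega>))" using simply_connected_iff_simple by blast
  then have "connected (d ` (- (c ` \<Omega>)))" by (rule connected_continuous_image[OF dcont])
  moreover have "d ` (- (c ` \<Omega>)) = - \<Omega>"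
  proof (intro equalityI subsetI)
    fix x assume "x \<in> - \<Omega>"
    then have "c x \<in> - (c ` \<Omega>)" unfolding im by (simp add: dc)
    then have "d (c x) \<in> d ` (- (c ` \<Omega>))" by (rule imageI)
    then show "x \<in> d ` (- (c ` \<Omega>))" by (simp only: dc)
  qed (auto simp: im)
  ultimately show ?thesis by simp
qed

lemma smooth_gradient_nonzero:
  assumes "smooth \<rho>" "frechet_derivative \<rho> (at x) \<noteq> (\<lambda>v. 0)"
  shows "(pd \<rho> 1 x)^2 + (pd \<rho> 2 x)^2 > 0"
proof (rule ccontr)
  assume "\<not> (pd \<rho> 1 x)^2 + (pd \<rho> 2 x)^2 > 0"
  then have "pd \<rho> 1 x = 0" "pd \<rho> 2 x = 0"
    using zero_le_power2[of "pd \<rho> 1 x"] zero_le_power2[of "pd \<rho> 2 x"] by (auto simp: sum_power2_gt_zero_iff)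
  then have "(\<rho> has_derivative (\<lambda>v. 0)) (at x)" using smooth_has_derivative[OF assms(1), of x] by simp
  then show False using assms(2) frechet_derivative_at by metis
qed

text \<open>Near a boundary point the function increases in the direction of its gradient, so that the
  positive side is locally connected.\<close>
lemma positive_side_locally_connected:
  assumes \<rho>: "smooth \<rho>" and p: "\<rho> p = 0" "(pd \<rho> 1 p)^2 + (pd \<rho> 2 p)^2 > 0"
  obtains r C where "r > 0" "connected C" "C \<subseteq> {x. \<rho> x > 0}" "ball p r \<inter> {x. \<rho> x > 0} \<subseteq> C"
proof -
  let ?P = "{x. \<rho> x > 0}"
  define a where "a = pd \<rho> 1 p"
  define b where "b = pd \<rho> 2 p"
  define n :: pt where "n = a *\<^sub>R axis 1 1 + b *\<^sub>R axis 2 1"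
  have n: "n $ 1 = a" "n $ 2 = b" by (auto simp: n_def axis_def)
  define g where "g x = a * pd \<rho> 1 x + b * pd \<rho> 2 x" for x
  have gc: "continuous_on UNIV g" unfolding g_def
    by (intro continuous_intros smooth_continuous smooth_pd \<rho>)
  have gp: "g p > 0" using p(2) by (simp add: g_def a_def b_def power2_eq_square)
  have "open {x. 0 < g x}" by (rule open_Collect_less[OF continuous_on_const gc])
  then obtain q where q: "q > 0" "ball p q \<subseteq> {x. 0 < g x}" using gp by (metis mem_Collect_eq openE)
  have mono: "\<rho> x < \<rho> (x + s *\<^sub>R n)" if s: "s > 0" "\<And>t. 0 \<le> t \<Longrightarrow> t \<le> s \<Longrightarrow> x + t *\<^sub>R n \<in> ball p q" for x s
  proof (rule DERIV_pos_imp_increasing[of 0 s "\<lambda>t. \<rho> (x + t *\<^sub>R n)", simplified, OF s(1)])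
    fix t :: real assume t: "0 \<le> t" "t \<le> s"
    have "((\<lambda>t. x + t *\<^sub>R n) has_derivative (\<lambda>r. r *\<^sub>R n)) (at t)" by (auto intro!: derivative_eq_intros)
    from has_derivative_compose[OF this smooth_has_derivative[OF \<rho>]]
    have "((\<lambda>t. \<rho> (x + t *\<^sub>R n)) has_real_derivative g (x + t *\<^sub>R n)) (at t)"
      unfolding has_field_derivative_def by (rule has_derivative_eq_rhs) (auto simp: n g_def algebra_simps)
    moreover have "g (x + t *\<^sub>R n) > 0" using s(2)[OF t] q(2) by blast
    ultimately show "\<exists>y. ((\<lambda>t. \<rho> (x + t *\<^sub>R n)) has_real_derivative y) (at t) \<and> 0 < y" by blast
  qed
  \<comment> \<open>So small that a segment of length s |n| starting in the ball of radius q/2 stays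
    in the ball where \<open>\<rho>\<close> increases along n.\<close>
  define s where "s = q / (2 * (norm n + 1))"
  have s: "s > 0" unfolding s_def using q(1) by (intro divide_pos_pos mult_pos_pos add_nonneg_pos) auto
  have sn: "s * norm n < q / 2"
  proof -
    have "s * norm n < s * (norm n + 1)" using s by simp
    also have "\<dots> = q / 2" unfolding s_def using norm_ge_zero[of n] by (simp add: field_simps add_nonneg_eq_0_iff)
    finally show ?thesis .
  qed
  have inb: "x + t *\<^sub>R n \<in> ball p q" if "x \<in> ball p (q/2)" "0 \<le> t" "t \<le> s" for x t
  proof -
    have "t * norm n \<le> s * norm n" using that by (intro mult_right_mono) auto
    then have "norm (t *\<^sub>R n) < q/2" using sn that(2) by simp
    moreover have "dist p (x + t *\<^sub>R n) \<le> dist p x + norm (t *\<^sub>R n)"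
      using norm_triangle_ineq4[of "p - x" "t *\<^sub>R n"] by (simp add: dist_norm algebra_simps)
    ultimately show ?thesis using that(1) by simp
  qed
  have pq: "p \<in> ball p (q/2)" using q(1) by simp
  then have "\<rho> (p + s *\<^sub>R n) > 0" using mono[OF s inb, of p] p(1) by simp
  moreover have "open ?P" by (rule open_Collect_less[OF continuous_on_const smooth_continuous[OF \<rho>]])
  ultimately obtain r' where r': "r' > 0" "ball (p + s *\<^sub>R n) r' \<subseteq> ?P" by (metis mem_Collect_eq openE)
  define r where "r = min r' (q/2)"
  have r: "r > 0" "r \<le> r'" "r \<le> q/2" using r' q by (auto simp: r_def)
  define L where "L x = closed_segment x (x + s *\<^sub>R n)" for x
  \<comment> \<open>Every positive point near p is pushed along its segment into one common ball
    around \<open>p + s *\<^sub>R n\<close>. The segments stay on the positive side because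
    \<open>\<rho>\<close> increases along them.\<close>
  define C where "C = (\<Union>x\<in>ball p r \<inter> ?P. L x) \<union> ball (p + s *\<^sub>R n) r"
  have LP: "L x \<subseteq> ?P" if x: "x \<in> ball p r" "\<rho> x > 0" for x
  proof
    fix y assume "y \<in> L x"
    then obtain u where u: "0 \<le> u" "u \<le> 1" "y = (1 - u) *\<^sub>R x + u *\<^sub>R (x + s *\<^sub>R n)" by (auto simp: L_def in_segment)
    then have y: "y = x + (u * s) *\<^sub>R n" by (simp add: algebra_simps)
    have us: "u * s \<le> s" using u s by (simp add: mult_left_le_one_le)
    show "y \<in> ?P"
    proof (cases "u = 0")
      case False
      then have "u * s > 0" using u s by simp
      moreover have "x \<in> ball p (q/2)" using x r by auto
      ultimately have "\<rho> x < \<rho> y" unfolding y by (intro mono inb) (use us in auto)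
      then show ?thesis using x by simp
    qed (use y x in simp)
  qed
  have top: "x + s *\<^sub>R n \<in> ball (p + s *\<^sub>R n) r" if "x \<in> ball p r" for x
    using that by (simp add: dist_norm)
  have "connected C"
  proof -
    have "C = (\<Union>x\<in>ball p r \<inter> ?P. L x \<union> ball (p + s *\<^sub>R n) r) \<union> ball (p + s *\<^sub>R n) r" by (auto simp: C_def)
    moreover have "connected ((\<Union>x\<in>ball p r \<inter> ?P. L x \<union> ball (p + s *\<^sub>R n) r) \<union> ball (p + s *\<^sub>R n) r)"
    proof (cases "ball p r \<inter> ?P = {}")
      case False
      then obtain x0 where x0: "x0 \<in> ball p r \<inter> ?P" by blast
      have "connected (\<Union>x\<in>ball p r \<inter> ?P. L x \<union> ball (p + s *\<^sub>R n) r)"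
      proof (rule connected_Union)
        show "connected S" if "S \<in> (\<lambda>x. L x \<union> ball (p + s *\<^sub>R n) r) ` (ball p r \<inter> ?P)" for S
        proof -
          from that obtain x where x: "x \<in> ball p r" "S = L x \<union> ball (p + s *\<^sub>R n) r" by auto
          have "x + s *\<^sub>R n \<in> L x \<inter> ball (p + s *\<^sub>R n) r" using top[OF x(1)] by (simp add: L_def)
          then show ?thesis unfolding x(2) by (intro connected_Un) (auto simp: L_def)
        qed
        have "p + s *\<^sub>R n \<in> \<Inter>((\<lambda>x. L x \<union> ball (p + s *\<^sub>R n) r) ` (ball p r \<inter> ?P))" using r by auto
        then show "\<Inter>((\<lambda>x. L x \<union> ball (p + s *\<^sub>R n) r) ` (ball p r \<inter> ?P)) \<noteq> {}" by blast
      qed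
      then show ?thesis using x0 by (intro connected_Un) (use r in auto)
    qed (simp add: connected_ball)
    ultimately show ?thesis by simp
  qed
  moreover have "C \<subseteq> ?P"
  proof -
    have "ball (p + s *\<^sub>R n) r \<subseteq> ?P" using subset_ball[OF r(2)] r'(2) by blast
    moreover have "(\<Union>x\<in>ball p r \<inter> ?P. L x) \<subseteq> ?P" using LP by blast
    ultimately show ?thesis unfolding C_def by blast
  qed
  moreover have sub: "ball p r \<inter> ?P \<subseteq> C" unfolding C_def L_def by auto
  ultimately show ?thesis by (intro that[OF r(1)])
qed

text \<open>A separation A, B of the open positive side gives two closed sets, the closures of A and
  B, that cover {\<open>\<rho>\<close> >= 0}. They are disjoint, since near a boundary point the
  positive side lies in one connected piece; this contradicts connectedness of
  {\<open>\<rho>\<close> >= 0}.\<close>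

lemma connected_positive_side:
  assumes \<rho>: "smooth \<rho>" and nd: "\<And>x. \<rho> x = 0 \<Longrightarrow> (pd \<rho> 1 x)^2 + (pd \<rho> 2 x)^2 > 0"
    and con: "connected {x. \<rho> x \<ge> 0}"
  shows "connected {x. \<rho> x > 0}"
proof (rule ccontr)
  let ?P = "{x. \<rho> x > 0}"
  have oP: "open ?P" by (rule open_Collect_less[OF continuous_on_const smooth_continuous[OF \<rho>]])
  have cQ: "closed {x. \<rho> x \<ge> 0}" by (rule closed_Collect_le[OF continuous_on_const smooth_continuous[OF \<rho>]])
  assume "\<not> connected ?P"
  then obtain A' B' where AB': "open A'" "open B'" "?P \<subseteq> A' \<union> B'" "A' \<inter> B' \<inter> ?P = {}" "A' \<inter> ?P \<noteq> {}" "B' \<inter> ?P \<noteq> {}"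
    unfolding connected_def by blast
  define A where "A = A' \<inter> ?P"
  define B where "B = B' \<inter> ?P"
  have AB: "open A" "open B" "A \<noteq> {}" "B \<noteq> {}" "A \<inter> B = {}" "A \<union> B = ?P"
    using AB' oP unfolding A_def B_def by (auto intro: open_Int)
  have PQ: "?P \<subseteq> {x. \<rho> x \<ge> 0}" by auto
  have sub: "closure A \<subseteq> {x. \<rho> x \<ge> 0}" "closure B \<subseteq> {x. \<rho> x \<ge> 0}"
  proof -
    have "A \<subseteq> {x. \<rho> x \<ge> 0}" "B \<subseteq> {x. \<rho> x \<ge> 0}" using AB(6) PQ by blast+
    then show "closure A \<subseteq> {x. \<rho> x \<ge> 0}" "closure B \<subseteq> {x. \<rho> x \<ge> 0}" using closure_minimal[OF _ cQ] by blast+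
  qed
  have cover: "{x. \<rho> x \<ge> 0} \<subseteq> closure A \<union> closure B"
  proof
    fix p assume "p \<in> {x. \<rho> x \<ge> 0}"
    then consider "\<rho> p > 0" | "\<rho> p = 0" by force
    then show "p \<in> closure A \<union> closure B"
    proof cases
      case 1 then show ?thesis using AB(6) closure_subset[of A] closure_subset[of B] by blast
    next
      case 2
      \<comment> \<open>Otherwise p would be a local maximum of \<open>\<rho>\<close> and the
        gradient would vanish at p.\<close>
      have "p \<in> closure ?P"
      proof (rule ccontr)
        assume "p \<notin> closure ?P"
        then have "open (- closure ?P)" "p \<in> - closure ?P" by auto
        moreover have "\<forall>y\<in>- closure ?P. \<rho> y \<le> \<rho> p" using closure_subset[of ?P] 2 by force
        ultimately have "(\<lambda>v::pt. v $ 1 * pd \<rho> 1 p + v $ 2 * pd \<rho> 2 p) = (\<lambda>v. 0)"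
          by (intro differential_zero_maxmin[of p "- closure ?P" \<rho>, OF _ _ smooth_has_derivative[OF \<rho>]] disjI1)
        from fun_cong[OF this, of "axis 1 1"] fun_cong[OF this, of "axis 2 1"]
        have "pd \<rho> 1 p = 0" "pd \<rho> 2 p = 0" by (auto simp: axis_def)
        with nd[OF 2] show False by simp
      qed
      then show ?thesis using AB(6) by (metis closure_Un)
    qed
  qed
  have disj: "closure A \<inter> closure B = {}"
  proof (rule ccontr)
    assume "closure A \<inter> closure B \<noteq> {}"
    then obtain p where p: "p \<in> closure A" "p \<in> closure B" by blast
    have np: "p \<notin> A \<and> p \<notin> B"
      using p AB open_Int_closure_eq_empty[OF AB(1), of B] open_Int_closure_eq_empty[OF AB(2), of A] by blast
    then have p0: "\<rho> p = 0" using sub(1) p(1) AB(6) by force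
    obtain r C where r: "r > 0" and C: "connected C" "C \<subseteq> ?P" "ball p r \<inter> ?P \<subseteq> C"
      by (rule positive_side_locally_connected[OF \<rho> p0 nd[OF p0]])
    obtain x where x: "x \<in> A" "x \<in> ball p r" using p(1) r by (metis closure_approachable dist_commute mem_ball)
    obtain y where y: "y \<in> B" "y \<in> ball p r" using p(2) r by (metis closure_approachable dist_commute mem_ball)
    have "x \<in> C" "y \<in> C" using C(3) x y AB(6) by blast+
    then show False using connectedD[OF C(1) AB(1,2)] C(2) x(1) y(1) AB(5,6) by blast
  qed
  have "A \<subseteq> {x. \<rho> x \<ge> 0}" "B \<subseteq> {x. \<rho> x \<ge> 0}" using AB(6) PQ by blast+
  then have "closure A \<inter> {x. \<rho> x \<ge> 0} \<noteq> {}" "closure B \<inter> {x. \<rho> x \<ge> 0} \<noteq> {}"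
    using AB(3,4) closure_subset[of A] closure_subset[of B] by blast+
  then show False
    using con cover disj unfolding connected_closed by (metis Int_empty_left closed_closure)
qed

lemma dom_exists:
  assumes "open \<Omega>" "bounded \<Omega>" "simply_connected \<Omega>" "smooth_boundary \<Omega>"
  obtains R \<rho> G c0 e0 T T1 T2 CT where "dom \<Omega> R \<rho> G c0 e0 T T1 T2 CT"
proof -
  from assms(4) obtain \<rho> where \<rho>: "smooth \<rho>" "\<Omega> = {x. \<rho> x < 0}"
    "\<And>x. \<rho> x = 0 \<Longrightarrow> frechet_derivative \<rho> (at x) \<noteq> (\<lambda>v. 0)"
    unfolding smooth_boundary_def by blast
  note nd = smooth_gradient_nonzero[OF \<rho>(1) \<rho>(3)]
  obtain b where b: "b > 0" "\<And>x. x \<in> \<Omega> \<Longrightarrow> norm x \<le> b" using assms(2) unfolding bounded_pos by blast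
  define R where "R = b + 2"
  have sub: "\<Omega> \<subseteq> ball 0 (R - 1)" using b by (force simp: R_def)
  have cont: "continuous_on S (pd \<rho> i)" "continuous_on S (pd (pd \<rho> i) j)" "continuous_on S \<rho>" for S i j
    by (intro smooth_continuous smooth_pd \<rho>)+
  \<comment> \<open>Outside the ball \<open>\<rho>\<close> is nonnegative, so a zero there would be
    a local minimum, which the nonvanishing gradient excludes.\<close>
  have far: "\<rho> x > 0" if x: "norm x > R - 1" for x
  proof (rule ccontr)
    have ge: "\<rho> y \<ge> 0" if "y \<in> - cball 0 (R - 1)" for y
    proof -
      have "y \<notin> \<Omega>" using that sub by auto
      then show ?thesis by (simp add: \<rho>(2))
    qed
    assume "\<not> \<rho> x > 0"
    then have x0: "\<rho> x = 0" using ge[of x] x by simp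
    have "(\<lambda>v::pt. v $ 1 * pd \<rho> 1 x + v $ 2 * pd \<rho> 2 x) = (\<lambda>v. 0)"
      by (rule differential_zero_maxmin[of x "- cball 0 (R - 1)" \<rho>, OF _ _ smooth_has_derivative[OF \<rho>(1)]])
        (use x x0 ge in auto)
    from fun_cong[OF this, of "axis 1 1"] fun_cong[OF this, of "axis 2 1"]
    have "pd \<rho> 1 x = 0" "pd \<rho> 2 x = 0" by (auto simp: axis_def)
    with nd[OF x0] show False by simp
  qed
  have bd: "\<exists>C. \<forall>x\<in>cball 0 R. \<bar>g x\<bar> \<le> C" if "continuous_on (cball 0 R) g" for g :: "pt \<Rightarrow> real"
    using compact_imp_bounded[OF compact_continuous_image[OF that compact_cball]] bounded_iff[of "g ` cball 0 R"] by auto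
  obtain G1 where G1: "\<And>i x. x \<in> cball 0 R \<Longrightarrow> \<bar>pd \<rho> i x\<bar> \<le> G1 i" using bd[OF cont(1)] by metis
  obtain G2 where G2: "\<And>i j x. x \<in> cball 0 R \<Longrightarrow> \<bar>pd (pd \<rho> i) j x\<bar> \<le> G2 i j" using bd[OF cont(2)] by metis
  define G where "G = 1 + (\<Sum>i\<in>UNIV. \<bar>G1 i\<bar>) + (\<Sum>i\<in>UNIV. \<Sum>j\<in>UNIV. \<bar>G2 i j\<bar>)"
  have G1': "\<bar>G1 i\<bar> \<le> G" for i
    unfolding G_def using exhaust_2[of i] by (auto simp: sum_2)
  have G2': "\<bar>G2 i j\<bar> \<le> G" for i j
    unfolding G_def using exhaust_2[of i] exhaust_2[of j] by (auto simp: sum_2)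
  have G: "G > 0" unfolding G_def by (intro add_pos_nonneg sum_nonneg) auto
  \<comment> \<open>The function h has a positive minimum on the compact ball. Half of it serves
    both as collar width and as gradient bound: where |\<open>\<rho>\<close>| is at most half the
    minimum, the squared gradient makes up the other half.\<close>
  define h where "h x = \<bar>\<rho> x\<bar> + ((pd \<rho> 1 x)^2 + (pd \<rho> 2 x)^2)" for x
  have hc: "continuous_on (cball 0 R) h" unfolding h_def by (intro continuous_intros cont)
  have "cball (0::pt) R \<noteq> {}" using b by (simp add: R_def)
  from continuous_attains_inf[OF compact_cball this hc]
  obtain z where z: "z \<in> cball 0 R" "\<And>x. x \<in> cball 0 R \<Longrightarrow> h z \<le> h x" by blast
  have hz: "h z > 0"
    unfolding h_def using nd[of z] by (cases "\<rho> z = 0") (auto intro: add_pos_nonneg)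
  define c0 where "c0 = h z / 2"
  have c0: "c0 > 0" "norm x \<le> R \<Longrightarrow> \<bar>\<rho> x\<bar> \<le> c0 \<Longrightarrow> c0 \<le> (pd \<rho> 1 x)^2 + (pd \<rho> 2 x)^2" for x
    using hz z(2)[of x] unfolding c0_def h_def[of x] by auto
  have "- \<Omega> = {x. \<rho> x \<ge> 0}" by (auto simp: \<rho>(2))
  then have conn: "connected {x. \<rho> x > 0}"
    using connected_positive_side[OF \<rho>(1) nd] connected_complement[OF assms(1-3)] by simp
  obtain T T1 T2 :: "real \<Rightarrow> real" and CT where T:
    "smooth1 T" "smooth1 T1" "smooth1 T2"
    "\<And>t. (T has_real_derivative T1 t) (at t)" "\<And>t. (T1 has_real_derivative T2 t) (at t)"
    "\<And>t. 0 \<le> T t" "\<And>t. T t \<le> 1" "\<And>t. t \<le> -2 \<Longrightarrow> T t = 1" "\<And>t. t \<ge> -1 \<Longrightarrow> T t = 0"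
    "\<And>t. T1 t \<le> 0" "\<And>t. t < -2 \<Longrightarrow> T1 t = 0" "\<And>t. t > -1 \<Longrightarrow> T1 t = 0"
    "\<And>t. t < -2 \<Longrightarrow> T2 t = 0" "\<And>t. t > -1 \<Longrightarrow> T2 t = 0"
    "\<And>t. \<bar>T1 t\<bar> \<le> CT" "\<And>t. \<bar>T2 t\<bar> \<le> CT"
    by (rule cutoff_exists) blast
  have "dom \<Omega> R \<rho> G c0 c0 T T1 T2 CT"
  proof unfold_locales
    show "\<bar>pd \<rho> i x\<bar> \<le> G" if "norm x \<le> R" for x i
      using G1[of x i] G1'[of i] that by auto
    show "\<bar>pd (pd \<rho> i) j x\<bar> \<le> G" if "norm x \<le> R" for x i j
      using G2[of x i j] G2'[of i j] that by auto
    show "R \<ge> 1" using b by (simp add: R_def)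
  qed (fact assms sub \<rho> G c0 far conn T)+
  then show ?thesis by (rule that)
qed

subsection \<open>The estimates for solutions\<close>

text \<open>Hoelder's inequality for two functions with integrable fourth powers;
  \<open>nrm (\<lambda>x. f x * f x)\<close> stands for the square of the L4 norm, which avoids
  fourth roots.\<close>

lemma fourth_power_products:
  assumes f: "sqi f" "integrable lebesgue (\<lambda>x. (f x)^4)" and g: "sqi g" "integrable lebesgue (\<lambda>x. (g x)^4)"
  shows "sqi (\<lambda>x. f x * f x)" "(nrm (\<lambda>x. f x * f x))^2 = (\<integral>x. (f x)^4 \<partial>lebesgue)"
    "sqi (\<lambda>x. f x * g x)" "(nrm (\<lambda>x. f x * g x))^2 \<le> nrm (\<lambda>x. f x * f x) * nrm (\<lambda>x. g x * g x)"
proof -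
  have p4: "(h x * h x)^2 = (h x)^4" for h :: "pt \<Rightarrow> real" and x by (simp add: power2_eq_square power4_eq_xxxx mult_ac)
  have sq: "sqi (\<lambda>x. h x * h x)" if "sqi h" "integrable lebesgue (\<lambda>x. (h x)^4)" for h
    unfolding sqi_def p4 using that by (simp add: sqi_meas borel_measurable_times)
  show s: "sqi (\<lambda>x. f x * f x)" by (rule sq[OF f])
  show "(nrm (\<lambda>x. f x * f x))^2 = (\<integral>x. (f x)^4 \<partial>lebesgue)" by (simp add: nrm_power2 p4)
  have fg: "(f x * g x)^2 = (f x * f x) * (g x * g x)" for x by (simp add: power2_eq_square mult_ac)
  show "sqi (\<lambda>x. f x * g x)"
    unfolding sqi_def fg using sqi_mult_integrable[OF s sq[OF g]] f g by (simp add: sqi_meas borel_measurable_times)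
  show "(nrm (\<lambda>x. f x * g x))^2 \<le> nrm (\<lambda>x. f x * f x) * nrm (\<lambda>x. g x * g x)"
    unfolding nrm_power2 fg using Cauchy_Schwarz[OF s sq[OF g]] by linarith
qed

lemma norm_complex_vec2: "(norm (v :: complex^2))^2 = (cmod (v $ 1))^2 + (cmod (v $ 2))^2"
  by (simp add: norm_vec_def L2_set_def sum_2)

lemma norm_complex_vec2_le: "norm (v :: complex^2) \<le> cmod (v $ 1) + cmod (v $ 2)"
  by (rule power2_le_imp_le) (auto simp: norm_complex_vec2 power2_sum)

lemma L4norm_eq:
  assumes "(\<integral>x. (ext \<Omega> (\<lambda>x. norm (u x)) x)^4 \<partial>lebesgue) = P^2" "P \<ge> 0"
  shows "L4norm \<Omega> u = sqrt P"
proof -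
  have "indicator \<Omega> x *\<^sub>R (norm (u x))^4 = (ext \<Omega> (\<lambda>x. norm (u x)) x)^4" for x
    by (simp add: ext_def indicator_def)
  then have "L4norm \<Omega> u = (P^2) powr (1/4)"
    unfolding L4norm_def set_lebesgue_integral_def using assms(1) by simp
  also have "\<dots> = sqrt P"
  proof (cases "P = 0")
    case False
    then have "P > 0" using assms(2) by simp
    then show ?thesis using powr_powr[of P 2 "1/4"] by (simp add: powr_half_sqrt)
  qed simp
  finally show ?thesis .
qed

lemma nrm_abs: "nrm (\<lambda>x. \<bar>f x\<bar>) = nrm f" by (simp add: nrm_def)

context dom
begin

text \<open>The magnetic term is a product of A and psi; it is square-integrable because both have
  integrable fourth powers by \<open>Sobolev\<close>.\<close>

lemma mgrad_sqi:
  assumes \<psi>: "H1 \<Omega> \<psi> D\<psi>" and A: "H1div \<Omega> A DA"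
  shows "sqi (ext \<Omega> (\<lambda>x. norm (mgrad \<kappa> H A \<psi> D\<psi> x)))"
proof -
  let ?\<Psi> = "ext \<Omega> (\<lambda>x. cmod (\<psi> x))"
  have L: "L2 \<Omega> \<psi>" "L2 \<Omega> (\<lambda>x. D\<psi> x $ j)" for j using \<psi> by (auto simp: H1_def)
  have tA: "h1 \<Omega> (extV A i) (extD DA i)" for i using A tangD(1) unfolding H1div_iff_tang by blast
  have sA: "sqi (extV A i)" "integrable lebesgue (\<lambda>x. (extV A i x)^4)" for i
    using h1D(1)[OF tA] Sobolev(1)[OF tA] by auto
  note \<Psi> = L2_complex(2)[OF L(1)] modulus_fourth_integrable[OF \<psi>]
  define c where "c j = ext \<Omega> (\<lambda>x. cmod (mgrad \<kappa> H A \<psi> D\<psi> x $ j))" for j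
  have sc: "sqi (c j)" for j
  proof (rule sqi_bound)
    show "sqi (\<lambda>x. ext \<Omega> (\<lambda>x. cmod (D\<psi> x $ j)) x + \<bar>\<kappa> * H\<bar> * \<bar>extV A j x * ?\<Psi> x\<bar>)"
      by (intro sqi_add sqi_cmult sqi_abs L2_complex(2)[OF L(2)] fourth_power_products(3)[OF sA \<Psi>])
    have ceq: "c j = (\<lambda>x. cmod (indicator \<Omega> x *\<^sub>R (D\<psi> x $ j) - \<i> * complex_of_real (\<kappa> * H * extV A j x) * (indicator \<Omega> x *\<^sub>R \<psi> x)))"
      by (auto simp: c_def fun_eq_iff mgrad_def extV_def ext_def indicator_def)
    show "c j \<in> borel_measurable lebesgue"
      unfolding ceq using L2_complex(1)[OF L(1)] L2_complex(1)[OF L(2)] sqi_meas[OF sA(1)] by measurable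
    fix x
    show "\<bar>c j x\<bar> \<le> \<bar>ext \<Omega> (\<lambda>x. cmod (D\<psi> x $ j)) x + \<bar>\<kappa> * H\<bar> * \<bar>extV A j x * ?\<Psi> x\<bar>\<bar>"
    proof (cases "x \<in> \<Omega>")
      case True
      have "cmod (mgrad \<kappa> H A \<psi> D\<psi> x $ j) \<le> cmod (D\<psi> x $ j) + cmod (\<i> * complex_of_real (\<kappa> * H * A x $ j) * \<psi> x)"
        unfolding mgrad_def by (simp only: vec_lambda_beta) (rule norm_triangle_ineq4)
      also have "cmod (\<i> * complex_of_real (\<kappa> * H * A x $ j) * \<psi> x) = \<bar>\<kappa> * H\<bar> * \<bar>A x $ j * cmod (\<psi> x)\<bar>"
        by (simp add: norm_mult abs_mult mult_ac)
      finally show ?thesis using True by (simp add: c_def extV_def)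
    qed (simp add: c_def)
  qed
  show ?thesis
  proof (rule sqi_bound)
    show "sqi (\<lambda>x. c 1 x + c 2 x)" by (intro sqi_add sc)
    have "ext \<Omega> (\<lambda>x. norm (mgrad \<kappa> H A \<psi> D\<psi> x)) x = sqrt ((c 1 x)^2 + (c 2 x)^2)" for x
      by (cases "x \<in> \<Omega>") (auto simp: c_def simp flip: norm_complex_vec2)
    then show "ext \<Omega> (\<lambda>x. norm (mgrad \<kappa> H A \<psi> D\<psi> x)) \<in> borel_measurable lebesgue"
      using sqi_meas[OF sc] by (simp add: fun_eq_iff[symmetric] cong: measurable_cong)
    show "\<bar>ext \<Omega> (\<lambda>x. norm (mgrad \<kappa> H A \<psi> D\<psi> x)) x\<bar> \<le> \<bar>c 1 x + c 2 x\<bar>" for x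
      using norm_complex_vec2_le[of "mgrad \<kappa> H A \<psi> D\<psi> x"] by (cases "x \<in> \<Omega>") (auto simp: c_def)
  qed
qed

text \<open>Square root of the area of the ball containing the domain; it enters when the L2 norm of
  psi is bounded by its L4 norm.\<close>

definition ball_nrm :: real where "ball_nrm = nrm (indicator (cball (0::pt) R))"

text \<open>Testing with psi gives |grad_A psi|^2 = kappa^2 (integral of a |psi|^2 minus integral of
  |psi|^4). Dropping the quartic term gives the first bound; dropping the gradient gives |psi|_4^4
  <= M |psi|_2^2, and then Cauchy-Schwarz on the ball gives the second.\<close>

lemma GL_energy:
  assumes GL: "GL_solution \<Omega> a F DF \<kappa> H \<psi> D\<psi> A DA" and \<kappa>: "\<kappa> > 0" and M: "M > 0"
    and a: "ext \<Omega> (\<lambda>x. a x \<kappa>) \<in> borel_measurable lebesgue" "\<And>x. x \<in> \<Omega> \<Longrightarrow> \<bar>a x \<kappa>\<bar> \<le> M"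
  defines "\<Psi> \<equiv> ext \<Omega> (\<lambda>x. cmod (\<psi> x))"
  shows "nrm (ext \<Omega> (\<lambda>x. norm (mgrad \<kappa> H A \<psi> D\<psi> x))) \<le> sqrt M * \<kappa> * nrm \<Psi>"
    "nrm (\<lambda>x. \<Psi> x * \<Psi> x) \<le> M * ball_nrm"
proof -
  let ?Mg = "ext \<Omega> (\<lambda>x. norm (mgrad \<kappa> H A \<psi> D\<psi> x))"
  let ?\<alpha> = "ext \<Omega> (\<lambda>x. a x \<kappa>)"
  let ?m = "mgrad \<kappa> H A \<psi> D\<psi>"
  have \<psi>: "H1 \<Omega> \<psi> D\<psi>" and A: "H1div \<Omega> A DA" using GL by (auto simp: GL_solution_def)
  have L: "L2 \<Omega> \<psi>" using \<psi> by (simp add: H1_def)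
  have s\<Psi>: "sqi \<Psi>" unfolding \<Psi>_def by (rule L2_complex(2)[OF L])
  have \<Psi>4: "integrable lebesgue (\<lambda>x. (\<Psi> x)^4)" unfolding \<Psi>_def by (rule modulus_fourth_integrable[OF \<psi>])
  note fp = fourth_power_products[OF s\<Psi> \<Psi>4 s\<Psi> \<Psi>4]
  let ?P = "nrm (\<lambda>x. \<Psi> x * \<Psi> x)"
  have \<alpha>b: "\<bar>?\<alpha> x\<bar> \<le> M" for x using a(2)[of x] M by (cases "x \<in> \<Omega>") auto
  have eq: "(LINT x:\<Omega>|lebesgue. (\<Sum>j\<in>UNIV. ?m x $ j * cnj (?m x $ j)))
        = complex_of_real (\<kappa>^2) * (LINT x:\<Omega>|lebesgue. complex_of_real (a x \<kappa> - (cmod (\<psi> x))^2) * \<psi> x * cnj (\<psi> x))"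
    using GL \<psi> unfolding GL_solution_def by blast
  have l: "(LINT x:\<Omega>|lebesgue. (\<Sum>j\<in>UNIV. ?m x $ j * cnj (?m x $ j))) = complex_of_real (\<integral>x. (?Mg x)^2 \<partial>lebesgue)"
  proof -
    have "indicator \<Omega> x *\<^sub>R (\<Sum>j\<in>UNIV. ?m x $ j * cnj (?m x $ j)) = complex_of_real ((?Mg x)^2)" for x
    proof -
      have "(\<Sum>j\<in>UNIV. ?m x $ j * cnj (?m x $ j)) = complex_of_real ((norm (?m x))^2)"
        unfolding norm_complex_vec2 by (simp only: sum_2 of_real_add complex_norm_square)
      then show ?thesis by (cases "x \<in> \<Omega>") auto
    qed
    then show ?thesis unfolding set_lebesgue_integral_def by (simp only: integral_complex_of_real)
  qed
  have r: "(LINT x:\<Omega>|lebesgue. complex_of_real (a x \<kappa> - (cmod (\<psi> x))^2) * \<psi> x * cnj (\<psi> x))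
     = complex_of_real (\<integral>x. ?\<alpha> x * \<Psi> x * \<Psi> x - (\<Psi> x)^4 \<partial>lebesgue)"
  proof -
    have "indicator \<Omega> x *\<^sub>R (complex_of_real (a x \<kappa> - (cmod (\<psi> x))^2) * \<psi> x * cnj (\<psi> x))
       = complex_of_real (?\<alpha> x * \<Psi> x * \<Psi> x - (\<Psi> x)^4)" for x
    proof -
      have "complex_of_real (a x \<kappa> - (cmod (\<psi> x))^2) * \<psi> x * cnj (\<psi> x) = complex_of_real ((a x \<kappa> - (cmod (\<psi> x))^2) * (cmod (\<psi> x))^2)"
        by (simp only: of_real_mult complex_norm_square mult.assoc)
      also have "(a x \<kappa> - (cmod (\<psi> x))^2) * (cmod (\<psi> x))^2 = a x \<kappa> * cmod (\<psi> x) * cmod (\<psi> x) - (cmod (\<psi> x))^4"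
        by (simp add: power2_eq_square power4_eq_xxxx algebra_simps)
      finally show ?thesis by (cases "x \<in> \<Omega>") (auto simp: \<Psi>_def)
    qed
    then show ?thesis unfolding set_lebesgue_integral_def by (simp only: integral_complex_of_real)
  qed
  have i\<alpha>: "integrable lebesgue (\<lambda>x. ?\<alpha> x * \<Psi> x * \<Psi> x)" by (rule sqi_int3[OF a(1) \<alpha>b s\<Psi> s\<Psi>])
  have "complex_of_real ((nrm ?Mg)^2) = complex_of_real (\<kappa>^2 * (\<integral>x. ?\<alpha> x * \<Psi> x * \<Psi> x - (\<Psi> x)^4 \<partial>lebesgue))"
    using eq unfolding l r nrm_power2 by simp
  then have "(nrm ?Mg)^2 = \<kappa>^2 * (\<integral>x. ?\<alpha> x * \<Psi> x * \<Psi> x - (\<Psi> x)^4 \<partial>lebesgue)"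
    by (simp only: of_real_eq_iff)
  then have en: "(nrm ?Mg)^2 = \<kappa>^2 * ((\<integral>x. ?\<alpha> x * \<Psi> x * \<Psi> x \<partial>lebesgue) - ?P^2)"
    unfolding fp(2) using i\<alpha> \<Psi>4 by simp
  have ab: "(\<integral>x. ?\<alpha> x * \<Psi> x * \<Psi> x \<partial>lebesgue) \<le> M * (nrm \<Psi>)^2"
    using nrm_abs_int3[OF a(1) \<alpha>b s\<Psi> s\<Psi>] by (simp add: power2_eq_square mult.assoc)
  have "(nrm ?Mg)^2 \<le> \<kappa>^2 * (M * (nrm \<Psi>)^2)"
    unfolding en using ab by (intro mult_left_mono) (auto intro: order_trans[of _ "\<integral>x. ?\<alpha> x * \<Psi> x * \<Psi> x \<partial>lebesgue"])
  also have "\<dots> = (sqrt M * \<kappa> * nrm \<Psi>)^2" using M by (simp add: power_mult_distrib)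
  finally show "nrm ?Mg \<le> sqrt M * \<kappa> * nrm \<Psi>"
    by (rule power2_le_imp_le) (use M \<kappa> in simp)
  have "0 \<le> (\<integral>x. ?\<alpha> x * \<Psi> x * \<Psi> x \<partial>lebesgue) - ?P^2"
    using en \<kappa> zero_le_power2[of "nrm ?Mg"] by (simp add: zero_le_mult_iff)
  then have P2: "?P^2 \<le> M * (nrm \<Psi>)^2" using ab by linarith
  have "(nrm \<Psi>)^2 = (\<integral>x. \<Psi> x * \<Psi> x * indicator (cball 0 R) x \<partial>lebesgue)"
    unfolding nrm_power2
  proof (rule Bochner_Integration.integral_cong)
    fix x
    show "(\<Psi> x)^2 = \<Psi> x * \<Psi> x * indicator (cball 0 R) x"
      using dom_norm[of x] by (cases "x \<in> \<Omega>") (auto simp: \<Psi>_def power2_eq_square)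
  qed simp
  also have "\<dots> \<le> ?P * ball_nrm"
    using Cauchy_Schwarz[OF fp(1) sqi_cball[of R]] unfolding ball_nrm_def by linarith
  finally have "?P^2 \<le> M * (?P * ball_nrm)" using P2 M by (meson less_imp_le mult_left_mono order_trans)
  then have "?P * ?P \<le> ?P * (M * ball_nrm)" by (simp add: power2_eq_square mult_ac)
  then show "?P \<le> M * ball_nrm"
    using nrm_nonneg[of "\<lambda>x. \<Psi> x * \<Psi> x"] M
    by (cases "?P = 0") (auto simp: ball_nrm_def dest: mult_left_le_imp_le)
qed

lemma GL_estimates:
  assumes GL: "GL_solution \<Omega> a F DF \<kappa> H \<psi> D\<psi> A DA" and F: "H1div \<Omega> F DF"
    and \<kappa>: "\<kappa> > 0" and H: "H > 0" and M: "M > 0"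
    and a: "ext \<Omega> (\<lambda>x. a x \<kappa>) \<in> borel_measurable lebesgue" "\<And>x. x \<in> \<Omega> \<Longrightarrow> \<bar>a x \<kappa>\<bar> \<le> M"
    and C: "C > 0" "\<And>B DB i. tang B DB \<Longrightarrow> integrable lebesgue (\<lambda>x. (B i x)^4) \<and>
      (\<integral>x. (B i x)^4 \<partial>lebesgue) \<le> (C * (nrm (wcurl2 DB))^2)^2"
  shows "L2norm \<Omega> (mgrad \<kappa> H A \<psi> D\<psi>) \<le> sqrt M * \<kappa> * L2norm \<Omega> \<psi>"
    "L2norm \<Omega> (\<lambda>x. wcurl DA x - wcurl DF x) \<le> 2 * sqrt M * sqrt C / H * L2norm \<Omega> \<psi> * L4norm \<Omega> \<psi>"
    "L2norm \<Omega> (mgrad \<kappa> H F \<psi> D\<psi>) \<le> (sqrt M + 4 * sqrt M * C * (M * ball_nrm)) * \<kappa> * L2norm \<Omega> \<psi>"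
proof -
  define \<Psi> where "\<Psi> = ext \<Omega> (\<lambda>x. cmod (\<psi> x))"
  define P where "P = nrm (\<lambda>x. \<Psi> x * \<Psi> x)"
  define Mg where "Mg = ext \<Omega> (\<lambda>x. norm (mgrad \<kappa> H A \<psi> D\<psi> x))"
  have \<psi>: "H1 \<Omega> \<psi> D\<psi>" and A: "H1div \<Omega> A DA" using GL by (auto simp: GL_solution_def)
  have s\<Psi>: "sqi \<Psi>" unfolding \<Psi>_def by (rule L2_complex(2)) (use \<psi> in \<open>simp add: H1_def\<close>)
  have \<Psi>4: "integrable lebesgue (\<lambda>x. (\<Psi> x)^4)" unfolding \<Psi>_def by (rule modulus_fourth_integrable[OF \<psi>])
  have sMg: "sqi Mg" unfolding Mg_def by (rule mgrad_sqi[OF \<psi> A])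
  note en = GL_energy[OF GL \<kappa> M a, folded \<Psi>_def, folded P_def Mg_def]
  have P0: "P \<ge> 0" by (simp add: P_def)
  have L4: "L4norm \<Omega> \<psi> = sqrt P"
    by (rule L4norm_eq[OF _ P0])
      (use fourth_power_products(2)[OF s\<Psi> \<Psi>4 s\<Psi> \<Psi>4] in \<open>simp add: P_def \<Psi>_def\<close>)
  have n\<psi>: "L2norm \<Omega> \<psi> = nrm \<Psi>" by (simp add: L2norm_eq \<Psi>_def)
  show "L2norm \<Omega> (mgrad \<kappa> H A \<psi> D\<psi>) \<le> sqrt M * \<kappa> * L2norm \<Omega> \<psi>"
    unfolding L2norm_eq Mg_def[symmetric] \<Psi>_def[symmetric] by (rule en(1))
  define B where "B i x = extV A i x - extV F i x" for i x
  define DB where "DB i j x = extD DA i j x - extD DF i j x" for i j x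
  have tB: "tang B DB"
    unfolding B_def[abs_def] DB_def[abs_def] using tang_diff A F unfolding H1div_iff_tang by blast
  have B_eq: "B = extV (\<lambda>x. A x - F x)" "DB = extD (\<lambda>x. DA x - DF x)"
    by (auto simp: B_def DB_def extV_def extD_def ext_def fun_eq_iff algebra_simps)
  have B4: "integrable lebesgue (\<lambda>x. (B i x)^4)" "(\<integral>x. (B i x)^4 \<partial>lebesgue) \<le> (C * (nrm (wcurl2 DB))^2)^2" for i
    using C(2)[OF tB] by auto
  have sB: "sqi (B i)" for i by (rule h1D(1)[OF tangD(1)[OF tB]])
  define f where "f = nrm (wcurl2 DB)"
  have f0: "f \<ge> 0" by (simp add: f_def)
  have cur: "L2norm \<Omega> (\<lambda>x. wcurl DA x - wcurl DF x) = f"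
  proof -
    have "(ext \<Omega> (\<lambda>x. norm (wcurl DA x - wcurl DF x)) x)^2 = (wcurl2 DB x)^2" for x
      by (cases "x \<in> \<Omega>") (auto simp: wcurl2_def DB_def extD_def wcurl_def algebra_simps)
    then show ?thesis unfolding L2norm_eq f_def nrm_def by simp
  qed
  have n\<Psi>B: "nrm (\<lambda>x. \<Psi> x * B i x) \<le> sqrt P * sqrt C * f" and s\<Psi>B: "sqi (\<lambda>x. \<Psi> x * B i x)" for i
  proof -
    note fB = fourth_power_products[OF sB[of i] B4(1)[of i] sB[of i] B4(1)[of i]]
      and f\<Psi> = fourth_power_products[OF s\<Psi> \<Psi>4 sB[of i] B4(1)[of i]]
    show "sqi (\<lambda>x. \<Psi> x * B i x)" by (rule f\<Psi>(3))
    have "(nrm (\<lambda>x. B i x * B i x))^2 \<le> (C * f^2)^2" using fB(2) B4(2)[of i] by (simp add: f_def)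
    then have "nrm (\<lambda>x. B i x * B i x) \<le> C * f^2" by (rule power2_le_imp_le) (use C(1) in simp)
    then have "P * nrm (\<lambda>x. B i x * B i x) \<le> P * (C * f^2)" using P0 by (rule mult_left_mono)
    then have "(nrm (\<lambda>x. \<Psi> x * B i x))^2 \<le> P * (C * f^2)" using f\<Psi>(4) unfolding P_def by linarith
    also have "\<dots> = (sqrt P * sqrt C * f)^2" using P0 C(1) by (simp add: power_mult_distrib)
    finally show "nrm (\<lambda>x. \<Psi> x * B i x) \<le> sqrt P * sqrt C * f"
      by (rule power2_le_imp_le) (use P0 C(1) f0 in simp)
  qed
  have curl_est: "f \<le> 2 * sqrt M * sqrt C / H * nrm \<Psi> * sqrt P"
  proof -
    let ?s = "\<lambda>x. supercurrent \<kappa> H A \<psi> D\<psi> x \<bullet> (A x - F x)"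
    have "H1div \<Omega> (\<lambda>x. A x - F x) (\<lambda>x. DA x - DF x)" unfolding H1div_iff_tang using tB unfolding B_eq .
    then have e2: "- (LINT x:\<Omega>|lebesgue. (wcurl DA x - wcurl DF x) * wcurl (\<lambda>x. DA x - DF x) x) = (1 / (\<kappa> * H)) * (LINT x:\<Omega>|lebesgue. ?s x)"
      using GL unfolding GL_solution_def by blast
    have "(LINT x:\<Omega>|lebesgue. (wcurl DA x - wcurl DF x) * wcurl (\<lambda>x. DA x - DF x) x) = f^2"
    proof -
      have "indicator \<Omega> x * ((wcurl DA x - wcurl DF x) * wcurl (\<lambda>x. DA x - DF x) x) = (wcurl2 DB x)^2" for x
        by (cases "x \<in> \<Omega>") (auto simp: wcurl2_def DB_def extD_def wcurl_def power2_eq_square algebra_simps)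
      then show ?thesis unfolding set_lint_eq f_def nrm_power2 by simp
    qed
    moreover have "q = \<bar>s\<bar>" if "l = q" "- l = s" "0 \<le> q" for l q s :: real using that by linarith
    ultimately have "f^2 = \<bar>(1 / (\<kappa> * H)) * (LINT x:\<Omega>|lebesgue. ?s x)\<bar>" using e2 zero_le_power2 by blast
    also have "\<dots> = (1 / (\<kappa> * H)) * \<bar>LINT x:\<Omega>|lebesgue. ?s x\<bar>" using \<kappa> H by (simp add: abs_mult)
    also have "\<dots> \<le> (1 / (\<kappa> * H)) * (2 * (sqrt M * \<kappa> * nrm \<Psi>) * (sqrt P * sqrt C * f))"
    proof (rule mult_left_mono)
      \<comment> \<open>One pointwise bound per component of the field, whence the factor 2 in the
        curl estimate.\<close>
      have "\<bar>LINT x:\<Omega>|lebesgue. ?s x\<bar> \<le> (\<integral>x. \<bar>Mg x * (\<Psi> x * B 1 x)\<bar> + \<bar>Mg x * (\<Psi> x * B 2 x)\<bar> \<partial>lebesgue)"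
        unfolding set_lint_eq
      proof (rule abs_integral_le)
        show "integrable lebesgue (\<lambda>x. \<bar>Mg x * (\<Psi> x * B 1 x)\<bar> + \<bar>Mg x * (\<Psi> x * B 2 x)\<bar>)"
          by (intro Bochner_Integration.integrable_add integrable_abs sqi_mult_integrable sMg s\<Psi>B)
        fix x
        show "\<bar>indicator \<Omega> x * ?s x\<bar> \<le> \<bar>Mg x * (\<Psi> x * B 1 x)\<bar> + \<bar>Mg x * (\<Psi> x * B 2 x)\<bar>"
        proof (cases "x \<in> \<Omega>")
          case True
          let ?m = "mgrad \<kappa> H A \<psi> D\<psi> x"
          have c: "\<bar>Im (cnj (\<psi> x) * ?m $ j) * (A x $ j - F x $ j)\<bar> \<le> \<bar>Mg x * (\<Psi> x * B j x)\<bar>" for j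
          proof -
            have "\<bar>Im (cnj (\<psi> x) * ?m $ j)\<bar> \<le> cmod (cnj (\<psi> x) * ?m $ j)" by (rule abs_Im_le_cmod)
            also have "\<dots> = cmod (\<psi> x) * cmod (?m $ j)" by (simp add: norm_mult)
            also have "\<dots> \<le> cmod (\<psi> x) * norm ?m" by (intro mult_left_mono Finite_Cartesian_Product.norm_nth_le) auto
            finally have "\<bar>Im (cnj (\<psi> x) * ?m $ j)\<bar> * \<bar>A x $ j - F x $ j\<bar> \<le> cmod (\<psi> x) * norm ?m * \<bar>A x $ j - F x $ j\<bar>"
              by (rule mult_right_mono) simp
            then show ?thesis using True by (simp add: abs_mult Mg_def \<Psi>_def B_def extV_def mult_ac)
          qed
          have "?s x = Im (cnj (\<psi> x) * ?m $ 1) * (A x $ 1 - F x $ 1) + Im (cnj (\<psi> x) * ?m $ 2) * (A x $ 2 - F x $ 2)"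
            by (simp add: inner_vec_def sum_2 supercurrent_def)
          then have "\<bar>?s x\<bar> \<le> \<bar>Mg x * (\<Psi> x * B 1 x)\<bar> + \<bar>Mg x * (\<Psi> x * B 2 x)\<bar>"
            using c[of 1] c[of 2] by linarith
          then show ?thesis using True by simp
        qed simp
      qed
      also have "\<dots> = (\<integral>x. \<bar>Mg x * (\<Psi> x * B 1 x)\<bar> \<partial>lebesgue) + (\<integral>x. \<bar>Mg x * (\<Psi> x * B 2 x)\<bar> \<partial>lebesgue)"
        by (intro Bochner_Integration.integral_add integrable_abs sqi_mult_integrable sMg s\<Psi>B)
      also have "\<dots> \<le> nrm Mg * nrm (\<lambda>x. \<Psi> x * B 1 x) + nrm Mg * nrm (\<lambda>x. \<Psi> x * B 2 x)"
        by (intro add_mono Cauchy_Schwarz_abs sMg s\<Psi>B)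
      also have "\<dots> \<le> (sqrt M * \<kappa> * nrm \<Psi>) * (sqrt P * sqrt C * f) + (sqrt M * \<kappa> * nrm \<Psi>) * (sqrt P * sqrt C * f)"
        by (intro add_mono mult_mono en(1) n\<Psi>B) (use M \<kappa> in auto)
      also have "\<dots> = 2 * (sqrt M * \<kappa> * nrm \<Psi>) * (sqrt P * sqrt C * f)" by simp
      finally show "\<bar>LINT x:\<Omega>|lebesgue. ?s x\<bar> \<le> 2 * (sqrt M * \<kappa> * nrm \<Psi>) * (sqrt P * sqrt C * f)" .
    qed (use \<kappa> H in simp)
    also have "\<dots> = f * (2 * sqrt M * sqrt C / H * nrm \<Psi> * sqrt P)" using \<kappa> by simp
    finally have "f * f \<le> f * (2 * sqrt M * sqrt C / H * nrm \<Psi> * sqrt P)" by (simp add: power2_eq_square)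
    moreover have "0 \<le> 2 * sqrt M * sqrt C / H * nrm \<Psi> * sqrt P" using M C(1) H P0 by simp
    ultimately show ?thesis using f0 mult_left_le_imp_le by (metis order_le_less)
  qed
  show "L2norm \<Omega> (\<lambda>x. wcurl DA x - wcurl DF x) \<le> 2 * sqrt M * sqrt C / H * L2norm \<Omega> \<psi> * L4norm \<Omega> \<psi>"
    using curl_est by (simp add: cur n\<psi> L4)
  \<comment> \<open>The magnetic gradient with F is the one with A plus i kappa H (A - F) psi. The
    factor H is cancelled by the 1/H in \<open>curl_est\<close>, and the two roots of P combine to
    P, which the energy identity bounds.\<close>
  have "nrm (ext \<Omega> (\<lambda>x. norm (mgrad \<kappa> H F \<psi> D\<psi> x))) \<le> nrm (\<lambda>x. Mg x + \<kappa> * H * (\<bar>\<Psi> x * B 1 x\<bar> + \<bar>\<Psi> x * B 2 x\<bar>))"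
  proof (rule nrm_mono)
    show "sqi (\<lambda>x. Mg x + \<kappa> * H * (\<bar>\<Psi> x * B 1 x\<bar> + \<bar>\<Psi> x * B 2 x\<bar>))"
      by (intro sqi_add sqi_cmult sqi_abs sMg s\<Psi>B)
    show "ext \<Omega> (\<lambda>x. norm (mgrad \<kappa> H F \<psi> D\<psi> x)) \<in> borel_measurable lebesgue"
      by (rule sqi_meas[OF mgrad_sqi[OF \<psi> F]])
    show "AE x in lebesgue. \<bar>ext \<Omega> (\<lambda>x. norm (mgrad \<kappa> H F \<psi> D\<psi> x)) x\<bar> \<le> \<bar>Mg x + \<kappa> * H * (\<bar>\<Psi> x * B 1 x\<bar> + \<bar>\<Psi> x * B 2 x\<bar>)\<bar>"
    proof (intro always_eventually allI)
      fix x
      show "\<bar>ext \<Omega> (\<lambda>x. norm (mgrad \<kappa> H F \<psi> D\<psi> x)) x\<bar> \<le> \<bar>Mg x + \<kappa> * H * (\<bar>\<Psi> x * B 1 x\<bar> + \<bar>\<Psi> x * B 2 x\<bar>)\<bar>"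
      proof (cases "x \<in> \<Omega>")
        case True
        let ?d = "(\<chi> j. \<i> * complex_of_real (\<kappa> * H * (A x $ j - F x $ j)) * \<psi> x) :: complex^2"
        have "mgrad \<kappa> H F \<psi> D\<psi> x = mgrad \<kappa> H A \<psi> D\<psi> x + ?d"
          by (simp add: mgrad_def vec_eq_iff algebra_simps)
        then have "norm (mgrad \<kappa> H F \<psi> D\<psi> x) \<le> Mg x + norm ?d"
          using norm_triangle_ineq[of "mgrad \<kappa> H A \<psi> D\<psi> x" ?d] True by (simp add: Mg_def)
        also have "norm ?d \<le> cmod (?d $ 1) + cmod (?d $ 2)" by (rule norm_complex_vec2_le)
        also have "\<dots> = \<kappa> * H * (\<bar>\<Psi> x * B 1 x\<bar> + \<bar>\<Psi> x * B 2 x\<bar>)"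
        proof -
          have "cmod (?d $ j) = \<kappa> * H * \<bar>\<Psi> x * B j x\<bar>" for j
            using True \<kappa> H by (simp add: norm_mult abs_mult \<Psi>_def B_def extV_def mult_ac del: of_real_mult)
          then show ?thesis by (simp add: distrib_left)
        qed
        finally show ?thesis using True by simp
      qed simp
    qed
  qed
  also have "\<dots> \<le> nrm Mg + \<kappa> * H * (nrm (\<lambda>x. \<Psi> x * B 1 x) + nrm (\<lambda>x. \<Psi> x * B 2 x))"
  proof -
    have "nrm (\<lambda>x. Mg x + \<kappa> * H * (\<bar>\<Psi> x * B 1 x\<bar> + \<bar>\<Psi> x * B 2 x\<bar>))
       \<le> nrm Mg + nrm (\<lambda>x. \<kappa> * H * (\<bar>\<Psi> x * B 1 x\<bar> + \<bar>\<Psi> x * B 2 x\<bar>))"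
      by (rule nrm_triangle) (intro sqi_add sqi_cmult sqi_abs sMg s\<Psi>B)+
    also have "nrm (\<lambda>x. \<kappa> * H * (\<bar>\<Psi> x * B 1 x\<bar> + \<bar>\<Psi> x * B 2 x\<bar>)) = \<kappa> * H * nrm (\<lambda>x. \<bar>\<Psi> x * B 1 x\<bar> + \<bar>\<Psi> x * B 2 x\<bar>)"
      using \<kappa> H by (simp add: nrm_cmult)
    also have "nrm (\<lambda>x. \<bar>\<Psi> x * B 1 x\<bar> + \<bar>\<Psi> x * B 2 x\<bar>) \<le> nrm (\<lambda>x. \<bar>\<Psi> x * B 1 x\<bar>) + nrm (\<lambda>x. \<bar>\<Psi> x * B 2 x\<bar>)"
      by (rule nrm_triangle) (intro sqi_abs s\<Psi>B)+
    finally show ?thesis using \<kappa> H by (simp add: nrm_abs)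
  qed
  also have "\<dots> \<le> sqrt M * \<kappa> * nrm \<Psi> + \<kappa> * H * (2 * (sqrt P * sqrt C * (2 * sqrt M * sqrt C / H * nrm \<Psi> * sqrt P)))"
  proof -
    have "sqrt P * sqrt C * f \<le> sqrt P * sqrt C * (2 * sqrt M * sqrt C / H * nrm \<Psi> * sqrt P)"
      using P0 C(1) by (intro mult_left_mono curl_est) auto
    then have "nrm (\<lambda>x. \<Psi> x * B 1 x) + nrm (\<lambda>x. \<Psi> x * B 2 x) \<le> 2 * (sqrt P * sqrt C * (2 * sqrt M * sqrt C / H * nrm \<Psi> * sqrt P))"
      using n\<Psi>B[of 1] n\<Psi>B[of 2] by linarith
    then show ?thesis using en(1) \<kappa> H by (intro add_mono mult_left_mono) auto
  qed
  also have "\<dots> = sqrt M * \<kappa> * nrm \<Psi> + 4 * sqrt M * C * P * \<kappa> * nrm \<Psi>"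
  proof -
    have "sqrt P * sqrt C * (2 * sqrt M * sqrt C / H * nrm \<Psi> * sqrt P) = (sqrt P * sqrt P) * (sqrt C * sqrt C) * (2 * sqrt M / H * nrm \<Psi>)"
      by (simp add: mult_ac)
    also have "\<dots> = P * C * (2 * sqrt M / H * nrm \<Psi>)" using P0 C(1) by simp
    finally have "sqrt P * sqrt C * (2 * sqrt M * sqrt C / H * nrm \<Psi> * sqrt P) = P * C * (2 * sqrt M / H * nrm \<Psi>)" .
    then show ?thesis using H by (simp only:) simp
  qed
  also have "\<dots> \<le> sqrt M * \<kappa> * nrm \<Psi> + 4 * sqrt M * C * (M * ball_nrm) * \<kappa> * nrm \<Psi>"
    using en(2) \<kappa> M C(1) by (intro add_left_mono mult_right_mono mult_left_mono) auto
  finally show "L2norm \<Omega> (mgrad \<kappa> H F \<psi> D\<psi>) \<le> (sqrt M + 4 * sqrt M * C * (M * ball_nrm)) * \<kappa> * L2norm \<Omega> \<psi>"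
    unfolding L2norm_eq[of _ "mgrad \<kappa> H F \<psi> D\<psi>"] n\<psi> by (simp add: distrib_right)
qed

end

theorem theorem8p1:
  fixes \<Omega> :: "(real^2) set" and B0 :: "real^2 \<Rightarrow> real" and a :: "real^2 \<Rightarrow> real \<Rightarrow> real"
    and \<kappa>0 :: real and F :: "real^2 \<Rightarrow> real^2" and DF :: "real^2 \<Rightarrow> real^2^2"
  assumes "open \<Omega>" and "bounded \<Omega>" and "\<Omega> \<noteq> {}" and "simply_connected \<Omega>"
    and "smooth_boundary \<Omega>"
    and "smooth_closure \<Omega> B0"
    and "\<kappa>0 > 0"
    and "\<forall>\<kappa>\<ge>\<kappa>0. Ck_closure 1 \<Omega> (\<lambda>x. a x \<kappa>)"
    and "H1div \<Omega> F DF"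
    and "AE x in lebesgue. x \<in> \<Omega> \<longrightarrow> wcurl DF x = B0 x"
    and "\<exists>M. \<forall>x\<in>closure \<Omega>. \<forall>\<kappa>\<ge>\<kappa>0. \<bar>a x \<kappa>\<bar> \<le> M"
  shows "\<exists>C1 C2 C3 :: real. C1 > 0 \<and> C2 > 0 \<and> C3 > 0 \<and>
    (\<forall>\<kappa> H \<psi> D\<psi> A DA. \<kappa> \<ge> \<kappa>0 \<and> H > 0 \<and> GL_solution \<Omega> a F DF \<kappa> H \<psi> D\<psi> A DA \<longrightarrow>
       L2norm \<Omega> (mgrad \<kappa> H A \<psi> D\<psi>) \<le> C1 * \<kappa> * L2norm \<Omega> \<psi> \<and>
       L2norm \<Omega> (\<lambda>x. wcurl DA x - wcurl DF x) \<le> C2 / H * L2norm \<Omega> \<psi> * L4norm \<Omega> \<psi> \<and>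
       L2norm \<Omega> (mgrad \<kappa> H F \<psi> D\<psi>) \<le> C3 * \<kappa> * L2norm \<Omega> \<psi>)"
proof -
  obtain R \<rho> G c0 e0 T T1 T2 CT where "dom \<Omega> R \<rho> G c0 e0 T T1 T2 CT"
    using dom_exists[OF assms(1,2,4,5)] .
  then interpret dom \<Omega> R \<rho> G c0 e0 T T1 T2 CT .
  obtain C where C: "C > 0" "\<And>B DB i. tang B DB \<Longrightarrow> integrable lebesgue (\<lambda>x. (B i x)^4) \<and>
      (\<integral>x. (B i x)^4 \<partial>lebesgue) \<le> (C * (nrm (wcurl2 DB))^2)^2"
    by (rule div_curl_L4) blast
  obtain M0 where M0: "\<And>x \<kappa>. x \<in> closure \<Omega> \<Longrightarrow> \<kappa> \<ge> \<kappa>0 \<Longrightarrow> \<bar>a x \<kappa>\<bar> \<le> M0" using assms(11) by blast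
  \<comment> \<open>Adding 1 makes the bound strictly positive even when a vanishes, as the
    constants must be positive.\<close>
  define M where "M = \<bar>M0\<bar> + 1"
  have M: "M > 0" by (simp add: M_def)
  have aM: "\<bar>a x \<kappa>\<bar> \<le> M" if "x \<in> \<Omega>" "\<kappa> \<ge> \<kappa>0" for x \<kappa>
    using M0[of x \<kappa>] that closure_subset[of \<Omega>] unfolding M_def by force
  \<comment> \<open>Measurability of a on the domain comes from its continuous extension to the
    plane.\<close>
  have am: "ext \<Omega> (\<lambda>x. a x \<kappa>) \<in> borel_measurable lebesgue" if \<kappa>: "\<kappa> \<ge> \<kappa>0" for \<kappa>
  proof -
    obtain g where g: "Ck 1 UNIV g" "\<And>x. x \<in> closure \<Omega> \<Longrightarrow> g x = a x \<kappa>"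
      using assms(8) \<kappa> unfolding Ck_closure_def by blast
    have "Ck 0 UNIV g" using g(1) Ck_SucD[of 0 g] by simp
    then have "g \<in> borel_measurable lebesgue" by (simp add: continuous_meas)
    then have "(\<lambda>x. indicator \<Omega> x * g x) \<in> borel_measurable lebesgue"
      using dom_meas by (intro borel_measurable_times borel_measurable_indicator)
    moreover have "indicator \<Omega> x * g x = ext \<Omega> (\<lambda>x. a x \<kappa>) x" for x
      using g(2)[of x] closure_subset[of \<Omega>] by (cases "x \<in> \<Omega>") auto
    ultimately show ?thesis by simp
  qed
  have b0: "ball_nrm \<ge> 0" by (simp add: ball_nrm_def)
  show ?thesis
  proof (rule exI[of _ "sqrt M"], rule exI[of _ "2 * sqrt M * sqrt C"],
      rule exI[of _ "sqrt M + 4 * sqrt M * C * (M * ball_nrm)"], intro conjI allI impI)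
    show "sqrt M > 0" "2 * sqrt M * sqrt C > 0" using M C(1) by auto
    show "sqrt M + 4 * sqrt M * C * (M * ball_nrm) > 0" using M C(1) b0 by (intro add_pos_nonneg) auto
    fix \<kappa> H \<psi> D\<psi> A DA
    assume "\<kappa> \<ge> \<kappa>0 \<and> H > 0 \<and> GL_solution \<Omega> a F DF \<kappa> H \<psi> D\<psi> A DA"
    then have h: "\<kappa> \<ge> \<kappa>0" "H > 0" "GL_solution \<Omega> a F DF \<kappa> H \<psi> D\<psi> A DA" by auto
    have \<kappa>: "\<kappa> > 0" using h(1) assms(7) by simp
    note est = GL_estimates[OF h(3) assms(9) \<kappa> h(2) M am[OF h(1)] _ C(1)]
    show "L2norm \<Omega> (mgrad \<kappa> H A \<psi> D\<psi>) \<le> sqrt M * \<kappa> * L2norm \<Omega> \<psi>"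
      by (rule est(1)) (rule aM[OF _ h(1)] C(2), assumption)+
    show "L2norm \<Omega> (\<lambda>x. wcurl DA x - wcurl DF x) \<le> 2 * sqrt M * sqrt C / H * L2norm \<Omega> \<psi> * L4norm \<Omega> \<psi>"
      by (rule est(2)) (rule aM[OF _ h(1)] C(2), assumption)+
    show "L2norm \<Omega> (mgrad \<kappa> H F \<psi> D\<psi>) \<le> (sqrt M + 4 * sqrt M * C * (M * ball_nrm)) * \<kappa> * L2norm \<Omega> \<psi>"
      by (rule est(3)) (rule aM[OF _ h(1)] C(2), assumption)+
  qed
qed

end
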